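(* Assume (A1)–(A4) (listed in the context) and that the coupling functions vanish to first order in hyperbolic directions. Let $V_0\in\mathcal S(\mathbb R^2,\mathbb C^5)$ and let $V(t,x)$ be the solution of $\mathrm D_tV=B(\mathrm D)V$, $V(0,\cdot)=V_0$. Then for dual indices $p\in(1,2]$, $pq=p+q$, and Sobolev regularity $r>2(1/p-1/q)$ the following a priori estimates hold for all $t\ge0$: $$\|\chi(\mathrm D)P_{par}(\mathrm D)V(t,\cdot)\|_q\lesssim e^{-Ct}\|V_0\|_{p,r},$$ $$\|(1-\chi(\mathrm D))P_{par}(\mathrm D)V(t,\cdot)\|_q\lesssim(1+t)^{-\left(\frac1p-\frac1q\right)}\|V_0\|_p,$$ $$\|\chi(\mathrm D)P_{hyp}(\mathrm D)V(t,\cdot)\|_q\lesssim(1+t)^{-\frac12\left(\frac1p-\frac1q\right)}\|V_0\|_{p,r},$$ $$\|(1-\chi(\mathrm D))P_{hyp}(\mathrm D)V(t,\cdot)\|_q\lesssim(1+t)^{-\frac12\left(\frac1p-\frac1q\right)}\|V_0\|_p,$$ with some constant $C>0$; the implied constants are independent of $t$ and $V_0$.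
   Context: Constants: $\kappa>0$, $\gamma\in\mathbb R\setminus\{0\}$. The map $A:\mathbb S^1\to\mathbb C^{2\times2}$ satisfies (A1) $A$ is real-analytic on $\mathbb S^1$; (A2) $A(\eta)$ is self-adjoint and positive for all $\eta\in\mathbb S^1$. The eigenvalues $\varkappa_1,\varkappa_2$ of $A(\eta)$ and corresponding normalised eigenvectors $r_1,r_2:\mathbb S^1\to\mathbb S^1\subset\mathbb R^2$ (orthonormal) are assumed to be globally defined smooth, real-analytic functions of $\eta\in\mathbb S^1$. (A3) $A(\eta)$ has two distinct eigenvalues for every $\eta\in\mathbb S^1$. Put $\omega_j=\sqrt{\varkappa_j}$ and, for $\xi\ne0$, $\eta=\xi/|\xi|$, $\omega_j(\xi)=|\xi|\omega_j(\eta)$. The coupling functions are $a_j(\eta)=r_j(\eta)\cdot\eta$, $a_j(\xi)=r_j(\eta)\cdot\xi=|\xi|a_j(\eta)$, and $$B(\xi)=\begin{pmatrix}\omega_1(\xi)&0&0&0&\mathrm i\gamma a_1(\xi)\\0&\omega_2(\xi)&0&0&\mathrm i\gamma a_2(\xi)\\0&0&-\omega_1(\xi)&0&\mathrm i\gamma a_1(\xi)\\0&0&0&-\omega_2(\xi)&\mathrm i\gamma a_2(\xi)\\-\frac{\mathrm i\gamma}2a_1(\xi)&-\frac{\mathrm i\gamma}2a_2(\xi)&-\frac{\mathrm i\gamma}2a_1(\xi)&-\frac{\mathrm i\gamma}2a_2(\xi)&\mathrm i\kappa|\xi|^2\end{pmatrix}.$$ $B(\mathrm D)$ is the Fourier multiplier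 with symbol $B(\xi)$, and $\mathrm D_t=-\mathrm i\partial_t$. A direction $\eta\in\mathbb S^1$ is hyperbolic if $B(\xi)$, $\xi=|\xi|\eta\neq0$, has a real eigenvalue (this depends only on $\eta$), and parabolic otherwise; it is hyperbolic with respect to the index $j_0$ if $\pm\omega_{j_0}(\xi)\in\operatorname{spec}B(\xi)$. Under (A3), $\eta$ is hyperbolic with respect to $j_0$ iff $a_{j_0}(\eta)=0$; "the coupling functions vanish to first order in hyperbolic directions" means that in each hyperbolic direction $\bar\eta$ with respect to $j_0$ the zero of $a_{j_0}$ at $\bar\eta$ is simple (so there are finitely many hyperbolic directions). (A4) $\gamma^2\neq2\varkappa_{j_0}(\bar\eta)-\operatorname{tr}A(\bar\eta)$ for all hyperbolic directions $\bar\eta$ with respect to $j_0$. Cut-offs: $\chi\in C^\infty(\mathbb R_+)$ is a cut-off function with $\chi(s)=0$ for $s\le\epsilon$ and $\chi(s)=1$ for $s\ge2\epsilon$; $P_{par}(\eta)=\prod_{\bar\eta\text{ hyperbolic}}\chi(|\eta-\bar\eta|)$, $P_{hyp}(\eta)=1-P_{par}(\eta)$. The operators $\chi(\mathrm D)$, $P_{par}(\mathrm D)$, $P_{hyp}(\mathrm D)$ are the Fourier multipliers with symbols $\chi(|\xi|)$, $P_{par}(\xi/|\xi|)$, $P_{hyp}(\xi/|\xi|)$. Thus $P_{hyp}(\mathrm D)$ localises to a conical neighbourhood of the set of hyperbolic directions. Norms: $\|\cdot\|_q$ is the $L^q(\mathbb R^2)$ norm and $\|f\|_{p,r}=\|\langle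 \mathrm D\rangle^rf\|_{L^p}$, where $\langle\mathrm D\rangle$ has symbol $(1+|\xi|^2)^{1/2}$. *)

theory Defs
  imports "HOL-Analysis.Analysis"
begin

definition circ :: "real \<Rightarrow> real^2" where
  "circ \<theta> = vector [cos \<theta>, sin \<theta>]"

definition real_analytic :: "(real \<Rightarrow> 'a::real_normed_vector) \<Rightarrow> bool" where
  "real_analytic f \<longleftrightarrow>
     (\<forall>x. \<exists>\<delta>>0. \<exists>c. \<forall>y. \<bar>y - x\<bar> < \<delta> \<longrightarrow> (\<lambda>n. (y - x) ^ n *\<^sub>R c n) sums f y)"

text \<open>The angle is a real-analytic (local) coordinate on the circle. Functions on the circle
  are total functions on the plane whose values off the circle are never used.\<close>

definition analytic_on_circle :: "(real^2 \<Rightarrow> 'a::real_normed_vector) \<Rightarrow> bool" where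
  "analytic_on_circle f \<longleftrightarrow> real_analytic (\<lambda>\<theta>. f (circ \<theta>))"

definition simple_zero_on_circle :: "(real^2 \<Rightarrow> real) \<Rightarrow> real^2 \<Rightarrow> bool" where
  "simple_zero_on_circle f \<eta> \<longleftrightarrow>
     f \<eta> = 0 \<and>
     (\<exists>\<theta> D. circ \<theta> = \<eta> \<and> ((\<lambda>\<phi>. f (circ \<phi>)) has_real_derivative D) (at \<theta>) \<and> D \<noteq> 0)"

definition self_adjoint :: "complex^'n^'n \<Rightarrow> bool" where
  "self_adjoint M \<longleftrightarrow> (\<forall>i j. M $ i $ j = cnj (M $ j $ i))"

definition positive_matrix :: "complex^'n^'n \<Rightarrow> bool" where
  "positive_matrix M \<longleftrightarrow>
     (\<forall>v. v \<noteq> 0 \<longrightarrow> 0 < Re (\<Sum>i\<in>UNIV. cnj (v $ i) * (M *v v) $ i))"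

definition spectrum :: "complex^'n^'n \<Rightarrow> complex set" where
  "spectrum M = {l. \<exists>v. v \<noteq> 0 \<and> M *v v = l *s v}"

definition cvec :: "real^'n \<Rightarrow> complex^'n" where
  "cvec v = (\<chi> i. complex_of_real (v $ i))"

text \<open>Throughout, \<open>\<mu> j\<close> and \<open>r j\<close> are the j-th eigenvalue and the j-th normalised eigenvector
  of the matrix, as functions on the circle; the indices 1 and 2 are the two elements of the
  type \<open>2\<close>.\<close>

definition dir :: "real^2 \<Rightarrow> real^2" where
  "dir \<xi> = (1 / norm \<xi>) *\<^sub>R \<xi>"

definition omega :: "(2 \<Rightarrow> real^2 \<Rightarrow> real) \<Rightarrow> 2 \<Rightarrow> real^2 \<Rightarrow> real" where
  "omega \<mu> j \<xi> = norm \<xi> * sqrt (\<mu> j (dir \<xi>))"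

definition coupling :: "(2 \<Rightarrow> real^2 \<Rightarrow> real^2) \<Rightarrow> 2 \<Rightarrow> real^2 \<Rightarrow> real" where
  "coupling r j \<xi> = r j (dir \<xi>) \<bullet> \<xi>"

definition symbolB ::
  "real \<Rightarrow> real \<Rightarrow> (2 \<Rightarrow> real^2 \<Rightarrow> real) \<Rightarrow> (2 \<Rightarrow> real^2 \<Rightarrow> real^2) \<Rightarrow> real^2 \<Rightarrow> complex^5^5" where
  "symbolB \<kappa> \<gamma> \<mu> r \<xi> =
     (let w1 = complex_of_real (omega \<mu> 1 \<xi>); w2 = complex_of_real (omega \<mu> 2 \<xi>);
          b1 = \<i> * complex_of_real (\<gamma> * coupling r 1 \<xi>);
          b2 = \<i> * complex_of_real (\<gamma> * coupling r 2 \<xi>);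
          d = \<i> * complex_of_real (\<kappa> * (norm \<xi>)\<^sup>2)
      in vector [vector [w1, 0, 0, 0, b1],
                 vector [0, w2, 0, 0, b2],
                 vector [0, 0, - w1, 0, b1],
                 vector [0, 0, 0, - w2, b2],
                 vector [- b1 / 2, - b2 / 2, - b1 / 2, - b2 / 2, d]])"

lemma UNIV_5: "(UNIV :: 5 set) = {1, 2, 3, 4, 5}"
proof -
  have "card {1, 2, 3, 4, 5 :: 5} = card (UNIV :: 5 set)" by simp
  then show ?thesis by (metis card_subset_eq finite_class.finite_UNIV subset_UNIV)
qed

lemma vector_5:
  "(vector [a, b, c, d, e] :: 'a::zero^5) $ 1 = a"
  "(vector [a, b, c, d, e] :: 'a::zero^5) $ 2 = b"
  "(vector [a, b, c, d, e] :: 'a::zero^5) $ 3 = c"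
  "(vector [a, b, c, d, e] :: 'a::zero^5) $ 4 = d"
  "(vector [a, b, c, d, e] :: 'a::zero^5) $ 5 = e"
  by (simp_all add: vector_def)

text \<open>Both conditions below are independent of the length \<open>\<rho>\<close>.\<close>

definition hyperbolic_dir ::
  "real \<Rightarrow> real \<Rightarrow> (2 \<Rightarrow> real^2 \<Rightarrow> real) \<Rightarrow> (2 \<Rightarrow> real^2 \<Rightarrow> real^2) \<Rightarrow> real^2 \<Rightarrow> bool" where
  "hyperbolic_dir \<kappa> \<gamma> \<mu> r \<eta> \<longleftrightarrow>
     norm \<eta> = 1 \<and>
     (\<exists>\<rho>>0. \<exists>l::real. complex_of_real l \<in> spectrum (symbolB \<kappa> \<gamma> \<mu> r (\<rho> *\<^sub>R \<eta>)))"

definition hyperbolic_dir_wrt ::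
  "real \<Rightarrow> real \<Rightarrow> (2 \<Rightarrow> real^2 \<Rightarrow> real) \<Rightarrow> (2 \<Rightarrow> real^2 \<Rightarrow> real^2) \<Rightarrow> 2 \<Rightarrow> real^2 \<Rightarrow> bool" where
  "hyperbolic_dir_wrt \<kappa> \<gamma> \<mu> r j \<eta> \<longleftrightarrow>
     norm \<eta> = 1 \<and>
     (\<exists>\<rho>>0. complex_of_real (omega \<mu> j (\<rho> *\<^sub>R \<eta>)) \<in> spectrum (symbolB \<kappa> \<gamma> \<mu> r (\<rho> *\<^sub>R \<eta>)) \<and>
            - complex_of_real (omega \<mu> j (\<rho> *\<^sub>R \<eta>)) \<in> spectrum (symbolB \<kappa> \<gamma> \<mu> r (\<rho> *\<^sub>R \<eta>)))"

definition fourier :: "(real^2 \<Rightarrow> complex^'n) \<Rightarrow> real^2 \<Rightarrow> complex^'n" where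
  "fourier f \<xi> = (1 / (2 * pi)) *\<^sub>R (LINT x|lborel. cis (- (x \<bullet> \<xi>)) *s f x)"

definition inv_fourier :: "(real^2 \<Rightarrow> complex^'n) \<Rightarrow> real^2 \<Rightarrow> complex^'n" where
  "inv_fourier g x = (1 / (2 * pi)) *\<^sub>R (LINT \<xi>|lborel. cis (x \<bullet> \<xi>) *s g \<xi>)"

text \<open>\<open>M(D) f\<close> for a matrix-valued symbol; it is meaningful for integrable \<open>f\<close> for which
  \<open>M \<cdot> fourier f\<close> is integrable. The symbol of a composition of multipliers is the product of
  the symbols.\<close>

definition mult_op ::
  "(real^2 \<Rightarrow> complex^'n^'n) \<Rightarrow> (real^2 \<Rightarrow> complex^'n) \<Rightarrow> real^2 \<Rightarrow> complex^'n" where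
  "mult_op M f = inv_fourier (\<lambda>\<xi>. M \<xi> *v fourier f \<xi>)"

definition scalar_op ::
  "(real^2 \<Rightarrow> real) \<Rightarrow> (real^2 \<Rightarrow> complex^'n) \<Rightarrow> real^2 \<Rightarrow> complex^'n" where
  "scalar_op m = mult_op (\<lambda>\<xi>. mat (complex_of_real (m \<xi>)))"

definition partials :: "2 list \<Rightarrow> (real^2 \<Rightarrow> complex^'n) \<Rightarrow> real^2 \<Rightarrow> complex^'n" where
  "partials is f = foldr (\<lambda>i g x. frechet_derivative g (at x) (axis i 1)) is f"

definition schwartz :: "(real^2 \<Rightarrow> complex^'n) \<Rightarrow> bool" where
  "schwartz f \<longleftrightarrow>
     (\<forall>is. (\<forall>x. partials is f differentiable (at x)) \<and>
           (\<forall>k::nat. bounded (range (\<lambda>x. norm x ^ k *\<^sub>R partials is f x))))"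

text \<open>The value is \<open>\<infinity>\<close> exactly if the function is not p-integrable.\<close>

definition Lp_norm :: "real \<Rightarrow> (real^2 \<Rightarrow> complex^'n) \<Rightarrow> ennreal" where
  "Lp_norm p f =
     (let I = (\<integral>\<^sup>+ x. ennreal (norm (f x) powr p) \<partial>lborel)
      in if I = \<infinity> then \<infinity> else ennreal (enn2real I powr (1 / p)))"

definition Sobolev_norm :: "real \<Rightarrow> real \<Rightarrow> (real^2 \<Rightarrow> complex^'n) \<Rightarrow> ennreal" where
  "Sobolev_norm p s f = Lp_norm p (scalar_op (\<lambda>\<xi>. (1 + (norm \<xi>)\<^sup>2) powr (s / 2)) f)"

text \<open>\<open>V\<close> is the solution of \<open>D\<^sub>t V = M(D) V\<close>, \<open>V(0) = V\<^sub>0\<close>, where \<open>D\<^sub>t = - \<i> \<partial>\<^sub>t\<close>: each \<open>V(t)\<close> is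
  integrable and lies in the domain of \<open>M(D)\<close>, and the time derivative is taken in \<open>L\<^sup>1\<close>
  (one-sided at \<open>t = 0\<close>). Convergence in \<open>L\<^sup>1\<close> implies pointwise convergence of the Fourier
  transforms, so the solution in this class is unique (up to null sets).\<close>

definition is_solution ::
  "(real^2 \<Rightarrow> complex^'n^'n) \<Rightarrow> (real^2 \<Rightarrow> complex^'n) \<Rightarrow> (real \<Rightarrow> real^2 \<Rightarrow> complex^'n) \<Rightarrow> bool" where
  "is_solution M V0 V \<longleftrightarrow>
     V 0 = V0 \<and>
     (\<forall>t\<ge>0. integrable lborel (V t) \<and>
            integrable lborel (\<lambda>\<xi>. M \<xi> *v fourier (V t) \<xi>) \<and>
            integrable lborel (mult_op M (V t)) \<and>
            ((\<lambda>s. LINT x|lborel.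
                 norm ((- \<i> / complex_of_real (s - t)) *s (V s x - V t x) - mult_op M (V t) x))
              \<longlongrightarrow> 0) (at t within {0..}))"

definition cutoff :: "real \<Rightarrow> (real \<Rightarrow> real) \<Rightarrow> bool" where
  "cutoff \<epsilon> h \<longleftrightarrow>
     (\<forall>n. \<forall>s>0. ((deriv ^^ n) h) differentiable (at s)) \<and>
     (\<forall>s. 0 \<le> s \<and> s \<le> \<epsilon> \<longrightarrow> h s = 0) \<and>
     (\<forall>s\<ge>2 * \<epsilon>. h s = 1)"

definition P_par ::
  "real \<Rightarrow> real \<Rightarrow> (2 \<Rightarrow> real^2 \<Rightarrow> real) \<Rightarrow> (2 \<Rightarrow> real^2 \<Rightarrow> real^2) \<Rightarrow> (real \<Rightarrow> real) \<Rightarrow> real^2 \<Rightarrow> real" where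
  "P_par \<kappa> \<gamma> \<mu> r h \<eta> = (\<Prod>\<eta>' | hyperbolic_dir \<kappa> \<gamma> \<mu> r \<eta>'. h (norm (\<eta> - \<eta>')))"

definition P_hyp ::
  "real \<Rightarrow> real \<Rightarrow> (2 \<Rightarrow> real^2 \<Rightarrow> real) \<Rightarrow> (2 \<Rightarrow> real^2 \<Rightarrow> real^2) \<Rightarrow> (real \<Rightarrow> real) \<Rightarrow> real^2 \<Rightarrow> real" where
  "P_hyp \<kappa> \<gamma> \<mu> r h \<eta> = 1 - P_par \<kappa> \<gamma> \<mu> r h \<eta>"

end

theory Submission
  imports Defs "HOL-Probability.Characteristic_Functions" "HOL-Real_Asymp.Real_Asymp"
begin

text \<open>In Fourier space the system is a linear ordinary differential equation for each frequency \<open>\<xi>\<close>. A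
  Lyapunov functional of Kawashima type, the energy minus a small compensator, bounds its solution operator by
  \<open>3 exp (- c t |\<xi>|\<^sup>2 / (1 + |\<xi>|\<^sup>2) m\<^sup>2)\<close>, where \<open>m\<close> is the smaller of \<open>|a\<^sub>1|\<close> and \<open>|a\<^sub>2|\<close> in the direction of \<open>\<xi>\<close>.
  The Hausdorff-Young inequality, applied to both Fourier transforms, and Hoelder's inequality between them reduce each
  estimate to a bound for the \<open>L\<^sup>a\<close> norm of this weight on the relevant part of the frequency space, where
  \<open>1/a = 1/p - 1/q\<close>. Since the zeros are simple, \<open>m\<close> dominates the distance to the finite set of hyperbolic
  directions. On the support of \<open>P\<^sub>p\<^sub>a\<^sub>r\<close> it is therefore bounded below, which gives exponential decay for high and
  Gaussian decay for low frequencies. Near a hyperbolic direction the weight is a Gaussian in the transversal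
  variable only, so its integral over a strip decays like \<open>(1 + t) powr (- 1/2)\<close>.\<close>

section \<open>The Hausdorff-Young inequality\<close>

text \<open>A spectral approach would expand eigenvalues separately for small, intermediate and
  large \<open>|\<xi>|\<close> and near each hyperbolic direction. The Lyapunov functional gives one
  inequality at all frequencies, with constants from compactness of the circle; the only loss is the
  factor m^2. It arises because the undamped components are recovered from their moments against the
  coupling vector by a Vandermonde system with columns scaled by a_1 and a_2, whose determinant the
  distinct eigenvalues keep away from zero. The same inequality characterises hyperbolic directions,
  as a real eigenvalue would give a solution that does not decay.

  The exponents come from the L^a norm: a Gaussian in d variables integrates to order (1+t)^(-d/2),
  and the power 1/a yields the two polynomial rates for d = 2 and d = 1. The bracket weight of order
  -s lies in L^a of the plane when s a > 2, which is the regularity condition. The Sobolev norm is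
  the L^p norm of a function not known to be integrable, so Hausdorff-Young is also needed in a dual
  form that assumes integrability only on the frequency side.\<close>

lemma inner_real2: "(x::real^2) \<bullet> y = x$1 * y$1 + x$2 * y$2"
  by (simp add: inner_vec_def UNIV_2)

lemma norm_real2_power2: "(norm (x::real^2))\<^sup>2 = (x$1)\<^sup>2 + (x$2)\<^sup>2"
  unfolding power2_norm_eq_inner by (simp add: inner_real2 power2_eq_square)

lemma measurable_vector2 [measurable]:
  "(\<lambda>(x,y). vector [x,y] :: real^2) \<in> borel_measurable (borel \<Otimes>\<^sub>M borel)"
proof -
  have "(\<lambda>z. vector [fst z, snd z] :: real^2) = (\<lambda>z. fst z *\<^sub>R axis 1 1 + snd z *\<^sub>R axis 2 1)"
    by (auto simp: fun_eq_iff vec_eq_iff forall_2 axis_def)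
  then show ?thesis
    by (simp add: case_prod_beta')
qed

text \<open>Lebesgue measure is determined by its values on boxes, and the preimage of a box is a
  rectangle. This gives access to Tonelli in the two coordinates, as \<open>real^2\<close> is not a
  product type.\<close>

lemma lborel_real2:
  "(lborel :: (real^2) measure) = distr (lborel \<Otimes>\<^sub>M lborel) borel (\<lambda>(x,y). vector [x,y])"
proof (rule lborel_eqI)
  fix l u :: "real^2"
  assume lu: "\<And>b. b \<in> Basis \<Longrightarrow> l \<bullet> b \<le> u \<bullet> b"
  have le: "l $ i \<le> u $ i" for i
    using lu[of "axis i 1"] by (simp add: inner_axis axis_in_Basis_iff)
  have "(\<lambda>(x,y). vector [x,y] :: real^2) -` box l u = {l$1<..<u$1} \<times> {l$2<..<u$2}"
    by (auto simp: mem_box_cart forall_2)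
  then have "emeasure (distr (lborel \<Otimes>\<^sub>M lborel) borel (\<lambda>(x,y). vector [x,y])) (box l u)
     = emeasure (lborel \<Otimes>\<^sub>M lborel) ({l$1<..<u$1} \<times> {l$2<..<u$2})"
    by (subst emeasure_distr) (auto simp: space_pair_measure)
  also have "\<dots> = ennreal (u$1 - l$1) * ennreal (u$2 - l$2)"
    by (subst lborel.emeasure_pair_measure_Times) (use le in auto)
  also have "\<dots> = ennreal (\<Prod>b\<in>Basis. (u - l) \<bullet> b)"
  proof -
    have "(\<Prod>b\<in>Basis. (u - l) \<bullet> b) = (\<Prod>i\<in>UNIV. (u - l) $ i)"
    proof -
      have "(\<Prod>b\<in>range (\<lambda>i::2. axis i (1::real)). (u - l) \<bullet> b) = (\<Prod>i\<in>UNIV. (u - l) \<bullet> axis i 1)"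
        by (subst prod.reindex) (auto simp: inj_on_def axis_eq_axis)
      moreover have "range (\<lambda>i::2. axis i (1::real)) = Basis"
        by (auto simp: Basis_vec_def)
      ultimately show ?thesis by (simp add: inner_axis)
    qed
    then show ?thesis using le by (simp add: UNIV_2 ennreal_mult)
  qed
  finally show "emeasure (distr (lborel \<Otimes>\<^sub>M lborel) borel (\<lambda>(x,y). vector [x,y])) (box l u)
     = ennreal (\<Prod>b\<in>Basis. (u - l) \<bullet> b)" .
qed simp

text \<open>Both orders of integration are recorded because \<open>nn_integral_strip_le\<close>
  integrates first in the coordinate along which its Gaussian varies faster, and which one that is
  depends on the direction.\<close>

lemma nn_integral_real2:
  fixes f :: "real^2 \<Rightarrow> ennreal"
  assumes [measurable]: "f \<in> borel_measurable borel"
  shows "(\<integral>\<^sup>+x. f x \<partial>lborel) = (\<integral>\<^sup>+x. \<integral>\<^sup>+y. f (vector [x,y]) \<partial>lborel \<partial>lborel)"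
    and "(\<integral>\<^sup>+x. f x \<partial>lborel) = (\<integral>\<^sup>+y. \<integral>\<^sup>+x. f (vector [x,y]) \<partial>lborel \<partial>lborel)"
proof -
  have "(\<integral>\<^sup>+x. f x \<partial>lborel) = (\<integral>\<^sup>+z. f (case z of (x,y) \<Rightarrow> vector [x,y]) \<partial>(lborel \<Otimes>\<^sub>M lborel))"
    by (subst lborel_real2, subst nn_integral_distr) auto
  also have "\<dots> = (\<integral>\<^sup>+x. \<integral>\<^sup>+y. f (vector [x,y]) \<partial>lborel \<partial>lborel)"
    by (subst lborel.nn_integral_fst[symmetric]) auto
  finally show 1: "(\<integral>\<^sup>+x. f x \<partial>lborel) = (\<integral>\<^sup>+x. \<integral>\<^sup>+y. f (vector [x,y]) \<partial>lborel \<partial>lborel)" .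
  also have "\<dots> = (\<integral>\<^sup>+y. \<integral>\<^sup>+x. f (vector [x,y]) \<partial>lborel \<partial>lborel)"
    using lborel_pair.Fubini'[of "\<lambda>x y. f (vector [x,y])"] by auto
  finally show "(\<integral>\<^sup>+x. f x \<partial>lborel) = (\<integral>\<^sup>+y. \<integral>\<^sup>+x. f (vector [x,y]) \<partial>lborel \<partial>lborel)" .
qed

lemma borel_measurable_cis [measurable (raw)]:
  "f \<in> borel_measurable M \<Longrightarrow> (\<lambda>x. cis (f x)) \<in> borel_measurable M"
  by (rule borel_measurable_continuous_on[of cis]) (auto intro!: continuous_intros)

section \<open>Gaussian integrals and their Fourier transforms\<close>

lemma gaussian_density_eq:
  assumes "\<alpha> > 0"
  shows "exp (- \<alpha> * x\<^sup>2 / 2) = sqrt (2 * pi / \<alpha>) * normal_density 0 (1 / sqrt \<alpha>) x"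
  using assms by (simp add: normal_density_def power_divide real_sqrt_divide field_simps)

lemma integrable_gaussian:
  assumes "\<alpha> > (0::real)"
  shows "integrable lborel (\<lambda>x. exp (- \<alpha> * x\<^sup>2 / 2))"
  unfolding gaussian_density_eq[OF assms] using assms by simp

lemma integral_gaussian:
  assumes "\<alpha> > (0::real)"
  shows "(LINT x|lborel. exp (- \<alpha> * x\<^sup>2 / 2)) = sqrt (2 * pi / \<alpha>)"
  unfolding gaussian_density_eq[OF assms] using assms by simp

lemma nn_integral_gaussian_affine:
  assumes "\<alpha> > (0::real)" "m \<noteq> 0"
  shows "(\<integral>\<^sup>+x. ennreal (exp (- \<alpha> * (b + m * x)\<^sup>2 / 2)) \<partial>lborel) = ennreal (sqrt (2 * pi / \<alpha>) / \<bar>m\<bar>)"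
proof -
  have "ennreal (sqrt (2 * pi / \<alpha>)) = (\<integral>\<^sup>+x. ennreal (exp (- \<alpha> * x\<^sup>2 / 2)) \<partial>lborel)"
    using integrable_gaussian[OF assms(1)] integral_gaussian[OF assms(1)]
    by (subst nn_integral_eq_integral) auto
  also have "\<dots> = ennreal \<bar>m\<bar> * (\<integral>\<^sup>+x. ennreal (exp (- \<alpha> * (b + m * x)\<^sup>2 / 2)) \<partial>lborel)"
    using assms by (subst nn_integral_real_affine[where c=m and t=b]) auto
  finally have *: "ennreal (sqrt (2 * pi / \<alpha>)) = ennreal \<bar>m\<bar> * (\<integral>\<^sup>+x. ennreal (exp (- \<alpha> * (b + m * x)\<^sup>2 / 2)) \<partial>lborel)" .
  have "ennreal (1/\<bar>m\<bar>) * ennreal (sqrt (2 * pi / \<alpha>)) = (\<integral>\<^sup>+x. ennreal (exp (- \<alpha> * (b + m * x)\<^sup>2 / 2)) \<partial>lborel)"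
    unfolding * mult.assoc[symmetric] using assms by (simp flip: ennreal_mult')
  then show ?thesis using assms by (simp flip: ennreal_mult')
qed

text \<open>The characteristic function of the standard normal law, rescaled.\<close>

lemma gaussian_fourier_1d:
  assumes "\<alpha> > 0"
  shows "(LINT x|lborel. cis (- (x * t)) * complex_of_real (exp (- \<alpha> * x\<^sup>2 / 2)))
         = complex_of_real (sqrt (2 * pi / \<alpha>) * exp (- t\<^sup>2 / (2 * \<alpha>)))"
proof -
  \<comment> \<open>Dilation by \<open>c\<close> turns the variance 1 of the standard normal law
    into \<open>1 / \<alpha>\<close>.\<close>
  define c where "c = 1 / sqrt \<alpha>"
  have c: "c > 0" "\<alpha> * c\<^sup>2 = 1" using assms by (auto simp: c_def power_divide)
  have "char std_normal_distribution (- (c * t)) = complex_of_real (exp (- (- (c * t))\<^sup>2 / 2))"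
    by (simp only: char_std_normal_distribution)
  then have "complex_of_real (exp (- (c * t)\<^sup>2 / 2)) = (LINT x|lborel. std_normal_density x *\<^sub>R iexp (- (c * t) * x))"
    unfolding char_def by (subst (asm) integral_density) auto
  also have "\<dots> = complex_of_real (1 / sqrt (2 * pi)) * (LINT x|lborel. cis (- (c * x * t)) * complex_of_real (exp (- \<alpha> * (0 + c * x)\<^sup>2 / 2)))"
  proof (subst integral_mult_right_zero[symmetric], rule Bochner_Integration.integral_cong)
    fix x :: real
    have *: "\<alpha> * (c * x)\<^sup>2 = x\<^sup>2" using c by (simp add: power_mult_distrib mult.assoc[symmetric])
    show "std_normal_density x *\<^sub>R iexp (- (c * t) * x) = complex_of_real (1 / sqrt (2 * pi)) * (cis (- (c * x * t)) * complex_of_real (exp (- \<alpha> * (0 + c * x)\<^sup>2 / 2)))"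
      using * by (simp add: cis_conv_exp std_normal_density_def scaleR_conv_of_real mult_ac)
  qed simp
  also have "(LINT x|lborel. cis (- (c * x * t)) * complex_of_real (exp (- \<alpha> * (0 + c * x)\<^sup>2 / 2)))
     = complex_of_real (1/c) * (LINT x|lborel. cis (- (x * t)) * complex_of_real (exp (- \<alpha> * x\<^sup>2 / 2)))"
    using c by (subst lborel_integral_real_affine[where c=c and t=0 and f="\<lambda>x. cis (- (x * t)) * complex_of_real (exp (- \<alpha> * x\<^sup>2 / 2))"])
     (auto simp: scaleR_conv_of_real)
  finally have *: "complex_of_real (exp (- (c * t)\<^sup>2 / 2)) = complex_of_real (1 / sqrt (2 * pi)) * (complex_of_real (1/c) * (LINT x|lborel. cis (- (x * t)) * complex_of_real (exp (- \<alpha> * x\<^sup>2 / 2))))" .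
  have "(c * t)\<^sup>2 / 2 = t\<^sup>2 / (2 * \<alpha>)" using c assms by (simp add: power_mult_distrib c_def power_divide)
  then have e: "exp (- (c * t)\<^sup>2 / 2) = exp (- t\<^sup>2 / (2 * \<alpha>))" by simp
  have "complex_of_real (sqrt (2*pi) * c) * complex_of_real (exp (- (c * t)\<^sup>2 / 2)) = (LINT x|lborel. cis (- (x * t)) * complex_of_real (exp (- \<alpha> * x\<^sup>2 / 2)))"
    unfolding * using c by simp
  moreover have "sqrt (2*pi) * c = sqrt (2 * pi / \<alpha>)" by (simp add: c_def real_sqrt_divide)
  ultimately show ?thesis unfolding e by simp
qed

lemma integrable_gaussian_2d:
  assumes "\<alpha> > 0"
  shows "integrable lborel (\<lambda>x::real^2. exp (- \<alpha> * (norm x)\<^sup>2 / 2))"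
    and "(\<integral>\<^sup>+x. ennreal (exp (- \<alpha> * (norm (x::real^2))\<^sup>2 / 2)) \<partial>lborel) = ennreal (2 * pi / \<alpha>)"
proof -
  have "(\<integral>\<^sup>+x. ennreal (exp (- \<alpha> * (norm (x::real^2))\<^sup>2 / 2)) \<partial>lborel)
    = (\<integral>\<^sup>+x. \<integral>\<^sup>+y. ennreal (exp (- \<alpha> * (0 + 1 * x)\<^sup>2 / 2)) * ennreal (exp (- \<alpha> * (0 + 1 * y)\<^sup>2 / 2)) \<partial>lborel \<partial>lborel)"
    by (subst nn_integral_real2) (auto simp: norm_real2_power2 distrib_left add_divide_distrib diff_divide_distrib
        simp flip: ennreal_mult' exp_add intro!: nn_integral_cong)
  also have "\<dots> = ennreal (sqrt (2 * pi / \<alpha>)) * ennreal (sqrt (2 * pi / \<alpha>))"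
    using nn_integral_gaussian_affine[OF assms, of 1 0]
    by (simp add: nn_integral_cmult nn_integral_multc)
  also have "\<dots> = ennreal (2 * pi / \<alpha>)"
    using assms by (subst ennreal_mult[symmetric]) auto
  finally show *: "(\<integral>\<^sup>+x. ennreal (exp (- \<alpha> * (norm (x::real^2))\<^sup>2 / 2)) \<partial>lborel) = ennreal (2 * pi / \<alpha>)" .
  show "integrable lborel (\<lambda>x::real^2. exp (- \<alpha> * (norm x)\<^sup>2 / 2))"
    by (rule integrableI_bounded) (use * in auto)
qed

text \<open>The integrand factors over the coordinates, so Fubini reduces the claim to the
  one-dimensional transform.\<close>

lemma gaussian_fourier_2d:
  assumes "\<alpha> > 0"
  shows "(LINT x|lborel. cis (- (x \<bullet> (\<xi>::real^2))) * complex_of_real (exp (- \<alpha> * (norm x)\<^sup>2 / 2)))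
         = complex_of_real (2 * pi / \<alpha> * exp (- (norm \<xi>)\<^sup>2 / (2 * \<alpha>)))"
proof -
  let ?g = "\<lambda>x t. cis (- (x * t)) * complex_of_real (exp (- \<alpha> * x\<^sup>2 / 2))"
  have int: "integrable lborel (\<lambda>x. ?g x t)" for t
    by (rule Bochner_Integration.integrable_bound[OF integrable_gaussian[OF assms]])
       (auto simp: norm_mult)
  have "(LINT x|lborel. cis (- (x \<bullet> \<xi>)) * complex_of_real (exp (- \<alpha> * (norm x)\<^sup>2 / 2)))
     = (LINT z|(lborel \<Otimes>\<^sub>M lborel). ?g (fst z) (\<xi>$1) * ?g (snd z) (\<xi>$2))"
  proof -
    have "cis (- (vector [a,b] \<bullet> \<xi>)) * complex_of_real (exp (- \<alpha> * (norm (vector [a,b] :: real^2))\<^sup>2 / 2))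
       = ?g a (\<xi>$1) * ?g b (\<xi>$2)" for a b
    proof -
      have "cis (- (vector [a,b] \<bullet> \<xi>)) = cis (- (a * \<xi>$1)) * cis (- (b * \<xi>$2))"
        by (simp add: inner_real2 cis_mult)
      moreover have "exp (- \<alpha> * (norm (vector [a,b] :: real^2))\<^sup>2 / 2) = exp (- \<alpha> * a\<^sup>2 / 2) * exp (- \<alpha> * b\<^sup>2 / 2)"
        unfolding exp_add[symmetric] norm_real2_power2 by (simp add: field_simps)
      ultimately show ?thesis by simp
    qed
    then show ?thesis
      by (subst lborel_real2, subst integral_distr) (auto simp: case_prod_beta)
  qed
  also have "\<dots> = (LINT x|lborel. ?g x (\<xi>$1)) * (LINT y|lborel. ?g y (\<xi>$2))"
  proof -
    have "integrable (lborel \<Otimes>\<^sub>M lborel) (\<lambda>z. ?g (fst z) (\<xi>$1) * ?g (snd z) (\<xi>$2))"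
    proof (rule lborel_pair.Fubini_integrable)
      have "integrable lborel (\<lambda>x. exp (- \<alpha> * x\<^sup>2 / 2) * (LINT y|lborel. exp (- \<alpha> * y\<^sup>2 / 2)))"
        using integrable_gaussian[OF assms] by simp
      then show "integrable lborel (\<lambda>x. LINT y|lborel. norm (?g (fst (x, y)) (\<xi>$1) * ?g (snd (x, y)) (\<xi>$2)))"
        by (simp add: norm_mult)
    qed (use int in auto)
    then have "(LINT z|(lborel \<Otimes>\<^sub>M lborel). ?g (fst z) (\<xi>$1) * ?g (snd z) (\<xi>$2))
      = (LINT x|lborel. LINT y|lborel. ?g x (\<xi>$1) * ?g y (\<xi>$2))"
      by (subst lborel_pair.integral_fst'[symmetric]) simp_all
    then show ?thesis by simp
  qed
  also have "\<dots> = complex_of_real (2 * pi / \<alpha> * exp (- (norm \<xi>)\<^sup>2 / (2 * \<alpha>)))"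
  proof -
    define S where "S = sqrt (2 * pi / \<alpha>)"
    have S: "S * S = 2 * pi / \<alpha>" using assms by (simp add: S_def)
    have "exp (- (norm \<xi>)\<^sup>2 / (2 * \<alpha>)) = exp (- (\<xi>$1)\<^sup>2 / (2 * \<alpha>)) * exp (- (\<xi>$2)\<^sup>2 / (2 * \<alpha>))"
      unfolding exp_add[symmetric] norm_real2_power2 add_divide_distrib[symmetric] by simp
    then have "(S * exp (- (\<xi>$1)\<^sup>2 / (2 * \<alpha>))) * (S * exp (- (\<xi>$2)\<^sup>2 / (2 * \<alpha>))) = 2 * pi / \<alpha> * exp (- (norm \<xi>)\<^sup>2 / (2 * \<alpha>))"
      unfolding S[symmetric] by simp
    then show ?thesis
      unfolding gaussian_fourier_1d[OF assms] of_real_mult[symmetric] of_real_eq_iff S_def .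
  qed
  finally show ?thesis .
qed

section \<open>The scalar Fourier transform\<close>

definition sft :: "(real^2 \<Rightarrow> complex) \<Rightarrow> real^2 \<Rightarrow> complex" where
  "sft f \<xi> = (1 / (2 * pi)) *\<^sub>R (LINT x|lborel. cis (- (x \<bullet> \<xi>)) * f x)"

lemma integrable_cis_mult:
  fixes f :: "real^2 \<Rightarrow> complex"
  assumes f: "integrable lborel f" and [measurable]: "b \<in> borel_measurable borel"
  shows "integrable lborel (\<lambda>x. cis (b x) * f x)"
proof (rule Bochner_Integration.integrable_bound[OF f])
  show "(\<lambda>x. cis (b x) * f x) \<in> borel_measurable lborel"
    using f by (auto dest: borel_measurable_integrable)
qed (auto simp: norm_mult)

lemma norm_sft_le:
  assumes "integrable lborel f"
  shows "norm (sft f \<xi>) \<le> (LINT x|lborel. norm (f x)) / (2 * pi)"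
proof -
  have "norm (LINT x|lborel. cis (- (x \<bullet> \<xi>)) * f x) \<le> (LINT x|lborel. norm (cis (- (x \<bullet> \<xi>)) * f x))"
    by (rule integral_norm_bound)
  then show ?thesis by (simp add: sft_def norm_mult divide_right_mono)
qed

lemma continuous_on_sft:
  assumes f: "integrable lborel f"
  shows "continuous_on UNIV (sft f)"
  unfolding continuous_on_eq_continuous_at[OF open_UNIV] 
proof (intro ballI, unfold continuous_at_sequentially, intro allI impI)
  fix a :: "real^2" and u assume u: "u \<longlonglongrightarrow> a"
  have [measurable]: "f \<in> borel_measurable borel" using f by (auto dest: borel_measurable_integrable)
  have "(\<lambda>n. LINT x|lborel. cis (- (x \<bullet> u n)) * f x) \<longlonglongrightarrow> (LINT x|lborel. cis (- (x \<bullet> a)) * f x)"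
  proof (rule integral_dominated_convergence[where w="\<lambda>x. norm (f x)"])
    show "AE x in lborel. (\<lambda>n. cis (- (x \<bullet> u n)) * f x) \<longlonglongrightarrow> cis (- (x \<bullet> a)) * f x"
      using u by (intro AE_I2 tendsto_intros isCont_tendsto_compose[of _ cis]) (auto intro!: continuous_intros)
  qed (use f in \<open>auto simp: norm_mult\<close>)
  then show "((sft f) \<circ> u) \<longlonglongrightarrow> sft f a"
    unfolding sft_def o_def by (intro tendsto_intros)
qed

lemma borel_measurable_sft [measurable]:
  "integrable lborel f \<Longrightarrow> sft f \<in> borel_measurable borel"
  using continuous_on_sft by (rule borel_measurable_continuous_onI)

lemma sft_add:
  assumes "integrable lborel f" "integrable lborel g"
  shows "sft (\<lambda>x. f x + g x) \<xi> = sft f \<xi> + sft g \<xi>"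
proof -
  have "(LINT x|lborel. cis (- (x \<bullet> \<xi>)) * (f x + g x)) = (LINT x|lborel. cis (- (x \<bullet> \<xi>)) * f x) + (LINT x|lborel. cis (- (x \<bullet> \<xi>)) * g x)"
    unfolding distrib_left by (intro Bochner_Integration.integral_add integrable_cis_mult assms) auto
  then show ?thesis by (simp add: sft_def scaleR_right_distrib)
qed

lemma sft_cmult: "sft (\<lambda>x. c * f x) \<xi> = c * sft f \<xi>"
proof -
  have "(LINT x|lborel. cis (- (x \<bullet> \<xi>)) * (c * f x)) = c * (LINT x|lborel. cis (- (x \<bullet> \<xi>)) * f x)"
    unfolding mult.left_commute[of _ c] by simp
  then show ?thesis by (simp add: sft_def)
qed

text \<open>The kernel of the transform is symmetric in its two variables, so Fubini moves it from
  \<open>f\<close> to \<open>g\<close>. Plancherel and inversion below both rest on this identity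
  with a Gaussian factor in \<open>g\<close>.\<close>

lemma integral_sft_mult:
  assumes f: "integrable lborel f" and g: "integrable lborel g"
  shows "(LINT \<xi>|lborel. sft f \<xi> * g \<xi>) = (LINT x|lborel. f x * sft g x)"
proof -
  have [measurable]: "f \<in> borel_measurable borel" "g \<in> borel_measurable borel"
    using f g by (auto dest: borel_measurable_integrable)
  let ?h = "\<lambda>\<xi> x. cis (- (x \<bullet> \<xi>)) * f x * g \<xi>"
  have "integrable (lborel \<Otimes>\<^sub>M lborel) (case_prod ?h)"
  proof (rule lborel_pair.Fubini_integrable)
    have "integrable lborel (\<lambda>\<xi>. (LINT x|lborel. norm (f x)) * norm (g \<xi>))"
      using g by simp
    then show "integrable lborel (\<lambda>\<xi>. LINT x|lborel. norm (case (\<xi>, x) of (\<xi>, x) \<Rightarrow> ?h \<xi> x))"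
      by (simp add: norm_mult)
    show "AE \<xi> in lborel. integrable lborel (\<lambda>x. case (\<xi>, x) of (\<xi>, x) \<Rightarrow> ?h \<xi> x)"
      using integrable_cis_mult[OF f] by (intro AE_I2) simp
  qed auto
  from lborel_pair.Fubini_integral[OF this]
  have "(LINT x|lborel. LINT \<xi>|lborel. ?h \<xi> x) = (LINT \<xi>|lborel. LINT x|lborel. ?h \<xi> x)" .
  moreover have "(LINT \<xi>|lborel. ?h \<xi> x) = f x * (LINT \<xi>|lborel. cis (- (\<xi> \<bullet> x)) * g \<xi>)" for x
    by (subst integral_mult_right_zero[symmetric]) (simp add: mult_ac inner_commute)
  moreover have "(LINT x|lborel. ?h \<xi> x) = (LINT x|lborel. cis (- (x \<bullet> \<xi>)) * f x) * g \<xi>" for \<xi>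
    by simp
  ultimately show ?thesis
    by (simp add: sft_def)
qed

section \<open>Heat kernel regularisation and Plancherel\<close>

definition heat_kernel :: "real \<Rightarrow> real^2 \<Rightarrow> real" where
  "heat_kernel \<delta> z = exp (- (norm z)\<^sup>2 / (2 * \<delta>)) / (2 * pi * \<delta>)"

lemma heat_kernel_pos: "\<delta> > 0 \<Longrightarrow> heat_kernel \<delta> z > 0"
  by (simp add: heat_kernel_def)

lemma borel_measurable_heat_kernel [measurable]: "heat_kernel \<delta> \<in> borel_measurable borel"
  unfolding heat_kernel_def[abs_def] by measurable

lemma nn_integral_translate:
  fixes f :: "real^2 \<Rightarrow> ennreal"
  assumes [measurable]: "f \<in> borel_measurable borel"
  shows "(\<integral>\<^sup>+x. f (x - a) \<partial>lborel) = (\<integral>\<^sup>+x. f x \<partial>lborel)"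
proof -
  have "(\<integral>\<^sup>+x. f x \<partial>lborel) = (\<integral>\<^sup>+x. f x \<partial>distr lborel borel ((+) (-a)))"
    by (simp add: lborel_distr_plus)
  also have "\<dots> = (\<integral>\<^sup>+x. f (x - a) \<partial>lborel)"
    by (subst nn_integral_distr) auto
  finally show ?thesis by simp
qed

lemma nn_integral_uminus_lborel:
  fixes f :: "real^2 \<Rightarrow> ennreal"
  assumes [measurable]: "f \<in> borel_measurable borel"
  shows "(\<integral>\<^sup>+x. f (- x) \<partial>lborel) = (\<integral>\<^sup>+x. f x \<partial>lborel)"
proof -
  have "(lborel :: (real^2) measure) = distr lborel borel (\<lambda>x. - x)"
    using lborel_affine[of "-1" "0 :: real^2"] by (simp add: density_1 one_ennreal_def[symmetric])
  then have "(\<integral>\<^sup>+x. f x \<partial>lborel) = (\<integral>\<^sup>+x. f x \<partial>distr lborel borel (\<lambda>x. - x))" by simp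
  also have "\<dots> = (\<integral>\<^sup>+x. f (- x) \<partial>lborel)"
    by (subst nn_integral_distr) auto
  finally show ?thesis by simp
qed

lemma nn_integral_heat_kernel:
  assumes "\<delta> > 0"
  shows "(\<integral>\<^sup>+x. ennreal (heat_kernel \<delta> x) \<partial>lborel) = 1"
    and "(\<integral>\<^sup>+x. ennreal (heat_kernel \<delta> (x - a)) \<partial>lborel) = 1"
    and "(\<integral>\<^sup>+x. ennreal (heat_kernel \<delta> (a - x)) \<partial>lborel) = 1"
proof -
  have "(\<integral>\<^sup>+x. ennreal (heat_kernel \<delta> x) \<partial>lborel)
     = (\<integral>\<^sup>+x. ennreal (1 / (2 * pi * \<delta>)) * ennreal (exp (- (1/\<delta>) * (norm (x::real^2))\<^sup>2 / 2)) \<partial>lborel)"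
    using assms by (intro nn_integral_cong) (simp add: heat_kernel_def flip: ennreal_mult')
  also have "\<dots> = ennreal (1 / (2 * pi * \<delta>)) * ennreal (2 * pi / (1 / \<delta>))"
    using integrable_gaussian_2d(2)[of "1/\<delta>"] assms by (subst nn_integral_cmult) auto
  also have "\<dots> = 1"
    using assms by (simp flip: ennreal_mult')
  finally show 1: "(\<integral>\<^sup>+x. ennreal (heat_kernel \<delta> x) \<partial>lborel) = 1" .
  show 2: "(\<integral>\<^sup>+x. ennreal (heat_kernel \<delta> (x - a)) \<partial>lborel) = 1"
    using 1 by (subst nn_integral_translate[of "\<lambda>x. ennreal (heat_kernel \<delta> x)"]) auto
  have "heat_kernel \<delta> (a - x) = heat_kernel \<delta> (x - a)" for x
    by (simp add: heat_kernel_def norm_minus_commute)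
  then show "(\<integral>\<^sup>+x. ennreal (heat_kernel \<delta> (a - x)) \<partial>lborel) = 1" using 2 by simp
qed

lemma integrable_gaussian_mult:
  fixes F :: "real^2 \<Rightarrow> complex"
  assumes "\<delta> > 0" and [measurable]: "F \<in> borel_measurable borel" and "\<And>\<xi>. norm (F \<xi>) \<le> C"
  shows "integrable lborel (\<lambda>\<xi>. F \<xi> * complex_of_real (exp (- \<delta> * (norm \<xi>)\<^sup>2 / 2)))"
proof (rule Bochner_Integration.integrable_bound)
  show "integrable lborel (\<lambda>\<xi>::real^2. C * exp (- \<delta> * (norm \<xi>)\<^sup>2 / 2))"
    using integrable_gaussian_2d(1)[OF assms(1)] by simp
  have "C \<ge> 0" using assms(3)[of 0] norm_ge_zero order_trans by blast
  then show "AE x in lborel. norm (F x * complex_of_real (exp (- \<delta> * (norm x)\<^sup>2 / 2))) \<le> norm (C * exp (- \<delta> * (norm x)\<^sup>2 / 2))"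
    using assms(3) by (auto simp: norm_mult mult_right_mono)
qed auto

lemma sft_gaussian:
  assumes "\<delta> > 0"
  shows "sft (\<lambda>\<xi>. cis (x \<bullet> \<xi>) * complex_of_real (exp (- \<delta> * (norm \<xi>)\<^sup>2 / 2))) y
    = complex_of_real (2 * pi * heat_kernel \<delta> (x - y))"
proof -
  have "(LINT \<xi>|lborel. cis (- (\<xi> \<bullet> y)) * (cis (x \<bullet> \<xi>) * complex_of_real (exp (- \<delta> * (norm \<xi>)\<^sup>2 / 2))))
      = (LINT \<xi>|lborel. cis (- (\<xi> \<bullet> (y - x))) * complex_of_real (exp (- \<delta> * (norm \<xi>)\<^sup>2 / 2)))"
    by (intro Bochner_Integration.integral_cong)
       (auto simp: mult.assoc[symmetric] cis_mult inner_diff_right inner_commute algebra_simps)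
  also have "\<dots> = complex_of_real (2 * pi / \<delta> * exp (- (norm (y - x))\<^sup>2 / (2 * \<delta>)))"
    by (rule gaussian_fourier_2d[OF assms])
  finally show ?thesis
    using assms by (simp add: sft_def heat_kernel_def scaleR_conv_of_real norm_minus_commute)
qed

text \<open>The Gaussian factor makes the inversion integral converge although \<open>sft f\<close>
  need not be integrable; moving the transform to the other factor produces the convolution of
  \<open>f\<close> with the heat kernel.\<close>

lemma regularised_inversion:
  assumes "\<delta> > 0" and f: "integrable lborel f"
  shows "(1 / (2 * pi)) *\<^sub>R (LINT \<xi>|lborel. cis (x \<bullet> \<xi>) * (sft f \<xi> * complex_of_real (exp (- \<delta> * (norm \<xi>)\<^sup>2 / 2))))
    = (LINT y|lborel. f y * complex_of_real (heat_kernel \<delta> (x - y)))"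
proof -
  let ?g = "\<lambda>\<xi>. cis (x \<bullet> \<xi>) * complex_of_real (exp (- \<delta> * (norm \<xi>)\<^sup>2 / 2))"
  have "integrable lborel ?g"
    by (rule integrable_gaussian_mult[OF assms(1), of _ 1]) auto
  from integral_sft_mult[OF f this]
  have "(LINT \<xi>|lborel. cis (x \<bullet> \<xi>) * (sft f \<xi> * complex_of_real (exp (- \<delta> * (norm \<xi>)\<^sup>2 / 2))))
     = (LINT y|lborel. 2 * pi * (f y * complex_of_real (heat_kernel \<delta> (x - y))))"
    unfolding sft_gaussian[OF assms(1)] by (simp add: mult_ac)
  then show ?thesis by (simp add: scaleR_conv_of_real)
qed

text \<open>Fatou's lemma, in the form that removes the regularisation in Plancherel and in the dual
  Hausdorff-Young inequality.\<close>

lemma nn_integral_le_of_LIMSEQ: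
  fixes f :: "nat \<Rightarrow> 'a \<Rightarrow> ennreal"
  assumes "\<And>n. f n \<in> borel_measurable M" "\<And>x. x \<in> space M \<Longrightarrow> (\<lambda>n. f n x) \<longlonglongrightarrow> g x"
    and "\<And>n. (\<integral>\<^sup>+x. f n x \<partial>M) \<le> B"
  shows "(\<integral>\<^sup>+x. g x \<partial>M) \<le> B"
proof -
  have "(\<integral>\<^sup>+x. g x \<partial>M) = (\<integral>\<^sup>+x. liminf (\<lambda>n. f n x) \<partial>M)"
    by (intro nn_integral_cong lim_imp_Liminf[symmetric] assms(2)) auto
  also have "\<dots> \<le> liminf (\<lambda>n. \<integral>\<^sup>+x. f n x \<partial>M)"
    using assms(1) by (rule nn_integral_liminf)
  also have "\<dots> \<le> B"
    by (rule Liminf_le) (use assms(3) in auto)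
  finally show ?thesis .
qed

text \<open>Holds for every \<open>f\<close> because a function that is not integrable has integral
  0 by default.\<close>

lemma norm_integral_le_nn_integral:
  fixes f :: "'a \<Rightarrow> 'b::{banach, second_countable_topology}"
  shows "ennreal (norm (LINT x|M. f x)) \<le> (\<integral>\<^sup>+x. norm (f x) \<partial>M)"
  by (cases "integrable M f") (auto intro: integral_norm_bound_ennreal simp: not_integrable_integral_eq)

text \<open>With \<open>g\<close> the conjugate of \<open>sft f\<close> times the Gaussian, the
  left-hand side is the integral of \<open>sft f * g\<close>. The multiplication formula turns it
  into a pairing of \<open>f\<close> with its own mollification, which is bounded because the heat
  kernel has mass 1 in either variable. The right-hand side may be infinite.\<close>

lemma plancherel_regularised:
  assumes \<delta>: "\<delta> > 0" and f: "integrable lborel f"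
  shows "(\<integral>\<^sup>+\<xi>. ennreal ((norm (sft f \<xi>))\<^sup>2 * exp (- \<delta> * (norm \<xi>)\<^sup>2 / 2)) \<partial>lborel)
      \<le> (\<integral>\<^sup>+x. ennreal ((norm (f x))\<^sup>2) \<partial>lborel)"
proof -
  have [measurable]: "f \<in> borel_measurable borel" using f by (auto dest: borel_measurable_integrable)
  have [measurable]: "sft f \<in> borel_measurable borel" using f by simp
  let ?e = "\<lambda>\<xi>::real^2. exp (- \<delta> * (norm \<xi>)\<^sup>2 / 2)"
  define g where "g \<xi> = cnj (sft f \<xi>) * complex_of_real (?e \<xi>)" for \<xi>
  let ?C = "(LINT x|lborel. norm (f x)) / (2 * pi)"
  have [measurable]: "g \<in> borel_measurable borel" unfolding g_def[abs_def]
    by (intro borel_measurable_times borel_measurable_continuous_on[of cnj]) (auto intro!: continuous_intros)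
  have g: "integrable lborel g"
    unfolding g_def by (rule integrable_gaussian_mult[OF \<delta>, of _ ?C])
      (auto simp: norm_sft_le[OF f] intro!: borel_measurable_continuous_on[of cnj] continuous_intros)
  have sq: "sft f \<xi> * g \<xi> = complex_of_real ((norm (sft f \<xi>))\<^sup>2 * ?e \<xi>)" for \<xi>
    unfolding g_def mult.assoc[symmetric] complex_norm_square[symmetric] by simp
  have int: "integrable lborel (\<lambda>\<xi>. sft f \<xi> * g \<xi>)"
  proof (rule Bochner_Integration.integrable_bound)
    show "integrable lborel (\<lambda>\<xi>. ?C * norm (g \<xi>))" using g by simp
    show "AE x in lborel. norm (sft f x * g x) \<le> norm (?C * norm (g x))"
    proof (intro AE_I2)
      fix x have "norm (sft f x * g x) \<le> ?C * norm (g x)"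
        by (simp only: norm_mult mult_right_mono norm_sft_le[OF f] norm_ge_zero)
      then show "norm (sft f x * g x) \<le> norm (?C * norm (g x))" by simp
    qed
  qed auto
  then have intr: "integrable lborel (\<lambda>\<xi>. (norm (sft f \<xi>))\<^sup>2 * ?e \<xi>)"
    unfolding sq by (simp only: complex_of_real_integrable_eq)
  \<comment> \<open>Up to conjugation \<open>sft g\<close> is the mollified \<open>f\<close>, by
    \<open>regularised_inversion\<close>.\<close>
  have sg: "ennreal (norm (sft g x)) \<le> (\<integral>\<^sup>+y. ennreal (norm (f y) * heat_kernel \<delta> (x - y)) \<partial>lborel)" for x
  proof -
    have "cis (- (\<xi> \<bullet> x)) * g \<xi> = cnj (cis (x \<bullet> \<xi>) * (sft f \<xi> * complex_of_real (?e \<xi>)))" for \<xi>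
      by (simp add: g_def cis_cnj inner_commute[of \<xi> x])
    then have "sft g x = (1 / (2 * pi)) *\<^sub>R (LINT \<xi>|lborel. cnj (cis (x \<bullet> \<xi>) * (sft f \<xi> * complex_of_real (?e \<xi>))))"
      unfolding sft_def[of g] by presburger
    also have "\<dots> = cnj ((1 / (2 * pi)) *\<^sub>R (LINT \<xi>|lborel. cis (x \<bullet> \<xi>) * (sft f \<xi> * complex_of_real (?e \<xi>))))"
      by (simp only: complex_cnj_scaleR Bochner_Integration.integral_cnj)
    also have "\<dots> = cnj (LINT y|lborel. f y * complex_of_real (heat_kernel \<delta> (x - y)))"
      by (simp only: regularised_inversion[OF \<delta> f])
    finally have "norm (sft g x) = norm (LINT y|lborel. f y * complex_of_real (heat_kernel \<delta> (x - y)))" by simp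
    also have "ennreal \<dots> \<le> (\<integral>\<^sup>+y. norm (f y * complex_of_real (heat_kernel \<delta> (x - y))) \<partial>lborel)"
      by (rule norm_integral_le_nn_integral)
    also have "\<dots> = (\<integral>\<^sup>+y. ennreal (norm (f y) * heat_kernel \<delta> (x - y)) \<partial>lborel)"
      using heat_kernel_pos[OF \<delta>] by (simp add: norm_mult abs_of_pos)
    finally show ?thesis .
  qed
  have "(\<integral>\<^sup>+\<xi>. ennreal ((norm (sft f \<xi>))\<^sup>2 * ?e \<xi>) \<partial>lborel) = ennreal (LINT \<xi>|lborel. (norm (sft f \<xi>))\<^sup>2 * ?e \<xi>)"
    using intr by (intro nn_integral_eq_integral) auto
  also have "(LINT \<xi>|lborel. (norm (sft f \<xi>))\<^sup>2 * ?e \<xi>) = norm (LINT \<xi>|lborel. sft f \<xi> * g \<xi>)"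
    unfolding sq integral_complex_of_real norm_of_real by (subst abs_of_nonneg) auto
  also have "\<dots> = norm (LINT x|lborel. f x * sft g x)"
    using integral_sft_mult[OF f g] by simp
  also have "ennreal \<dots> \<le> (\<integral>\<^sup>+x. norm (f x * sft g x) \<partial>lborel)"
    by (rule norm_integral_le_nn_integral)
  also have "\<dots> \<le> (\<integral>\<^sup>+x. \<integral>\<^sup>+y. ennreal (norm (f x) * (norm (f y) * heat_kernel \<delta> (x - y))) \<partial>lborel \<partial>lborel)"
  proof (intro nn_integral_mono)
    fix x
    have "ennreal (norm (f x * sft g x)) = ennreal (norm (f x)) * ennreal (norm (sft g x))"
      by (simp add: norm_mult ennreal_mult)
    also have "\<dots> \<le> ennreal (norm (f x)) * (\<integral>\<^sup>+y. ennreal (norm (f y) * heat_kernel \<delta> (x - y)) \<partial>lborel)"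
      by (intro mult_left_mono sg) auto
    also have "\<dots> = (\<integral>\<^sup>+y. ennreal (norm (f x) * (norm (f y) * heat_kernel \<delta> (x - y))) \<partial>lborel)"
      by (subst nn_integral_cmult[symmetric]) (auto simp: ennreal_mult')
    finally show "ennreal (norm (f x * sft g x)) \<le> \<dots>" .
  qed
  \<comment> \<open>Schur's test: the product is split into halves of squares, and the kernel is
    then integrated in the variable that does not occur in the square.\<close>
  also have "\<dots> \<le> (\<integral>\<^sup>+x. \<integral>\<^sup>+y. ennreal (1/2 * (norm (f x))\<^sup>2) * ennreal (heat_kernel \<delta> (x - y)) + ennreal (1/2 * (norm (f y))\<^sup>2) * ennreal (heat_kernel \<delta> (x - y)) \<partial>lborel \<partial>lborel)"
  proof (intro nn_integral_mono)
    fix x y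
    let ?k = "heat_kernel \<delta> (x - y)"
    have k: "?k \<ge> 0" using heat_kernel_pos[OF \<delta>] by (simp add: less_imp_le)
    have "norm (f x) * norm (f y) \<le> 1/2 * (norm (f x))\<^sup>2 + 1/2 * (norm (f y))\<^sup>2"
      using sum_squares_bound[of "norm (f x)" "norm (f y)"] by simp
    then have "norm (f x) * (norm (f y) * ?k) \<le> 1/2 * (norm (f x))\<^sup>2 * ?k + 1/2 * (norm (f y))\<^sup>2 * ?k"
      using mult_right_mono[OF _ k, of "norm (f x) * norm (f y)" "1/2 * (norm (f x))\<^sup>2 + 1/2 * (norm (f y))\<^sup>2"] by (simp add: algebra_simps)
    then have "ennreal (norm (f x) * (norm (f y) * ?k)) \<le> ennreal (1/2 * (norm (f x))\<^sup>2 * ?k + 1/2 * (norm (f y))\<^sup>2 * ?k)"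
      by (rule ennreal_leI)
    also have "\<dots> = ennreal (1/2 * (norm (f x))\<^sup>2) * ennreal ?k + ennreal (1/2 * (norm (f y))\<^sup>2) * ennreal ?k"
      using k by (subst ennreal_plus) (auto simp flip: ennreal_mult)
    finally show "ennreal (norm (f x) * (norm (f y) * ?k)) \<le> \<dots>" .
  qed
  also have "\<dots> = (\<integral>\<^sup>+x. ennreal (1/2 * (norm (f x))\<^sup>2) \<partial>lborel) + (\<integral>\<^sup>+x. \<integral>\<^sup>+y. ennreal (1/2 * (norm (f y))\<^sup>2) * ennreal (heat_kernel \<delta> (x - y)) \<partial>lborel \<partial>lborel)"
    by (simp add: nn_integral_add nn_integral_cmult nn_integral_heat_kernel[OF \<delta>])
  also have "(\<integral>\<^sup>+x. \<integral>\<^sup>+y. ennreal (1/2 * (norm (f y))\<^sup>2) * ennreal (heat_kernel \<delta> (x - y)) \<partial>lborel \<partial>lborel) = (\<integral>\<^sup>+y. ennreal (1/2 * (norm (f y))\<^sup>2) \<partial>lborel)"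
    by (subst lborel_pair.Fubini') (simp_all add: nn_integral_cmult nn_integral_heat_kernel[OF \<delta>])
  also have "(\<integral>\<^sup>+y. ennreal (1/2 * (norm (f y))\<^sup>2) \<partial>lborel) + (\<integral>\<^sup>+y. ennreal (1/2 * (norm (f y))\<^sup>2) \<partial>lborel) = (\<integral>\<^sup>+x. ennreal ((norm (f x))\<^sup>2) \<partial>lborel)"
    by (subst nn_integral_add[symmetric]) (auto simp flip: ennreal_plus)
  finally show ?thesis .
qed

text \<open>Fatou along \<open>\<delta> = 1 / Suc n\<close>. The constant is 1 because the factor
  \<open>1 / (2 * pi)\<close> in \<open>sft\<close> makes the transform unitary on the
  plane.\<close>

lemma plancherel_le:
  assumes f: "integrable lborel f"
  shows "(\<integral>\<^sup>+\<xi>. ennreal ((norm (sft f \<xi>))\<^sup>2) \<partial>lborel) \<le> (\<integral>\<^sup>+x. ennreal ((norm (f x))\<^sup>2) \<partial>lborel)"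
proof (rule nn_integral_le_of_LIMSEQ)
  fix n
  show "(\<integral>\<^sup>+\<xi>. ennreal ((norm (sft f \<xi>))\<^sup>2 * exp (- (1 / real (Suc n)) * (norm \<xi>)\<^sup>2 / 2)) \<partial>lborel)
      \<le> (\<integral>\<^sup>+x. ennreal ((norm (f x))\<^sup>2) \<partial>lborel)"
    by (rule plancherel_regularised[OF _ f]) simp
  have [measurable]: "sft f \<in> borel_measurable borel" using f by simp
  show "(\<lambda>\<xi>. ennreal ((norm (sft f \<xi>))\<^sup>2 * exp (- (1 / real (Suc n)) * (norm \<xi>)\<^sup>2 / 2))) \<in> borel_measurable lborel"
    by measurable
next
  fix \<xi> :: "real^2"
  have "(\<lambda>n. (norm (sft f \<xi>))\<^sup>2 * exp (- (1 / real (Suc n)) * (norm \<xi>)\<^sup>2 / 2)) \<longlonglongrightarrow> (norm (sft f \<xi>))\<^sup>2 * exp (- 0 * (norm \<xi>)\<^sup>2 / 2)"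
    by (intro tendsto_intros LIMSEQ_Suc[OF lim_1_over_n]) simp
  then show "(\<lambda>n. ennreal ((norm (sft f \<xi>))\<^sup>2 * exp (- (1 / real (Suc n)) * (norm \<xi>)\<^sup>2 / 2))) \<longlonglongrightarrow> ennreal ((norm (sft f \<xi>))\<^sup>2)"
    by (intro tendsto_ennrealI) simp
qed


section \<open>Interpolation: the scalar Hausdorff-Young inequality\<close>

lemma nn_integral_powr_interval:
  fixes a c :: real
  assumes "a > -1" "c \<ge> 0"
  shows "(\<integral>\<^sup>+\<tau>. ennreal (\<tau> powr a) * indicator {0<..<c} \<tau> \<partial>lborel) = ennreal (c powr (a + 1) / (a + 1))"
proof -
  have "((\<lambda>x. x powr a) has_integral (c powr (a+1) / (a+1))) {0..c}"
    by (rule has_integral_powr_from_0[OF assms])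
  then have "(\<integral>\<^sup>+\<tau>. ennreal (\<tau> powr a) * indicator {0..c} \<tau> \<partial>lborel) = ennreal (c powr (a + 1) / (a + 1))"
    by (intro nn_integral_has_integral_lebesgue') auto
  also have "(\<integral>\<^sup>+\<tau>. ennreal (\<tau> powr a) * indicator {0..c} \<tau> \<partial>lborel) = (\<integral>\<^sup>+\<tau>. ennreal (\<tau> powr a) * indicator {0<..<c} \<tau> \<partial>lborel)"
  proof (rule nn_integral_cong_AE)
    have "AE x in lborel. x \<noteq> 0 \<and> x \<noteq> c"
      using AE_lborel_singleton[of 0] AE_lborel_singleton[of c] by eventually_elim auto
    then show "AE x in lborel. ennreal (x powr a) * indicator {0..c} x = ennreal (x powr a) * indicator {0<..<c} x"
      by eventually_elim (auto simp: indicator_def)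
  qed
  finally show ?thesis .
qed

text \<open>Marcinkiewicz interpolation between the trivial bound and Plancherel: at level \<open>\<tau>\<close>
  the function is cut at height \<open>\<tau> powr (1 - q)\<close>, which makes the transform of the tall part
  bounded by \<open>\<tau>\<close>.\<close>

lemma hausdorff_young_distribution:
  fixes p q \<tau> :: real
  assumes pq: "1 < p" "p * q = p + q" and f: "integrable lborel f"
    and N: "(\<integral>\<^sup>+x. ennreal (norm (f x) powr p) \<partial>lborel) \<le> 1" and \<tau>: "\<tau> > 0"
  shows "(\<integral>\<^sup>+\<xi>. indicator {\<xi>. 2 * \<tau> < norm (sft f \<xi>)} \<xi> \<partial>lborel)
    \<le> ennreal (\<tau> powr (-2)) * (\<integral>\<^sup>+x. ennreal ((norm (f x))\<^sup>2) * indicator {x. norm (f x) < \<tau> powr (1 - q)} x \<partial>lborel)"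
proof -
  have [measurable]: "f \<in> borel_measurable borel" using f by (auto dest: borel_measurable_integrable)
  have pq1: "(p - 1) * (q - 1) = 1" using pq by (simp add: algebra_simps)
  define h where "h = \<tau> powr (1 - q)"
  define f1 where "f1 x = (if norm (f x) < h then 0 else f x)" for x
  define f2 where "f2 x = (if norm (f x) < h then f x else 0)" for x
  have h: "h > 0" using \<tau> by (simp add: h_def)
  have [measurable]: "f1 \<in> borel_measurable borel" "f2 \<in> borel_measurable borel"
    unfolding f1_def[abs_def] f2_def[abs_def] by measurable
  have i1: "integrable lborel f1" by (rule Bochner_Integration.integrable_bound[OF f]) (auto simp: f1_def)
  have i2: "integrable lborel f2" by (rule Bochner_Integration.integrable_bound[OF f]) (auto simp: f2_def)
  have [measurable]: "sft f2 \<in> borel_measurable borel" using i2 by simp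
  have "f = (\<lambda>x. f1 x + f2 x)" by (auto simp: f1_def f2_def)
  then have sum: "sft f \<xi> = sft f1 \<xi> + sft f2 \<xi>" for \<xi> using sft_add[OF i1 i2] by simp
  \<comment> \<open>Height and level are dual: \<open>(1 - q) * (1 - p) = 1\<close> makes the factor
    gained on the tall part equal to \<open>\<tau>\<close>.\<close>
  have h\<tau>: "h powr (1 - p) = \<tau>"
  proof -
    have "(1 - q) * (1 - p) = 1" using pq1 by (simp add: algebra_simps)
    then show ?thesis using \<tau> by (simp add: h_def powr_powr)
  qed
  have "ennreal (LINT x|lborel. norm (f1 x)) = (\<integral>\<^sup>+x. ennreal (norm (f1 x)) \<partial>lborel)"
    using i1 by (subst nn_integral_eq_integral) auto
  \<comment> \<open>On the tall part the negative power \<open>1 - p\<close> of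
    \<open>norm (f x)\<close> is at most that of \<open>h\<close>, so the p-th moment controls the
    L^1 norm.\<close>
  also have "\<dots> \<le> (\<integral>\<^sup>+x. ennreal (h powr (1 - p)) * ennreal (norm (f x) powr p) \<partial>lborel)"
  proof (intro nn_integral_mono)
    fix x
    have "norm (f1 x) \<le> h powr (1 - p) * norm (f x) powr p"
    proof (cases "norm (f x) < h")
      case False
      then have g: "norm (f x) > 0" "h \<le> norm (f x)" using h by linarith+
      have "norm (f x) powr (1 - p) \<le> h powr (1 - p)"
        using g h pq(1) by (intro powr_mono2') auto
      then have "norm (f x) powr (1 - p) * norm (f x) powr p \<le> h powr (1 - p) * norm (f x) powr p"
        by (intro mult_right_mono) auto
      then show ?thesis using False g by (simp add: f1_def powr_add[symmetric])
    qed (simp add: f1_def)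
    then show "ennreal (norm (f1 x)) \<le> ennreal (h powr (1 - p)) * ennreal (norm (f x) powr p)"
      by (simp flip: ennreal_mult')
  qed
  also have "\<dots> = ennreal \<tau> * (\<integral>\<^sup>+x. ennreal (norm (f x) powr p) \<partial>lborel)"
    unfolding h\<tau> by (simp add: nn_integral_cmult)
  also have "\<dots> \<le> ennreal \<tau> * 1"
    using N by (intro mult_left_mono) auto
  finally have L1: "(LINT x|lborel. norm (f1 x)) \<le> \<tau>"
    using \<tau> by simp
  have s1: "norm (sft f1 \<xi>) \<le> \<tau>" for \<xi>
  proof -
    have "norm (sft f1 \<xi>) \<le> (LINT x|lborel. norm (f1 x)) / (2 * pi)" by (rule norm_sft_le[OF i1])
    also have "\<dots> \<le> \<tau> / (2 * pi)" using L1 by (simp add: divide_right_mono)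
    also have "\<dots> \<le> \<tau>" 
    proof -
      have "1 \<le> 2 * pi" using pi_gt3 by linarith
      then show ?thesis using \<tau> by (simp add: divide_le_eq mult_le_cancel_left1)
    qed
    finally show ?thesis .
  qed
  have "(\<integral>\<^sup>+\<xi>. indicator {\<xi>. 2 * \<tau> < norm (sft f \<xi>)} \<xi> \<partial>lborel) \<le> (\<integral>\<^sup>+\<xi>. ennreal (\<tau> powr (-2)) * ennreal ((norm (sft f2 \<xi>))\<^sup>2) \<partial>lborel)"
  proof (intro nn_integral_mono)
    fix \<xi>
    show "indicator {\<xi>. 2 * \<tau> < norm (sft f \<xi>)} \<xi> \<le> ennreal (\<tau> powr (-2)) * ennreal ((norm (sft f2 \<xi>))\<^sup>2)"
    \<comment> \<open>Chebyshev: above the level \<open>2 * \<tau>\<close> the transform of the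
      short part alone is at least \<open>\<tau>\<close>.\<close>
    proof (cases "2 * \<tau> < norm (sft f \<xi>)")
      case True
      have "norm (sft f \<xi>) \<le> norm (sft f1 \<xi>) + norm (sft f2 \<xi>)" unfolding sum by (rule norm_triangle_ineq)
      then have "\<tau> \<le> norm (sft f2 \<xi>)" using True s1[of \<xi>] by linarith
      then have "\<tau>\<^sup>2 \<le> (norm (sft f2 \<xi>))\<^sup>2" using \<tau> by (intro power_mono) auto
      then have "1 \<le> (norm (sft f2 \<xi>))\<^sup>2 / \<tau>\<^sup>2" using \<tau> by simp
      then have "1 \<le> \<tau> powr (-2) * (norm (sft f2 \<xi>))\<^sup>2"
        using \<tau> by (simp add: powr_minus_divide)
      then show ?thesis using True by (simp flip: ennreal_mult')
    qed simp
  qed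
  also have "\<dots> = ennreal (\<tau> powr (-2)) * (\<integral>\<^sup>+\<xi>. ennreal ((norm (sft f2 \<xi>))\<^sup>2) \<partial>lborel)"
    by (rule nn_integral_cmult) measurable
  also have "\<dots> \<le> ennreal (\<tau> powr (-2)) * (\<integral>\<^sup>+x. ennreal ((norm (f2 x))\<^sup>2) \<partial>lborel)"
    by (intro mult_left_mono plancherel_le i2) auto
  also have "(\<integral>\<^sup>+x. ennreal ((norm (f2 x))\<^sup>2) \<partial>lborel) = (\<integral>\<^sup>+x. ennreal ((norm (f x))\<^sup>2) * indicator {x. norm (f x) < \<tau> powr (1 - q)} x \<partial>lborel)"
    by (intro nn_integral_cong) (auto simp: f2_def h_def)
  finally show ?thesis .
qed

text \<open>The layer-cake formula expresses the q-th moment through the level sets of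
  \<open>sft f\<close>. After inserting the level set bound, Tonelli leaves for each
  \<open>x\<close> an integral of \<open>\<tau> powr (q - 3)\<close> up to
  \<open>norm (f x) powr (1 - p)\<close>. It converges at 0 because \<open>q > 2\<close>; the
  constant blows up as q tends to 2, so \<open>p = 2\<close> is left to Plancherel.\<close>

lemma hausdorff_young_unit:
  fixes p q :: real
  assumes pq: "1 < p" "p < 2" "p * q = p + q" and f: "integrable lborel f"
    and N: "(\<integral>\<^sup>+x. ennreal (norm (f x) powr p) \<partial>lborel) \<le> 1"
  shows "(\<integral>\<^sup>+\<xi>. ennreal (norm (sft f \<xi>) powr q) \<partial>lborel) \<le> ennreal (q * 2 powr q / (q - 2))"
proof -
  have [measurable]: "f \<in> borel_measurable borel" using f by (auto dest: borel_measurable_integrable)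
  have [measurable]: "sft f \<in> borel_measurable borel" using f by simp
  have pq1: "(p - 1) * (q - 1) = 1" using pq by (simp add: algebra_simps)
  have q2: "q > 2"
  proof (rule ccontr)
    assume "\<not> q > 2"
    then have "(p - 1) * (q - 1) \<le> (p - 1) * 1" using pq by (intro mult_left_mono) auto
    then show False using pq1 pq by simp
  qed
  \<comment> \<open>The factor \<open>2 powr q\<close> arises because the level is
    \<open>2 * \<tau>\<close>, one \<open>\<tau>\<close> for each part of the decomposition.\<close>
  let ?w = "\<lambda>\<tau>::real. ennreal (q * 2 powr q * \<tau> powr (q - 1)) * indicator {0<..} \<tau>"
  have "(\<integral>\<^sup>+\<xi>. ennreal (norm (sft f \<xi>) powr q) \<partial>lborel)
     = (\<integral>\<^sup>+\<xi>. \<integral>\<^sup>+\<tau>. ?w \<tau> * indicator {\<xi>. 2 * \<tau> < norm (sft f \<xi>)} \<xi> \<partial>lborel \<partial>lborel)"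
  proof (intro nn_integral_cong)
    fix \<xi>
    let ?c = "norm (sft f \<xi>) / 2"
    have "(\<integral>\<^sup>+\<tau>. ?w \<tau> * indicator {\<xi>. 2 * \<tau> < norm (sft f \<xi>)} \<xi> \<partial>lborel)
      = (\<integral>\<^sup>+\<tau>. ennreal (q * 2 powr q) * (ennreal (\<tau> powr (q - 1)) * indicator {0<..<?c} \<tau>) \<partial>lborel)"
      using q2 by (intro nn_integral_cong) (auto simp: indicator_def ennreal_mult)
    also have "\<dots> = ennreal (q * 2 powr q) * ennreal (?c powr (q - 1 + 1) / (q - 1 + 1))"
      using q2 by (subst nn_integral_cmult) (auto simp: nn_integral_powr_interval)
    also have "\<dots> = ennreal (norm (sft f \<xi>) powr q)"
      using q2 by (simp add: powr_divide flip: ennreal_mult')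
    finally show "ennreal (norm (sft f \<xi>) powr q) = (\<integral>\<^sup>+\<tau>. ?w \<tau> * indicator {\<xi>. 2 * \<tau> < norm (sft f \<xi>)} \<xi> \<partial>lborel)" ..
  qed
  also have "\<dots> = (\<integral>\<^sup>+\<tau>. \<integral>\<^sup>+\<xi>. ?w \<tau> * indicator {\<xi>. 2 * \<tau> < norm (sft f \<xi>)} \<xi> \<partial>lborel \<partial>lborel)"
    by (rule lborel_pair.Fubini') measurable
  also have "\<dots> \<le> (\<integral>\<^sup>+\<tau>. \<integral>\<^sup>+x. ennreal (q * 2 powr q) * (ennreal (\<tau> powr (q - 3)) * indicator {0<..} \<tau>) * (ennreal ((norm (f x))\<^sup>2) * indicator {x. norm (f x) < \<tau> powr (1 - q)} x) \<partial>lborel \<partial>lborel)"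
  proof (rule nn_integral_mono)
    fix \<tau> :: real
    show "(\<integral>\<^sup>+\<xi>. ?w \<tau> * indicator {\<xi>. 2 * \<tau> < norm (sft f \<xi>)} \<xi> \<partial>lborel)
       \<le> (\<integral>\<^sup>+x. ennreal (q * 2 powr q) * (ennreal (\<tau> powr (q - 3)) * indicator {0<..} \<tau>) * (ennreal ((norm (f x))\<^sup>2) * indicator {x. norm (f x) < \<tau> powr (1 - q)} x) \<partial>lborel)"
    proof (cases "\<tau> > 0")
      case True
      have w: "?w \<tau> * ennreal (\<tau> powr (-2)) = ennreal (q * 2 powr q) * (ennreal (\<tau> powr (q - 3)) * indicator {0<..} \<tau>)"
      proof -
        have "\<tau> powr (q - 1) * \<tau> powr (-2) = \<tau> powr (q - 3)" using True by (simp add: powr_add[symmetric])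
        then have "q * 2 powr q * \<tau> powr (q - 1) * \<tau> powr (-2) = q * 2 powr q * \<tau> powr (q - 3)" by simp
        then show ?thesis using True q2 by (simp flip: ennreal_mult')
      qed
      have "(\<integral>\<^sup>+\<xi>. ?w \<tau> * indicator {\<xi>. 2 * \<tau> < norm (sft f \<xi>)} \<xi> \<partial>lborel) = ?w \<tau> * (\<integral>\<^sup>+\<xi>. indicator {\<xi>. 2 * \<tau> < norm (sft f \<xi>)} \<xi> \<partial>lborel)"
        by (rule nn_integral_cmult) measurable
      also have "\<dots> \<le> ?w \<tau> * (ennreal (\<tau> powr (-2)) * (\<integral>\<^sup>+x. ennreal ((norm (f x))\<^sup>2) * indicator {x. norm (f x) < \<tau> powr (1 - q)} x \<partial>lborel))"
        by (intro mult_left_mono hausdorff_young_distribution[OF pq(1,3) f N True]) auto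
      also have "\<dots> = (\<integral>\<^sup>+x. ennreal (q * 2 powr q) * (ennreal (\<tau> powr (q - 3)) * indicator {0<..} \<tau>) * (ennreal ((norm (f x))\<^sup>2) * indicator {x. norm (f x) < \<tau> powr (1 - q)} x) \<partial>lborel)"
        unfolding mult.assoc[symmetric, of "?w \<tau>"] w by (rule nn_integral_cmult[symmetric]) measurable
      finally show ?thesis .
    qed simp
  qed
  also have "\<dots> = (\<integral>\<^sup>+x. \<integral>\<^sup>+\<tau>. ennreal (q * 2 powr q) * (ennreal (\<tau> powr (q - 3)) * indicator {0<..} \<tau>) * (ennreal ((norm (f x))\<^sup>2) * indicator {x. norm (f x) < \<tau> powr (1 - q)} x) \<partial>lborel \<partial>lborel)"
    by (rule lborel_pair.Fubini') measurable
  also have "\<dots> \<le> (\<integral>\<^sup>+x. ennreal (q * 2 powr q / (q - 2)) * ennreal (norm (f x) powr p) \<partial>lborel)"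
  proof (intro nn_integral_mono)
    fix x
    let ?a = "norm (f x)"
    show "(\<integral>\<^sup>+\<tau>. ennreal (q * 2 powr q) * (ennreal (\<tau> powr (q - 3)) * indicator {0<..} \<tau>) * (ennreal (?a\<^sup>2) * indicator {x. norm (f x) < \<tau> powr (1 - q)} x) \<partial>lborel)
      \<le> ennreal (q * 2 powr q / (q - 2)) * ennreal (?a powr p)"
    proof (cases "f x = 0")
      case False
      let ?c = "?a powr (1 - p)"
      have "(\<integral>\<^sup>+\<tau>. ennreal (q * 2 powr q) * (ennreal (\<tau> powr (q - 3)) * indicator {0<..} \<tau>) * (ennreal (?a\<^sup>2) * indicator {x. norm (f x) < \<tau> powr (1 - q)} x) \<partial>lborel)
       \<le> (\<integral>\<^sup>+\<tau>. ennreal (q * 2 powr q * ?a\<^sup>2) * (ennreal (\<tau> powr (q - 3)) * indicator {0<..<?c} \<tau>) \<partial>lborel)"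
      proof (intro nn_integral_mono)
        fix \<tau> :: real
        have "\<tau> < ?c" if "\<tau> > 0" "?a < \<tau> powr (1 - q)"
        proof -
          have "(\<tau> powr (1 - q)) powr (1 - p) < ?a powr (1 - p)"
            using that False pq(1) by (intro powr_less_mono2_neg) auto
          moreover have "(1 - q) * (1 - p) = 1" using pq1 by (simp add: algebra_simps)
          ultimately show ?thesis using that by (simp add: powr_powr)
        qed
        then show "ennreal (q * 2 powr q) * (ennreal (\<tau> powr (q - 3)) * indicator {0<..} \<tau>) * (ennreal (?a\<^sup>2) * indicator {x. norm (f x) < \<tau> powr (1 - q)} x)
          \<le> ennreal (q * 2 powr q * ?a\<^sup>2) * (ennreal (\<tau> powr (q - 3)) * indicator {0<..<?c} \<tau>)"
          using q2 by (auto simp: indicator_def ennreal_mult mult_ac)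
      qed
      also have "\<dots> = ennreal (q * 2 powr q * ?a\<^sup>2) * ennreal (?c powr (q - 3 + 1) / (q - 3 + 1))"
        using q2 by (subst nn_integral_cmult) (auto simp: nn_integral_powr_interval)
      also have "\<dots> = ennreal (q * 2 powr q / (q - 2)) * ennreal (?a powr p)"
      proof -
        \<comment> \<open>Duality of the exponents makes the powers of \<open>norm (f x)\<close> add
          up to exactly \<open>p\<close>.\<close>
        have e: "2 + (1 - p) * (q - 2) = p" using pq1 by (simp add: algebra_simps)
        have "?a\<^sup>2 * ?c powr (q - 2) = ?a powr 2 * ?a powr ((1 - p) * (q - 2))"
          using False by (simp add: powr_powr)
        also have "\<dots> = ?a powr p" by (simp only: powr_add[symmetric] e)
        finally have "q * 2 powr q * ?a\<^sup>2 * (?c powr (q - 2) / (q - 2)) = q * 2 powr q / (q - 2) * ?a powr p"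
          by simp
        then show ?thesis using q2 by (simp flip: ennreal_mult')
      qed
      finally show ?thesis .
    qed simp
  qed
  also have "\<dots> = ennreal (q * 2 powr q / (q - 2)) * (\<integral>\<^sup>+x. ennreal (norm (f x) powr p) \<partial>lborel)"
    by (rule nn_integral_cmult) measurable
  also have "\<dots> \<le> ennreal (q * 2 powr q / (q - 2)) * 1"
    using N by (intro mult_left_mono) auto
  finally show ?thesis by simp
qed

lemma powr_dual_gt_2:
  fixes p q :: real
  assumes "1 < p" "p \<le> 2" "p * q = p + q"
  shows "q \<ge> 2" "p < 2 \<Longrightarrow> q > 2" "p = 2 \<Longrightarrow> q = 2" "q > 1" "q > 0"
proof -
  have pq1: "(p - 1) * (q - 1) = 1" using assms by (simp add: algebra_simps)
  have "q - 1 = 1 / (p - 1)" using pq1 assms by (simp add: field_simps)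
  moreover have "1 / (p - 1) \<ge> 1" "p < 2 \<Longrightarrow> 1 / (p - 1) > 1" "p = 2 \<Longrightarrow> 1 / (p - 1) = 1" using assms by auto
  ultimately show "q \<ge> 2" "p < 2 \<Longrightarrow> q > 2" "p = 2 \<Longrightarrow> q = 2" "q > 1" "q > 0" by linarith+
qed

text \<open>Homogeneity reduces the claim to \<open>N = 1\<close>. The number \<open>N\<close> is
  any positive bound on the norm, so a vanishing \<open>f\<close> needs no separate case.\<close>

lemma hausdorff_young_scalar:
  fixes p q :: real
  assumes pq: "1 < p" "p \<le> 2" "p * q = p + q"
  obtains C where "C > 0"
    "\<And>(f :: real^2 \<Rightarrow> complex) N. integrable lborel f \<Longrightarrow> N > 0 \<Longrightarrow> (\<integral>\<^sup>+x. ennreal (norm (f x) powr p) \<partial>lborel) \<le> ennreal (N powr p)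
      \<Longrightarrow> (\<integral>\<^sup>+\<xi>. ennreal (norm (sft f \<xi>) powr q) \<partial>lborel) \<le> ennreal (C * N powr q)"
proof -
  define C where "C = (if p < 2 then q * 2 powr q / (q - 2) else 1)"
  have q: "q \<ge> 2" "p < 2 \<Longrightarrow> q > 2" "p = 2 \<Longrightarrow> q = 2" using powr_dual_gt_2[OF pq] by auto
  have C: "C > 0" using q by (auto simp: C_def)
  have unit: "(\<integral>\<^sup>+\<xi>. ennreal (norm (sft f \<xi>) powr q) \<partial>lborel) \<le> ennreal C"
    if f: "integrable lborel f" and N: "(\<integral>\<^sup>+x. ennreal (norm (f x) powr p) \<partial>lborel) \<le> 1" for f :: "real^2 \<Rightarrow> complex"
  proof (cases "p < 2")
    case True
    then show ?thesis using hausdorff_young_unit[OF pq(1) True pq(3) f N] by (simp add: C_def)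
  next
    case False
    then have "p = 2" "q = 2" using pq q by auto
    then show ?thesis using plancherel_le[OF f] N by (simp add: C_def)
  qed
  show thesis
  proof (rule that[OF C])
    fix f :: "real^2 \<Rightarrow> complex" and N :: real
    assume f: "integrable lborel f" and N: "N > 0" and le: "(\<integral>\<^sup>+x. ennreal (norm (f x) powr p) \<partial>lborel) \<le> ennreal (N powr p)"
    have [measurable]: "f \<in> borel_measurable borel" using f by (auto dest: borel_measurable_integrable)
    have [measurable]: "sft f \<in> borel_measurable borel" using f by simp
    define g where "g x = complex_of_real (1 / N) * f x" for x
    have g: "integrable lborel g" unfolding g_def using f by simp
    have [measurable]: "sft g \<in> borel_measurable borel" using g by simp
    have "(\<integral>\<^sup>+x. ennreal (norm (g x) powr p) \<partial>lborel) = (\<integral>\<^sup>+x. ennreal (N powr (-p)) * ennreal (norm (f x) powr p) \<partial>lborel)"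
      using N by (intro nn_integral_cong) (simp add: g_def norm_mult norm_divide powr_divide powr_minus_divide flip: ennreal_mult')
    also have "\<dots> = ennreal (N powr (-p)) * (\<integral>\<^sup>+x. ennreal (norm (f x) powr p) \<partial>lborel)"
      by (rule nn_integral_cmult) measurable
    also have "\<dots> \<le> ennreal (N powr (-p)) * ennreal (N powr p)"
      using le by (intro mult_left_mono) auto
    also have "\<dots> = 1" using N by (simp add: powr_minus flip: ennreal_mult')
    finally have u: "(\<integral>\<^sup>+\<xi>. ennreal (norm (sft g \<xi>) powr q) \<partial>lborel) \<le> ennreal C"
      by (rule unit[OF g])
    have "(\<integral>\<^sup>+\<xi>. ennreal (norm (sft f \<xi>) powr q) \<partial>lborel) = (\<integral>\<^sup>+\<xi>. ennreal (N powr q) * ennreal (norm (sft g \<xi>) powr q) \<partial>lborel)"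
      unfolding g_def sft_cmult
      using N by (intro nn_integral_cong) (simp add: norm_mult norm_divide powr_divide flip: ennreal_mult')
    also have "\<dots> = ennreal (N powr q) * (\<integral>\<^sup>+\<xi>. ennreal (norm (sft g \<xi>) powr q) \<partial>lborel)"
      by (rule nn_integral_cmult) measurable
    also have "\<dots> \<le> ennreal (N powr q) * ennreal C"
      using u by (intro mult_left_mono) auto
    also have "\<dots> = ennreal (C * N powr q)" using C by (simp add: mult.commute flip: ennreal_mult')
    finally show "(\<integral>\<^sup>+\<xi>. ennreal (norm (sft f \<xi>) powr q) \<partial>lborel) \<le> ennreal (C * N powr q)" .
  qed
qed

section \<open>Passage to vector-valued functions\<close>

lemma norm_vec_le_sum: "norm (v :: complex^'n) \<le> (\<Sum>i\<in>UNIV. norm (v $ i))"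
  unfolding norm_vec_def by (rule L2_set_le_sum) auto

lemma norm_vec_powr_le:
  assumes "q > 0"
  shows "norm (v :: complex^'n) powr q \<le> real CARD('n) powr q * (\<Sum>i\<in>UNIV. norm (v $ i) powr q)"
proof -
  define m where "m = Max (range (\<lambda>i. norm (v $ i)))"
  have "m \<in> range (\<lambda>i. norm (v $ i))" unfolding m_def by (rule Max_in) auto
  then obtain i where i: "m = norm (v $ i)" by auto
  have le: "norm (v $ j) \<le> m" for j unfolding m_def by (rule Max_ge) auto
  have "(\<Sum>j\<in>UNIV. norm (v $ j)) \<le> (\<Sum>j\<in>(UNIV::'n set). m)" by (rule sum_mono) (rule le)
  with norm_vec_le_sum[of v] have "norm v \<le> (\<Sum>j\<in>(UNIV::'n set). m)" by (rule order_trans)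
  then have "norm v powr q \<le> (real CARD('n) * norm (v $ i)) powr q"
    using assms i by (intro powr_mono2) auto
  also have "\<dots> = real CARD('n) powr q * norm (v $ i) powr q" by (simp add: powr_mult)
  also have "\<dots> \<le> real CARD('n) powr q * (\<Sum>i\<in>UNIV. norm (v $ i) powr q)"
    by (intro mult_left_mono member_le_sum) auto
  finally show ?thesis .
qed

lemma integrable_vec_nth:
  fixes f :: "'a \<Rightarrow> complex^'n"
  shows "integrable M f \<Longrightarrow> integrable M (\<lambda>x. f x $ i)"
  by (rule integrable_bounded_linear[OF bounded_linear_vec_nth])

lemma borel_measurable_vecI:
  fixes f :: "'a \<Rightarrow> 'b::euclidean_space^'n"
  assumes "\<And>i. (\<lambda>x. f x $ i) \<in> borel_measurable M"
  shows "f \<in> borel_measurable M"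
proof (subst borel_measurable_euclidean_space, intro ballI)
  fix b :: "'b^'n" assume "b \<in> Basis"
  then obtain i u where b: "b = axis i u" by (auto simp: Basis_vec_def)
  show "(\<lambda>x. f x \<bullet> b) \<in> borel_measurable M"
    unfolding b inner_axis using assms[of i] by measurable
qed

lemma integrable_vecI:
  fixes f :: "'a \<Rightarrow> complex^'n"
  assumes "\<And>i. integrable M (\<lambda>x. f x $ i)"
  shows "integrable M f"
proof (rule Bochner_Integration.integrable_bound)
  show "integrable M (\<lambda>x. \<Sum>i\<in>UNIV. norm (f x $ i))"
    using assms by auto
  show "f \<in> borel_measurable M"
    using assms by (intro borel_measurable_vecI) auto
  show "AE x in M. norm (f x) \<le> norm (\<Sum>i\<in>UNIV. norm (f x $ i))"
    using norm_vec_le_sum by (auto simp: abs_of_nonneg sum_nonneg)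
qed

lemma integral_vec_nth:
  fixes f :: "'a \<Rightarrow> complex^'n"
  assumes "integrable M f"
  shows "(LINT x|M. f x) $ i = (LINT x|M. f x $ i)"
  using integral_bounded_linear[OF bounded_linear_vec_nth assms] by simp

lemma norm_vector_smult: "norm (c *s v :: complex^'n) = norm c * norm v"
  unfolding norm_vec_def by (simp add: norm_mult L2_set_left_distrib L2_set_right_distrib)

text \<open>The inverse transform is the forward one followed by a reflection, so one scalar theory
  serves both.\<close>

lemma fourier_nth:
  assumes f: "integrable lborel (f :: real^2 \<Rightarrow> complex^'n)"
  shows "fourier f \<xi> $ i = sft (\<lambda>x. f x $ i) \<xi>"
    and "inv_fourier f \<xi> $ i = sft (\<lambda>x. f x $ i) (- \<xi>)"
proof -
  have i1: "integrable lborel (\<lambda>x. cis (b x) *s f x)" if [measurable]: "b \<in> borel_measurable borel" for b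
  proof (rule integrable_vecI)
    fix i show "integrable lborel (\<lambda>x. (cis (b x) *s f x) $ i)"
      using integrable_cis_mult[OF integrable_vec_nth[OF f]] by simp
  qed
  show "fourier f \<xi> $ i = sft (\<lambda>x. f x $ i) \<xi>"
    unfolding fourier_def sft_def vector_scaleR_component by (subst integral_vec_nth[OF i1]) auto
  show "inv_fourier f \<xi> $ i = sft (\<lambda>x. f x $ i) (- \<xi>)"
    unfolding inv_fourier_def sft_def vector_scaleR_component by (subst integral_vec_nth[OF i1]) (auto simp: inner_commute)
qed

lemma continuous_on_fourier:
  assumes f: "integrable lborel (f :: real^2 \<Rightarrow> complex^'n)"
  shows "continuous_on UNIV (fourier f)"
proof -
  have "fourier f = (\<lambda>\<xi>. \<chi> i. sft (\<lambda>x. f x $ i) \<xi>)"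
    by (simp add: fun_eq_iff vec_eq_iff fourier_nth[OF f])
  then show ?thesis
    using continuous_on_sft[OF integrable_vec_nth[OF f]] by (simp add: continuous_on_vec_lambda)
qed

lemma inv_fourier_eq: "inv_fourier f x = fourier f (- x)"
  by (simp add: fourier_def inv_fourier_def inner_commute)

theorem hausdorff_young:
  fixes p q :: real
  assumes pq: "1 < p" "p \<le> 2" "p * q = p + q"
  obtains C where "C > 0"
    "\<And>(f :: real^2 \<Rightarrow> complex^'n) N. integrable lborel f \<Longrightarrow> N > 0 \<Longrightarrow> (\<integral>\<^sup>+x. ennreal (norm (f x) powr p) \<partial>lborel) \<le> ennreal (N powr p)
      \<Longrightarrow> (\<integral>\<^sup>+\<xi>. ennreal (norm (fourier f \<xi>) powr q) \<partial>lborel) \<le> ennreal ((C * N) powr q)"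
    "\<And>(f :: real^2 \<Rightarrow> complex^'n) N. integrable lborel f \<Longrightarrow> N > 0 \<Longrightarrow> (\<integral>\<^sup>+x. ennreal (norm (f x) powr p) \<partial>lborel) \<le> ennreal (N powr p)
      \<Longrightarrow> (\<integral>\<^sup>+\<xi>. ennreal (norm (inv_fourier f \<xi>) powr q) \<partial>lborel) \<le> ennreal ((C * N) powr q)"
proof -
  obtain C where C: "C > 0" and HY: "\<And>(f :: real^2 \<Rightarrow> complex) N. integrable lborel f \<Longrightarrow> N > 0 \<Longrightarrow> (\<integral>\<^sup>+x. ennreal (norm (f x) powr p) \<partial>lborel) \<le> ennreal (N powr p)
      \<Longrightarrow> (\<integral>\<^sup>+\<xi>. ennreal (norm (sft f \<xi>) powr q) \<partial>lborel) \<le> ennreal (C * N powr q)"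
    using hausdorff_young_scalar[OF pq] by blast
  have q: "q > 0" using powr_dual_gt_2[OF pq] by simp
  let ?n = "real CARD('n)"
  \<comment> \<open>The q-th root of the constant obtained by summing the scalar bounds over the
    components.\<close>
  define C' where "C' = (?n powr q * (?n * C)) powr (1 / q)"
  have C': "C' > 0" "C' powr q = ?n powr q * (?n * C)" using C q by (auto simp: C'_def powr_powr)
  have F: "(\<integral>\<^sup>+\<xi>. ennreal (norm (fourier f \<xi>) powr q) \<partial>lborel) \<le> ennreal ((C' * N) powr q)"
    if f: "integrable lborel f" and N: "N > 0" "(\<integral>\<^sup>+x. ennreal (norm (f x) powr p) \<partial>lborel) \<le> ennreal (N powr p)"
    for f :: "real^2 \<Rightarrow> complex^'n" and N
  proof -
    have [measurable]: "sft (\<lambda>x. f x $ i) \<in> borel_measurable borel" for i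
      using integrable_vec_nth[OF f] by simp
    have "(\<integral>\<^sup>+\<xi>. ennreal (norm (fourier f \<xi>) powr q) \<partial>lborel)
       \<le> (\<integral>\<^sup>+\<xi>. ennreal (?n powr q) * (\<Sum>i\<in>UNIV. ennreal (norm (sft (\<lambda>x. f x $ i) \<xi>) powr q)) \<partial>lborel)"
    proof (rule nn_integral_mono)
      fix \<xi>
      have "norm (fourier f \<xi>) powr q \<le> ?n powr q * (\<Sum>i\<in>UNIV. norm (sft (\<lambda>x. f x $ i) \<xi>) powr q)"
        using norm_vec_powr_le[OF q, of "fourier f \<xi>"] by (simp add: fourier_nth[OF f])
      then have "ennreal (norm (fourier f \<xi>) powr q) \<le> ennreal (?n powr q * (\<Sum>i\<in>UNIV. norm (sft (\<lambda>x. f x $ i) \<xi>) powr q))"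
        by (rule ennreal_leI)
      then show "ennreal (norm (fourier f \<xi>) powr q) \<le> ennreal (?n powr q) * (\<Sum>i\<in>UNIV. ennreal (norm (sft (\<lambda>x. f x $ i) \<xi>) powr q))"
        by (simp add: ennreal_mult sum_nonneg sum_ennreal)
    qed
    also have "\<dots> = ennreal (?n powr q) * (\<Sum>i\<in>UNIV. (\<integral>\<^sup>+\<xi>. ennreal (norm (sft (\<lambda>x. f x $ i) \<xi>) powr q) \<partial>lborel))"
      by (simp add: nn_integral_cmult nn_integral_sum del: sum_ennreal)
    also have "\<dots> \<le> ennreal (?n powr q) * (\<Sum>i\<in>(UNIV::'n set). ennreal (C * N powr q))"
    proof (intro mult_left_mono sum_mono HY integrable_vec_nth f N(1))
      fix i
      have "(\<integral>\<^sup>+x. ennreal (norm (f x $ i) powr p) \<partial>lborel) \<le> (\<integral>\<^sup>+x. ennreal (norm (f x) powr p) \<partial>lborel)"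
        using pq by (intro nn_integral_mono ennreal_leI powr_mono2) (auto intro: Finite_Cartesian_Product.norm_nth_le)
      then show "(\<integral>\<^sup>+x. ennreal (norm (f x $ i) powr p) \<partial>lborel) \<le> ennreal (N powr p)" using N(2) by (rule order_trans)
    qed auto
    also have "\<dots> = ennreal (?n powr q * (?n * (C * N powr q)))"
      using C by (simp add: ennreal_of_nat_eq_real_of_nat flip: ennreal_mult')
    also have "?n powr q * (?n * (C * N powr q)) = (C' * N) powr q"
      using C'(1) N(1) by (simp add: powr_mult C'(2))
    finally show ?thesis .
  qed
  show thesis
  proof (rule that[OF C'(1) F])
    fix f :: "real^2 \<Rightarrow> complex^'n" and N :: real
    assume a: "integrable lborel f" "N > 0" "(\<integral>\<^sup>+x. ennreal (norm (f x) powr p) \<partial>lborel) \<le> ennreal (N powr p)"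
    have [measurable]: "fourier f \<in> borel_measurable borel"
      by (rule borel_measurable_continuous_onI[OF continuous_on_fourier[OF a(1)]])
    have "(\<integral>\<^sup>+\<xi>. ennreal (norm (inv_fourier f \<xi>) powr q) \<partial>lborel) = (\<integral>\<^sup>+\<xi>. ennreal (norm (fourier f \<xi>) powr q) \<partial>lborel)"
      unfolding inv_fourier_eq by (rule nn_integral_uminus_lborel[where f="\<lambda>\<xi>. ennreal (norm (fourier f \<xi>) powr q)"]) measurable
    then show "(\<integral>\<^sup>+\<xi>. ennreal (norm (inv_fourier f \<xi>) powr q) \<partial>lborel) \<le> ennreal ((C' * N) powr q)"
      using F[OF a] by simp
  qed
qed


section \<open>Fourier inversion and the dual inequality\<close>

lemma heat_kernel_far:
  assumes "\<delta> > 0" "r > 0" "norm z \<ge> r"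
  shows "heat_kernel \<delta> z \<le> exp (- r\<^sup>2 / (2 * \<delta>)) / (2 * pi * \<delta>)"
    and "heat_kernel \<delta> z \<le> 2 * exp (- r\<^sup>2 / (4 * \<delta>)) * heat_kernel (2 * \<delta>) z"
proof -
  have rz: "r\<^sup>2 \<le> (norm z)\<^sup>2" using assms by (intro power_mono) auto
  then show "heat_kernel \<delta> z \<le> exp (- r\<^sup>2 / (2 * \<delta>)) / (2 * pi * \<delta>)"
    using assms unfolding heat_kernel_def by (intro divide_right_mono) (auto simp: divide_right_mono)
  have "exp (- (norm z)\<^sup>2 / (2 * \<delta>)) = exp (- (norm z)\<^sup>2 / (4 * \<delta>)) * exp (- (norm z)\<^sup>2 / (2 * (2 * \<delta>)))"
    unfolding exp_add[symmetric] using assms by (simp add: field_simps)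
  also have "\<dots> \<le> exp (- r\<^sup>2 / (4 * \<delta>)) * exp (- (norm z)\<^sup>2 / (2 * (2 * \<delta>)))"
    using rz assms by (intro mult_right_mono) (auto simp: divide_right_mono)
  finally show "heat_kernel \<delta> z \<le> 2 * exp (- r\<^sup>2 / (4 * \<delta>)) * heat_kernel (2 * \<delta>) z"
    using assms by (simp add: heat_kernel_def field_simps)
qed

lemma integrable_heat_kernel_shift:
  assumes "\<delta> > 0"
  shows "integrable lborel (\<lambda>y. heat_kernel \<delta> (x - y))" "(LINT y|lborel. heat_kernel \<delta> (x - y)) = 1"
proof -
  show i: "integrable lborel (\<lambda>y. heat_kernel \<delta> (x - y))"
    using nn_integral_heat_kernel(3)[OF assms, of x] heat_kernel_pos[OF assms]
    by (intro integrableI_bounded) (auto simp: abs_of_pos)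
  show "(LINT y|lborel. heat_kernel \<delta> (x - y)) = 1"
    using nn_integral_heat_kernel(3)[OF assms, of x] heat_kernel_pos[OF assms]
    by (simp add: integral_eq_nn_integral less_imp_le)
qed

lemma integrable_mult_heat_kernel:
  fixes f :: "real^2 \<Rightarrow> complex"
  assumes "\<delta> > 0" and f: "integrable lborel f"
  shows "integrable lborel (\<lambda>y. f y * complex_of_real (heat_kernel \<delta> (x - y)))"
proof (rule Bochner_Integration.integrable_bound)
  have [measurable]: "f \<in> borel_measurable borel" using f by (auto dest: borel_measurable_integrable)
  show "(\<lambda>y. f y * complex_of_real (heat_kernel \<delta> (x - y))) \<in> borel_measurable lborel" by measurable
  show "integrable lborel (\<lambda>y. 1 / (2 * pi * \<delta>) * norm (f y))" using f by simp
  have "heat_kernel \<delta> z \<le> 1 / (2 * pi * \<delta>)" for z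
    using assms by (simp add: heat_kernel_def divide_right_mono)
  then have "norm (f y * complex_of_real (heat_kernel \<delta> (x - y))) \<le> 1 / (2 * pi * \<delta>) * norm (f y)" for y
    using heat_kernel_pos[OF assms(1), of "x - y"] mult_right_mono[of "heat_kernel \<delta> (x - y)" "1 / (2 * pi * \<delta>)" "norm (f y)"]
    by (simp add: norm_mult abs_of_pos mult.commute)
  then show "AE y in lborel. norm (f y * complex_of_real (heat_kernel \<delta> (x - y))) \<le> norm (1 / (2 * pi * \<delta>) * norm (f y))"
    using assms by simp
qed

text \<open>Near \<open>x\<close> continuity is used. Far away a bound on the kernel is multiplied
  with the integrable \<open>f\<close>, whereas the constant \<open>f x\<close> calls for a bound of
  finite mass, namely by the kernel of doubled width.\<close>

lemma heat_kernel_approximates: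
  fixes f :: "real^2 \<Rightarrow> complex"
  assumes f: "integrable lborel f" and cont: "isCont f x"
  shows "(\<lambda>n. LINT y|lborel. f y * complex_of_real (heat_kernel (1 / real (Suc n)) (x - y))) \<longlonglongrightarrow> f x"
proof (rule LIMSEQ_I)
  fix e :: real assume e: "e > 0"
  obtain r where r: "r > 0" "\<And>y. dist y x < r \<Longrightarrow> dist (f y) (f x) < e / 2"
    using cont e unfolding continuous_at_eps_delta by (metis half_gt_zero)
  \<comment> \<open>\<open>A n\<close> bounds the kernel outside the disc of radius
    \<open>r\<close>, and \<open>B n\<close> is the factor in front of the kernel of doubled width;
    both tend to 0 exponentially.\<close>
  define A where "A n = exp (- r\<^sup>2 * real (Suc n) / 2) * real (Suc n) / (2 * pi)" for n
  define B where "B n = 2 * exp (- r\<^sup>2 * real (Suc n) / 4)" for n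
  have bound: "norm ((LINT y|lborel. f y * complex_of_real (heat_kernel (1 / real (Suc n)) (x - y))) - f x)
     \<le> e / 2 + A n * (LINT y|lborel. norm (f y)) + B n * norm (f x)" for n
  proof -
    define \<delta> where "\<delta> = 1 / real (Suc n)"
    have \<delta>: "\<delta> > 0" by (simp add: \<delta>_def)
    let ?k = "\<lambda>y. heat_kernel \<delta> (x - y)" and ?k2 = "\<lambda>y. heat_kernel (2 * \<delta>) (x - y)"
    have "f x = (LINT y|lborel. f x * complex_of_real (?k y))"
      using integrable_heat_kernel_shift[OF \<delta>, of x] by simp
    then have "(LINT y|lborel. f y * complex_of_real (?k y)) - f x
       = (LINT y|lborel. f y * complex_of_real (?k y)) - (LINT y|lborel. f x * complex_of_real (?k y))" by simp
    also have "\<dots> = (LINT y|lborel. f y * complex_of_real (?k y) - f x * complex_of_real (?k y))"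
      using integrable_mult_heat_kernel[OF \<delta> f] integrable_heat_kernel_shift[OF \<delta>, of x]
      by (intro Bochner_Integration.integral_diff[symmetric]) auto
    finally have "norm ((LINT y|lborel. f y * complex_of_real (?k y)) - f x) \<le> (LINT y|lborel. norm (f y * complex_of_real (?k y) - f x * complex_of_real (?k y)))"
      by (simp only: integral_norm_bound)
    also have "\<dots> \<le> (LINT y|lborel. e / 2 * ?k y + A n * norm (f y) + B n * norm (f x) * ?k2 y)"
    proof (rule integral_mono)
      show "integrable lborel (\<lambda>y. norm (f y * complex_of_real (?k y) - f x * complex_of_real (?k y)))"
        using integrable_mult_heat_kernel[OF \<delta> f] integrable_heat_kernel_shift[OF \<delta>, of x] by auto
      show "integrable lborel (\<lambda>y. e / 2 * ?k y + A n * norm (f y) + B n * norm (f x) * ?k2 y)"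
        using f integrable_heat_kernel_shift[OF \<delta>, of x] integrable_heat_kernel_shift[of "2 * \<delta>" x] \<delta> by auto
    next
      fix y
      have k: "?k y > 0" "?k2 y > 0" using heat_kernel_pos \<delta> by auto
      have AB: "A n \<ge> 0" "B n \<ge> 0" by (auto simp: A_def B_def)
      have eq: "norm (f y * complex_of_real (?k y) - f x * complex_of_real (?k y)) = norm (f y - f x) * ?k y"
        unfolding left_diff_distrib[symmetric] norm_mult using k by simp
      show "norm (f y * complex_of_real (?k y) - f x * complex_of_real (?k y)) \<le> e / 2 * ?k y + A n * norm (f y) + B n * norm (f x) * ?k2 y"
      proof (cases "dist y x < r")
        case True
        then have "norm (f y - f x) \<le> e / 2" using r(2)[of y] by (simp add: dist_norm)
        then have "norm (f y - f x) * ?k y \<le> e / 2 * ?k y" using k by (intro mult_right_mono) auto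
        moreover have "0 \<le> A n * norm (f y)" "0 \<le> B n * norm (f x) * ?k2 y" using AB k by auto
        ultimately show ?thesis unfolding eq by linarith
      next
        case False
        then have far: "r \<le> norm (x - y)" by (simp add: dist_norm norm_minus_commute)
        have kA: "?k y \<le> A n" using heat_kernel_far(1)[OF \<delta> r(1) far] by (simp add: A_def \<delta>_def)
        have kB: "?k y \<le> B n * ?k2 y" using heat_kernel_far(2)[OF \<delta> r(1) far] by (simp add: B_def \<delta>_def)
        have "norm (f y - f x) * ?k y \<le> (norm (f y) + norm (f x)) * ?k y"
          using k by (intro mult_right_mono norm_triangle_ineq4) auto
        moreover have "(norm (f y) + norm (f x)) * ?k y = norm (f y) * ?k y + norm (f x) * ?k y"
          by (rule distrib_right)
        ultimately have "norm (f y - f x) * ?k y \<le> norm (f y) * A n + norm (f x) * (B n * ?k2 y)"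
          using mult_left_mono[OF kA norm_ge_zero[of "f y"]] mult_left_mono[OF kB norm_ge_zero[of "f x"]]
          by linarith
        moreover have "0 \<le> e / 2 * ?k y" using e k by simp
        ultimately show ?thesis unfolding eq by (simp add: mult_ac)
      qed
    qed
    also have "\<dots> = e / 2 + A n * (LINT y|lborel. norm (f y)) + B n * norm (f x)"
      using f integrable_heat_kernel_shift[OF \<delta>, of x] integrable_heat_kernel_shift[of "2 * \<delta>" x] \<delta>
      by (subst Bochner_Integration.integral_add, simp, simp)+ simp
    finally show ?thesis by (simp add: \<delta>_def)
  qed
  have "A \<longlonglongrightarrow> 0" "B \<longlonglongrightarrow> 0" unfolding A_def[abs_def] B_def[abs_def] using r(1) by real_asymp+
  then have "(\<lambda>n. A n * (LINT y|lborel. norm (f y)) + B n * norm (f x)) \<longlonglongrightarrow> 0 * (LINT y|lborel. norm (f y)) + 0 * norm (f x)"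
    by (intro tendsto_intros)
  then have "(\<lambda>n. A n * (LINT y|lborel. norm (f y)) + B n * norm (f x)) \<longlonglongrightarrow> 0" by simp
  from order_tendstoD(2)[OF this, of "e/2"] e
  obtain N where N: "\<And>n. n \<ge> N \<Longrightarrow> A n * (LINT y|lborel. norm (f y)) + B n * norm (f x) < e / 2"
    by (auto simp: eventually_sequentially)
  have "norm ((LINT y|lborel. f y * complex_of_real (heat_kernel (1 / real (Suc n)) (x - y))) - f x) < e" if "n \<ge> N" for n
    using bound[of n] N[OF that] by linarith
  then show "\<exists>N. \<forall>n\<ge>N. norm ((LINT y|lborel. f y * complex_of_real (heat_kernel (1 / real (Suc n)) (x - y))) - f x) < e"
    by blast
qed

lemma integral_uminus_lborel:
  fixes g :: "real^2 \<Rightarrow> complex"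
  assumes [measurable]: "g \<in> borel_measurable borel"
  shows "(LINT x|lborel. g (- x)) = (LINT x|lborel. g x)"
proof -
  have "(lborel :: (real^2) measure) = distr lborel borel (\<lambda>x. - x)"
    using lborel_affine[of "-1" "0 :: real^2"] by (simp add: density_1 one_ennreal_def[symmetric])
  then have "(LINT x|lborel. g x) = (LINT x|distr lborel borel (\<lambda>x. - x). g x)" by simp
  also have "\<dots> = (LINT x|lborel. g (- x))" by (subst integral_distr) auto
  finally show ?thesis by simp
qed

lemma sft_uminus:
  assumes [measurable]: "g \<in> borel_measurable borel"
  shows "sft (\<lambda>x. g (- x)) \<xi> = sft g (- \<xi>)"
  unfolding sft_def using integral_uminus_lborel[of "\<lambda>x. cis (x \<bullet> \<xi>) * g x"] by simp

text \<open>The same Gaussian-damped integral has two limits: \<open>f x\<close>, by approximation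
  at a point of continuity, and the undamped inversion integral, by dominated convergence.\<close>

lemma sft_inversion:
  assumes f: "integrable lborel f" and F: "integrable lborel (sft f)" and cont: "isCont f x"
  shows "sft (sft f) (- x) = f x"
proof (rule LIMSEQ_unique)
  have [measurable]: "f \<in> borel_measurable borel" "sft f \<in> borel_measurable borel" using f F by (auto dest: borel_measurable_integrable)
  let ?S = "\<lambda>n. (1 / (2 * pi)) *\<^sub>R (LINT \<xi>|lborel. cis (x \<bullet> \<xi>) * (sft f \<xi> * complex_of_real (exp (- (1 / real (Suc n)) * (norm \<xi>)\<^sup>2 / 2))))"
  show "?S \<longlonglongrightarrow> f x"
    by (subst regularised_inversion[OF _ f]) (simp, rule heat_kernel_approximates[OF f cont])
  have "(\<lambda>n. LINT \<xi>|lborel. cis (x \<bullet> \<xi>) * (sft f \<xi> * complex_of_real (exp (- (1 / real (Suc n)) * (norm \<xi>)\<^sup>2 / 2)))) \<longlonglongrightarrow> (LINT \<xi>|lborel. cis (x \<bullet> \<xi>) * sft f \<xi>)"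
  proof (rule integral_dominated_convergence[where w="\<lambda>\<xi>. norm (sft f \<xi>)"])
    show "AE \<xi> in lborel. (\<lambda>n. cis (x \<bullet> \<xi>) * (sft f \<xi> * complex_of_real (exp (- (1 / real (Suc n)) * (norm \<xi>)\<^sup>2 / 2)))) \<longlonglongrightarrow> cis (x \<bullet> \<xi>) * sft f \<xi>"
    proof (rule AE_I2)
      fix \<xi> :: "real^2"
      have "(\<lambda>n. cis (x \<bullet> \<xi>) * (sft f \<xi> * complex_of_real (exp (- (1 / real (Suc n)) * (norm \<xi>)\<^sup>2 / 2)))) \<longlonglongrightarrow> cis (x \<bullet> \<xi>) * (sft f \<xi> * complex_of_real (exp (- 0 * (norm \<xi>)\<^sup>2 / 2)))"
        by (intro tendsto_intros LIMSEQ_Suc[OF lim_1_over_n]) simp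
      then show "(\<lambda>n. cis (x \<bullet> \<xi>) * (sft f \<xi> * complex_of_real (exp (- (1 / real (Suc n)) * (norm \<xi>)\<^sup>2 / 2)))) \<longlonglongrightarrow> cis (x \<bullet> \<xi>) * sft f \<xi>" by simp
    qed
    show "AE \<xi> in lborel. norm (cis (x \<bullet> \<xi>) * (sft f \<xi> * complex_of_real (exp (- (1 / real (Suc n)) * (norm \<xi>)\<^sup>2 / 2)))) \<le> norm (sft f \<xi>)" for n
      by (intro AE_I2) (simp add: norm_mult mult_left_le)
  qed (use F in auto)
  then have "?S \<longlonglongrightarrow> (1 / (2 * pi)) *\<^sub>R (LINT \<xi>|lborel. cis (x \<bullet> \<xi>) * sft f \<xi>)"
    by (rule tendsto_scaleR[OF tendsto_const])
  then show "?S \<longlonglongrightarrow> sft (sft f) (- x)"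
    by (simp add: sft_def[of "sft f"] inner_commute)
qed

text \<open>The integrability hypotheses are those that \<open>is_solution\<close> provides for the
  symbol times the transform of the solution. Hence \<open>mult_op M (V t)\<close> has the expected
  transform.\<close>

lemma fourier_inversion:
  fixes G :: "real^2 \<Rightarrow> complex^'n"
  assumes G: "integrable lborel G" and cont: "continuous_on UNIV G" and F: "integrable lborel (inv_fourier G)"
  shows "fourier (inv_fourier G) \<xi> = G \<xi>"
proof (subst vec_eq_iff, rule allI)
  fix i
  let ?g = "\<lambda>x. G x $ i"
  have g: "integrable lborel ?g" using integrable_vec_nth[OF G] .
  have [measurable]: "sft ?g \<in> borel_measurable borel" using g by simp
  have i1: "integrable lborel (\<lambda>x. sft ?g (- x))"
    using integrable_vec_nth[OF F, of i] by (simp add: fourier_nth[OF G])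
  have "(lborel :: (real^2) measure) = distr lborel borel (\<lambda>x. - x)"
    using lborel_affine[of "-1" "0 :: real^2"] by (simp add: density_1 one_ennreal_def[symmetric])
  then have i2: "integrable lborel (sft ?g)"
    using i1 by (subst \<open>lborel = _\<close>, subst integrable_distr_eq) auto
  have "isCont ?g \<xi>"
    using cont by (intro continuous_intros) (auto simp: continuous_on_eq_continuous_at)
  from sft_inversion[OF g i2 this]
  show "fourier (inv_fourier G) \<xi> $ i = G \<xi> $ i"
    by (simp add: fourier_nth[OF F] fourier_nth[OF G] sft_uminus)
qed

text \<open>In the Sobolev norm the function that is under control lives on the frequency side, and
  its inverse transform is not known to be integrable, so \<open>hausdorff_young\<close> does not
  apply directly. Multiplying the inverse transform by Gaussians makes it integrable without
  increasing its norm; the transforms of the products converge to \<open>G\<close>, and Fatou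
  concludes.\<close>

theorem hausdorff_young_dual:
  fixes p q :: real
  assumes pq: "1 < p" "p \<le> 2" "p * q = p + q"
  obtains C where "C > 0"
    "\<And>(G :: real^2 \<Rightarrow> complex^'n) N. integrable lborel G \<Longrightarrow> continuous_on UNIV G \<Longrightarrow> N > 0 \<Longrightarrow>
       (\<integral>\<^sup>+x. ennreal (norm (inv_fourier G x) powr p) \<partial>lborel) \<le> ennreal (N powr p)
      \<Longrightarrow> (\<integral>\<^sup>+\<xi>. ennreal (norm (G \<xi>) powr q) \<partial>lborel) \<le> ennreal ((C * N) powr q)"
proof -
  obtain C where C: "C > 0" and HY: "\<And>(f :: real^2 \<Rightarrow> complex^'n) N. integrable lborel f \<Longrightarrow> N > 0 \<Longrightarrow> (\<integral>\<^sup>+x. ennreal (norm (f x) powr p) \<partial>lborel) \<le> ennreal (N powr p)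
      \<Longrightarrow> (\<integral>\<^sup>+\<xi>. ennreal (norm (fourier f \<xi>) powr q) \<partial>lborel) \<le> ennreal ((C * N) powr q)"
    by (rule hausdorff_young[OF pq, where 'n='n]) (rule that)
  have q: "q > 0" using powr_dual_gt_2[OF pq] by simp
  show thesis
  proof (rule that[OF C])
    fix G :: "real^2 \<Rightarrow> complex^'n" and N :: real
    assume G: "integrable lborel G" and cont: "continuous_on UNIV G" and N: "N > 0"
      "(\<integral>\<^sup>+x. ennreal (norm (inv_fourier G x) powr p) \<partial>lborel) \<le> ennreal (N powr p)"
    let ?e = "\<lambda>n x. exp (- (1 / real (Suc n)) * (norm (x::real^2))\<^sup>2 / 2)"
    define f where "f n x = (\<chi> i. inv_fourier G x $ i * complex_of_real (?e n x))" for n x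
    have g: "integrable lborel (\<lambda>x. G x $ i)" for i using integrable_vec_nth[OF G] .
    have [measurable]: "sft (\<lambda>x. G x $ i) \<in> borel_measurable borel" for i using g by simp
    have int: "integrable lborel (\<lambda>x. f n x $ i)" for n i
      unfolding f_def vec_lambda_beta fourier_nth[OF G]
      by (rule integrable_gaussian_mult[where C="(LINT x|lborel. norm (G x $ i)) / (2 * pi)"]) (auto simp: norm_sft_le[OF g])
    have f: "integrable lborel (f n)" for n by (rule integrable_vecI) (rule int)
    have nf: "norm (f n x) \<le> norm (inv_fourier G x)" for n x
    proof -
      have "f n x = ?e n x *\<^sub>R inv_fourier G x" by (simp add: f_def vec_eq_iff scaleR_complex.code complex_eq_iff)
      then show ?thesis by (simp add: mult_left_le_one_le)
    qed
    have bound: "(\<integral>\<^sup>+\<xi>. ennreal (norm (fourier (f n) \<xi>) powr q) \<partial>lborel) \<le> ennreal ((C * N) powr q)" for n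
    proof (rule HY[OF f N(1)])
      have "(\<integral>\<^sup>+x. ennreal (norm (f n x) powr p) \<partial>lborel) \<le> (\<integral>\<^sup>+x. ennreal (norm (inv_fourier G x) powr p) \<partial>lborel)"
        using pq nf by (intro nn_integral_mono ennreal_leI powr_mono2) auto
      then show "(\<integral>\<^sup>+x. ennreal (norm (f n x) powr p) \<partial>lborel) \<le> ennreal (N powr p)"
        using N(2) by (rule order_trans)
    qed
    \<comment> \<open>On the frequency side the Gaussian factor acts as convolution with the heat
      kernel.\<close>
    have lim: "(\<lambda>n. fourier (f n) \<xi>) \<longlonglongrightarrow> G \<xi>" for \<xi>
    proof (rule vec_tendstoI)
      fix i
      have "isCont (\<lambda>x. G x $ i) \<xi>"
        using cont by (intro continuous_intros) (auto simp: continuous_on_eq_continuous_at)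
      from heat_kernel_approximates[OF g this]
      have "(\<lambda>n. (1 / (2 * pi)) *\<^sub>R (LINT x|lborel. cis (\<xi> \<bullet> x) * (sft (\<lambda>x. G x $ i) x * complex_of_real (?e n x)))) \<longlonglongrightarrow> G \<xi> $ i"
        by (subst regularised_inversion[OF _ g]) simp
      moreover have eq: "(1 / (2 * pi)) *\<^sub>R (LINT x|lborel. cis (\<xi> \<bullet> x) * (sft (\<lambda>x. G x $ i) x * complex_of_real (?e n x))) = fourier (f n) \<xi> $ i" for n
      proof -
        have "fourier (f n) \<xi> $ i = sft (\<lambda>x. (\<lambda>x. sft (\<lambda>x. G x $ i) x * complex_of_real (?e n x)) (- x)) \<xi>"
          unfolding fourier_nth[OF f] by (simp add: f_def fourier_nth[OF G])
        also have "\<dots> = sft (\<lambda>x. sft (\<lambda>x. G x $ i) x * complex_of_real (?e n x)) (- \<xi>)"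
          by (rule sft_uminus) measurable
        finally show ?thesis by (simp add: sft_def[of _ "- \<xi>"] inner_commute)
      qed
      ultimately show "(\<lambda>n. fourier (f n) \<xi> $ i) \<longlonglongrightarrow> G \<xi> $ i" unfolding eq by blast
    qed
    have [measurable]: "fourier (f n) \<in> borel_measurable borel" for n
      by (rule borel_measurable_continuous_onI[OF continuous_on_fourier[OF f]])
    show "(\<integral>\<^sup>+\<xi>. ennreal (norm (G \<xi>) powr q) \<partial>lborel) \<le> ennreal ((C * N) powr q)"
    proof (rule nn_integral_le_of_LIMSEQ[OF _ _ bound])
      show "(\<lambda>\<xi>. ennreal (norm (fourier (f n) \<xi>) powr q)) \<in> borel_measurable lborel" for n by measurable
      show "(\<lambda>n. ennreal (norm (fourier (f n) \<xi>) powr q)) \<longlonglongrightarrow> ennreal (norm (G \<xi>) powr q)" for \<xi>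
        using q by (intro tendsto_ennrealI tendsto_powr' tendsto_norm lim tendsto_const) auto
    qed
  qed
qed

section \<open>Integrals of the frequency weights\<close>

text \<open>One coordinate of the unit normal \<open>n\<close> has square at least 1/2. Integrating
  first in that coordinate over the whole line costs at most \<open>sqrt 2\<close> times the
  Gaussian integral, and the other coordinate ranges over an interval of length
  \<open>2 * R\<close>. This takes the place of a rotation of the plane.\<close>

lemma nn_integral_strip_le:
  fixes n :: "real^2"
  assumes n: "norm n = 1" and R: "R > 0" and \<alpha>: "\<alpha> > 0"
  shows "(\<integral>\<^sup>+\<xi>. ennreal (exp (- \<alpha> * (\<xi> \<bullet> n)\<^sup>2 / 2)) * indicator {\<xi>. norm \<xi> \<le> R} \<xi> \<partial>lborel) \<le> ennreal (2 * R * (sqrt 2 * sqrt (2 * pi / \<alpha>)))"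
proof -
  have nn: "(n$1)\<^sup>2 + (n$2)\<^sup>2 = 1" using n norm_real2_power2[of n] by simp
  have comp: "\<bar>\<xi> $ i\<bar> \<le> R" if "norm \<xi> \<le> R" for \<xi> :: "real^2" and i
    using that component_le_norm_cart[of \<xi> i] by linarith
  have inner: "(\<integral>\<^sup>+x. ennreal (exp (- \<alpha> * (b + m * x)\<^sup>2 / 2)) \<partial>lborel) \<le> ennreal (sqrt 2 * sqrt (2 * pi / \<alpha>))"
    if m: "m\<^sup>2 \<ge> 1/2" for b m
  proof -
    have m0: "m \<noteq> 0" using m by auto
    have "1 / sqrt 2 = sqrt (1/2)" by (simp add: real_sqrt_divide)
    also have "\<dots> \<le> sqrt (m\<^sup>2)" using m by (rule real_sqrt_le_mono)
    finally have "1 \<le> sqrt 2 * \<bar>m\<bar>" by (simp add: divide_le_eq mult.commute)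
    then have "sqrt (2 * pi / \<alpha>) / \<bar>m\<bar> \<le> sqrt 2 * sqrt (2 * pi / \<alpha>)"
      using m0 \<alpha> mult_right_mono[of 1 "sqrt 2 * \<bar>m\<bar>" "sqrt (2 * pi / \<alpha>)"] by (simp add: divide_le_eq mult_ac)
    then show ?thesis
      unfolding nn_integral_gaussian_affine[OF \<alpha> m0] by (rule ennreal_leI)
  qed
  have outer: "(\<integral>\<^sup>+y. ennreal (sqrt 2 * sqrt (2 * pi / \<alpha>)) * indicator {-R..R} y \<partial>lborel) = ennreal (2 * R * (sqrt 2 * sqrt (2 * pi / \<alpha>)))"
    using R by (subst nn_integral_cmult_indicator) (auto simp: mult_ac simp flip: ennreal_mult')
  consider "(n$1)\<^sup>2 \<ge> 1/2" | "(n$2)\<^sup>2 \<ge> 1/2" using nn by linarith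
  then show ?thesis
  proof cases
    case 1
    have "(\<integral>\<^sup>+\<xi>. ennreal (exp (- \<alpha> * (\<xi> \<bullet> n)\<^sup>2 / 2)) * indicator {\<xi>. norm \<xi> \<le> R} \<xi> \<partial>lborel)
      = (\<integral>\<^sup>+y. \<integral>\<^sup>+x. ennreal (exp (- \<alpha> * (vector [x,y] \<bullet> n)\<^sup>2 / 2)) * indicator {\<xi>. norm \<xi> \<le> R} (vector [x,y] :: real^2) \<partial>lborel \<partial>lborel)"
      by (rule nn_integral_real2(2)) measurable
    also have "\<dots> \<le> (\<integral>\<^sup>+y. \<integral>\<^sup>+x. ennreal (exp (- \<alpha> * (y * n$2 + n$1 * x)\<^sup>2 / 2)) * indicator {-R..R} y \<partial>lborel \<partial>lborel)"
    proof (intro nn_integral_mono)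
      fix y x
      show "ennreal (exp (- \<alpha> * (vector [x,y] \<bullet> n)\<^sup>2 / 2)) * indicator {\<xi>. norm \<xi> \<le> R} (vector [x,y] :: real^2)
        \<le> ennreal (exp (- \<alpha> * (y * n$2 + n$1 * x)\<^sup>2 / 2)) * indicator {-R..R} y"
        using comp[of "vector [x,y]" 2] by (auto simp: indicator_def inner_real2 add.commute mult.commute)
    qed
    also have "\<dots> \<le> (\<integral>\<^sup>+y. ennreal (sqrt 2 * sqrt (2 * pi / \<alpha>)) * indicator {-R..R} y \<partial>lborel)"
    proof (rule nn_integral_mono)
      fix y
      have "(\<integral>\<^sup>+x. ennreal (exp (- \<alpha> * (y * n$2 + n$1 * x)\<^sup>2 / 2)) * indicator {-R..R} y \<partial>lborel)
        = (\<integral>\<^sup>+x. ennreal (exp (- \<alpha> * (y * n$2 + n$1 * x)\<^sup>2 / 2)) \<partial>lborel) * indicator {-R..R} y"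
        by (rule nn_integral_multc) measurable
      also have "\<dots> \<le> ennreal (sqrt 2 * sqrt (2 * pi / \<alpha>)) * indicator {-R..R} y"
        by (intro mult_right_mono inner 1) auto
      finally show "(\<integral>\<^sup>+x. ennreal (exp (- \<alpha> * (y * n$2 + n$1 * x)\<^sup>2 / 2)) * indicator {-R..R} y \<partial>lborel) \<le> \<dots>" .
    qed
    finally show ?thesis unfolding outer .
  next
    case 2
    have "(\<integral>\<^sup>+\<xi>. ennreal (exp (- \<alpha> * (\<xi> \<bullet> n)\<^sup>2 / 2)) * indicator {\<xi>. norm \<xi> \<le> R} \<xi> \<partial>lborel)
      = (\<integral>\<^sup>+x. \<integral>\<^sup>+y. ennreal (exp (- \<alpha> * (vector [x,y] \<bullet> n)\<^sup>2 / 2)) * indicator {\<xi>. norm \<xi> \<le> R} (vector [x,y] :: real^2) \<partial>lborel \<partial>lborel)"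
      by (rule nn_integral_real2(1)) measurable
    also have "\<dots> \<le> (\<integral>\<^sup>+x. \<integral>\<^sup>+y. ennreal (exp (- \<alpha> * (x * n$1 + n$2 * y)\<^sup>2 / 2)) * indicator {-R..R} x \<partial>lborel \<partial>lborel)"
    proof (intro nn_integral_mono)
      fix x y
      show "ennreal (exp (- \<alpha> * (vector [x,y] \<bullet> n)\<^sup>2 / 2)) * indicator {\<xi>. norm \<xi> \<le> R} (vector [x,y] :: real^2)
        \<le> ennreal (exp (- \<alpha> * (x * n$1 + n$2 * y)\<^sup>2 / 2)) * indicator {-R..R} x"
        using comp[of "vector [x,y]" 1] by (auto simp: indicator_def inner_real2 add.commute mult.commute)
    qed
    also have "\<dots> \<le> (\<integral>\<^sup>+x. ennreal (sqrt 2 * sqrt (2 * pi / \<alpha>)) * indicator {-R..R} x \<partial>lborel)"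
    proof (rule nn_integral_mono)
      fix x
      have "(\<integral>\<^sup>+y. ennreal (exp (- \<alpha> * (x * n$1 + n$2 * y)\<^sup>2 / 2)) * indicator {-R..R} x \<partial>lborel)
        = (\<integral>\<^sup>+y. ennreal (exp (- \<alpha> * (x * n$1 + n$2 * y)\<^sup>2 / 2)) \<partial>lborel) * indicator {-R..R} x"
        by (rule nn_integral_multc) measurable
      also have "\<dots> \<le> ennreal (sqrt 2 * sqrt (2 * pi / \<alpha>)) * indicator {-R..R} x"
        by (intro mult_right_mono inner 2) auto
      finally show "(\<integral>\<^sup>+y. ennreal (exp (- \<alpha> * (x * n$1 + n$2 * y)\<^sup>2 / 2)) * indicator {-R..R} x \<partial>lborel) \<le> \<dots>" .
    qed
    finally show ?thesis unfolding outer .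
  qed
qed

lemma inner_unit_le:
  fixes n \<xi> :: "real^2"
  assumes "norm n = 1"
  shows "(\<xi> \<bullet> n)\<^sup>2 \<le> (norm \<xi>)\<^sup>2"
  using Cauchy_Schwarz_ineq2[of \<xi> n] assms by (metis abs_le_square_iff abs_norm_cancel mult.right_neutral)

text \<open>The exponent is scaled by the radius, so the bound grows like \<open>R\<^sup>2\<close>
  with a constant independent of \<open>R\<close>; the dyadic summation below relies on
  this.\<close>

lemma nn_integral_strip_decay:
  fixes n :: "real^2"
  assumes n: "norm n = 1" and R: "R > 0" and c: "c > 0" and t: "t \<ge> 0"
  shows "(\<integral>\<^sup>+\<xi>. ennreal (exp (- c * t * (\<xi> \<bullet> n)\<^sup>2 / R\<^sup>2)) * indicator {\<xi>. norm \<xi> \<le> R} \<xi> \<partial>lborel)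
    \<le> ennreal (exp c * (2 * sqrt 2 * sqrt (pi / c)) * R\<^sup>2 * (1 + t) powr (- 1 / 2))"
proof -
  \<comment> \<open>Replacing \<open>t\<close> by \<open>1 + t\<close> changes the exponent by at
    most \<open>c\<close> on the disc, which the factor \<open>exp c\<close> pays for. This removes
    the singularity at \<open>t = 0\<close>.\<close>
  define \<alpha> where "\<alpha> = 2 * c * (1 + t) / R\<^sup>2"
  have \<alpha>: "\<alpha> > 0" using R c t by (simp add: \<alpha>_def)
  have "(\<integral>\<^sup>+\<xi>. ennreal (exp (- c * t * (\<xi> \<bullet> n)\<^sup>2 / R\<^sup>2)) * indicator {\<xi>. norm \<xi> \<le> R} \<xi> \<partial>lborel)
    \<le> (\<integral>\<^sup>+\<xi>. ennreal (exp c) * (ennreal (exp (- \<alpha> * (\<xi> \<bullet> n)\<^sup>2 / 2)) * indicator {\<xi>. norm \<xi> \<le> R} \<xi>) \<partial>lborel)"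
  proof (intro nn_integral_mono)
    fix \<xi> :: "real^2"
    have "exp (- c * t * (\<xi> \<bullet> n)\<^sup>2 / R\<^sup>2) \<le> exp c * exp (- \<alpha> * (\<xi> \<bullet> n)\<^sup>2 / 2)" if "norm \<xi> \<le> R"
    proof -
      have "(\<xi> \<bullet> n)\<^sup>2 \<le> R\<^sup>2" using inner_unit_le[OF n, of \<xi>] that R by (smt (verit) norm_ge_zero power_mono)
      then have le1: "(\<xi> \<bullet> n)\<^sup>2 / R\<^sup>2 \<le> 1" using R by (simp add: divide_le_eq)
      have "c * ((\<xi> \<bullet> n)\<^sup>2 / R\<^sup>2) \<le> c" using mult_left_mono[OF le1, of c] c by simp
      moreover have "- \<alpha> * (\<xi> \<bullet> n)\<^sup>2 / 2 = - c * t * (\<xi> \<bullet> n)\<^sup>2 / R\<^sup>2 - c * ((\<xi> \<bullet> n)\<^sup>2 / R\<^sup>2)"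
        using R by (simp add: \<alpha>_def field_simps)
      ultimately show ?thesis unfolding exp_add[symmetric] by simp
    qed
    then show "ennreal (exp (- c * t * (\<xi> \<bullet> n)\<^sup>2 / R\<^sup>2)) * indicator {\<xi>. norm \<xi> \<le> R} \<xi>
      \<le> ennreal (exp c) * (ennreal (exp (- \<alpha> * (\<xi> \<bullet> n)\<^sup>2 / 2)) * indicator {\<xi>. norm \<xi> \<le> R} \<xi>)"
      by (auto simp: indicator_def simp flip: ennreal_mult' intro!: ennreal_leI)
  qed
  also have "\<dots> = ennreal (exp c) * (\<integral>\<^sup>+\<xi>. (ennreal (exp (- \<alpha> * (\<xi> \<bullet> n)\<^sup>2 / 2)) * indicator {\<xi>. norm \<xi> \<le> R} \<xi>) \<partial>lborel)"
    by (rule nn_integral_cmult) measurable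
  also have "\<dots> \<le> ennreal (exp c) * ennreal (2 * R * (sqrt 2 * sqrt (2 * pi / \<alpha>)))"
    by (intro mult_left_mono nn_integral_strip_le n R \<alpha>) auto
  also have "\<dots> = ennreal (exp c * (2 * R * (sqrt 2 * sqrt (2 * pi / \<alpha>))))"
    by (simp flip: ennreal_mult')
  also have "exp c * (2 * R * (sqrt 2 * sqrt (2 * pi / \<alpha>))) = exp c * (2 * sqrt 2 * sqrt (pi / c)) * R\<^sup>2 * (1 + t) powr (- 1 / 2)"
  proof -
    have "2 * pi / \<alpha> = (2 * (pi * R\<^sup>2)) / (2 * (c * (1 + t)))"
      by (simp only: \<alpha>_def divide_divide_eq_right mult.assoc)
    also have "\<dots> = pi * R\<^sup>2 / (c * (1 + t))" by (rule mult_divide_mult_cancel_left) simp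
    finally have "2 * pi / \<alpha> = pi / c * R\<^sup>2 * (1 / (1 + t))" by simp
    then have "sqrt (2 * pi / \<alpha>) = sqrt (pi / c) * sqrt (R\<^sup>2) * sqrt (1 / (1 + t))" by (simp only: real_sqrt_mult)
    also have "sqrt (R\<^sup>2) = R" using R by simp
    finally have "sqrt (2 * pi / \<alpha>) = sqrt (pi / c) * R * sqrt (1 / (1 + t))" .
    moreover have "sqrt (1 / (1 + t)) = (1 + t) powr (- 1 / 2)"
      using t by (simp add: powr_half_sqrt real_sqrt_divide powr_minus_divide)
    ultimately show ?thesis by (simp add: power2_eq_square)
  qed
  finally show ?thesis .
qed

lemma dyadic_bracket:
  fixes x :: real
  assumes "x \<ge> 1"
  obtains k :: nat where "2 ^ k \<le> x" "x < 2 ^ Suc k"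
proof -
  define k where "k = (LEAST n. x < 2 ^ Suc n)"
  obtain n where "x < 2 ^ n" using real_arch_pow[of 2 x] by auto
  moreover have "(2::real) ^ n \<le> 2 ^ Suc n" by simp
  ultimately have "x < 2 ^ Suc n" by linarith
  then have k: "x < 2 ^ Suc k" unfolding k_def by (rule LeastI)
  have "2 ^ k \<le> x"
  proof (cases k)
    case (Suc m)
    then have "\<not> x < 2 ^ Suc m" using not_less_Least[of m "\<lambda>n. x < 2 ^ Suc n"] by (simp add: k_def)
    then show ?thesis using Suc by simp
  qed (use assms in simp)
  then show thesis using k by (rule that)
qed

text \<open>The damping exponent is homogeneous of degree 0, so where the bracket is about
  \<open>2 ^ k\<close> the transversal Gaussian has a width proportional to \<open>2 ^ k\<close>.
  The strip bound contributes \<open>4 ^ k\<close>, the weight \<open>2 powr (- b * k)\<close>, and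
  the resulting geometric series converges because \<open>b > 2\<close>.\<close>

lemma nn_integral_sobolev_weight_decay:
  fixes b c :: real
  assumes b: "b > 2" and c: "c > 0"
  obtains K where "K > 0"
    "\<And>(n::real^2) t. norm n = 1 \<Longrightarrow> t \<ge> 0 \<Longrightarrow>
      (\<integral>\<^sup>+\<xi>. ennreal ((1 + (norm \<xi>)\<^sup>2) powr (- b / 2) * exp (- c * t * (\<xi> \<bullet> n)\<^sup>2 / (norm \<xi>)\<^sup>2)) \<partial>lborel) \<le> ennreal (K * (1 + t) powr (- 1 / 2))"
proof -
  \<comment> \<open>The factor 4 is \<open>(R 0)\<^sup>2\<close>, the outer radius of the k-th shell
    being \<open>2 ^ Suc k\<close>.\<close>
  define K0 where "K0 = exp c * (2 * sqrt 2 * sqrt (pi / c)) * 4"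
  \<comment> \<open>The ratio between consecutive shells: growth of the area by 4 against decay of
    the weight.\<close>
  define \<rho> :: real where "\<rho> = 4 * 2 powr (- b)"
  have "(2::real) powr (- b) < 2 powr (- 2)" using b by (intro powr_less_mono) auto
  then have \<rho>: "0 < \<rho>" "\<rho> < 1" by (auto simp: \<rho>_def powr_minus_divide)
  define K where "K = K0 * (1 / (1 - \<rho>))"
  have K0: "K0 > 0" using c by (simp add: K0_def)
  have K: "K > 0" using \<rho> K0 by (simp add: K_def)
  show thesis
  proof (rule that[OF K])
    fix n :: "real^2" and t :: real assume n: "norm n = 1" and t: "t \<ge> 0"
    define R :: "nat \<Rightarrow> real" where "R k = 2 ^ Suc k" for k
    have R: "R k > 0" for k by (simp add: R_def)
    let ?g = "\<lambda>k \<xi>. ennreal ((2::real) powr (- b * real k)) * (ennreal (exp (- c * t * (\<xi> \<bullet> n)\<^sup>2 / (R k)\<^sup>2)) * indicator {\<xi>. norm \<xi> \<le> R k} \<xi>)"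
    have "(\<integral>\<^sup>+\<xi>. ennreal ((1 + (norm \<xi>)\<^sup>2) powr (- b / 2) * exp (- c * t * (\<xi> \<bullet> n)\<^sup>2 / (norm \<xi>)\<^sup>2)) \<partial>lborel) \<le> (\<integral>\<^sup>+\<xi>. (\<Sum>k. ?g k \<xi>) \<partial>lborel)"
    proof (rule nn_integral_mono)
      fix \<xi> :: "real^2"
      have s1: "sqrt (1 + (norm \<xi>)\<^sup>2) \<ge> 1" by simp
      obtain k where k: "2 ^ k \<le> sqrt (1 + (norm \<xi>)\<^sup>2)" "sqrt (1 + (norm \<xi>)\<^sup>2) < 2 ^ Suc k"
        using dyadic_bracket[OF s1] .
      have "norm \<xi> \<le> sqrt (1 + (norm \<xi>)\<^sup>2)" by (rule real_le_rsqrt) simp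
      then have nR: "norm \<xi> \<le> R k" using k by (simp add: R_def)
      have "(1 + (norm \<xi>)\<^sup>2) powr (- b / 2) = ((1 + (norm \<xi>)\<^sup>2) powr (1/2)) powr (- b)" by (simp add: powr_powr)
      also have "(1 + (norm \<xi>)\<^sup>2) powr (1/2) = sqrt (1 + (norm \<xi>)\<^sup>2)" by (rule powr_half_sqrt) simp
      also have "sqrt (1 + (norm \<xi>)\<^sup>2) powr (- b) \<le> (2 ^ k) powr (- b)"
        using k b by (intro powr_mono2') auto
      also have "(2 ^ k) powr (- b) = (2::real) powr (- b * real k)"
        by (simp add: powr_powr mult.commute flip: powr_realpow)
      finally have 1: "(1 + (norm \<xi>)\<^sup>2) powr (- b / 2) \<le> 2 powr (- b * real k)" .
      have 2: "exp (- c * t * (\<xi> \<bullet> n)\<^sup>2 / (norm \<xi>)\<^sup>2) \<le> exp (- c * t * (\<xi> \<bullet> n)\<^sup>2 / (R k)\<^sup>2)"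
      proof (cases "\<xi> = 0")
        case False
        then have "(\<xi> \<bullet> n)\<^sup>2 / (R k)\<^sup>2 \<le> (\<xi> \<bullet> n)\<^sup>2 / (norm \<xi>)\<^sup>2"
          using nR R[of k] by (intro divide_left_mono power_mono) auto
        then have "c * t * ((\<xi> \<bullet> n)\<^sup>2 / (R k)\<^sup>2) \<le> c * t * ((\<xi> \<bullet> n)\<^sup>2 / (norm \<xi>)\<^sup>2)"
          using c t by (intro mult_left_mono) auto
        then show ?thesis by simp
      qed simp
      have "(1 + (norm \<xi>)\<^sup>2) powr (- b / 2) * exp (- c * t * (\<xi> \<bullet> n)\<^sup>2 / (norm \<xi>)\<^sup>2) \<le> 2 powr (- b * real k) * exp (- c * t * (\<xi> \<bullet> n)\<^sup>2 / (R k)\<^sup>2)"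
        by (intro mult_mono 1 2) auto
      then have "ennreal ((1 + (norm \<xi>)\<^sup>2) powr (- b / 2) * exp (- c * t * (\<xi> \<bullet> n)\<^sup>2 / (norm \<xi>)\<^sup>2)) \<le> ?g k \<xi>"
        using nR by (simp flip: ennreal_mult')
      also have "\<dots> = sum (\<lambda>k. ?g k \<xi>) {k}" by simp
      also have "\<dots> \<le> (\<Sum>k. ?g k \<xi>)" by (rule sum_le_suminf) auto
      finally show "ennreal ((1 + (norm \<xi>)\<^sup>2) powr (- b / 2) * exp (- c * t * (\<xi> \<bullet> n)\<^sup>2 / (norm \<xi>)\<^sup>2)) \<le> (\<Sum>k. ?g k \<xi>)" .
    qed
    also have "\<dots> = (\<Sum>k. \<integral>\<^sup>+\<xi>. ?g k \<xi> \<partial>lborel)"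
      by (rule nn_integral_suminf) measurable
    also have "\<dots> \<le> (\<Sum>k. ennreal (K0 * (1 + t) powr (- 1 / 2) * \<rho> ^ k))"
    proof (rule suminf_le)
      fix k
      have "(\<integral>\<^sup>+\<xi>. ?g k \<xi> \<partial>lborel) = ennreal (2 powr (- b * real k)) * (\<integral>\<^sup>+\<xi>. ennreal (exp (- c * t * (\<xi> \<bullet> n)\<^sup>2 / (R k)\<^sup>2)) * indicator {\<xi>. norm \<xi> \<le> R k} \<xi> \<partial>lborel)"
        by (rule nn_integral_cmult) measurable
      also have "\<dots> \<le> ennreal (2 powr (- b * real k)) * ennreal (exp c * (2 * sqrt 2 * sqrt (pi / c)) * (R k)\<^sup>2 * (1 + t) powr (- 1 / 2))"
        by (intro mult_left_mono nn_integral_strip_decay n R c t) auto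
      also have "\<dots> = ennreal (2 powr (- b * real k) * (exp c * (2 * sqrt 2 * sqrt (pi / c)) * (R k)\<^sup>2 * (1 + t) powr (- 1 / 2)))"
        by (simp flip: ennreal_mult')
      also have "2 powr (- b * real k) * (exp c * (2 * sqrt 2 * sqrt (pi / c)) * (R k)\<^sup>2 * (1 + t) powr (- 1 / 2)) = K0 * (1 + t) powr (- 1 / 2) * \<rho> ^ k"
      proof -
        have "(R k)\<^sup>2 = 4 * 4 ^ k"
          by (simp add: R_def power_mult_distrib power2_eq_square flip: power_mult_distrib)
        moreover have "(2::real) powr (- b * real k) = (2 powr (- b)) ^ k"
          by (simp add: powr_powr flip: powr_realpow)
        ultimately have "2 powr (- b * real k) * (R k)\<^sup>2 = 4 * \<rho> ^ k"
          by (simp add: \<rho>_def power_mult_distrib)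
        then show ?thesis by (simp add: K0_def mult_ac)
      qed
      finally show "(\<integral>\<^sup>+\<xi>. ?g k \<xi> \<partial>lborel) \<le> ennreal (K0 * (1 + t) powr (- 1 / 2) * \<rho> ^ k)" .
    qed auto
    also have "\<dots> = ennreal (\<Sum>k. K0 * (1 + t) powr (- 1 / 2) * \<rho> ^ k)"
      using \<rho> K0 by (intro suminf_ennreal2 summable_mult summable_geometric) auto
    also have "(\<Sum>k. K0 * (1 + t) powr (- 1 / 2) * \<rho> ^ k) = K * (1 + t) powr (- 1 / 2)"
      using \<rho> by (subst suminf_mult) (auto simp: suminf_geometric K_def intro!: summable_geometric)
    finally show "(\<integral>\<^sup>+\<xi>. ennreal ((1 + (norm \<xi>)\<^sup>2) powr (- b / 2) * exp (- c * t * (\<xi> \<bullet> n)\<^sup>2 / (norm \<xi>)\<^sup>2)) \<partial>lborel) \<le> ennreal (K * (1 + t) powr (- 1 / 2))" .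
  qed
qed

text \<open>The case \<open>t = 0\<close> of the preceding bound, for an arbitrary
  direction.\<close>

lemma integrable_sobolev_weight:
  assumes "b > 2"
  shows "integrable lborel (\<lambda>\<xi>::real^2. (1 + (norm \<xi>)\<^sup>2) powr (- b / 2))"
proof -
  obtain K where "\<And>(n::real^2) t. norm n = 1 \<Longrightarrow> t \<ge> 0 \<Longrightarrow>
      (\<integral>\<^sup>+\<xi>. ennreal ((1 + (norm \<xi>)\<^sup>2) powr (- b / 2) * exp (- 1 * t * (\<xi> \<bullet> n)\<^sup>2 / (norm \<xi>)\<^sup>2)) \<partial>lborel) \<le> ennreal (K * (1 + t) powr (- 1 / 2))"
    by (rule nn_integral_sobolev_weight_decay[OF assms, of 1]) auto
  from this[of "axis 1 1" 0]
  have "(\<integral>\<^sup>+\<xi>. ennreal ((1 + (norm (\<xi>::real^2))\<^sup>2) powr (- b / 2)) \<partial>lborel) \<le> ennreal K" by simp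
  then show ?thesis
    by (intro integrableI_bounded) (auto simp: less_top[symmetric] top_unique)
qed

text \<open>Here both variables are damped, which doubles the decay exponent of the strip. As there,
  \<open>t\<close> is traded for \<open>1 + t\<close> at the price of a constant.\<close>

lemma nn_integral_disc_decay:
  assumes R: "R > 0" and c: "c > 0" and t: "t \<ge> 0"
  shows "(\<integral>\<^sup>+\<xi>. ennreal (exp (- c * t * (norm \<xi>)\<^sup>2)) * indicator {\<xi>. norm \<xi> \<le> R} (\<xi>::real^2) \<partial>lborel)
    \<le> ennreal (exp (c * R\<^sup>2) * (pi / c) * (1 + t) powr (- 1))"
proof -
  define \<alpha> where "\<alpha> = 2 * c * (1 + t)"
  have \<alpha>: "\<alpha> > 0" using c t by (simp add: \<alpha>_def)
  have "(\<integral>\<^sup>+\<xi>. ennreal (exp (- c * t * (norm \<xi>)\<^sup>2)) * indicator {\<xi>. norm \<xi> \<le> R} (\<xi>::real^2) \<partial>lborel)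
    \<le> (\<integral>\<^sup>+\<xi>. ennreal (exp (c * R\<^sup>2)) * ennreal (exp (- \<alpha> * (norm (\<xi>::real^2))\<^sup>2 / 2)) \<partial>lborel)"
  proof (intro nn_integral_mono)
    fix \<xi> :: "real^2"
    have "exp (- c * t * (norm \<xi>)\<^sup>2) \<le> exp (c * R\<^sup>2) * exp (- \<alpha> * (norm \<xi>)\<^sup>2 / 2)" if "norm \<xi> \<le> R"
    proof -
      have "c * (norm \<xi>)\<^sup>2 \<le> c * R\<^sup>2" using that c by (intro mult_left_mono power_mono) auto
      moreover have "- \<alpha> * (norm \<xi>)\<^sup>2 / 2 = - c * t * (norm \<xi>)\<^sup>2 - c * (norm \<xi>)\<^sup>2"
        by (simp add: \<alpha>_def field_simps)
      ultimately show ?thesis unfolding exp_add[symmetric] by simp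
    qed
    then show "ennreal (exp (- c * t * (norm \<xi>)\<^sup>2)) * indicator {\<xi>. norm \<xi> \<le> R} \<xi>
      \<le> ennreal (exp (c * R\<^sup>2)) * ennreal (exp (- \<alpha> * (norm \<xi>)\<^sup>2 / 2))"
      by (auto simp: indicator_def simp flip: ennreal_mult' intro!: ennreal_leI)
  qed
  also have "\<dots> = ennreal (exp (c * R\<^sup>2)) * ennreal (2 * pi / \<alpha>)"
    unfolding integrable_gaussian_2d(2)[OF \<alpha>, symmetric] by (rule nn_integral_cmult) measurable
  also have "\<dots> = ennreal (exp (c * R\<^sup>2) * (2 * pi / \<alpha>))" by (simp flip: ennreal_mult')
  also have "exp (c * R\<^sup>2) * (2 * pi / \<alpha>) = exp (c * R\<^sup>2) * (pi / c) * (1 + t) powr (- 1)"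
    using t c by (simp add: \<alpha>_def powr_minus_divide)
  finally show ?thesis .
qed

section \<open>Fourier transforms of Schwartz functions\<close>

text \<open>Peetre's inequality for shifts of length at most 1; it makes the dominating function of
  the difference quotients in \<open>fourier_partial\<close> independent of the step size.\<close>

lemma bracket_le_shift:
  fixes x e :: "real^2"
  assumes "norm e \<le> 1"
  shows "1 + (norm x)\<^sup>2 \<le> 3 * (1 + (norm (x + e))\<^sup>2)"
proof -
  have "norm x \<le> norm (x + e) + 1" using norm_triangle_ineq4[of "x + e" e] assms by simp
  then have "(norm x)\<^sup>2 \<le> (norm (x + e) + 1)\<^sup>2" by (intro power_mono) auto
  also have "\<dots> \<le> 2 * (norm (x + e))\<^sup>2 + 2" using sum_squares_bound[of "norm (x+e)" 1] by (simp add: power2_sum)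
  finally have "(norm x)\<^sup>2 \<le> 2 * (norm (x + e))\<^sup>2 + 2" .
  then show ?thesis using zero_le_power2[of "norm (x + e)"] unfolding distrib_left by linarith
qed

lemma partials_append: "partials (is @ js) f = partials is (partials js f)"
  by (simp add: partials_def)

lemma partials_Nil [simp]: "partials [] f = f"
  by (simp add: partials_def)

lemma partials_single: "partials [i] f x = frechet_derivative f (at x) (axis i 1)"
  by (simp add: partials_def)

lemma schwartz_partials:
  assumes "schwartz f" shows "schwartz (partials is f)"
  using assms unfolding schwartz_def partials_append[symmetric] by blast

lemma schwartz_differentiable:
  assumes "schwartz f" shows "f differentiable (at x)"
proof -
  have "\<forall>x. partials [] f differentiable (at x)" using assms unfolding schwartz_def by blast
  then show ?thesis by simp
qed

text \<open>The exponent -2 is chosen so that the bound is integrable over the plane; the seminorms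
  with weights of degree 0 and 4 combine to it.\<close>

lemma schwartz_bound:
  assumes "schwartz f"
  obtains C where "C > 0" "\<And>x. norm (f x) \<le> C * (1 + (norm x)\<^sup>2) powr (-2)"
proof -
  have b: "bounded (range (\<lambda>x. norm x ^ k *\<^sub>R f x))" for k
  proof -
    have "bounded (range (\<lambda>x. norm x ^ k *\<^sub>R partials [] f x))" using assms unfolding schwartz_def by blast
    then show ?thesis by simp
  qed
  obtain A where A: "\<And>x. norm (f x) \<le> A" using b[of 0] by (auto simp: bounded_iff)
  obtain B where B: "\<And>x. norm x ^ 4 * norm (f x) \<le> B" using b[of 4] by (auto simp: bounded_iff)
  define C where "C = 2 * \<bar>A\<bar> + 2 * \<bar>B\<bar> + 1"
  have "norm (f x) \<le> C * (1 + (norm x)\<^sup>2) powr (-2)" for x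
  proof -
    have "(1 + (norm x)\<^sup>2)\<^sup>2 \<le> 2 + 2 * norm x ^ 4"
      using sum_squares_bound[of 1 "(norm x)\<^sup>2"] by (simp add: power2_sum flip: power_mult)
    then have "norm (f x) * (1 + (norm x)\<^sup>2)\<^sup>2 \<le> norm (f x) * (2 + 2 * norm x ^ 4)" by (intro mult_left_mono) auto
    also have "\<dots> = 2 * norm (f x) + 2 * (norm x ^ 4 * norm (f x))" by (simp add: algebra_simps)
    also have "\<dots> \<le> C" using A[of x] B[of x] by (simp add: C_def)
    finally have "norm (f x) * (1 + (norm x)\<^sup>2)\<^sup>2 \<le> C" .
    moreover have "(1 + (norm x)\<^sup>2) powr (-2) = 1 / (1 + (norm x)\<^sup>2)\<^sup>2"
      by (simp add: powr_minus_divide)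
    moreover have "1 + (norm x)\<^sup>2 > 0" by (rule add_pos_nonneg) auto
    ultimately show ?thesis by (simp add: le_divide_eq)
  qed
  moreover have "C > 0" by (simp add: C_def)
  ultimately show thesis by (rule that[rotated])
qed

lemma schwartz_continuous: "schwartz f \<Longrightarrow> continuous_on UNIV f"
  by (auto simp: continuous_on_eq_continuous_at intro!: differentiable_imp_continuous_within schwartz_differentiable)

lemma schwartz_integrable:
  fixes f :: "real^2 \<Rightarrow> complex^'n"
  assumes "schwartz f" shows "integrable lborel f"
proof -
  obtain C where C: "C > 0" "\<And>x. norm (f x) \<le> C * (1 + (norm x)\<^sup>2) powr (-2)"
    by (rule schwartz_bound[OF assms]) (rule that)
  show ?thesis
  proof (rule Bochner_Integration.integrable_bound)
    show "integrable lborel (\<lambda>x::real^2. C * (1 + (norm x)\<^sup>2) powr (-2))"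
      using integrable_sobolev_weight[of 4] by simp
    show "f \<in> borel_measurable lborel"
      using borel_measurable_continuous_onI[OF schwartz_continuous[OF assms]] by simp
    show "AE x in lborel. norm (f x) \<le> norm (C * (1 + (norm x)\<^sup>2) powr (-2))"
      using C by (auto simp: abs_of_nonneg)
  qed
qed

lemma sft_translate:
  assumes [measurable]: "f \<in> borel_measurable borel"
  shows "sft (\<lambda>x. f (x + a)) \<xi> = cis (a \<bullet> \<xi>) * sft f \<xi>"
proof -
  have "(LINT x|lborel. cis (- (x \<bullet> \<xi>)) * f x) = (LINT x|distr lborel borel ((+) a). cis (- (x \<bullet> \<xi>)) * f x)"
    by (simp add: lborel_distr_plus)
  also have "\<dots> = (LINT x|lborel. cis (- ((a + x) \<bullet> \<xi>)) * f (a + x))"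
    by (subst integral_distr) auto
  also have "\<dots> = (LINT x|lborel. cis (- (a \<bullet> \<xi>)) * (cis (- (x \<bullet> \<xi>)) * f (x + a)))"
    by (simp add: inner_add_left add.commute cis_mult mult.assoc[symmetric])
  also have "\<dots> = cis (- (a \<bullet> \<xi>)) * (LINT x|lborel. cis (- (x \<bullet> \<xi>)) * f (x + a))" by simp
  finally have "sft f \<xi> = cis (- (a \<bullet> \<xi>)) * sft (\<lambda>x. f (x + a)) \<xi>" by (simp add: sft_def)
  then show ?thesis by (simp add: mult.assoc[symmetric] cis_mult)
qed

lemma has_vector_derivative_quotient:
  fixes f :: "real \<Rightarrow> 'a::real_normed_vector"
  assumes "(f has_vector_derivative d) (at 0)"
  shows "((\<lambda>s. (f s - f 0) /\<^sub>R s) \<longlongrightarrow> d) (at 0)"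
proof (rule LIM_zero_cancel, rule tendsto_norm_zero_cancel)
  have "((\<lambda>s. norm (f (0 + s) - f 0 - s *\<^sub>R d) / norm s) \<longlongrightarrow> 0) (at 0)"
    using assms unfolding has_vector_derivative_def has_derivative_at by blast
  moreover have "\<forall>\<^sub>F s in at 0. norm (f (0 + s) - f 0 - s *\<^sub>R d) / norm s = norm ((f s - f 0) /\<^sub>R s - d)"
    unfolding eventually_at_filter
  proof (rule always_eventually, intro allI impI)
    fix s :: real assume "s \<noteq> 0"
    then have "(f s - f 0) /\<^sub>R s - d = (f (0 + s) - f 0 - s *\<^sub>R d) /\<^sub>R s"
      by (simp add: scaleR_diff_right)
    then show "norm (f (0 + s) - f 0 - s *\<^sub>R d) / norm s = norm ((f s - f 0) /\<^sub>R s - d)"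
      by (simp add: divide_inverse mult.commute)
  qed
  ultimately show "((\<lambda>s. norm ((f s - f 0) /\<^sub>R s - d)) \<longlongrightarrow> 0) (at 0)"
    by (rule Lim_transform_eventually)
qed

text \<open>Difference quotients replace integration by parts. On the frequency side a translation
  is multiplication by a character, whose quotient tends to \<open>\<i> * \<xi> $ j\<close>; on the
  other side dominated convergence applies.\<close>

lemma fourier_partial:
  fixes f :: "real^2 \<Rightarrow> complex^'n"
  assumes f: "schwartz f"
  shows "fourier (partials [j] f) \<xi> = (\<i> * complex_of_real (\<xi> $ j)) *s fourier f \<xi>"
proof (subst vec_eq_iff, rule allI)
  fix i
  let ?df = "partials [j] f" and ?e = "axis j 1 :: real^2"
  have fi: "integrable lborel f" using schwartz_integrable[OF f] .
  have sdf: "schwartz ?df" using schwartz_partials[OF f] .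
  have dfi: "integrable lborel ?df" using schwartz_integrable[OF sdf] .
  have [measurable]: "f \<in> borel_measurable borel" "?df \<in> borel_measurable borel"
    using fi dfi by (auto dest: borel_measurable_integrable)
  have fim[measurable]: "(\<lambda>x. f x $ i) \<in> borel_measurable borel" "(\<lambda>x. ?df x $ i) \<in> borel_measurable borel"
    using integrable_vec_nth[OF fi] integrable_vec_nth[OF dfi] by (auto dest: borel_measurable_integrable)
  obtain C where C: "C > 0" "\<And>x. norm (?df x) \<le> C * (1 + (norm x)\<^sup>2) powr (-2)"
    by (rule schwartz_bound[OF sdf]) (rule that)
  have der: "((\<lambda>s. f (x + s *\<^sub>R ?e)) has_derivative (\<lambda>s. s *\<^sub>R ?df (x + a *\<^sub>R ?e))) (at a)" for x a
  proof -
    have fd: "(f has_derivative frechet_derivative f (at (x + a *\<^sub>R ?e))) (at (x + a *\<^sub>R ?e))"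
      using schwartz_differentiable[OF f] frechet_derivative_works by blast
    have "((\<lambda>s. x + s *\<^sub>R ?e) has_derivative (\<lambda>s. s *\<^sub>R ?e)) (at a)"
      by (auto intro!: derivative_eq_intros)
    from diff_chain_at[OF this fd]
    have "((\<lambda>s. f (x + s *\<^sub>R ?e)) has_derivative (\<lambda>s. frechet_derivative f (at (x + a *\<^sub>R ?e)) (s *\<^sub>R ?e))) (at a)"
      by (simp add: o_def)
    moreover have "frechet_derivative f (at (x + a *\<^sub>R ?e)) (s *\<^sub>R ?e) = s *\<^sub>R ?df (x + a *\<^sub>R ?e)" for s
      using linear_frechet_derivative[OF schwartz_differentiable[OF f]] by (simp add: partials_single linear_cmul)
    ultimately show ?thesis by simp
  qed
  define h :: "nat \<Rightarrow> real" where "h n = 1 / real (Suc n)" for n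
  have h: "h n > 0" "h n \<le> 1" for n by (auto simp: h_def)
  have h0: "h \<longlonglongrightarrow> 0" unfolding h_def[abs_def] by (rule LIMSEQ_Suc[OF lim_1_over_n])
  have h0': "filterlim h (at 0) sequentially"
    using h0 h(1) by (intro filterlim_atI) (auto simp: less_le)
  define g where "g n x = complex_of_real (1 / h n) * (f (x + h n *\<^sub>R ?e) $ i + (- 1) * f x $ i)" for n x
  have [measurable]: "g n \<in> borel_measurable borel" for n
    unfolding g_def[abs_def] using measurable_compose[OF _ fim(1), of "\<lambda>x. x + h n *\<^sub>R ?e"] by measurable
  \<comment> \<open>The mean value theorem bounds the quotient by the derivative at a point within
    distance 1; the factor 9 is the square of the constant 3 in
    \<open>bracket_le_shift\<close>.\<close>
  have gb: "norm (g n x) \<le> C * 9 * (1 + (norm x)\<^sup>2) powr (-2)" for n x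
  proof -
    have "\<exists>s\<in>{0<..<h n}. norm (f (x + h n *\<^sub>R ?e) - f (x + 0 *\<^sub>R ?e)) \<le> norm ((h n - 0) *\<^sub>R ?df (x + s *\<^sub>R ?e))"
    proof (rule mvt_general[where f="\<lambda>s. f (x + s *\<^sub>R ?e)" and f'="\<lambda>a s. s *\<^sub>R ?df (x + a *\<^sub>R ?e)"])
      show "0 < h n" by (rule h)
      show "continuous_on {0..h n} (\<lambda>s. f (x + s *\<^sub>R ?e))"
        by (rule has_derivative_continuous_on) (rule has_derivative_at_withinI[OF der])
      show "((\<lambda>s. f (x + s *\<^sub>R ?e)) has_derivative (\<lambda>s. s *\<^sub>R ?df (x + a *\<^sub>R ?e))) (at a)" for a
        by (rule der)
    qed
    then obtain s where s: "0 < s" "s < h n" "norm (f (x + h n *\<^sub>R ?e) - f x) \<le> h n * norm (?df (x + s *\<^sub>R ?e))"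
      using h(1)[of n] by auto
    have "norm (g n x) = norm ((f (x + h n *\<^sub>R ?e) - f x) $ i) / h n"
      using h(1)[of n] by (simp add: g_def norm_mult norm_divide)
    also have "\<dots> \<le> norm (f (x + h n *\<^sub>R ?e) - f x) / h n"
      using h(1)[of n] by (intro divide_right_mono Finite_Cartesian_Product.norm_nth_le) auto
    also have "\<dots> \<le> norm (?df (x + s *\<^sub>R ?e))" using s(3) h(1)[of n] by (simp add: divide_le_eq mult.commute)
    also have "\<dots> \<le> C * (1 + (norm (x + s *\<^sub>R ?e))\<^sup>2) powr (-2)" by (rule C(2))
    also have "\<dots> \<le> C * ((1 + (norm x)\<^sup>2) / 3) powr (-2)"
    proof (intro mult_left_mono powr_mono2')
      have "norm (s *\<^sub>R ?e) \<le> 1" using s h(2)[of n] by simp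
      from bracket_le_shift[OF this, of x] show "(1 + (norm x)\<^sup>2) / 3 \<le> 1 + (norm (x + s *\<^sub>R ?e))\<^sup>2" by simp
      show "0 < (1 + (norm x)\<^sup>2) / 3" by (intro divide_pos_pos add_pos_nonneg) auto
    qed (use C in auto)
    also have "\<dots> = C * 9 * (1 + (norm x)\<^sup>2) powr (-2)"
      by (simp add: powr_divide powr_minus_divide)
    finally show ?thesis .
  qed
  have lim1: "(\<lambda>n. sft (g n) \<xi>) \<longlonglongrightarrow> sft (\<lambda>x. ?df x $ i) \<xi>"
    unfolding sft_def
  proof (intro tendsto_scaleR tendsto_const integral_dominated_convergence)
    show "integrable lborel (\<lambda>x::real^2. C * 9 * (1 + (norm x)\<^sup>2) powr (-2))"
      using integrable_sobolev_weight[of 4] by simp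
    show "AE x in lborel. norm (cis (- (x \<bullet> \<xi>)) * g n x) \<le> C * 9 * (1 + (norm x)\<^sup>2) powr (-2)" for n
      using gb by (simp add: norm_mult)
    show "AE x in lborel. (\<lambda>n. cis (- (x \<bullet> \<xi>)) * g n x) \<longlonglongrightarrow> cis (- (x \<bullet> \<xi>)) * ?df x $ i"
    proof (intro AE_I2 tendsto_mult tendsto_const)
      fix x
      have "((\<lambda>s. f (x + s *\<^sub>R ?e)) has_vector_derivative ?df x) (at 0)"
        using der[of x 0] by (simp add: has_vector_derivative_def)
      from has_vector_derivative_quotient[OF this]
      have "((\<lambda>s. (f (x + s *\<^sub>R ?e) - f x) /\<^sub>R s) \<longlongrightarrow> ?df x) (at 0)" by simp
      from filterlim_compose[OF this h0']
      have "(\<lambda>n. (f (x + h n *\<^sub>R ?e) - f x) /\<^sub>R h n) \<longlonglongrightarrow> ?df x" .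
      from tendsto_vec_nth[OF this, of i]
      show "(\<lambda>n. g n x) \<longlonglongrightarrow> ?df x $ i"
        unfolding vector_scaleR_component vector_minus_component scaleR_conv_of_real[where 'a=complex]
        by (simp add: g_def divide_inverse)
    qed
  qed measurable
  have "sft (g n) \<xi> = (cis (h n * \<xi> $ j) - 1) / complex_of_real (h n) * sft (\<lambda>x. f x $ i) \<xi>" for n
  proof -
    have int: "integrable lborel (\<lambda>x. f x $ i)" using integrable_vec_nth[OF fi] .
    have intt: "integrable lborel (\<lambda>x. f (x + h n *\<^sub>R ?e) $ i)"
    proof -
      have "integrable (distr lborel borel ((+) (h n *\<^sub>R ?e))) (\<lambda>x. f x $ i)"
        using int by (simp add: lborel_distr_plus)
      then show ?thesis by (subst (asm) integrable_distr_eq) (auto simp: add.commute)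
    qed
    have "sft (g n) \<xi> = complex_of_real (1 / h n) * (sft (\<lambda>x. f (x + h n *\<^sub>R ?e) $ i) \<xi> + (-1) * sft (\<lambda>x. f x $ i) \<xi>)"
      unfolding g_def sft_cmult using int intt by (subst sft_add) (auto simp: sft_cmult[of "-1", simplified])
    also have "sft (\<lambda>x. f (x + h n *\<^sub>R ?e) $ i) \<xi> = cis ((h n *\<^sub>R ?e) \<bullet> \<xi>) * sft (\<lambda>x. f x $ i) \<xi>"
      by (rule sft_translate) measurable
    also have "(h n *\<^sub>R ?e) \<bullet> \<xi> = h n * \<xi> $ j" by (simp add: inner_axis')
    finally show ?thesis by (simp add: algebra_simps diff_divide_distrib)
  qed
  moreover have "(\<lambda>n. (cis (h n * \<xi> $ j) - 1) / complex_of_real (h n) * sft (\<lambda>x. f x $ i) \<xi>) \<longlonglongrightarrow> \<i> * complex_of_real (\<xi> $ j) * sft (\<lambda>x. f x $ i) \<xi>"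
  proof (intro tendsto_mult tendsto_const)
    have "((\<lambda>s. cis (s * \<xi> $ j)) has_vector_derivative (\<i> * complex_of_real (\<xi> $ j))) (at 0)"
      using exp_scaleR_has_vector_derivative_right[of "\<i> * complex_of_real (\<xi> $ j)" 0 UNIV]
      by (simp add: cis_conv_exp scaleR_conv_of_real mult_ac)
    from has_vector_derivative_quotient[OF this]
    have "((\<lambda>s. (cis (s * \<xi> $ j) - 1) /\<^sub>R s) \<longlongrightarrow> \<i> * complex_of_real (\<xi> $ j)) (at 0)" by simp
    from filterlim_compose[OF this h0']
    show "(\<lambda>n. (cis (h n * \<xi> $ j) - 1) / complex_of_real (h n)) \<longlonglongrightarrow> \<i> * complex_of_real (\<xi> $ j)"
      by (simp add: scaleR_conv_of_real divide_inverse mult.commute)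
  qed
  ultimately have "(\<lambda>n. sft (g n) \<xi>) \<longlonglongrightarrow> \<i> * complex_of_real (\<xi> $ j) * sft (\<lambda>x. f x $ i) \<xi>" by simp
  from LIMSEQ_unique[OF lim1 this]
  show "fourier ?df \<xi> $ i = ((\<i> * complex_of_real (\<xi> $ j)) *s fourier f \<xi>) $ i"
    by (simp add: fourier_nth[OF fi] fourier_nth[OF dfi])
qed

lemma norm_fourier_le:
  fixes f :: "real^2 \<Rightarrow> complex^'n"
  shows "norm (fourier f \<xi>) \<le> (LINT x|lborel. norm (f x)) / (2 * pi)"
proof -
  have "norm (LINT x|lborel. cis (- (x \<bullet> \<xi>)) *s f x) \<le> (LINT x|lborel. norm (cis (- (x \<bullet> \<xi>)) *s f x))"
    by (rule integral_norm_bound)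
  then show ?thesis by (simp add: fourier_def norm_vector_smult divide_right_mono)
qed

lemma fourier_partial_power:
  fixes f :: "real^2 \<Rightarrow> complex^'n"
  assumes f: "schwartz f"
  shows "norm (fourier (partials (replicate k j) f) \<xi>) = \<bar>\<xi> $ j\<bar> ^ k * norm (fourier f \<xi>)"
proof (induction k)
  case (Suc k)
  have "partials (replicate (Suc k) j) f = partials [j] (partials (replicate k j) f)"
    by (simp add: partials_append[symmetric])
  then show ?case
    using Suc fourier_partial[OF schwartz_partials[OF f, of "replicate k j"], of j \<xi>]
    by (simp add: norm_vector_smult norm_mult)
qed simp

text \<open>Pure derivatives of even order suffice, because \<open>1 + (norm \<xi>)\<^sup>2\<close>
  is at most three times the largest of 1 and the squares of the two coordinates.\<close>

lemma schwartz_fourier_decay: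
  fixes f :: "real^2 \<Rightarrow> complex^'n"
  assumes f: "schwartz f"
  obtains C where "C > 0" "\<And>\<xi>. norm (fourier f \<xi>) \<le> C * (1 + (norm \<xi>)\<^sup>2) powr (- m)"
proof -
  define k where "k = nat \<lceil>m\<rceil>"
  define K where "K j = (LINT x|lborel. norm (partials (replicate (2 * k) j) f x)) / (2 * pi)" for j
  have K: "\<bar>\<xi> $ j\<bar> ^ (2 * k) * norm (fourier f \<xi>) \<le> K j" for j \<xi>
    using norm_fourier_le[of "partials (replicate (2 * k) j) f" \<xi>] unfolding fourier_partial_power[OF f] K_def .
  define K0 where "K0 = (LINT x|lborel. norm (f x)) / (2 * pi)"
  have K0: "norm (fourier f \<xi>) \<le> K0" for \<xi> unfolding K0_def by (rule norm_fourier_le)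
  define C where "C = 3 ^ k * (\<bar>K0\<bar> + \<bar>K 1\<bar> + \<bar>K 2\<bar>) + 1"
  have "norm (fourier f \<xi>) \<le> C * (1 + (norm \<xi>)\<^sup>2) powr (- m)" for \<xi>
  proof -
    define M where "M = max 1 (max ((\<xi> $ 1)\<^sup>2) ((\<xi> $ 2)\<^sup>2))"
    have M: "M \<ge> 1" "1 + (norm \<xi>)\<^sup>2 \<le> 3 * M" by (auto simp: M_def norm_real2_power2)
    have pos: "1 + (norm \<xi>)\<^sup>2 \<ge> 1" by simp
    have "(1 + (norm \<xi>)\<^sup>2) powr m \<le> (1 + (norm \<xi>)\<^sup>2) powr real k"
      using pos by (intro powr_mono) (auto simp: k_def real_nat_ceiling_ge)
    also have "\<dots> = (1 + (norm \<xi>)\<^sup>2) ^ k" using pos by (intro powr_realpow) linarith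
    also have "\<dots> \<le> (3 * M) ^ k" using M pos by (intro power_mono) auto
    also have "\<dots> = 3 ^ k * M ^ k" by (rule power_mult_distrib)
    finally have 1: "(1 + (norm \<xi>)\<^sup>2) powr m \<le> 3 ^ k * M ^ k" .
    have e: "((\<xi> $ j)\<^sup>2) ^ k = \<bar>\<xi> $ j\<bar> ^ (2 * k)" for j by (simp add: power_mult)
    have "M ^ k * norm (fourier f \<xi>) \<le> \<bar>K0\<bar> + \<bar>K 1\<bar> + \<bar>K 2\<bar>"
    proof -
      consider "M = 1" | "M = (\<xi> $ 1)\<^sup>2" | "M = (\<xi> $ 2)\<^sup>2" unfolding M_def by linarith
      then show ?thesis
      proof cases
        case 1 then show ?thesis using K0[of \<xi>] by simp
      next
        case 2 then show ?thesis using K[of \<xi> 1] e[of 1] by simp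
      next
        case 3 then show ?thesis using K[of \<xi> 2] e[of 2] by simp
      qed
    qed
    then have "3 ^ k * (M ^ k * norm (fourier f \<xi>)) \<le> 3 ^ k * (\<bar>K0\<bar> + \<bar>K 1\<bar> + \<bar>K 2\<bar>)"
      by (rule mult_left_mono) simp
    then have "3 ^ k * M ^ k * norm (fourier f \<xi>) \<le> C"
      unfolding C_def mult.assoc by linarith
    then have "(1 + (norm \<xi>)\<^sup>2) powr m * norm (fourier f \<xi>) \<le> C"
      using mult_right_mono[OF 1 norm_ge_zero[of "fourier f \<xi>"]] by linarith
    then show ?thesis
      using less_le_trans[OF zero_less_one pos] by (simp add: powr_minus divide_inverse[symmetric] le_divide_eq mult.commute)
  qed
  moreover have "C > 0" unfolding C_def by (intro add_nonneg_pos) auto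
  ultimately show thesis by (rule that[rotated])
qed

section \<open>Decay of the symbol semigroup\<close>

text \<open>A completed square. The small share \<open>b / 8\<close> lets several such terms fit
  under one half of the dissipated quadratic form.\<close>

lemma young_weighted:
  fixes x y c b :: real
  assumes "b > 0"
  shows "c * (x * y) \<le> b / 8 * x\<^sup>2 + 2 * c\<^sup>2 / b * y\<^sup>2"
proof -
  have "0 \<le> (b * x - 4 * c * y)\<^sup>2 / (8 * b)" using assms by simp
  also have "\<dots> = b / 8 * x\<^sup>2 + 2 * c\<^sup>2 / b * y\<^sup>2 - c * (x * y)"
    using assms by (simp add: power2_eq_square field_simps)
  finally show ?thesis by linarith
qed

text \<open>Here \<open>x0\<close> stands for the size of the dissipated component and
  \<open>x1\<close> to \<open>x4\<close> for those of the chain. The shares taken from the four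
  weighted squares add up to 3/8, 1/4, 1/4 and 3/16, all within the admissible half; the rest is
  charged to \<open>x0\<close>, where the constant may be large.\<close>

lemma compensator_scalar:
  fixes \<tau> x0 x1 x2 x3 x4 a b G H \<sigma> \<pi> :: real
  assumes \<tau>: "0 < \<tau>" "\<tau> \<le> 1 / 32" and \<sigma>: "\<tau> * \<sigma> \<le> 1 / 8" and \<pi>: "\<pi> \<ge> 0" "\<tau> * \<pi> \<le> 1"
  shows "a * (x1 * x0) + G * (x2 * x0) + H * (x4 * x0) + \<tau>^3 * (x1 * x3) + \<tau>^5 * (x2 * x4) + \<tau>^6 * \<sigma> * x3\<^sup>2 + \<tau>^6 * \<pi> * (x1 * x3)
    \<le> 1/2 * (x1\<^sup>2 + \<tau>^3 * x2\<^sup>2 + \<tau>^5 * x3\<^sup>2 + \<tau>^6 * x4\<^sup>2) + (2 * a\<^sup>2 + 2 * G\<^sup>2 / \<tau>^3 + 2 * H\<^sup>2 / \<tau>^6) * x0\<^sup>2"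
proof -
  have t1: "a * (x1 * x0) \<le> 1 / 8 * x1\<^sup>2 + 2 * a\<^sup>2 * x0\<^sup>2" using young_weighted[of 1 a x1 x0] by simp
  have t2: "G * (x2 * x0) \<le> \<tau>^3 / 8 * x2\<^sup>2 + 2 * G\<^sup>2 / \<tau>^3 * x0\<^sup>2" using \<tau> by (intro young_weighted) auto
  have t3: "H * (x4 * x0) \<le> \<tau>^6 / 8 * x4\<^sup>2 + 2 * H\<^sup>2 / \<tau>^6 * x0\<^sup>2" using \<tau> by (intro young_weighted) auto
  \<comment> \<open>The exponent 3 exceeds the mean 5/2 of the exponents 0 and 5 by 1/2, which after
    squaring leaves the small factor \<open>\<tau>\<close>. In the next estimate 5 exceeds the mean
    9/2 of 3 and 6 in the same way.\<close>
  have t4: "\<tau>^3 * (x1 * x3) \<le> 1 / 8 * x1\<^sup>2 + \<tau>^5 / 16 * x3\<^sup>2"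
  proof -
    have "2 * (\<tau>^3)\<^sup>2 = \<tau>^5 * (2 * \<tau>)" by (simp add: eval_nat_numeral)
    also have "\<dots> \<le> \<tau>^5 * (1 / 16)" using \<tau> by (intro mult_left_mono) auto
    finally have "2 * (\<tau>^3)\<^sup>2 * x3\<^sup>2 \<le> \<tau>^5 / 16 * x3\<^sup>2" by (intro mult_right_mono) auto
    then show ?thesis using young_weighted[of 1 "\<tau>^3" x1 x3] by simp
  qed
  have t5: "\<tau>^5 * (x2 * x4) \<le> \<tau>^3 / 8 * x2\<^sup>2 + \<tau>^6 / 16 * x4\<^sup>2"
  proof -
    have "2 * (\<tau>^5)\<^sup>2 / \<tau>^3 = \<tau>^6 * (2 * \<tau>)" using \<tau> by (simp add: eval_nat_numeral)
    also have "\<dots> \<le> \<tau>^6 * (1 / 16)" using \<tau> by (intro mult_left_mono) auto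
    finally have "2 * (\<tau>^5)\<^sup>2 / \<tau>^3 * x4\<^sup>2 \<le> \<tau>^6 / 16 * x4\<^sup>2" by (intro mult_right_mono) auto
    then show ?thesis using young_weighted[of "\<tau>^3" "\<tau>^5" x2 x4] \<tau> by simp
  qed
  have t6: "\<tau>^6 * \<sigma> * x3\<^sup>2 \<le> \<tau>^5 / 8 * x3\<^sup>2"
  proof -
    have "\<tau>^6 * \<sigma> = \<tau>^5 * (\<tau> * \<sigma>)" by (simp add: eval_nat_numeral)
    also have "\<dots> \<le> \<tau>^5 * (1 / 8)" using \<tau> \<sigma> by (intro mult_left_mono) auto
    finally show ?thesis by (intro mult_right_mono) auto
  qed
  have t7: "\<tau>^6 * \<pi> * (x1 * x3) \<le> 1 / 8 * x1\<^sup>2 + \<tau>^5 / 16 * x3\<^sup>2"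
  proof -
    have "2 * (\<tau>^6 * \<pi>)\<^sup>2 = \<tau>^5 * ((\<tau> * \<pi>)\<^sup>2 * (2 * \<tau>) * \<tau>^4)" by (simp add: eval_nat_numeral)
    also have "\<dots> \<le> \<tau>^5 * (1 * (1/16) * 1)"
      using \<tau> \<pi> by (intro mult_left_mono mult_mono power_le_one) auto
    finally have "2 * (\<tau>^6 * \<pi>)\<^sup>2 * x3\<^sup>2 \<le> \<tau>^5 / 16 * x3\<^sup>2" by (intro mult_right_mono) auto
    then show ?thesis using young_weighted[of 1 "\<tau>^6 * \<pi>" x1 x3] by simp
  qed
  define y2 y3 y4 A1 A2 A3 where y: "y2 = \<tau>^3 * x2\<^sup>2" "y3 = \<tau>^5 * x3\<^sup>2" "y4 = \<tau>^6 * x4\<^sup>2"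
    "A1 = 2 * a\<^sup>2 * x0\<^sup>2" "A2 = 2 * G\<^sup>2 / \<tau>^3 * x0\<^sup>2" "A3 = 2 * H\<^sup>2 / \<tau>^6 * x0\<^sup>2"
  have "y2 \<ge> 0" "y3 \<ge> 0" "y4 \<ge> 0" using \<tau> by (auto simp: y)
  moreover have "a * (x1 * x0) \<le> 1/8 * x1\<^sup>2 + A1" "G * (x2 * x0) \<le> 1/8 * y2 + A2" "H * (x4 * x0) \<le> 1/8 * y4 + A3"
    "\<tau>^3 * (x1 * x3) \<le> 1/8 * x1\<^sup>2 + 1/16 * y3" "\<tau>^5 * (x2 * x4) \<le> 1/8 * y2 + 1/16 * y4"
    "\<tau>^6 * \<sigma> * x3\<^sup>2 \<le> 1/8 * y3" "\<tau>^6 * \<pi> * (x1 * x3) \<le> 1/8 * x1\<^sup>2 + 1/16 * y3"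
    using t1 t2 t3 t4 t5 t6 t7 by (simp_all add: y)
  moreover have A: "(2 * a\<^sup>2 + 2 * G\<^sup>2 / \<tau>^3 + 2 * H\<^sup>2 / \<tau>^6) * x0\<^sup>2 = A1 + A2 + A3"
    unfolding y by (simp only: distrib_right)
  ultimately show ?thesis unfolding A unfolding y(1-3)[symmetric] distrib_left[of "1/2"] using zero_le_power2[of x1] by linarith
qed

text \<open>The compensator \<open>Y\<close> couples the dissipated component \<open>th\<close> to the Krylov chain \<open>P\<close>, \<open>N1\<close>, \<open>P2\<close>, \<open>N3\<close>
  generated from the coupling vector by the propagation matrix. The exponents 3, 5, 6 of \<open>\<tau>\<close> increase concavely, so
  each error term is dominated by its two neighbours in the chain.\<close>

lemma compensator_derivative:
  fixes th P N1 P2 N3 :: "'a::real_inner"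
  assumes \<tau>: "0 < \<tau>" "\<tau> \<le> 1 / 32" and \<sigma>: "\<tau> * \<sigma> \<le> 1 / 8" and \<pi>: "\<pi> \<ge> 0" "\<tau> * \<pi> \<le> 1"
    and g: "g \<noteq> 0" and k: "k \<ge> 0" and \<rho>: "\<rho> \<ge> 0" and \<zeta>: "0 \<le> \<zeta>" "\<zeta> \<le> S"
    and d: "dth = (g * \<rho>) *\<^sub>R P - (k * \<rho>\<^sup>2) *\<^sub>R th" "dP = \<rho> *\<^sub>R N1 - (g * \<rho>) *\<^sub>R th"
      "dN1 = - (\<rho> *\<^sub>R P2)" "dP2 = \<rho> *\<^sub>R N3 - (g * \<rho> * \<zeta>) *\<^sub>R th" "dN3 = - (\<rho> *\<^sub>R (\<sigma> *\<^sub>R P2 - \<pi> *\<^sub>R P))"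
  shows "(dth \<bullet> P + th \<bullet> dP) / g + \<tau>^3 * (dP \<bullet> N1 + P \<bullet> dN1) - \<tau>^5 * (dN1 \<bullet> P2 + N1 \<bullet> dP2) + \<tau>^6 * (dP2 \<bullet> N3 + P2 \<bullet> dN3)
    \<ge> \<rho> * (1/2 * ((norm P)\<^sup>2 + \<tau>^3 * (norm N1)\<^sup>2 + \<tau>^5 * (norm P2)\<^sup>2 + \<tau>^6 * (norm N3)\<^sup>2)
        - (1 + 2 * (k / \<bar>g\<bar>)\<^sup>2 + 2 * (1 / \<bar>g\<bar> + \<bar>g\<bar> + \<bar>g\<bar> * S)\<^sup>2 / \<tau>^3 + 2 * (\<bar>g\<bar> * S)\<^sup>2 / \<tau>^6) * (1 + \<rho>\<^sup>2) * (norm th)\<^sup>2)"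
    (is "?dY \<ge> \<rho> * (1/2 * ?S - ?M * (1 + \<rho>\<^sup>2) * (norm th)\<^sup>2)")
proof -
  let ?x0 = "norm th" and ?x1 = "norm P" and ?x2 = "norm N1" and ?x3 = "norm P2" and ?x4 = "norm N3"
  let ?G = "1 / \<bar>g\<bar> + \<bar>g\<bar> + \<bar>g\<bar> * S" and ?H = "\<bar>g\<bar> * S"
  \<comment> \<open>All contributions except the four squares, with the factor
    \<open>- \<rho>\<close> taken out.\<close>
  define R where "R = k / g * \<rho> * (th \<bullet> P) - 1 / g * (th \<bullet> N1) + ?x0\<^sup>2 + \<tau>^3 * (g * (th \<bullet> N1) + P \<bullet> P2)
     + \<tau>^5 * (N1 \<bullet> N3 - g * \<zeta> * (th \<bullet> N1)) + \<tau>^6 * (g * \<zeta> * (th \<bullet> N3) + \<sigma> * ?x3\<^sup>2 - \<pi> * (P \<bullet> P2))"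
  \<comment> \<open>The minus sign in front of \<open>\<tau>^5\<close> compensates the sign of
    \<open>dN1\<close>, so that all four squares appear positively.\<close>
  have eq: "?dY = \<rho> * (?S - R)"
    unfolding R_def power2_norm_eq_inner d
    using g by (simp add: inner_diff_left inner_diff_right inner_commute field_simps power2_eq_square)
  have cs: "\<bar>u \<bullet> v\<bar> \<le> norm u * norm v" for u v :: 'a by (rule Cauchy_Schwarz_ineq2)
  have b: "c * (u \<bullet> v) \<le> C * (norm v * norm u)" if "\<bar>c\<bar> \<le> C" for c C and u v :: 'a
  proof -
    have "c * (u \<bullet> v) \<le> \<bar>c\<bar> * \<bar>u \<bullet> v\<bar>" by (metis abs_ge_self abs_mult)
    also have "\<dots> \<le> C * (norm u * norm v)" using that cs by (intro mult_mono) auto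
    finally show ?thesis by (simp add: mult.commute)
  qed
  have \<tau>1: "\<tau>^3 \<le> 1" "\<tau>^5 \<le> 1" "\<tau>^6 \<le> 1" using \<tau> by (auto intro!: power_le_one)
  have \<tau>0: "\<tau>^3 \<ge> 0" "\<tau>^5 \<ge> 0" "\<tau>^6 \<ge> 0" using \<tau> by auto
  have "k / g * \<rho> * (th \<bullet> P) \<le> k / \<bar>g\<bar> * \<rho> * (?x1 * ?x0)"
    by (rule b) (use k \<rho> in \<open>simp add: abs_mult\<close>)
  \<comment> \<open>Three of the pairings produce a multiple of \<open>th \<bullet> N1\<close>;
    their coefficients are estimated together.\<close>
  moreover have "(- 1 / g + \<tau>^3 * g - \<tau>^5 * (g * \<zeta>)) * (th \<bullet> N1) \<le> ?G * (?x2 * ?x0)"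
  proof (rule b)
    have "\<bar>\<tau>^3 * g\<bar> \<le> \<bar>g\<bar>" using \<tau>1 \<tau>0 by (simp add: abs_mult mult_left_le_one_le)
    moreover have "\<bar>\<tau>^5 * (g * \<zeta>)\<bar> \<le> \<bar>g\<bar> * S"
    proof -
      have "\<bar>\<tau>^5 * (g * \<zeta>)\<bar> = \<tau>^5 * (\<bar>g\<bar> * \<zeta>)" using \<tau>0 \<zeta> by (simp add: abs_mult)
      also have "\<dots> \<le> 1 * (\<bar>g\<bar> * S)" using \<tau>1 \<tau>0 \<zeta> by (intro mult_mono) auto
      finally show ?thesis by simp
    qed
    moreover have "\<bar>- 1 / g\<bar> = 1 / \<bar>g\<bar>" by simp
    moreover have "\<bar>- 1 / g + \<tau>^3 * g - \<tau>^5 * (g * \<zeta>)\<bar> \<le> \<bar>- 1 / g\<bar> + \<bar>\<tau>^3 * g\<bar> + \<bar>\<tau>^5 * (g * \<zeta>)\<bar>" by linarith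
    ultimately show "\<bar>- 1 / g + \<tau>^3 * g - \<tau>^5 * (g * \<zeta>)\<bar> \<le> ?G" by linarith
  qed
  moreover have "\<tau>^6 * (g * \<zeta>) * (th \<bullet> N3) \<le> ?H * (?x4 * ?x0)"
  proof (rule b)
    have "\<bar>\<tau>^6 * (g * \<zeta>)\<bar> = \<tau>^6 * (\<bar>g\<bar> * \<zeta>)" using \<tau>0 \<zeta> by (simp add: abs_mult)
    also have "\<dots> \<le> 1 * (\<bar>g\<bar> * S)" using \<tau>1 \<tau>0 \<zeta> by (intro mult_mono) auto
    finally show "\<bar>\<tau>^6 * (g * \<zeta>)\<bar> \<le> ?H" by simp
  qed
  moreover have "\<tau>^3 * (P \<bullet> P2) \<le> \<tau>^3 * (?x1 * ?x3)"
    using cs[of P P2] \<tau>0 by (intro mult_left_mono) auto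
  moreover have "\<tau>^5 * (N1 \<bullet> N3) \<le> \<tau>^5 * (?x2 * ?x4)"
    using cs[of N1 N3] \<tau>0 by (intro mult_left_mono) auto
  moreover have "- (\<tau>^6 * \<pi> * (P \<bullet> P2)) \<le> \<tau>^6 * \<pi> * (?x1 * ?x3)"
    using mult_left_mono[of "- (P \<bullet> P2)" "?x1 * ?x3" "\<tau>^6 * \<pi>"] cs[of P P2] \<tau>0 \<pi> by simp
  moreover have "R = k / g * \<rho> * (th \<bullet> P) + (- 1 / g + \<tau>^3 * g - \<tau>^5 * (g * \<zeta>)) * (th \<bullet> N1) + \<tau>^6 * (g * \<zeta>) * (th \<bullet> N3)
     + \<tau>^3 * (P \<bullet> P2) + \<tau>^5 * (N1 \<bullet> N3) - (\<tau>^6 * \<pi> * (P \<bullet> P2)) + \<tau>^6 * \<sigma> * ?x3\<^sup>2 + ?x0\<^sup>2"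
    unfolding R_def by (simp add: algebra_simps)
  ultimately have "R \<le> (k / \<bar>g\<bar> * \<rho> * (?x1 * ?x0) + ?G * (?x2 * ?x0) + ?H * (?x4 * ?x0) + \<tau>^3 * (?x1 * ?x3) + \<tau>^5 * (?x2 * ?x4)
     + \<tau>^6 * \<sigma> * ?x3\<^sup>2 + \<tau>^6 * \<pi> * (?x1 * ?x3)) + ?x0\<^sup>2" by linarith
  also have "\<dots> \<le> (1/2 * ?S + (2 * (k / \<bar>g\<bar> * \<rho>)\<^sup>2 + 2 * ?G\<^sup>2 / \<tau>^3 + 2 * ?H\<^sup>2 / \<tau>^6) * ?x0\<^sup>2) + ?x0\<^sup>2"
    by (intro add_right_mono compensator_scalar assms)
  \<comment> \<open>Among the coefficients of \<open>?x0\<close> only the one caused by heat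
    conduction grows with \<open>\<rho>\<close>, and it enters squared; hence the factor
    \<open>1 + \<rho>\<^sup>2\<close>.\<close>
  also have "\<dots> \<le> 1/2 * ?S + ?M * (1 + \<rho>\<^sup>2) * ?x0\<^sup>2"
  proof -
    have nn: "0 \<le> 2 * (k / \<bar>g\<bar>)\<^sup>2" "0 \<le> 2 * ?G\<^sup>2 / \<tau>^3" "0 \<le> 2 * ?H\<^sup>2 / \<tau>^6" using \<tau> by auto
    have "2 * (k / \<bar>g\<bar> * \<rho>)\<^sup>2 + 2 * ?G\<^sup>2 / \<tau>^3 + 2 * ?H\<^sup>2 / \<tau>^6 + 1 \<le> ?M * (1 + \<rho>\<^sup>2)"
    proof -
      have "?M * (1 + \<rho>\<^sup>2) = ?M + \<rho>\<^sup>2 * (2 * (k / \<bar>g\<bar>)\<^sup>2) + \<rho>\<^sup>2 * (1 + 2 * ?G\<^sup>2 / \<tau>^3 + 2 * ?H\<^sup>2 / \<tau>^6)"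
        by (simp only: algebra_simps)
      moreover have "0 \<le> \<rho>\<^sup>2 * (1 + 2 * ?G\<^sup>2 / \<tau>^3 + 2 * ?H\<^sup>2 / \<tau>^6)" using nn by (intro mult_nonneg_nonneg add_nonneg_nonneg) auto
      moreover have "2 * (k / \<bar>g\<bar> * \<rho>)\<^sup>2 = \<rho>\<^sup>2 * (2 * (k / \<bar>g\<bar>)\<^sup>2)"
        unfolding power_mult_distrib by (simp only: mult_ac)
      ultimately show ?thesis using nn by linarith
    qed
    from mult_right_mono[OF this, of "?x0\<^sup>2"] show ?thesis by (simp add: distrib_right)
  qed
  finally have "R \<le> 1/2 * ?S + ?M * (1 + \<rho>\<^sup>2) * ?x0\<^sup>2" .
  moreover have "u \<le> 1/2 * v + w \<Longrightarrow> 1/2 * v - w \<le> v - u" for u v w :: real by linarith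
  ultimately have "1/2 * ?S - ?M * (1 + \<rho>\<^sup>2) * ?x0\<^sup>2 \<le> ?S - R" by blast
  then show ?thesis unfolding eq using \<rho> by (rule mult_left_mono)
qed

text \<open>Gronwall's inequality: \<open>L s * exp (c * s)\<close> is decreasing in the interior,
  and the one-sided derivative at 0 provides continuity up to the initial time.\<close>

lemma exponential_decay:
  fixes L :: "real \<Rightarrow> real"
  assumes L: "\<And>t. t \<ge> 0 \<Longrightarrow> (L has_real_derivative L' t) (at t within {0..})" "\<And>t. t \<ge> 0 \<Longrightarrow> L' t \<le> - c * L t" and t: "t \<ge> 0"
  shows "L t \<le> exp (- c * t) * L 0"
proof (cases "t = 0")
  case False
  have der: "((\<lambda>s. L s * exp (c * s)) has_real_derivative (L' s + c * L s) * exp (c * s)) (at s within {0..})" if "s \<ge> 0" for s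
    using L(1)[OF that] by (auto intro!: derivative_eq_intros simp: algebra_simps)
  have "L t * exp (c * t) \<le> L 0 * exp (c * 0)"
  proof (rule DERIV_nonpos_imp_decreasing_open[OF t])
    fix s assume s: "0 < s" "s < t"
    have "at s within {0..} = at s" using s by (intro at_within_interior) (simp add: interior_real_atLeast)
    moreover have "(L' s + c * L s) * exp (c * s) \<le> 0"
      using L(2)[of s] s by (intro mult_nonpos_nonneg) auto
    ultimately show "\<exists>y. ((\<lambda>s. L s * exp (c * s)) has_real_derivative y) (at s) \<and> y \<le> 0"
      using der[of s] s by auto
  next
    show "continuous_on {0..t} (\<lambda>s. L s * exp (c * s))"
      by (rule continuous_on_subset[of "{0..}"], rule DERIV_continuous_on[OF der]) auto
  qed
  then show ?thesis by (simp add: exp_minus field_simps)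
qed simp

text \<open>The equation for one frequency \<open>\<xi>\<close> with \<open>|\<xi>| = \<rho>\<close>, in the unknowns \<open>p\<^sub>j = (v\<^sub>j + v\<^sub>j\<^sub>+\<^sub>2) / 2\<close>,
  \<open>n\<^sub>j = \<i> (v\<^sub>j - v\<^sub>j\<^sub>+\<^sub>2) / 2\<close> and \<open>th = v\<^sub>5\<close>. The constants up to \<open>rate\<close> depend only on \<open>g\<close>, \<open>k\<close>, \<open>\<Omega>\<close>, \<open>\<omega>0\<close>, \<open>D\<close>, so they are
  uniform in \<open>\<xi>\<close>.\<close>

locale damped_oscillators =
  fixes g k \<Omega> \<omega>0 D w1 w2 a1 a2 d \<rho> :: real
  assumes g: "g \<noteq> 0" and k: "k > 0" and \<Omega>: "\<Omega> \<ge> 1" and \<omega>0: "\<omega>0 > 0" and D: "D > 0"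
    and w1: "\<omega>0 \<le> w1" "w1 \<le> \<Omega>" and w2: "\<omega>0 \<le> w2" "w2 \<le> \<Omega>" and gap: "D \<le> \<bar>w1\<^sup>2 - w2\<^sup>2\<bar>"
    and a: "a1\<^sup>2 + a2\<^sup>2 = 1" and d: "0 \<le> d" "d \<le> \<bar>a1\<bar>" "d \<le> \<bar>a2\<bar>" and \<rho>: "\<rho> \<ge> 0"
begin

text \<open>Small enough for \<open>compensator_derivative\<close>, where the sum and the product of
  the squared frequencies are at most \<open>2 * \<Omega>\<^sup>2\<close> and
  \<open>\<Omega>^4\<close>.\<close>

definition "tau = 1 / (32 * \<Omega>^4)"
text \<open>The factor of the \<open>th\<close> error in \<open>compensator_derivative\<close> for
  \<open>S = \<Omega>\<^sup>2\<close>.\<close>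

definition "M = 1 + 2 * (k / \<bar>g\<bar>)\<^sup>2 + 2 * (1 / \<bar>g\<bar> + \<bar>g\<bar> + \<bar>g\<bar> * \<Omega>\<^sup>2)\<^sup>2 / tau^3 + 2 * (\<bar>g\<bar> * \<Omega>\<^sup>2)\<^sup>2 / tau^6"
definition "CY = (1 / \<bar>g\<bar> + 3) * (2 * \<Omega>^6)"
text \<open>The first bound lets the heat dissipation absorb the error of the compensator; the
  second keeps the functional comparable to the energy.\<close>

definition "\<nu> = min (k / M) (1 / (2 * CY))"
text \<open>The cost of recovering the unknowns from their moments: \<open>D\<close> and
  \<open>D * \<omega>0\<close> are the lower bounds for the factors left after eliminating one
  unknown from the even and from the odd moments.\<close>

definition "CV = 4 * \<Omega>^4 / (min D (D * \<omega>0))\<^sup>2 + 1"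
text \<open>The minimum is the dissipation rate common to \<open>th\<close> and the moments,
  \<open>CV\<close> converts moments into energy, and the factor 2 compares the functional with the
  energy.\<close>

definition "rate = min k (\<nu> * tau^6 / 2) / (2 * CV)"

text \<open>The pairing of the coupling vector with the m-th power of the diagonal propagation
  matrix applied to the pair. Propagation interchanges the \<open>p\<close> and the \<open>n\<close>
  unknowns, so the chain consists of even moments of the former and odd moments of the
  latter.\<close>

definition moment :: "nat \<Rightarrow> 'a::real_inner \<Rightarrow> 'a \<Rightarrow> 'a" where
  "moment m u v = (a1 * w1^m) *\<^sub>R u + (a2 * w2^m) *\<^sub>R v"

definition Y :: "'a::real_inner \<Rightarrow> 'a \<Rightarrow> 'a \<Rightarrow> 'a \<Rightarrow> 'a \<Rightarrow> real" where
  "Y p1 p2 n1 n2 th = (th \<bullet> moment 0 p1 p2) / g + tau^3 * (moment 0 p1 p2 \<bullet> moment 1 n1 n2)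
    - tau^5 * (moment 1 n1 n2 \<bullet> moment 2 p1 p2) + tau^6 * (moment 2 p1 p2 \<bullet> moment 3 n1 n2)"

definition En :: "'a::real_inner \<Rightarrow> 'a \<Rightarrow> 'a \<Rightarrow> 'a \<Rightarrow> 'a \<Rightarrow> real" where
  "En p1 p2 n1 n2 th = (norm p1)\<^sup>2 + (norm p2)\<^sup>2 + (norm n1)\<^sup>2 + (norm n2)\<^sup>2 + (norm th)\<^sup>2"

definition "\<beta> = \<rho>\<^sup>2 / (1 + \<rho>\<^sup>2)"
text \<open>Of order \<open>\<rho>\<close> for small and \<open>1 / \<rho>\<close> for large
  frequencies, so that \<open>lam * \<rho> * (1 + \<rho>\<^sup>2) = \<nu> * \<rho>\<^sup>2\<close>:
  the error of the compensator then has exactly the order of the heat dissipation.\<close>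

definition "lam = \<nu> * \<rho> / (1 + \<rho>\<^sup>2)"

lemma tau_pos: "tau > 0" and tau_le: "tau \<le> 1 / 32"
  using \<Omega> by (auto simp: tau_def divide_le_eq)

lemma M_pos: "M > 0"
proof -
  have "0 \<le> 2 * (k / \<bar>g\<bar>)\<^sup>2" "0 \<le> 2 * (1 / \<bar>g\<bar> + \<bar>g\<bar> + \<bar>g\<bar> * \<Omega>\<^sup>2)\<^sup>2 / tau^3" "0 \<le> 2 * (\<bar>g\<bar> * \<Omega>\<^sup>2)\<^sup>2 / tau^6"
    using tau_pos by auto
  then show ?thesis unfolding M_def by linarith
qed

lemma CY_pos: "CY > 0"
  using g \<Omega> by (auto simp: CY_def intro!: mult_pos_pos add_pos_pos)

lemma nu_pos: "\<nu> > 0" using k M_pos CY_pos by (simp add: \<nu>_def)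

lemma CV_pos: "CV > 0"
  unfolding CV_def by (intro add_nonneg_pos) auto

lemma rate_pos: "rate > 0"
  using nu_pos CV_pos tau_pos k by (simp add: rate_def)

lemma w_pos: "w1 > 0" "w2 > 0" using w1 w2 \<omega>0 by linarith+

lemma w_sq_le: "w1\<^sup>2 \<le> \<Omega>\<^sup>2" "w2\<^sup>2 \<le> \<Omega>\<^sup>2" using w1 w2 w_pos by (auto intro!: power_mono)

lemma a_sq_le: "a1\<^sup>2 \<le> 1" "a2\<^sup>2 \<le> 1"
  using a zero_le_power2[of a1] zero_le_power2[of a2] by linarith+

lemma a_le: "\<bar>a1\<bar> \<le> 1" "\<bar>a2\<bar> \<le> 1"
  using a_sq_le abs_square_le_1 by blast+

lemma d_le: "d \<le> 1" using d a_le by linarith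

lemma power2_le_of_le_add:
  fixes u x y :: real
  assumes "0 \<le> \<delta> * u" "\<delta> * u \<le> x + \<Omega>\<^sup>2 * y"
  shows "(\<delta> * u)\<^sup>2 \<le> 2 * \<Omega>^4 * (x\<^sup>2 + y\<^sup>2)"
proof -
  have "(\<delta> * u)\<^sup>2 \<le> (x + \<Omega>\<^sup>2 * y)\<^sup>2" using assms by (intro power_mono)
  also have "\<dots> \<le> 2 * x\<^sup>2 + 2 * (\<Omega>\<^sup>2 * y)\<^sup>2" using sum_squares_bound[of x "\<Omega>\<^sup>2 * y"] by (simp add: power2_sum)
  also have "\<dots> = 2 * x\<^sup>2 + 2 * \<Omega>^4 * y\<^sup>2" by (simp add: power_mult_distrib flip: power_mult)
  also have "\<dots> \<le> 2 * \<Omega>^4 * x\<^sup>2 + 2 * \<Omega>^4 * y\<^sup>2"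
  proof -
    have "1 \<le> \<Omega>^4" using \<Omega> by simp
    from mult_right_mono[OF this, of "x\<^sup>2"] show ?thesis by simp
  qed
  finally show ?thesis by (simp add: distrib_left)
qed

text \<open>The moments of order \<open>m\<close> and \<open>m + 2\<close> determine both unknowns, as \<open>w1\<^sup>2 \<noteq> w2\<^sup>2\<close>.\<close>

lemma vandermonde_bound:
  fixes u v :: "'a::real_inner"
  assumes A: "\<bar>\<alpha>\<bar> \<ge> d" and w: "w = w1 \<and> w' = w2 \<or> w = w2 \<and> w' = w1"
    and s: "e = 1 \<or> e = w" and eq: "(w\<^sup>2 - w'\<^sup>2) *\<^sub>R (e * \<alpha>) *\<^sub>R u = X - w'\<^sup>2 *\<^sub>R X0"
  shows "(min D (D * \<omega>0))\<^sup>2 * (d\<^sup>2 * (norm u)\<^sup>2) \<le> 2 * \<Omega>^4 * ((norm X)\<^sup>2 + (norm X0)\<^sup>2)"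
proof -
  let ?m = "min D (D * \<omega>0)"
  have m: "?m > 0" using D \<omega>0 by simp
  have "?m \<le> \<bar>w\<^sup>2 - w'\<^sup>2\<bar> * \<bar>e\<bar>"
  proof -
    have gap': "D \<le> \<bar>w\<^sup>2 - w'\<^sup>2\<bar>" using gap w by (auto simp: abs_minus_commute)
    show ?thesis using s
    proof
      assume "e = w"
      then have "\<omega>0 \<le> \<bar>e\<bar>" using w w1 w2 by auto
      then have "D * \<omega>0 \<le> \<bar>w\<^sup>2 - w'\<^sup>2\<bar> * \<bar>e\<bar>" using gap' D \<omega>0 by (intro mult_mono) auto
      then show ?thesis by linarith
    qed (use gap' in auto)
  qed
  then have "?m * d \<le> \<bar>w\<^sup>2 - w'\<^sup>2\<bar> * \<bar>e\<bar> * \<bar>\<alpha>\<bar>" using A d m by (intro mult_mono) auto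
  then have "?m * d * norm u \<le> norm ((w\<^sup>2 - w'\<^sup>2) *\<^sub>R (e * \<alpha>) *\<^sub>R u)"
    by (simp add: abs_mult mult_right_mono mult.assoc[symmetric])
  also have "\<dots> \<le> norm X + norm (w'\<^sup>2 *\<^sub>R X0)" unfolding eq by (rule norm_triangle_ineq4)
  also have "\<dots> \<le> norm X + \<Omega>\<^sup>2 * norm X0" using w w_sq_le by (auto intro!: mult_right_mono)
  finally have "(?m * d * norm u)\<^sup>2 \<le> 2 * \<Omega>^4 * ((norm X)\<^sup>2 + (norm X0)\<^sup>2)"
    using m d by (intro power2_le_of_le_add) auto
  then show ?thesis by (simp add: power_mult_distrib mult.assoc)
qed

text \<open>The unknowns occur in the moments with the coefficients \<open>a1\<close> and
  \<open>a2\<close>, so inverting the moments loses a factor \<open>d\<^sup>2\<close>; this becomes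
  the degeneration of the decay rate near hyperbolic directions. For \<open>th\<close> itself
  \<open>d \<le> 1\<close> is enough.\<close>

lemma energy_le_moments:
  fixes p1 p2 n1 n2 th :: "'a::real_inner"
  shows "d\<^sup>2 * En p1 p2 n1 n2 th \<le> CV * ((norm th)\<^sup>2 + (norm (moment 0 p1 p2))\<^sup>2 + (norm (moment 1 n1 n2))\<^sup>2
     + (norm (moment 2 p1 p2))\<^sup>2 + (norm (moment 3 n1 n2))\<^sup>2)"
proof -
  let ?m = "(min D (D * \<omega>0))\<^sup>2"
  let ?x0 = "(norm th)\<^sup>2" and ?x1 = "(norm (moment 0 p1 p2))\<^sup>2" and ?x2 = "(norm (moment 1 n1 n2))\<^sup>2"
    and ?x3 = "(norm (moment 2 p1 p2))\<^sup>2" and ?x4 = "(norm (moment 3 n1 n2))\<^sup>2"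
  have m: "?m > 0" using D \<omega>0 by (intro zero_less_power) simp
  have "?m * (d\<^sup>2 * (norm p1)\<^sup>2) \<le> 2 * \<Omega>^4 * (?x3 + ?x1)"
    by (rule vandermonde_bound[of a1 w1 w2 1]) (use d in \<open>auto simp: moment_def algebra_simps\<close>)
  moreover have "?m * (d\<^sup>2 * (norm p2)\<^sup>2) \<le> 2 * \<Omega>^4 * (?x3 + ?x1)"
    by (rule vandermonde_bound[of a2 w2 w1 1]) (use d in \<open>auto simp: moment_def algebra_simps\<close>)
  moreover have "?m * (d\<^sup>2 * (norm n1)\<^sup>2) \<le> 2 * \<Omega>^4 * (?x4 + ?x2)"
    by (rule vandermonde_bound[of a1 w1 w2 w1]) (use d in \<open>auto simp: moment_def algebra_simps power2_eq_square power3_eq_cube\<close>)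
  moreover have "?m * (d\<^sup>2 * (norm n2)\<^sup>2) \<le> 2 * \<Omega>^4 * (?x4 + ?x2)"
    by (rule vandermonde_bound[of a2 w2 w1 w2]) (use d in \<open>auto simp: moment_def algebra_simps power2_eq_square power3_eq_cube\<close>)
  moreover have "?m * (d\<^sup>2 * ?x0) \<le> ?m * ?x0"
    using d_le d m by (intro mult_left_mono) (auto simp: mult_left_le_one_le power_le_one)
  moreover have "0 \<le> ?m * ?x1" "0 \<le> ?m * ?x2" "0 \<le> ?m * ?x3" "0 \<le> ?m * ?x4" by auto
  moreover have "0 \<le> \<Omega>^4 * ?x0" by simp
  moreover have "?m * (d\<^sup>2 * En p1 p2 n1 n2 th) = ?m * (d\<^sup>2 * (norm p1)\<^sup>2) + ?m * (d\<^sup>2 * (norm p2)\<^sup>2) + ?m * (d\<^sup>2 * (norm n1)\<^sup>2)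
     + ?m * (d\<^sup>2 * (norm n2)\<^sup>2) + ?m * (d\<^sup>2 * ?x0)" by (simp only: En_def distrib_left)
  moreover have "(4 * \<Omega>^4 + ?m) * (?x0 + ?x1 + ?x2 + ?x3 + ?x4) = 4 * (\<Omega>^4 * ?x0) + (2 * \<Omega>^4 * (?x3 + ?x1) + 2 * \<Omega>^4 * (?x3 + ?x1))
    + (2 * \<Omega>^4 * (?x4 + ?x2) + 2 * \<Omega>^4 * (?x4 + ?x2)) + ?m * ?x0 + ?m * ?x1 + ?m * ?x2 + ?m * ?x3 + ?m * ?x4"
    by (simp add: distrib_left distrib_right)
  ultimately have "?m * (d\<^sup>2 * En p1 p2 n1 n2 th) \<le> (4 * \<Omega>^4 + ?m) * (?x0 + ?x1 + ?x2 + ?x3 + ?x4)" by linarith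
  also have "4 * \<Omega>^4 + ?m = ?m * CV" using m by (simp add: CV_def distrib_left)
  finally show ?thesis unfolding mult.assoc using m by (rule mult_left_le_imp_le)
qed

lemma norm_moment_le:
  fixes u v :: "'a::real_inner"
  assumes "m \<le> 3"
  shows "(norm (moment m u v))\<^sup>2 \<le> 2 * \<Omega>^6 * ((norm u)\<^sup>2 + (norm v)\<^sup>2)"
proof -
  have wm: "w1^m \<le> \<Omega>^3" "w2^m \<le> \<Omega>^3"
    using w1 w2 w_pos \<Omega> assms by (auto intro: order_trans[OF power_mono power_increasing])
  have b: "\<bar>a1 * w1^m\<bar> \<le> \<Omega>^3" "\<bar>a2 * w2^m\<bar> \<le> \<Omega>^3"
    using mult_mono[OF a_le(1) wm(1)] mult_mono[OF a_le(2) wm(2)] w_pos by (auto simp: abs_mult)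
  have "norm (moment m u v) \<le> \<bar>a1 * w1^m\<bar> * norm u + \<bar>a2 * w2^m\<bar> * norm v"
    unfolding moment_def by (metis norm_scaleR norm_triangle_ineq)
  also have "\<dots> \<le> \<Omega>^3 * norm u + \<Omega>^3 * norm v" using b by (intro add_mono mult_right_mono) auto
  finally have "(norm (moment m u v))\<^sup>2 \<le> (\<Omega>^3 * norm u + \<Omega>^3 * norm v)\<^sup>2" by (intro power_mono) auto
  also have "\<dots> = (\<Omega>^3)\<^sup>2 * (norm u + norm v)\<^sup>2" by (simp add: power_mult_distrib flip: distrib_left)
  also have "\<dots> \<le> (\<Omega>^3)\<^sup>2 * (2 * ((norm u)\<^sup>2 + (norm v)\<^sup>2))"
    using sum_squares_bound[of "norm u" "norm v"] by (intro mult_left_mono) (auto simp: power2_sum)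
  finally show ?thesis by (simp add: distrib_left mult_ac flip: power_mult)
qed

lemma abs_Y_le:
  fixes p1 p2 n1 n2 th :: "'a::real_inner"
  shows "\<bar>Y p1 p2 n1 n2 th\<bar> \<le> CY * En p1 p2 n1 n2 th"
proof -
  let ?E = "En p1 p2 n1 n2 th"
  have \<Omega>6: "1 \<le> 2 * \<Omega>^6" using one_le_power[OF \<Omega>, of 6] by linarith
  have EE: "0 \<le> ?E" by (simp add: En_def)
  have le: "2 * \<Omega>^6 * z \<le> 2 * \<Omega>^6 * ?E" if "z \<le> ?E" for z using that \<Omega>6 by (intro mult_left_mono) auto
  have P: "(norm (moment m p1 p2))\<^sup>2 \<le> 2 * \<Omega>^6 * ?E" if "m \<le> 3" for m
    using norm_moment_le[OF that, of p1 p2] le[of "(norm p1)\<^sup>2 + (norm p2)\<^sup>2"] by (simp add: En_def)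
  have N: "(norm (moment m n1 n2))\<^sup>2 \<le> 2 * \<Omega>^6 * ?E" if "m \<le> 3" for m
    using norm_moment_le[OF that, of n1 n2] le[of "(norm n1)\<^sup>2 + (norm n2)\<^sup>2"] by (simp add: En_def)
  have "(norm th)\<^sup>2 \<le> ?E" by (simp add: En_def)
  also have "\<dots> \<le> 2 * \<Omega>^6 * ?E" using mult_right_mono[OF \<Omega>6 EE] by simp
  finally have T: "(norm th)\<^sup>2 \<le> 2 * \<Omega>^6 * ?E" .
  have i: "\<bar>u \<bullet> v\<bar> \<le> B" if "(norm u)\<^sup>2 \<le> B" "(norm v)\<^sup>2 \<le> B" for u v :: 'a and B
    using Cauchy_Schwarz_ineq2[of u v] sum_squares_bound[of "norm u" "norm v"] that by linarith
  have t: "\<bar>tau^m * z\<bar> \<le> B" if "\<bar>z\<bar> \<le> B" for m z B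
  proof -
    have "tau^m \<le> 1" using tau_pos tau_le by (intro power_le_one) auto
    then have "\<bar>tau^m * z\<bar> \<le> \<bar>z\<bar>" using tau_pos by (simp add: abs_mult mult_left_le_one_le)
    then show ?thesis using that by linarith
  qed
  have "\<bar>(th \<bullet> moment 0 p1 p2) / g\<bar> \<le> 1 / \<bar>g\<bar> * (2 * \<Omega>^6 * ?E)"
    using divide_right_mono[OF i[OF T P[of 0]], of "\<bar>g\<bar>"] by simp
  moreover have "\<bar>tau^3 * (moment 0 p1 p2 \<bullet> moment 1 n1 n2)\<bar> \<le> 2 * \<Omega>^6 * ?E"
    "\<bar>tau^5 * (moment 1 n1 n2 \<bullet> moment 2 p1 p2)\<bar> \<le> 2 * \<Omega>^6 * ?E"
    "\<bar>tau^6 * (moment 2 p1 p2 \<bullet> moment 3 n1 n2)\<bar> \<le> 2 * \<Omega>^6 * ?E"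
    by (intro t i P N; simp)+
  ultimately have "\<bar>Y p1 p2 n1 n2 th\<bar> \<le> 1 / \<bar>g\<bar> * (2 * \<Omega>^6 * ?E) + 3 * (2 * \<Omega>^6 * ?E)"
    unfolding Y_def by linarith
  also have "\<dots> = CY * ?E" by (simp add: CY_def distrib_right)
  finally show ?thesis .
qed

lemma lam_bounds: "0 \<le> lam" "lam \<le> \<nu>" "lam * \<rho> = \<nu> * \<beta>"
proof -
  have "\<rho> \<le> 1 + \<rho>\<^sup>2" using sum_squares_bound[of \<rho> 1] \<rho> by simp
  moreover have "1 + \<rho>\<^sup>2 > 0" by (rule add_pos_nonneg) auto
  ultimately have "\<rho> / (1 + \<rho>\<^sup>2) \<le> 1" "0 \<le> \<rho> / (1 + \<rho>\<^sup>2)" using \<rho> by auto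
  then show "0 \<le> lam" "lam \<le> \<nu>"
    using nu_pos mult_left_mono[of "\<rho> / (1 + \<rho>\<^sup>2)" 1 \<nu>] mult_nonneg_nonneg[of \<nu> "\<rho> / (1 + \<rho>\<^sup>2)"] by (auto simp: lam_def)
  show "lam * \<rho> = \<nu> * \<beta>" by (simp add: lam_def \<beta>_def power2_eq_square)
qed

text \<open>As \<open>lam \<le> \<nu> \<le> 1 / (2 * CY)\<close>, the compensator changes the energy
  by at most one half of it.\<close>

lemma lyapunov_equivalent:
  fixes p1 p2 n1 n2 th :: "'a::real_inner"
  shows "En p1 p2 n1 n2 th / 2 \<le> En p1 p2 n1 n2 th - lam * Y p1 p2 n1 n2 th"
    and "En p1 p2 n1 n2 th - lam * Y p1 p2 n1 n2 th \<le> 2 * En p1 p2 n1 n2 th"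
proof -
  let ?E = "En p1 p2 n1 n2 th"
  have EE: "0 \<le> ?E" by (simp add: En_def)
  have "\<bar>lam * Y p1 p2 n1 n2 th\<bar> \<le> \<nu> * (CY * ?E)"
    unfolding abs_mult using lam_bounds abs_Y_le[of p1 p2 n1 n2 th] nu_pos by (intro mult_mono) auto
  also have "\<dots> \<le> 1 / (2 * CY) * (CY * ?E)"
    using EE CY_pos by (intro mult_right_mono) (auto simp: \<nu>_def)
  also have "\<dots> = ?E / 2" using CY_pos by simp
  finally have "\<bar>lam * Y p1 p2 n1 n2 th\<bar> \<le> ?E / 2" .
  then show "?E / 2 \<le> ?E - lam * Y p1 p2 n1 n2 th" "?E - lam * Y p1 p2 n1 n2 th \<le> 2 * ?E"
    using EE by linarith+
qed

text \<open>The energy alone dissipates only \<open>th\<close>, at the rate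
  \<open>2 * k * \<rho>\<^sup>2\<close>. One half of this pays for the error of the compensator,
  whose derivative supplies the missing dissipation of the moments; the other half remains for
  \<open>th\<close>.\<close>

lemma lyapunov_dissipation:
  fixes p1 p2 n1 n2 th :: "'a::real_inner"
  assumes der: "dp1 = (\<rho> * w1) *\<^sub>R n1 - (g * \<rho> * a1) *\<^sub>R th" "dp2 = (\<rho> * w2) *\<^sub>R n2 - (g * \<rho> * a2) *\<^sub>R th"
    "dn1 = - ((\<rho> * w1) *\<^sub>R p1)" "dn2 = - ((\<rho> * w2) *\<^sub>R p2)"
    "dth = (g * \<rho>) *\<^sub>R (a1 *\<^sub>R p1 + a2 *\<^sub>R p2) - (k * \<rho>\<^sup>2) *\<^sub>R th"
  shows "2 * (p1 \<bullet> dp1 + p2 \<bullet> dp2 + n1 \<bullet> dn1 + n2 \<bullet> dn2 + th \<bullet> dth)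
     - lam * ((dth \<bullet> moment 0 p1 p2 + th \<bullet> moment 0 dp1 dp2) / g
        + tau^3 * (moment 0 dp1 dp2 \<bullet> moment 1 n1 n2 + moment 0 p1 p2 \<bullet> moment 1 dn1 dn2)
        - tau^5 * (moment 1 dn1 dn2 \<bullet> moment 2 p1 p2 + moment 1 n1 n2 \<bullet> moment 2 dp1 dp2)
        + tau^6 * (moment 2 dp1 dp2 \<bullet> moment 3 n1 n2 + moment 2 p1 p2 \<bullet> moment 3 dn1 dn2))
    \<le> - (rate * (\<beta> * d\<^sup>2)) * (En p1 p2 n1 n2 th - lam * Y p1 p2 n1 n2 th)"
    (is "?dE - lam * ?dY \<le> _")
proof -
  let ?P = "moment 0 p1 p2" and ?N1 = "moment 1 n1 n2" and ?P2 = "moment 2 p1 p2" and ?N3 = "moment 3 n1 n2"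
  let ?S = "(norm ?P)\<^sup>2 + tau^3 * (norm ?N1)\<^sup>2 + tau^5 * (norm ?P2)\<^sup>2 + tau^6 * (norm ?N3)\<^sup>2"
  let ?s2 = "a1\<^sup>2 * w1\<^sup>2 + a2\<^sup>2 * w2\<^sup>2"
  let ?\<delta> = "min k (\<nu> * tau^6 / 2)"
  have dE: "?dE = - 2 * k * \<rho>\<^sup>2 * (norm th)\<^sup>2"
    unfolding power2_norm_eq_inner der
    by (simp add: inner_diff_left inner_diff_right inner_add_left inner_add_right inner_commute algebra_simps)
  have tau4: "tau * \<Omega>^4 = 1 / 32" using \<Omega> by (simp add: tau_def)
  have dY: "?dY \<ge> \<rho> * (1/2 * ?S - M * (1 + \<rho>\<^sup>2) * (norm th)\<^sup>2)"
    unfolding M_def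
  \<comment> \<open>\<open>\<sigma>\<close> and \<open>\<pi>\<close> are trace and determinant of
    the squared propagation matrix: by Cayley-Hamilton they express the fourth moment through the
    second and the zeroth, which closes the chain. \<open>\<zeta>\<close> is the second moment of
    the coupling vector itself.\<close>
  proof (rule compensator_derivative[where \<zeta>="?s2" and \<sigma>="w1\<^sup>2 + w2\<^sup>2" and \<pi>="w1\<^sup>2 * w2\<^sup>2"])
    show "0 < tau" "tau \<le> 1 / 32" by (rule tau_pos tau_le)+
    have \<Omega>24: "\<Omega>\<^sup>2 \<le> \<Omega>^4" using \<Omega> by (intro power_increasing) auto
    have "tau * (w1\<^sup>2 + w2\<^sup>2) \<le> tau * (\<Omega>^4 + \<Omega>^4)"
      using w_sq_le \<Omega>24 tau_pos by (intro mult_left_mono add_mono) auto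
    then show "tau * (w1\<^sup>2 + w2\<^sup>2) \<le> 1 / 8" using tau4 by (simp add: distrib_left)
    have "w1\<^sup>2 * w2\<^sup>2 \<le> \<Omega>\<^sup>2 * \<Omega>\<^sup>2" using w_sq_le by (intro mult_mono) auto
    then have "tau * (w1\<^sup>2 * w2\<^sup>2) \<le> tau * \<Omega>^4" using tau_pos by (intro mult_left_mono) (auto simp: power4_eq_xxxx power2_eq_square mult.assoc)
    then show "tau * (w1\<^sup>2 * w2\<^sup>2) \<le> 1" using tau4 by simp
    have "?s2 \<le> a1\<^sup>2 * \<Omega>\<^sup>2 + a2\<^sup>2 * \<Omega>\<^sup>2" using w_sq_le by (intro add_mono mult_left_mono) auto
    also have "\<dots> = \<Omega>\<^sup>2" using a by (simp flip: distrib_right)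
    finally show "?s2 \<le> \<Omega>\<^sup>2" .
    have aa: "a1 * a1 + a2 * a2 = 1" using a by (simp add: power2_eq_square)
    show "dth = (g * \<rho>) *\<^sub>R ?P - (k * \<rho>\<^sup>2) *\<^sub>R th" by (simp add: der moment_def)
    have "moment 0 dp1 dp2 = \<rho> *\<^sub>R ?N1 - (g * \<rho> * (a1 * a1 + a2 * a2)) *\<^sub>R th"
      by (simp add: der moment_def algebra_simps)
    then show "moment 0 dp1 dp2 = \<rho> *\<^sub>R ?N1 - (g * \<rho>) *\<^sub>R th" by (simp add: aa)
    show "moment 1 dn1 dn2 = - (\<rho> *\<^sub>R ?P2)"
      by (simp add: der moment_def algebra_simps power2_eq_square)
    show "moment 2 dp1 dp2 = \<rho> *\<^sub>R ?N3 - (g * \<rho> * ?s2) *\<^sub>R th"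
      by (simp add: der moment_def algebra_simps power2_eq_square power3_eq_cube)
    show "moment 3 dn1 dn2 = - (\<rho> *\<^sub>R ((w1\<^sup>2 + w2\<^sup>2) *\<^sub>R ?P2 - (w1\<^sup>2 * w2\<^sup>2) *\<^sub>R ?P))"
      by (simp add: der moment_def algebra_simps power2_eq_square power3_eq_cube)
  qed (use g k \<rho> in auto)
  have "lam * (\<rho> * (1/2 * ?S - M * (1 + \<rho>\<^sup>2) * (norm th)\<^sup>2)) \<le> lam * ?dY"
    using dY lam_bounds(1) by (rule mult_left_mono)
  also have "lam * (\<rho> * (1/2 * ?S - M * (1 + \<rho>\<^sup>2) * (norm th)\<^sup>2)) = \<nu> * \<beta> * (1/2 * ?S) - \<nu> * M * \<rho>\<^sup>2 * (norm th)\<^sup>2"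
  proof -
    have "1 + \<rho>\<^sup>2 > 0" by (rule add_pos_nonneg) auto
    then have "\<beta> * (1 + \<rho>\<^sup>2) = \<rho>\<^sup>2" by (simp add: \<beta>_def)
    moreover have "lam * (\<rho> * (1/2 * ?S - M * (1 + \<rho>\<^sup>2) * (norm th)\<^sup>2)) = \<nu> * \<beta> * (1/2 * ?S) - \<nu> * M * (\<beta> * (1 + \<rho>\<^sup>2)) * (norm th)\<^sup>2"
      unfolding mult.assoc[symmetric, of lam \<rho>] lam_bounds(3) right_diff_distrib by (simp only: mult_ac)
    ultimately show ?thesis by simp
  qed
  finally have "?dE - lam * ?dY \<le> - 2 * k * \<rho>\<^sup>2 * (norm th)\<^sup>2 - (\<nu> * \<beta> * (1/2 * ?S) - \<nu> * M * \<rho>\<^sup>2 * (norm th)\<^sup>2)"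
    unfolding dE by linarith
  also have "\<dots> \<le> - (\<beta> * ?\<delta>) * ((norm th)\<^sup>2 + (norm ?P)\<^sup>2 + (norm ?N1)\<^sup>2 + (norm ?P2)\<^sup>2 + (norm ?N3)\<^sup>2)"
  proof -
    have "\<nu> * M \<le> k / M * M" using M_pos by (intro mult_right_mono) (auto simp: \<nu>_def)
    then have "\<nu> * M \<le> k" using M_pos by simp
    then have 1: "\<nu> * M * (\<rho>\<^sup>2 * (norm th)\<^sup>2) \<le> k * (\<rho>\<^sup>2 * (norm th)\<^sup>2)" by (intro mult_right_mono) auto
    have \<beta>0: "\<beta> \<ge> 0" by (simp add: \<beta>_def)
    have "\<beta> \<le> \<rho>\<^sup>2" unfolding \<beta>_def by (simp add: divide_le_eq add_pos_nonneg mult_le_cancel_left1)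
    then have "\<beta> * ?\<delta> * (norm th)\<^sup>2 \<le> \<rho>\<^sup>2 * k * (norm th)\<^sup>2"
      using \<beta>0 k nu_pos tau_pos by (intro mult_right_mono mult_mono) auto
    then have 2: "\<beta> * ?\<delta> * (norm th)\<^sup>2 \<le> k * (\<rho>\<^sup>2 * (norm th)\<^sup>2)" by (simp add: mult_ac)
    \<comment> \<open>The smallest weight of the chain serves as a lower bound for all of
      them.\<close>
    have t6: "tau^6 \<le> 1" "tau^6 \<le> tau^3" "tau^6 \<le> tau^5"
      using tau_pos tau_le by (auto intro!: power_le_one power_decreasing)
    have "tau^6 * ((norm ?P)\<^sup>2 + (norm ?N1)\<^sup>2 + (norm ?P2)\<^sup>2 + (norm ?N3)\<^sup>2) \<le> ?S"
      using mult_right_mono[OF t6(1), of "(norm ?P)\<^sup>2"] mult_right_mono[OF t6(2), of "(norm ?N1)\<^sup>2"] mult_right_mono[OF t6(3), of "(norm ?P2)\<^sup>2"]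
      by (simp add: distrib_left)
    then have "\<nu> * \<beta> / 2 * (tau^6 * ((norm ?P)\<^sup>2 + (norm ?N1)\<^sup>2 + (norm ?P2)\<^sup>2 + (norm ?N3)\<^sup>2)) \<le> \<nu> * \<beta> / 2 * ?S"
      using nu_pos \<beta>0 by (intro mult_left_mono) auto
    moreover have "\<beta> * ?\<delta> * ((norm ?P)\<^sup>2 + (norm ?N1)\<^sup>2 + (norm ?P2)\<^sup>2 + (norm ?N3)\<^sup>2) \<le> \<beta> * (\<nu> * tau^6 / 2) * ((norm ?P)\<^sup>2 + (norm ?N1)\<^sup>2 + (norm ?P2)\<^sup>2 + (norm ?N3)\<^sup>2)"
      using \<beta>0 by (intro mult_right_mono mult_left_mono) auto
    ultimately have 3: "\<beta> * ?\<delta> * ((norm ?P)\<^sup>2 + (norm ?N1)\<^sup>2 + (norm ?P2)\<^sup>2 + (norm ?N3)\<^sup>2) \<le> \<nu> * \<beta> * (1/2 * ?S)"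
      by (simp add: mult_ac)
    have gen: "- 2 * k * r * x - (a - \<nu> * M * r * x) \<le> - b * (x + y1 + y2 + y3 + y4)"
      if "\<nu> * M * (r * x) \<le> k * (r * x)" "b * x \<le> k * (r * x)" "b * (y1 + y2 + y3 + y4) \<le> a" for a b r x y1 y2 y3 y4 :: real
      using that by (simp add: algebra_simps)
    show ?thesis by (rule gen[OF 1 2 3])
  qed
  also have "\<dots> \<le> - (\<beta> * ?\<delta>) * (d\<^sup>2 * En p1 p2 n1 n2 th / CV)"
  proof -
    have "d\<^sup>2 * En p1 p2 n1 n2 th / CV \<le> (norm th)\<^sup>2 + (norm ?P)\<^sup>2 + (norm ?N1)\<^sup>2 + (norm ?P2)\<^sup>2 + (norm ?N3)\<^sup>2"
      using energy_le_moments[of p1 p2 n1 n2 th] CV_pos by (simp add: divide_le_eq mult.commute)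
    moreover have "\<beta> * ?\<delta> \<ge> 0" using k nu_pos tau_pos by (simp add: \<beta>_def)
    ultimately show ?thesis using mult_left_mono by fastforce
  qed
  also have "\<dots> = - (rate * (\<beta> * d\<^sup>2)) * (2 * En p1 p2 n1 n2 th)" by (simp add: rate_def)
  also have "\<dots> \<le> - (rate * (\<beta> * d\<^sup>2)) * (En p1 p2 n1 n2 th - lam * Y p1 p2 n1 n2 th)"
  proof -
    have "rate * (\<beta> * d\<^sup>2) \<ge> 0" using rate_pos by (simp add: \<beta>_def)
    from mult_left_mono[OF lyapunov_equivalent(2)[of p1 p2 n1 n2 th] this] show ?thesis by simp
  qed
  finally show ?thesis .
qed

text \<open>The factor 4 is the product of the two constants 2 in
  \<open>lyapunov_equivalent\<close>, one at time 0 and one at time \<open>t\<close>.\<close>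

lemma energy_decay:
  fixes p1 p2 n1 n2 th :: "real \<Rightarrow> 'a::real_inner"
  assumes ode: "\<And>t. t \<ge> 0 \<Longrightarrow> (p1 has_vector_derivative (\<rho> * w1) *\<^sub>R n1 t - (g * \<rho> * a1) *\<^sub>R th t) (at t within {0..})"
    "\<And>t. t \<ge> 0 \<Longrightarrow> (p2 has_vector_derivative (\<rho> * w2) *\<^sub>R n2 t - (g * \<rho> * a2) *\<^sub>R th t) (at t within {0..})"
    "\<And>t. t \<ge> 0 \<Longrightarrow> (n1 has_vector_derivative - ((\<rho> * w1) *\<^sub>R p1 t)) (at t within {0..})"
    "\<And>t. t \<ge> 0 \<Longrightarrow> (n2 has_vector_derivative - ((\<rho> * w2) *\<^sub>R p2 t)) (at t within {0..})"
    "\<And>t. t \<ge> 0 \<Longrightarrow> (th has_vector_derivative (g * \<rho>) *\<^sub>R (a1 *\<^sub>R p1 t + a2 *\<^sub>R p2 t) - (k * \<rho>\<^sup>2) *\<^sub>R th t) (at t within {0..})"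
    and t: "t \<ge> 0"
  shows "En (p1 t) (p2 t) (n1 t) (n2 t) (th t) \<le> 4 * exp (- (rate * (\<rho>\<^sup>2 / (1 + \<rho>\<^sup>2) * d\<^sup>2)) * t) * En (p1 0) (p2 0) (n1 0) (n2 0) (th 0)"
proof -
  define dp1 where "dp1 t = (\<rho> * w1) *\<^sub>R n1 t - (g * \<rho> * a1) *\<^sub>R th t" for t
  define dp2 where "dp2 t = (\<rho> * w2) *\<^sub>R n2 t - (g * \<rho> * a2) *\<^sub>R th t" for t
  define dn1 where "dn1 t = - ((\<rho> * w1) *\<^sub>R p1 t)" for t
  define dn2 where "dn2 t = - ((\<rho> * w2) *\<^sub>R p2 t)" for t
  define dth where "dth t = (g * \<rho>) *\<^sub>R (a1 *\<^sub>R p1 t + a2 *\<^sub>R p2 t) - (k * \<rho>\<^sup>2) *\<^sub>R th t" for t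
  note ders = dp1_def dp2_def dn1_def dn2_def dth_def
  define L where "L t = En (p1 t) (p2 t) (n1 t) (n2 t) (th t) - lam * Y (p1 t) (p2 t) (n1 t) (n2 t) (th t)" for t
  define L' where "L' t = 2 * (p1 t \<bullet> dp1 t + p2 t \<bullet> dp2 t + n1 t \<bullet> dn1 t + n2 t \<bullet> dn2 t + th t \<bullet> dth t)
     - lam * ((dth t \<bullet> moment 0 (p1 t) (p2 t) + th t \<bullet> moment 0 (dp1 t) (dp2 t)) / g
        + tau^3 * (moment 0 (dp1 t) (dp2 t) \<bullet> moment 1 (n1 t) (n2 t) + moment 0 (p1 t) (p2 t) \<bullet> moment 1 (dn1 t) (dn2 t))
        - tau^5 * (moment 1 (dn1 t) (dn2 t) \<bullet> moment 2 (p1 t) (p2 t) + moment 1 (n1 t) (n2 t) \<bullet> moment 2 (dp1 t) (dp2 t))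
        + tau^6 * (moment 2 (dp1 t) (dp2 t) \<bullet> moment 3 (n1 t) (n2 t) + moment 2 (p1 t) (p2 t) \<bullet> moment 3 (dn1 t) (dn2 t)))" for t
  have dL: "(L has_real_derivative L' t) (at t within {0..})" if t: "t \<ge> 0" for t
  proof -
    have D: "(p1 has_vector_derivative dp1 t) (at t within {0..})" "(p2 has_vector_derivative dp2 t) (at t within {0..})"
      "(n1 has_vector_derivative dn1 t) (at t within {0..})" "(n2 has_vector_derivative dn2 t) (at t within {0..})"
      "(th has_vector_derivative dth t) (at t within {0..})"
      using ode t by (auto simp: ders)
    have mom: "((\<lambda>t. moment m (u t) (v t)) has_vector_derivative moment m du dv) (at t within {0..})"
      if "(u has_vector_derivative du) (at t within {0..})" "(v has_vector_derivative dv) (at t within {0..})"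
      for m and u v :: "real \<Rightarrow> 'a" and du dv
      unfolding moment_def using that
      by (intro has_vector_derivative_add bounded_linear.has_vector_derivative[OF bounded_linear_scaleR_right])
    have inn: "((\<lambda>t. u t \<bullet> v t) has_real_derivative (du \<bullet> v t + u t \<bullet> dv)) (at t within {0..})"
      if "(u has_vector_derivative du) (at t within {0..})" "(v has_vector_derivative dv) (at t within {0..})"
      for u v :: "real \<Rightarrow> 'a" and du dv
      using bounded_bilinear.has_vector_derivative[OF bounded_bilinear_inner that]
      by (simp add: has_real_derivative_iff_has_vector_derivative add.commute)
    have "((\<lambda>t. (p1 t \<bullet> p1 t) + (p2 t \<bullet> p2 t) + (n1 t \<bullet> n1 t) + (n2 t \<bullet> n2 t) + (th t \<bullet> th t)) has_real_derivative
       (dp1 t \<bullet> p1 t + p1 t \<bullet> dp1 t) + (dp2 t \<bullet> p2 t + p2 t \<bullet> dp2 t) + (dn1 t \<bullet> n1 t + n1 t \<bullet> dn1 t)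
       + (dn2 t \<bullet> n2 t + n2 t \<bullet> dn2 t) + (dth t \<bullet> th t + th t \<bullet> dth t)) (at t within {0..})"
      by (intro DERIV_add inn D)
    moreover have "(dp1 t \<bullet> p1 t + p1 t \<bullet> dp1 t) + (dp2 t \<bullet> p2 t + p2 t \<bullet> dp2 t) + (dn1 t \<bullet> n1 t + n1 t \<bullet> dn1 t)
       + (dn2 t \<bullet> n2 t + n2 t \<bullet> dn2 t) + (dth t \<bullet> th t + th t \<bullet> dth t)
       = 2 * (p1 t \<bullet> dp1 t + p2 t \<bullet> dp2 t + n1 t \<bullet> dn1 t + n2 t \<bullet> dn2 t + th t \<bullet> dth t)"
      by (simp add: inner_commute)
    ultimately have dEn: "((\<lambda>t. En (p1 t) (p2 t) (n1 t) (n2 t) (th t)) has_real_derivative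
       2 * (p1 t \<bullet> dp1 t + p2 t \<bullet> dp2 t + n1 t \<bullet> dn1 t + n2 t \<bullet> dn2 t + th t \<bullet> dth t)) (at t within {0..})"
      unfolding En_def power2_norm_eq_inner by simp
    have dY: "((\<lambda>t. Y (p1 t) (p2 t) (n1 t) (n2 t) (th t)) has_real_derivative
       (dth t \<bullet> moment 0 (p1 t) (p2 t) + th t \<bullet> moment 0 (dp1 t) (dp2 t)) / g
        + tau^3 * (moment 0 (dp1 t) (dp2 t) \<bullet> moment 1 (n1 t) (n2 t) + moment 0 (p1 t) (p2 t) \<bullet> moment 1 (dn1 t) (dn2 t))
        - tau^5 * (moment 1 (dn1 t) (dn2 t) \<bullet> moment 2 (p1 t) (p2 t) + moment 1 (n1 t) (n2 t) \<bullet> moment 2 (dp1 t) (dp2 t))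
        + tau^6 * (moment 2 (dp1 t) (dp2 t) \<bullet> moment 3 (n1 t) (n2 t) + moment 2 (p1 t) (p2 t) \<bullet> moment 3 (dn1 t) (dn2 t))) (at t within {0..})"
      unfolding Y_def by (intro DERIV_add DERIV_diff DERIV_cmult DERIV_cdivide inn mom D)
    show ?thesis
      unfolding L_def[abs_def] L'_def by (rule DERIV_diff[OF dEn DERIV_cmult[OF dY]])
  qed
  have "L t \<le> exp (- (rate * (\<beta> * d\<^sup>2)) * t) * L 0"
  proof (rule exponential_decay[OF dL _ t])
    fix s :: real
    show "L' s \<le> - (rate * (\<beta> * d\<^sup>2)) * L s"
      unfolding L_def L'_def by (rule lyapunov_dissipation) (simp_all add: ders)
  qed
  also have "\<dots> \<le> exp (- (rate * (\<beta> * d\<^sup>2)) * t) * (2 * En (p1 0) (p2 0) (n1 0) (n2 0) (th 0))"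
    unfolding L_def by (intro mult_left_mono lyapunov_equivalent) auto
  finally show ?thesis
    using lyapunov_equivalent(1)[of "p1 t" "p2 t" "n1 t" "n2 t" "th t"] by (simp add: L_def \<beta>_def)
qed

end

section \<open>Functions on the circle\<close>

lemma circ_nth [simp]: "circ \<theta> $ 1 = cos \<theta>" "circ \<theta> $ 2 = sin \<theta>"
  by (simp_all add: circ_def)

lemma norm_circ [simp]: "norm (circ \<theta>) = 1"
proof -
  have "(norm (circ \<theta>))\<^sup>2 = 1" by (simp add: norm_real2_power2)
  then show ?thesis using norm_ge_zero[of "circ \<theta>"] by (simp add: power2_eq_1_iff)
qed

lemma circ_surj:
  assumes "norm \<eta> = 1"
  obtains \<theta> where "0 \<le> \<theta>" "\<theta> \<le> 2 * pi" "circ \<theta> = \<eta>"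
proof -
  have "(\<eta>$1)\<^sup>2 + (\<eta>$2)\<^sup>2 = 1" using norm_real2_power2[of \<eta>] assms by simp
  then obtain t where "0 \<le> t" "t < 2 * pi" "\<eta>$1 = cos t" "\<eta>$2 = sin t" by (rule sincos_total_2pi)
  then show thesis by (intro that[of t]) (auto simp: vec_eq_iff forall_2)
qed

lemma norm_circ_diff_sq: "(norm (circ \<theta> - circ \<phi>))\<^sup>2 = 2 - 2 * cos (\<theta> - \<phi>)"
proof -
  have "(norm (circ \<theta> - circ \<phi>))\<^sup>2 = ((cos \<theta>)\<^sup>2 + (sin \<theta>)\<^sup>2) + ((cos \<phi>)\<^sup>2 + (sin \<phi>)\<^sup>2) - 2 * (cos \<theta> * cos \<phi> + sin \<theta> * sin \<phi>)"
    by (simp only: norm_real2_power2 vector_minus_component circ_nth) (simp add: power2_eq_square algebra_simps)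
  then show ?thesis by (simp add: cos_diff sin_cos_squared_add2)
qed

lemma norm_circ_diff_le: "norm (circ \<theta> - circ \<phi>) \<le> \<bar>\<theta> - \<phi>\<bar>"
proof (rule power2_le_imp_le)
  have half: "2 * ((\<theta> - \<phi>) / 2) = \<theta> - \<phi>" by simp
  have "cos (\<theta> - \<phi>) = 1 - 2 * (sin ((\<theta> - \<phi>) / 2))\<^sup>2"
    using cos_double_sin[of "(\<theta> - \<phi>) / 2"] unfolding half .
  then have "(norm (circ \<theta> - circ \<phi>))\<^sup>2 = 4 * (sin ((\<theta> - \<phi>) / 2))\<^sup>2" by (simp add: norm_circ_diff_sq)
  also have "\<dots> \<le> 4 * ((\<theta> - \<phi>) / 2)\<^sup>2"
    using abs_le_square_iff[THEN iffD1, OF abs_sin_x_le_abs_x[of "(\<theta> - \<phi>) / 2"]] by (intro mult_left_mono) auto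
  finally show "(norm (circ \<theta> - circ \<phi>))\<^sup>2 \<le> \<bar>\<theta> - \<phi>\<bar>\<^sup>2" by (simp add: power_divide)
qed simp

text \<open>Continuity and derivatives are given in the angle, while the compactness arguments on
  the circle measure chords; this is the bridge between them.\<close>

lemma circ_local_lift:
  assumes "\<delta> > 0"
  obtains r where "r > 0" "\<And>\<eta>. norm \<eta> = 1 \<Longrightarrow> norm (\<eta> - circ \<theta>0) < r \<Longrightarrow> \<exists>\<theta>. circ \<theta> = \<eta> \<and> \<bar>\<theta> - \<theta>0\<bar> < \<delta>"
proof -
  \<comment> \<open>The cosine is monotone only up to \<open>pi\<close>, hence the cap. The chord
    belonging to the angle \<open>d\<close> then serves as radius.\<close>
  define d where "d = min \<delta> pi"
  have d: "0 < d" "d \<le> pi" "d \<le> \<delta>" using assms by (auto simp: d_def)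
  have c1: "cos d < 1" using cos_monotone_0_pi[of 0 d] d by simp
  define r where "r = sqrt (2 - 2 * cos d)"
  have r: "r > 0" using c1 by (simp add: r_def)
  show thesis
  proof (rule that[OF r])
    fix \<eta> :: "real^2" assume \<eta>: "norm \<eta> = 1" "norm (\<eta> - circ \<theta>0) < r"
    obtain \<theta>1 where \<theta>1: "circ \<theta>1 = \<eta>" using circ_surj[OF \<eta>(1)] by blast
    obtain \<phi> where \<phi>: "- pi < \<phi>" "\<phi> \<le> pi" "sin \<phi> = sin (\<theta>1 - \<theta>0)" "cos \<phi> = cos (\<theta>1 - \<theta>0)"
      using sincos_principal_value by blast
    have c: "circ (\<theta>0 + \<phi>) = \<eta>"
    proof -
      have "cos (\<theta>0 + \<phi>) = cos (\<theta>0 + (\<theta>1 - \<theta>0))" "sin (\<theta>0 + \<phi>) = sin (\<theta>0 + (\<theta>1 - \<theta>0))"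
        by (simp_all only: cos_add sin_add \<phi>)
      then show ?thesis unfolding \<theta>1[symmetric] by (simp add: vec_eq_iff forall_2)
    qed
    have "\<bar>\<phi>\<bar> < d"
    proof (rule ccontr)
      assume "\<not> \<bar>\<phi>\<bar> < d"
      then have "cos \<bar>\<phi>\<bar> \<le> cos d" using \<phi> d by (intro cos_monotone_0_pi_le) auto
      then have "r\<^sup>2 \<le> (norm (\<eta> - circ \<theta>0))\<^sup>2"
        using c1 unfolding c[symmetric] norm_circ_diff_sq by (simp add: r_def)
      moreover have "(norm (\<eta> - circ \<theta>0))\<^sup>2 < r\<^sup>2" using \<eta>(2) by (intro power_strict_mono) auto
      ultimately show False by simp
    qed
    then show "\<exists>\<theta>. circ \<theta> = \<eta> \<and> \<bar>\<theta> - \<theta>0\<bar> < \<delta>" using c d by (intro exI[of _ "\<theta>0 + \<phi>"]) auto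
  qed
qed

lemma continuous_on_circle_lift:
  fixes f :: "real^2 \<Rightarrow> 'a::metric_space"
  assumes "continuous_on UNIV (\<lambda>\<theta>. f (circ \<theta>))"
  shows "continuous_on {\<eta>. norm \<eta> = 1} f"
  unfolding continuous_on_iff
proof (intro ballI allI impI)
  fix \<eta>0 :: "real^2" and e :: real assume "\<eta>0 \<in> {\<eta>. norm \<eta> = 1}" and e: "e > 0"
  then obtain \<theta>0 where \<theta>0: "circ \<theta>0 = \<eta>0" using circ_surj by blast
  obtain \<delta> where \<delta>: "\<delta> > 0" "\<And>\<theta>. dist \<theta> \<theta>0 < \<delta> \<Longrightarrow> dist (f (circ \<theta>)) (f (circ \<theta>0)) < e"
    using assms[unfolded continuous_on_iff, rule_format, OF UNIV_I e, of \<theta>0] by blast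
  obtain r where r: "r > 0" "\<And>\<eta>. norm \<eta> = 1 \<Longrightarrow> norm (\<eta> - circ \<theta>0) < r \<Longrightarrow> \<exists>\<theta>. circ \<theta> = \<eta> \<and> \<bar>\<theta> - \<theta>0\<bar> < \<delta>"
    by (rule circ_local_lift[OF \<delta>(1), of \<theta>0]) (rule that)
  show "\<exists>d>0. \<forall>\<eta>\<in>{\<eta>. norm \<eta> = 1}. dist \<eta> \<eta>0 < d \<longrightarrow> dist (f \<eta>) (f \<eta>0) < e"
  proof (intro exI[of _ r] conjI r(1) ballI impI)
    fix \<eta> :: "real^2" assume "\<eta> \<in> {\<eta>. norm \<eta> = 1}" "dist \<eta> \<eta>0 < r"
    then obtain \<theta> where "circ \<theta> = \<eta>" "\<bar>\<theta> - \<theta>0\<bar> < \<delta>" using r(2)[of \<eta>] by (auto simp: \<theta>0 dist_norm)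
    then show "dist (f \<eta>) (f \<eta>0) < e" using \<delta>(2)[of \<theta>] by (auto simp: \<theta>0 dist_real_def)
  qed
qed

text \<open>A power series is continuous at its centre, and every point is the centre of some
  expansion.\<close>

lemma real_analytic_continuous:
  fixes f :: "real \<Rightarrow> real"
  assumes "real_analytic f"
  shows "continuous_on UNIV f"
  unfolding continuous_on_eq_continuous_at[OF open_UNIV]
proof
  fix x :: real
  obtain \<delta> c where \<delta>: "\<delta> > 0" "\<And>y. \<bar>y - x\<bar> < \<delta> \<Longrightarrow> (\<lambda>n. (y - x) ^ n *\<^sub>R c n) sums f y"
    using assms unfolding real_analytic_def by blast
  have "(\<lambda>n. c n * y ^ n) sums f (x + y)" if "norm y < \<delta>" for y
    using \<delta>(2)[of "x + y"] that by (simp add: mult.commute)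
  from powser_limit_0[OF \<delta>(1) this]
  have l: "((\<lambda>y. f (x + y)) \<longlongrightarrow> c 0) (at 0)" .
  have "(\<lambda>n. c n * 0 ^ n) sums f (x + 0)" using \<delta>(2)[of x] \<delta>(1) by (simp add: mult.commute)
  moreover have "(\<lambda>n. c n * 0 ^ n) sums c 0" by (rule powser_sums_zero)
  ultimately have "f x = c 0" using sums_unique2 by fastforce
  then show "isCont f x" using l by (simp add: isCont_def LIM_offset_zero_iff)
qed

lemma analytic_on_circle_continuous:
  "analytic_on_circle (f :: real^2 \<Rightarrow> real) \<Longrightarrow> continuous_on {\<eta>. norm \<eta> = 1} f"
  unfolding analytic_on_circle_def by (intro continuous_on_circle_lift real_analytic_continuous)

lemma analytic_on_circle_continuous_vec:
  fixes f :: "real^2 \<Rightarrow> real^2"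
  assumes "analytic_on_circle f"
  shows "continuous_on {\<eta>. norm \<eta> = 1} f"
proof -
  have "analytic_on_circle (\<lambda>\<eta>. f \<eta> $ i)" for i
    unfolding analytic_on_circle_def real_analytic_def
  proof
    fix x
    obtain \<delta> c where "\<delta> > 0" and s: "\<forall>y. \<bar>y - x\<bar> < \<delta> \<longrightarrow> (\<lambda>n. (y - x) ^ n *\<^sub>R c n) sums f (circ y)"
      using assms unfolding analytic_on_circle_def real_analytic_def by blast
    moreover have "(\<lambda>n. (y - x) ^ n *\<^sub>R (c n $ i)) sums (f (circ y) $ i)" if "\<bar>y - x\<bar> < \<delta>" for y
      using bounded_linear.sums[OF bounded_linear_vec_nth s[rule_format, OF that], of i] by simp
    ultimately show "\<exists>\<delta>>0. \<exists>c. \<forall>y. \<bar>y - x\<bar> < \<delta> \<longrightarrow> (\<lambda>n. (y - x) ^ n *\<^sub>R c n) sums (f (circ y) $ i)"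
      by (intro exI[of _ \<delta>] conjI exI[of _ "\<lambda>n. c n $ i"]) auto
  qed
  then have "continuous_on {\<eta>. norm \<eta> = 1} (\<lambda>\<eta>. \<chi> i. f \<eta> $ i)"
    by (intro continuous_on_vec_lambda analytic_on_circle_continuous)
  then show ?thesis by simp
qed

lemma compact_circle: "compact {\<eta>::real^2. norm \<eta> = 1}"
  using compact_sphere[of "0 :: real^2" 1] by (simp add: sphere_def)

lemma norm_dir: "\<xi> \<noteq> 0 \<Longrightarrow> norm (dir \<xi>) = 1"
  by (simp add: dir_def)

lemma norm_scale_dir: "norm \<xi> *\<^sub>R dir \<xi> = \<xi>"
  by (simp add: dir_def)

lemma dir_scale: "norm \<eta> = 1 \<Longrightarrow> \<rho> > 0 \<Longrightarrow> dir (\<rho> *\<^sub>R \<eta>) = \<eta>"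
  by (simp add: dir_def)

lemma continuous_on_dir: "continuous_on (- {0}) dir"
  unfolding dir_def by (intro continuous_intros) auto

lemma borel_measurable_dir [measurable]: "dir \<in> borel_measurable borel"
  unfolding dir_def[abs_def] by measurable

text \<open>At the origin \<open>dir\<close> has the default value 0; continuity there comes from
  the factor \<open>norm \<xi>\<close> and the boundedness of \<open>f\<close> on the compact
  circle.\<close>

lemma homogeneous_continuous:
  fixes f :: "real^2 \<Rightarrow> real"
  assumes "continuous_on {\<eta>. norm \<eta> = 1} f"
  shows "continuous_on UNIV (\<lambda>\<xi>. norm \<xi> * f (dir \<xi>))"
  unfolding continuous_on_eq_continuous_at[OF open_UNIV]
proof
  fix \<xi> :: "real^2"
  show "isCont (\<lambda>\<xi>. norm \<xi> * f (dir \<xi>)) \<xi>"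
  proof (cases "\<xi> = 0")
    case False
    have "continuous_on (- {0}) (\<lambda>\<xi>. f (dir \<xi>))"
      by (rule continuous_on_compose2[OF assms continuous_on_dir]) (auto simp: norm_dir)
    then have "isCont (\<lambda>\<xi>. f (dir \<xi>)) \<xi>" using False by (simp add: continuous_on_eq_continuous_at open_Compl)
    then show ?thesis by (intro continuous_intros)
  next
    case True
    have "bounded (f ` {\<eta>. norm \<eta> = 1})"
      using compact_continuous_image[OF assms compact_circle] compact_imp_bounded by blast
    then obtain B where B: "\<And>\<eta>. norm \<eta> = 1 \<Longrightarrow> \<bar>f \<eta>\<bar> \<le> B" by (auto simp: bounded_iff)
    have "((\<lambda>\<xi>. norm \<xi> * f (dir \<xi>)) \<longlongrightarrow> 0) (at 0)"
    proof (rule Lim_null_comparison)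
      show "\<forall>\<^sub>F \<xi> in at 0. norm (norm \<xi> * f (dir \<xi>)) \<le> norm \<xi> * B"
        using B norm_dir unfolding eventually_at_filter by (auto simp: abs_mult intro!: always_eventually mult_left_mono)
      show "((\<lambda>\<xi>::real^2. norm \<xi> * B) \<longlongrightarrow> 0) (at 0)"
        by (auto intro!: tendsto_eq_intros)
    qed
    then show ?thesis unfolding True isCont_def by simp
  qed
qed

section \<open>The symbol and the equation in Fourier space\<close>

lemma sum_5: "sum f (UNIV :: 5 set) = f 1 + f 2 + f 3 + f 4 + f 5"
  unfolding UNIV_5 by (simp add: add.assoc)

lemma symbolB_mult:
  fixes v :: "complex^5" and \<mu> :: "2 \<Rightarrow> real^2 \<Rightarrow> real" and r :: "2 \<Rightarrow> real^2 \<Rightarrow> real^2" and \<kappa> \<gamma> :: real and \<xi> :: "real^2"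
  defines "w1 \<equiv> complex_of_real (omega \<mu> 1 \<xi>)" and "w2 \<equiv> complex_of_real (omega \<mu> 2 \<xi>)"
    and "b1 \<equiv> \<i> * complex_of_real (\<gamma> * coupling r 1 \<xi>)" and "b2 \<equiv> \<i> * complex_of_real (\<gamma> * coupling r 2 \<xi>)"
    and "d \<equiv> \<i> * complex_of_real (\<kappa> * (norm \<xi>)\<^sup>2)"
  shows "(symbolB \<kappa> \<gamma> \<mu> r \<xi> *v v) $ 1 = w1 * v $ 1 + b1 * v $ 5"
    and "(symbolB \<kappa> \<gamma> \<mu> r \<xi> *v v) $ 2 = w2 * v $ 2 + b2 * v $ 5"
    and "(symbolB \<kappa> \<gamma> \<mu> r \<xi> *v v) $ 3 = - w1 * v $ 3 + b1 * v $ 5"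
    and "(symbolB \<kappa> \<gamma> \<mu> r \<xi> *v v) $ 4 = - w2 * v $ 4 + b2 * v $ 5"
    and "(symbolB \<kappa> \<gamma> \<mu> r \<xi> *v v) $ 5 = - b1 / 2 * (v $ 1 + v $ 3) - b2 / 2 * (v $ 2 + v $ 4) + d * v $ 5"
  unfolding symbolB_def Let_def matrix_vector_mult_def sum_5 vec_lambda_beta vector_5 w1_def w2_def b1_def b2_def d_def
  by (simp_all add: distrib_left)

lemma forall_5: "(\<forall>i::5. P i) \<longleftrightarrow> P 1 \<and> P 2 \<and> P 3 \<and> P 4 \<and> P 5"
proof -
  have "(\<forall>i::5. P i) \<longleftrightarrow> (\<forall>i\<in>UNIV. P i)" by simp
  then show ?thesis unfolding UNIV_5 by simp
qed

lemma coupling_eq: "coupling r j \<xi> = norm \<xi> * (r j (dir \<xi>) \<bullet> dir \<xi>)"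
  using inner_scaleR_right[of "r j (dir \<xi>)" "norm \<xi>" "dir \<xi>"] unfolding coupling_def norm_scale_dir .

text \<open>The entries are homogeneous of degree 1 or polynomial in \<open>norm \<xi>\<close>, so
  they are continuous at the origin too; \<open>fourier_inversion\<close> depends on this.\<close>

lemma continuous_on_symbolB_mult:
  fixes F :: "real^2 \<Rightarrow> complex^5"
  assumes \<mu>: "\<And>j. continuous_on {\<eta>. norm \<eta> = 1} (\<mu> j)" and r: "\<And>j. continuous_on {\<eta>. norm \<eta> = 1} (r j)"
    and F: "continuous_on UNIV F"
  shows "continuous_on UNIV (\<lambda>\<xi>. symbolB \<kappa> \<gamma> \<mu> r \<xi> *v F \<xi>)"
proof -
  have "continuous_on UNIV (omega \<mu> j)" for j
    unfolding omega_def[abs_def] by (rule homogeneous_continuous) (intro continuous_intros \<mu>)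
  then have o: "continuous_on UNIV (\<lambda>\<xi>. complex_of_real (omega \<mu> j \<xi>))" for j
    by (rule continuous_on_of_real)
  have c0: "continuous_on UNIV (coupling r j)" for j
    unfolding coupling_eq[abs_def] by (rule homogeneous_continuous[of "\<lambda>\<eta>. r j \<eta> \<bullet> \<eta>"]) (intro continuous_intros r)
  have c: "continuous_on UNIV (\<lambda>\<xi>. \<i> * complex_of_real (\<gamma> * coupling r j \<xi>))" for j
    by (intro continuous_intros c0)
  have n: "continuous_on UNIV (\<lambda>\<xi>::real^2. \<i> * complex_of_real (\<kappa> * (norm \<xi>)\<^sup>2))"
    by (intro continuous_intros)
  have f: "continuous_on UNIV (\<lambda>\<xi>. F \<xi> $ i)" for i
    by (intro continuous_intros F)
  have two: "\<forall>\<xi>\<in>(UNIV :: (real^2) set). (2::complex) \<noteq> 0" by simp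
  have "\<forall>i. continuous_on UNIV (\<lambda>\<xi>. (symbolB \<kappa> \<gamma> \<mu> r \<xi> *v F \<xi>) $ i)"
    unfolding forall_5 symbolB_mult
    by (intro conjI continuous_on_add continuous_on_diff continuous_on_mult continuous_on_minus continuous_on_divide continuous_on_const o c n f two)
  then have "continuous_on UNIV (\<lambda>\<xi>. \<chi> i. (symbolB \<kappa> \<gamma> \<mu> r \<xi> *v F \<xi>) $ i)"
    by (intro continuous_on_vec_lambda) auto
  then show ?thesis by simp
qed

lemma fourier_cmult_diff:
  fixes f g :: "real^2 \<Rightarrow> complex^'n"
  assumes f: "integrable lborel f" and g: "integrable lborel g"
  shows "integrable lborel (\<lambda>x. c *s f x - g x)" "fourier (\<lambda>x. c *s f x - g x) \<xi> = c *s fourier f \<xi> - fourier g \<xi>"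
proof -
  have fi: "integrable lborel (\<lambda>x. f x $ i)" and gi: "integrable lborel (\<lambda>x. g x $ i)" for i
    using integrable_vec_nth[OF f] integrable_vec_nth[OF g] by auto
  have int: "integrable lborel (\<lambda>x. (c *s f x - g x) $ i)" for i
    using fi[of i] gi[of i] by simp
  then show i: "integrable lborel (\<lambda>x. c *s f x - g x)" by (rule integrable_vecI)
  show "fourier (\<lambda>x. c *s f x - g x) \<xi> = c *s fourier f \<xi> - fourier g \<xi>"
  proof (subst vec_eq_iff, rule allI)
    fix j
    have "fourier (\<lambda>x. c *s f x - g x) \<xi> $ j = sft (\<lambda>x. c * f x $ j + (-1) * g x $ j) \<xi>"
      by (simp add: fourier_nth[OF i])
    also have "\<dots> = c * sft (\<lambda>x. f x $ j) \<xi> + (-1) * sft (\<lambda>x. g x $ j) \<xi>"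
      using fi[of j] gi[of j] by (subst sft_add) (auto simp: sft_cmult sft_cmult[of "-1", simplified])
    finally show "fourier (\<lambda>x. c *s f x - g x) \<xi> $ j = (c *s fourier f \<xi> - fourier g \<xi>) $ j"
      by (simp add: fourier_nth[OF f] fourier_nth[OF g])
  qed
qed

text \<open>The transform maps L^1 to bounded functions, so the L^1 limit that defines the time
  derivative passes to every single frequency; inversion identifies the transform of
  \<open>mult_op M (V t)\<close>.\<close>

lemma solution_fourier_ode:
  fixes V :: "real \<Rightarrow> real^2 \<Rightarrow> complex^'n"
  assumes sol: "is_solution M V0 V" and t: "t \<ge> 0"
    and cont: "\<And>F :: real^2 \<Rightarrow> complex^'n. continuous_on UNIV F \<Longrightarrow> continuous_on UNIV (\<lambda>\<xi>. M \<xi> *v F \<xi>)"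
  shows "((\<lambda>s. fourier (V s) \<xi>) has_vector_derivative (\<i> *s (M \<xi> *v fourier (V t) \<xi>))) (at t within {0..})"
proof -
  have V: "integrable lborel (V s)" "integrable lborel (\<lambda>\<xi>. M \<xi> *v fourier (V s) \<xi>)" "integrable lborel (mult_op M (V s))"
    and lim: "((\<lambda>s'. LINT x|lborel. norm ((- \<i> / complex_of_real (s' - s)) *s (V s' x - V s x) - mult_op M (V s) x)) \<longlongrightarrow> 0) (at s within {0..})"
    if "s \<ge> 0" for s using sol that unfolding is_solution_def by blast+
  let ?w = "M \<xi> *v fourier (V t) \<xi>"
  have inv: "fourier (mult_op M (V t)) \<xi> = ?w"
    unfolding mult_op_def
    by (rule fourier_inversion[OF V(2)[OF t] cont[OF continuous_on_fourier[OF V(1)[OF t]]] V(3)[OF t, unfolded mult_op_def]])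
  let ?Q = "\<lambda>s. (- \<i> / complex_of_real (s - t)) *s (fourier (V s) \<xi> - fourier (V t) \<xi>) - ?w"
  have Q: "norm (?Q s) \<le> (LINT x|lborel. norm ((- \<i> / complex_of_real (s - t)) *s (V s x - V t x) - mult_op M (V t) x)) / (2 * pi)"
    if s: "s \<ge> 0" for s
  proof -
    have d: "integrable lborel (\<lambda>x. 1 *s V s x - V t x)" "fourier (\<lambda>x. 1 *s V s x - V t x) \<xi> = 1 *s fourier (V s) \<xi> - fourier (V t) \<xi>"
      by (rule fourier_cmult_diff[OF V(1)[OF s] V(1)[OF t]])+
    have "?Q s = fourier (\<lambda>x. (- \<i> / complex_of_real (s - t)) *s (1 *s V s x - V t x) - mult_op M (V t) x) \<xi>"
      unfolding fourier_cmult_diff(2)[OF d(1) V(3)[OF t]] d(2) inv by simp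
    then show ?thesis by (simp only: norm_fourier_le vector_smult_lid)
  qed
  have lim0: "((\<lambda>s. norm (?Q s)) \<longlongrightarrow> 0) (at t within {0..})"
  proof (rule Lim_null_comparison)
    show "\<forall>\<^sub>F s in at t within {0..}. norm (norm (?Q s)) \<le> (LINT x|lborel. norm ((- \<i> / complex_of_real (s - t)) *s (V s x - V t x) - mult_op M (V t) x)) / (2 * pi)"
      using Q unfolding eventually_at_filter by (intro always_eventually) auto
    show "((\<lambda>s. (LINT x|lborel. norm ((- \<i> / complex_of_real (s - t)) *s (V s x - V t x) - mult_op M (V t) x)) / (2 * pi)) \<longlongrightarrow> 0) (at t within {0..})"
      using tendsto_divide[OF lim[OF t] tendsto_const[of "2 * pi"]] by simp
  qed
  have eq: "norm (?Q s) = norm ((fourier (V s) \<xi> - fourier (V t) \<xi> - (s - t) *\<^sub>R (\<i> *s ?w)) /\<^sub>R norm (s - t))"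
    if "s \<noteq> t" for s
  proof -
    have "?Q s = (- \<i> / complex_of_real (s - t)) *s (fourier (V s) \<xi> - fourier (V t) \<xi> - (s - t) *\<^sub>R (\<i> *s ?w))"
    proof -
      have c: "complex_of_real (s - t) \<noteq> 0" using that by simp
      have "(- \<i> / c) * z - w = (- \<i> / c) * (z - c * (\<i> * w))" if "c \<noteq> 0" for c z w :: complex
        using that by (simp add: right_diff_distrib)
      from this[OF c] show ?thesis
        unfolding vec_eq_iff vector_minus_component vector_smult_component vector_scaleR_component scaleR_conv_of_real[where 'a=complex] by blast
    qed
    then have "norm (?Q s) = 1 / \<bar>s - t\<bar> * norm (fourier (V s) \<xi> - fourier (V t) \<xi> - (s - t) *\<^sub>R (\<i> *s ?w))"
      by (simp only: norm_vector_smult norm_divide norm_minus_cancel norm_ii norm_of_real)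
    then show ?thesis by (simp only: norm_scaleR real_norm_def) (simp add: divide_inverse)
  qed
  have "\<forall>\<^sub>F s in at t within {0..}. norm (?Q s) = norm ((fourier (V s) \<xi> - fourier (V t) \<xi> - (s - t) *\<^sub>R (\<i> *s ?w)) /\<^sub>R norm (s - t))"
    unfolding eventually_at_filter by (intro always_eventually allI impI eq)
  from Lim_transform_eventually[OF lim0 this]
  have "((\<lambda>s. norm ((fourier (V s) \<xi> - fourier (V t) \<xi> - (s - t) *\<^sub>R (\<i> *s ?w)) /\<^sub>R norm (s - t))) \<longlongrightarrow> 0) (at t within {0..})" .
  from tendsto_norm_zero_cancel[OF this]
  show ?thesis
    unfolding has_vector_derivative_def has_derivative_at_within
    by (intro conjI bounded_linear_scaleR_left)
qed

text \<open>Parseval in the plane: a square matrix with orthonormal rows \<open>u\<close> and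
  \<open>v\<close> has orthonormal columns as well.\<close>

lemma orthonormal_basis_real2:
  fixes u v \<eta> :: "real^2"
  assumes "norm u = 1" "norm v = 1" "u \<bullet> v = 0"
  shows "(u \<bullet> \<eta>)\<^sup>2 + (v \<bullet> \<eta>)\<^sup>2 = (norm \<eta>)\<^sup>2"
proof -
  define x y z w where xyzw: "x = u$1" "y = u$2" "z = v$1" "w = v$2"
  have 1: "x\<^sup>2 + y\<^sup>2 = 1" "z\<^sup>2 + w\<^sup>2 = 1" "x * z + y * w = 0"
    using assms norm_real2_power2[of u] norm_real2_power2[of v] by (auto simp: xyzw inner_real2)
  have "(x * z)\<^sup>2 = (y * w)\<^sup>2" using 1(3) by (simp add: power2_eq_iff eq_neg_iff_add_eq_0)
  then have "x\<^sup>2 * z\<^sup>2 = (1 - x\<^sup>2) * (1 - z\<^sup>2)" using 1 by (simp add: power_mult_distrib eq_diff_eq[symmetric])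
  then have a: "x\<^sup>2 + z\<^sup>2 = 1" by (simp add: algebra_simps)
  then have b: "y\<^sup>2 + w\<^sup>2 = 1" "x\<^sup>2 = w\<^sup>2" "z\<^sup>2 = y\<^sup>2" using 1 by auto
  have xz: "x * z = - (y * w)" using 1(3) by linarith
  \<comment> \<open>The product of the columns is multiplied by \<open>x\<close> and by
    \<open>z\<close> rather than divided by an entry that might vanish;
    \<open>x\<^sup>2 + z\<^sup>2 = 1\<close> shows that one of the two is nonzero.\<close>
  have "x * (x * y + z * w) = y * x\<^sup>2 + w * (x * z)" by (simp add: algebra_simps power2_eq_square)
  also have "\<dots> = y * (x\<^sup>2 - w\<^sup>2)" unfolding xz by (simp add: algebra_simps power2_eq_square)
  finally have c1: "x * (x * y + z * w) = 0" using b by simp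
  have "z * (x * y + z * w) = w * z\<^sup>2 + y * (x * z)" by (simp add: algebra_simps power2_eq_square)
  also have "\<dots> = w * (z\<^sup>2 - y\<^sup>2)" unfolding xz by (simp add: algebra_simps power2_eq_square)
  finally have c2: "z * (x * y + z * w) = 0" using b by simp
  have c: "x * y + z * w = 0" using c1 c2 a by auto
  have "(u \<bullet> \<eta>)\<^sup>2 + (v \<bullet> \<eta>)\<^sup>2 = (x\<^sup>2 + z\<^sup>2) * (\<eta>$1)\<^sup>2 + (y\<^sup>2 + w\<^sup>2) * (\<eta>$2)\<^sup>2 + 2 * (x * y + z * w) * (\<eta>$1 * \<eta>$2)"
    unfolding inner_real2 xyzw[symmetric] by (simp add: power2_eq_square algebra_simps)
  then show ?thesis unfolding a b(1) c norm_real2_power2 by simp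
qed

section \<open>Hyperbolic directions\<close>

locale thermoelastic_system =
  fixes \<kappa> \<gamma> :: real
    and A :: "real^2 \<Rightarrow> complex^2^2"
    and \<mu> :: "2 \<Rightarrow> real^2 \<Rightarrow> real"
    and r :: "2 \<Rightarrow> real^2 \<Rightarrow> real^2"
  assumes \<kappa>: "\<kappa> > 0" and \<gamma>: "\<gamma> \<noteq> 0"
    and A2: "\<And>\<eta>. norm \<eta> = 1 \<Longrightarrow> positive_matrix (A \<eta>)"
    and eigen: "\<And>j \<eta>. norm \<eta> = 1 \<Longrightarrow>
                  A \<eta> *v cvec (r j \<eta>) = complex_of_real (\<mu> j \<eta>) *s cvec (r j \<eta>)"
    and r_norm: "\<And>j \<eta>. norm \<eta> = 1 \<Longrightarrow> norm (r j \<eta>) = 1"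
    and r_orth: "\<And>\<eta>. norm \<eta> = 1 \<Longrightarrow> r 1 \<eta> \<bullet> r 2 \<eta> = 0"
    and analytic: "\<And>j. analytic_on_circle (\<mu> j)" "\<And>j. analytic_on_circle (r j)"
    and A3: "\<And>\<eta>. norm \<eta> = 1 \<Longrightarrow> card (spectrum (A \<eta>)) = 2"
    and first_order: "\<And>j \<eta>. hyperbolic_dir_wrt \<kappa> \<gamma> \<mu> r j \<eta> \<Longrightarrow>
                        simple_zero_on_circle (coupling r j) \<eta>"
begin

lemma cvec_nonzero: "norm \<eta> = 1 \<Longrightarrow> cvec (r j \<eta>) \<noteq> 0"
  using r_norm[of \<eta> j] by (auto simp: cvec_def vec_eq_iff)
     (metis norm_zero vec_eq_iff zero_index zero_neq_one)

lemma mu_pos: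
  assumes \<eta>: "norm \<eta> = 1" shows "\<mu> j \<eta> > 0"
proof -
  let ?v = "cvec (r j \<eta>)"
  have "0 < Re (\<Sum>i\<in>UNIV. cnj (?v $ i) * (A \<eta> *v ?v) $ i)"
    using A2[OF \<eta>] cvec_nonzero[OF \<eta>] unfolding positive_matrix_def by blast
  also have "(\<Sum>i\<in>UNIV. cnj (?v $ i) * (A \<eta> *v ?v) $ i) = complex_of_real (\<mu> j \<eta> * (r j \<eta> \<bullet> r j \<eta>))"
    unfolding eigen[OF \<eta>] by (simp add: cvec_def UNIV_2 inner_real2 algebra_simps)
  also have "r j \<eta> \<bullet> r j \<eta> = 1" using r_norm[OF \<eta>, of j] by (simp add: norm_eq_1)
  finally show ?thesis by simp
qed

text \<open>If the eigenvalues agreed, \<open>A \<eta>\<close> would act as a scalar on an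
  orthonormal basis and hence everywhere, leaving a single spectral point.\<close>

lemma mu_distinct:
  assumes \<eta>: "norm \<eta> = 1" shows "\<mu> 1 \<eta> \<noteq> \<mu> 2 \<eta>"
proof
  assume eq: "\<mu> 1 \<eta> = \<mu> 2 \<eta>"
  let ?a = "cvec (r 1 \<eta>)" and ?b = "cvec (r 2 \<eta>)" and ?m = "complex_of_real (\<mu> 1 \<eta>)"
  \<comment> \<open>The eigenvectors are real, so complex vectors expand without conjugation. The
    relations between the entries follow from Parseval at the two axes and at the vector with both
    entries 1.\<close>
  have expand: "v = (v$1 * ?a$1 + v$2 * ?a$2) *s ?a + (v$1 * ?b$1 + v$2 * ?b$2) *s ?b" for v :: "complex^2"
  proof -
    have e: "(r 1 \<eta> \<bullet> u)\<^sup>2 + (r 2 \<eta> \<bullet> u)\<^sup>2 = (norm u)\<^sup>2" for u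
      by (rule orthonormal_basis_real2) (use r_norm r_orth \<eta> in auto)
    have q: "(r 1 \<eta> $ 1)\<^sup>2 + (r 2 \<eta> $ 1)\<^sup>2 = 1" "(r 1 \<eta> $ 2)\<^sup>2 + (r 2 \<eta> $ 2)\<^sup>2 = 1"
      using e[of "axis 1 1"] e[of "axis 2 1"] by (auto simp: inner_axis)
    have "(norm (vector [1,1] :: real^2))\<^sup>2 = 2" by (simp add: norm_real2_power2)
    then have "(r 1 \<eta> $ 1 + r 1 \<eta> $ 2)\<^sup>2 + (r 2 \<eta> $ 1 + r 2 \<eta> $ 2)\<^sup>2 = 2"
      using e[of "vector [1,1]"] by (simp add: inner_real2)
    then have x: "r 1 \<eta> $ 1 * r 1 \<eta> $ 2 + r 2 \<eta> $ 1 * r 2 \<eta> $ 2 = 0"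
      using q by (simp add: power2_sum)
    have Q: "?a$1 * ?a$1 + ?b$1 * ?b$1 = 1" "?a$2 * ?a$2 + ?b$2 * ?b$2 = 1" "?a$1 * ?a$2 + ?b$1 * ?b$2 = 0"
      using q x by (simp_all add: cvec_def power2_eq_square flip: of_real_mult of_real_add)
    have "(v$1 * ?a$1 + v$2 * ?a$2) * ?a$1 + (v$1 * ?b$1 + v$2 * ?b$2) * ?b$1 = v$1 * (?a$1 * ?a$1 + ?b$1 * ?b$1) + v$2 * (?a$1 * ?a$2 + ?b$1 * ?b$2)"
      "(v$1 * ?a$1 + v$2 * ?a$2) * ?a$2 + (v$1 * ?b$1 + v$2 * ?b$2) * ?b$2 = v$1 * (?a$1 * ?a$2 + ?b$1 * ?b$2) + v$2 * (?a$2 * ?a$2 + ?b$2 * ?b$2)"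
      by (simp_all add: algebra_simps)
    then have "(v$1 * ?a$1 + v$2 * ?a$2) * ?a$1 + (v$1 * ?b$1 + v$2 * ?b$2) * ?b$1 = v$1"
      "(v$1 * ?a$1 + v$2 * ?a$2) * ?a$2 + (v$1 * ?b$1 + v$2 * ?b$2) * ?b$2 = v$2"
      unfolding Q by simp_all
    then show ?thesis by (simp only: vec_eq_iff forall_2 vector_add_component vector_smult_component)
  qed
  have A: "A \<eta> *v v = ?m *s v" for v
  proof -
    define p q where pq: "p = v$1 * ?a$1 + v$2 * ?a$2" "q = v$1 * ?b$1 + v$2 * ?b$2"
    have "v = p *s ?a + q *s ?b" using expand[of v] by (simp add: pq)
    then have "A \<eta> *v v = p *s (A \<eta> *v ?a) + q *s (A \<eta> *v ?b)"
      by (metis matrix_vector_right_distrib vector_scalar_commute)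
    also have "\<dots> = ?m *s (p *s ?a + q *s ?b)" unfolding eigen[OF \<eta>] eq by (simp add: vec_eq_iff algebra_simps)
    finally show ?thesis using \<open>v = p *s ?a + q *s ?b\<close> by simp
  qed
  have "spectrum (A \<eta>) \<subseteq> {?m}"
  proof
    fix l assume "l \<in> spectrum (A \<eta>)"
    then obtain v where v: "v \<noteq> 0" "?m *s v = l *s v" unfolding spectrum_def A by auto
    then obtain i where "v $ i \<noteq> 0" by (auto simp: vec_eq_iff)
    moreover have "?m * v $ i = l * v $ i" using v(2) by (metis vector_smult_component)
    ultimately show "l \<in> {?m}" by simp
  qed
  then have "card (spectrum (A \<eta>)) \<le> 1" using card_mono[of "{?m}"] by fastforce
  then show False using A3[OF \<eta>] by simp
qed

lemma continuous_mu: "continuous_on {\<eta>. norm \<eta> = 1} (\<mu> j)"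
  by (rule analytic_on_circle_continuous[OF analytic(1)])

lemma continuous_r: "continuous_on {\<eta>. norm \<eta> = 1} (r j)"
  by (rule analytic_on_circle_continuous_vec[OF analytic(2)])

definition a :: "2 \<Rightarrow> real^2 \<Rightarrow> real" where "a j \<eta> = r j \<eta> \<bullet> \<eta>"

definition dmin :: "real^2 \<Rightarrow> real" where "dmin \<eta> = min \<bar>a 1 \<eta>\<bar> \<bar>a 2 \<eta>\<bar>"

lemma a_sq: "norm \<eta> = 1 \<Longrightarrow> (a 1 \<eta>)\<^sup>2 + (a 2 \<eta>)\<^sup>2 = 1"
  unfolding a_def using orthonormal_basis_real2[of "r 1 \<eta>" "r 2 \<eta>" \<eta>] r_norm r_orth by simp

lemma circle_positive_lower_bound:
  fixes f :: "real^2 \<Rightarrow> real"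
  assumes "continuous_on {\<eta>. norm \<eta> = 1} f" "\<And>\<eta>. norm \<eta> = 1 \<Longrightarrow> f \<eta> > 0"
  obtains m where "m > 0" "\<And>\<eta>. norm \<eta> = 1 \<Longrightarrow> m \<le> f \<eta>"
proof -
  have "{\<eta>::real^2. norm \<eta> = 1} \<noteq> {}" using norm_circ by blast
  from continuous_attains_inf[OF compact_circle this assms(1)]
  obtain \<eta>0 where "norm \<eta>0 = 1" "\<And>\<eta>. norm \<eta> = 1 \<Longrightarrow> f \<eta>0 \<le> f \<eta>" by auto
  then show thesis using that[of "f \<eta>0"] assms(2) by blast
qed

lemma uniform_constants:
  obtains \<omega>0 \<Omega> D where "\<omega>0 > 0" "\<Omega> \<ge> 1" "D > 0"
    "\<And>\<eta> j. norm \<eta> = 1 \<Longrightarrow> \<omega>0 \<le> sqrt (\<mu> j \<eta>) \<and> sqrt (\<mu> j \<eta>) \<le> \<Omega>"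
    "\<And>\<eta>. norm \<eta> = 1 \<Longrightarrow> D \<le> \<bar>\<mu> 1 \<eta> - \<mu> 2 \<eta>\<bar>"
proof -
  have "\<exists>m>0. \<forall>\<eta>. norm \<eta> = 1 \<longrightarrow> m \<le> sqrt (\<mu> j \<eta>)" for j
    using circle_positive_lower_bound[of "\<lambda>\<eta>. sqrt (\<mu> j \<eta>)"] mu_pos
    by (metis continuous_mu continuous_on_real_sqrt real_sqrt_gt_zero)
  then obtain m where m: "\<And>j. m j > 0" "\<And>j \<eta>. norm \<eta> = 1 \<Longrightarrow> m j \<le> sqrt (\<mu> j \<eta>)" by metis
  have "\<exists>M. \<forall>\<eta>. norm \<eta> = 1 \<longrightarrow> sqrt (\<mu> j \<eta>) \<le> M" for j
  proof -
    have "bounded ((\<lambda>\<eta>. sqrt (\<mu> j \<eta>)) ` {\<eta>. norm \<eta> = 1})"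
      by (intro compact_imp_bounded compact_continuous_image compact_circle continuous_on_real_sqrt continuous_mu)
    then obtain M where "\<forall>x\<in>(\<lambda>\<eta>. sqrt (\<mu> j \<eta>)) ` {\<eta>. norm \<eta> = 1}. norm x \<le> M" unfolding bounded_iff by blast
    then show ?thesis by (intro exI[of _ M]) force
  qed
  then obtain M where M: "\<And>j \<eta>. norm \<eta> = 1 \<Longrightarrow> sqrt (\<mu> j \<eta>) \<le> M j" by metis
  obtain D where D: "D > 0" "\<And>\<eta>. norm \<eta> = 1 \<Longrightarrow> D \<le> \<bar>\<mu> 1 \<eta> - \<mu> 2 \<eta>\<bar>"
  proof (rule circle_positive_lower_bound[of "\<lambda>\<eta>. \<bar>\<mu> 1 \<eta> - \<mu> 2 \<eta>\<bar>"])
    show "continuous_on {\<eta>. norm \<eta> = 1} (\<lambda>\<eta>. \<bar>\<mu> 1 \<eta> - \<mu> 2 \<eta>\<bar>)"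
      by (intro continuous_intros continuous_mu)
  qed (use mu_distinct in auto)
  have all: "j = 1 \<or> j = 2" for j :: 2 by (rule exhaust_2)
  show thesis
  proof (rule that[of "min (m 1) (m 2)" "max 1 (max (M 1) (M 2))" D])
    show "min (m 1) (m 2) \<le> sqrt (\<mu> j \<eta>) \<and> sqrt (\<mu> j \<eta>) \<le> max 1 (max (M 1) (M 2))" if "norm \<eta> = 1" for \<eta> j
      using m(2)[OF that, of j] M[OF that, of j] all[of j] by (auto simp: min_le_iff_disj le_max_iff_disj)
  qed (use m D in auto)
qed

text \<open>Two waves of opposite frequencies combine into a rotating pair \<open>p\<close>,
  \<open>n\<close>, of which only \<open>p\<close> couples to the temperature; in these variables
  the equation is that of \<open>damped_oscillators\<close>.\<close>

lemma symbol_energy_decay: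
  obtains c where "c > 0"
    "\<And>\<xi> v t. \<xi> \<noteq> 0 \<Longrightarrow> t \<ge> 0 \<Longrightarrow>
       \<forall>s\<ge>0. (v has_vector_derivative (\<i> *s (symbolB \<kappa> \<gamma> \<mu> r \<xi> *v v s))) (at s within {0..}) \<Longrightarrow>
       norm (v t) \<le> 3 * exp (- c * t * ((norm \<xi>)\<^sup>2 / (1 + (norm \<xi>)\<^sup>2) * (dmin (dir \<xi>))\<^sup>2)) * norm (v 0)"
proof -
  obtain \<omega>0 \<Omega> D where const: "\<omega>0 > 0" "\<Omega> \<ge> 1" "D > 0"
    and w: "\<And>\<eta> j. norm \<eta> = 1 \<Longrightarrow> \<omega>0 \<le> sqrt (\<mu> j \<eta>) \<and> sqrt (\<mu> j \<eta>) \<le> \<Omega>"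
    and gap: "\<And>\<eta>. norm \<eta> = 1 \<Longrightarrow> D \<le> \<bar>\<mu> 1 \<eta> - \<mu> 2 \<eta>\<bar>"
    by (rule uniform_constants) (rule that)
  define R where "R = damped_oscillators.rate \<gamma> \<kappa> \<Omega> \<omega>0 D"
  have osc: "damped_oscillators \<gamma> \<kappa> \<Omega> \<omega>0 D (sqrt (\<mu> 1 \<eta>)) (sqrt (\<mu> 2 \<eta>)) (a 1 \<eta>) (a 2 \<eta>) (dmin \<eta>) \<rho>"
    if "norm \<eta> = 1" "\<rho> \<ge> 0" for \<eta> \<rho>
    using that const w[OF that(1)] gap[OF that(1)] a_sq[OF that(1)] \<kappa> \<gamma> mu_pos[OF that(1), of 1] mu_pos[OF that(1), of 2]
    by unfold_locales (auto simp: dmin_def)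
  \<comment> \<open>Any direction and length will do, as the rate depends only on the uniform
    constants.\<close>
  have R: "R > 0" using damped_oscillators.rate_pos[OF osc[of "circ 0" 0]] by (simp add: R_def)
  show thesis
  proof (rule that[of "R / 2"])
    fix \<xi> and v :: "real \<Rightarrow> complex^5" and t :: real
    assume \<xi>: "\<xi> \<noteq> 0" and t: "t \<ge> 0"
      and ode: "\<forall>s\<ge>0. (v has_vector_derivative (\<i> *s (symbolB \<kappa> \<gamma> \<mu> r \<xi> *v v s))) (at s within {0..})"
    define \<rho> where "\<rho> = norm \<xi>"
    define \<eta> where "\<eta> = dir \<xi>"
    have \<eta>: "norm \<eta> = 1" using norm_dir[OF \<xi>] by (simp add: \<eta>_def)
    interpret damped_oscillators \<gamma> \<kappa> \<Omega> \<omega>0 D "sqrt (\<mu> 1 \<eta>)" "sqrt (\<mu> 2 \<eta>)" "a 1 \<eta>" "a 2 \<eta>" "dmin \<eta>" \<rho>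
      by (rule osc[OF \<eta>]) (simp add: \<rho>_def)
    have om: "omega \<mu> j \<xi> = \<rho> * sqrt (\<mu> j \<eta>)" for j by (simp add: omega_def \<rho>_def \<eta>_def)
    have co: "coupling r j \<xi> = \<rho> * a j \<eta>" for j by (simp add: coupling_eq a_def \<rho>_def \<eta>_def)
    define p1 where "p1 s = (v s $ 1 + v s $ 3) / 2" for s
    define p2 where "p2 s = (v s $ 2 + v s $ 4) / 2" for s
    define n1 where "n1 s = \<i> * ((v s $ 1 - v s $ 3) / 2)" for s
    define n2 where "n2 s = \<i> * ((v s $ 2 - v s $ 4) / 2)" for s
    define th where "th s = v s $ 5" for s
    have comp: "((\<lambda>s. v s $ i) has_vector_derivative (\<i> * (symbolB \<kappa> \<gamma> \<mu> r \<xi> *v v s) $ i)) (at s within {0..})" if "s \<ge> 0" for s i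
      using bounded_linear.has_vector_derivative[OF bounded_linear_vec_nth ode[rule_format, OF that], of i] by simp
    note vd = has_vector_derivative_add has_vector_derivative_diff has_vector_derivative_mult_right has_vector_derivative_divide
    have "En (p1 t) (p2 t) (n1 t) (n2 t) (th t) \<le> 4 * exp (- (rate * (\<rho>\<^sup>2 / (1 + \<rho>\<^sup>2) * (dmin \<eta>)\<^sup>2)) * t) * En (p1 0) (p2 0) (n1 0) (n2 0) (th 0)"
    proof (rule energy_decay[OF _ _ _ _ _ t])
      fix s :: real assume s: "s \<ge> 0"
      note c = comp[OF s]
      have "(p1 has_vector_derivative ((\<i> * (symbolB \<kappa> \<gamma> \<mu> r \<xi> *v v s) $ 1 + \<i> * (symbolB \<kappa> \<gamma> \<mu> r \<xi> *v v s) $ 3) / 2)) (at s within {0..})"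
        unfolding p1_def[abs_def] by (intro vd c)
      also have "(\<i> * (symbolB \<kappa> \<gamma> \<mu> r \<xi> *v v s) $ 1 + \<i> * (symbolB \<kappa> \<gamma> \<mu> r \<xi> *v v s) $ 3) / 2 = (\<rho> * sqrt (\<mu> 1 \<eta>)) *\<^sub>R n1 s - (\<gamma> * \<rho> * a 1 \<eta>) *\<^sub>R th s"
        by (simp add: symbolB_mult om co n1_def th_def scaleR_conv_of_real algebra_simps add_divide_distrib diff_divide_distrib)
      finally show "(p1 has_vector_derivative ((\<rho> * sqrt (\<mu> 1 \<eta>)) *\<^sub>R n1 s - (\<gamma> * \<rho> * a 1 \<eta>) *\<^sub>R th s)) (at s within {0..})" .
      have "(p2 has_vector_derivative ((\<i> * (symbolB \<kappa> \<gamma> \<mu> r \<xi> *v v s) $ 2 + \<i> * (symbolB \<kappa> \<gamma> \<mu> r \<xi> *v v s) $ 4) / 2)) (at s within {0..})"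
        unfolding p2_def[abs_def] by (intro vd c)
      also have "(\<i> * (symbolB \<kappa> \<gamma> \<mu> r \<xi> *v v s) $ 2 + \<i> * (symbolB \<kappa> \<gamma> \<mu> r \<xi> *v v s) $ 4) / 2 = (\<rho> * sqrt (\<mu> 2 \<eta>)) *\<^sub>R n2 s - (\<gamma> * \<rho> * a 2 \<eta>) *\<^sub>R th s"
        by (simp add: symbolB_mult om co n2_def th_def scaleR_conv_of_real algebra_simps add_divide_distrib diff_divide_distrib)
      finally show "(p2 has_vector_derivative ((\<rho> * sqrt (\<mu> 2 \<eta>)) *\<^sub>R n2 s - (\<gamma> * \<rho> * a 2 \<eta>) *\<^sub>R th s)) (at s within {0..})" .
      have "(n1 has_vector_derivative (\<i> * ((\<i> * (symbolB \<kappa> \<gamma> \<mu> r \<xi> *v v s) $ 1 - \<i> * (symbolB \<kappa> \<gamma> \<mu> r \<xi> *v v s) $ 3) / 2))) (at s within {0..})"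
        unfolding n1_def[abs_def] by (intro vd c)
      also have "\<i> * ((\<i> * (symbolB \<kappa> \<gamma> \<mu> r \<xi> *v v s) $ 1 - \<i> * (symbolB \<kappa> \<gamma> \<mu> r \<xi> *v v s) $ 3) / 2) = - ((\<rho> * sqrt (\<mu> 1 \<eta>)) *\<^sub>R p1 s)"
        by (simp add: symbolB_mult om co p1_def scaleR_conv_of_real algebra_simps add_divide_distrib diff_divide_distrib)
      finally show "(n1 has_vector_derivative (- ((\<rho> * sqrt (\<mu> 1 \<eta>)) *\<^sub>R p1 s))) (at s within {0..})" .
      have "(n2 has_vector_derivative (\<i> * ((\<i> * (symbolB \<kappa> \<gamma> \<mu> r \<xi> *v v s) $ 2 - \<i> * (symbolB \<kappa> \<gamma> \<mu> r \<xi> *v v s) $ 4) / 2))) (at s within {0..})"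
        unfolding n2_def[abs_def] by (intro vd c)
      also have "\<i> * ((\<i> * (symbolB \<kappa> \<gamma> \<mu> r \<xi> *v v s) $ 2 - \<i> * (symbolB \<kappa> \<gamma> \<mu> r \<xi> *v v s) $ 4) / 2) = - ((\<rho> * sqrt (\<mu> 2 \<eta>)) *\<^sub>R p2 s)"
        by (simp add: symbolB_mult om co p2_def scaleR_conv_of_real algebra_simps add_divide_distrib diff_divide_distrib)
      finally show "(n2 has_vector_derivative (- ((\<rho> * sqrt (\<mu> 2 \<eta>)) *\<^sub>R p2 s))) (at s within {0..})" .
      have "(th has_vector_derivative (\<i> * (symbolB \<kappa> \<gamma> \<mu> r \<xi> *v v s) $ 5)) (at s within {0..})"
        unfolding th_def[abs_def] by (rule c)
      also have "\<i> * (symbolB \<kappa> \<gamma> \<mu> r \<xi> *v v s) $ 5 = (\<gamma> * \<rho>) *\<^sub>R (a 1 \<eta> *\<^sub>R p1 s + a 2 \<eta> *\<^sub>R p2 s) - (\<kappa> * \<rho>\<^sup>2) *\<^sub>R th s"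
        by (simp add: symbolB_mult om co p1_def p2_def th_def scaleR_conv_of_real algebra_simps add_divide_distrib diff_divide_distrib flip: \<rho>_def)
      finally show "(th has_vector_derivative ((\<gamma> * \<rho>) *\<^sub>R (a 1 \<eta> *\<^sub>R p1 s + a 2 \<eta> *\<^sub>R p2 s) - (\<kappa> * \<rho>\<^sup>2) *\<^sub>R th s)) (at s within {0..})" .
    qed
    \<comment> \<open>The parallelogram law halves the wave components but \<open>th\<close> is left
      unscaled, so the energy lies between one half of \<open>(norm (v s))\<^sup>2\<close> and the
      whole of it.\<close>
    moreover have En: "En (p1 s) (p2 s) (n1 s) (n2 s) (th s) = (norm (v s))\<^sup>2 / 2 + (norm (v s $ 5))\<^sup>2 / 2" for s
    proof -
      have par: "(norm ((x + y) / 2))\<^sup>2 + (norm (\<i> * ((x - y) / 2)))\<^sup>2 = (norm x)\<^sup>2 / 2 + (norm y)\<^sup>2 / 2" for x y :: complex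
      proof -
        have "norm ((x + y) / 2) = norm (x + y) / 2" by (simp add: norm_divide)
        moreover have "norm (\<i> * ((x - y) / 2)) = norm (x - y) / 2" by (simp only: norm_mult norm_divide norm_ii) simp
        ultimately show ?thesis unfolding power_divide cmod_power2
          by (simp add: power2_eq_square algebra_simps add_divide_distrib diff_divide_distrib)
      qed
      have "(norm (v s))\<^sup>2 = (norm (v s $ 1))\<^sup>2 + (norm (v s $ 2))\<^sup>2 + (norm (v s $ 3))\<^sup>2 + (norm (v s $ 4))\<^sup>2 + (norm (v s $ 5))\<^sup>2"
        by (simp add: norm_vec_def L2_set_def sum_5 sum_nonneg)
      then show ?thesis
        using par[of "v s $ 1" "v s $ 3"] par[of "v s $ 2" "v s $ 4"]
        unfolding En_def p1_def p2_def n1_def n2_def th_def by linarith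
    qed
    moreover have "(norm (v s $ 5))\<^sup>2 \<le> (norm (v s))\<^sup>2" for s
      by (intro power_mono Finite_Cartesian_Product.norm_nth_le) auto
    ultimately have "(norm (v t))\<^sup>2 / 2 \<le> 4 * exp (- (rate * (\<rho>\<^sup>2 / (1 + \<rho>\<^sup>2) * (dmin \<eta>)\<^sup>2)) * t) * (norm (v 0))\<^sup>2"
    proof -
      let ?e = "4 * exp (- (rate * (\<rho>\<^sup>2 / (1 + \<rho>\<^sup>2) * (dmin \<eta>)\<^sup>2)) * t)"
      assume 1: "En (p1 t) (p2 t) (n1 t) (n2 t) (th t) \<le> ?e * En (p1 0) (p2 0) (n1 0) (n2 0) (th 0)"
        and 2: "\<And>s. En (p1 s) (p2 s) (n1 s) (n2 s) (th s) = (norm (v s))\<^sup>2 / 2 + (norm (v s $ 5))\<^sup>2 / 2"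
        and 3: "\<And>s. (norm (v s $ 5))\<^sup>2 \<le> (norm (v s))\<^sup>2"
      have "(norm (v t))\<^sup>2 / 2 \<le> (norm (v t))\<^sup>2 / 2 + (norm (v t $ 5))\<^sup>2 / 2" by simp
      also have "\<dots> \<le> ?e * ((norm (v 0))\<^sup>2 / 2 + (norm (v 0 $ 5))\<^sup>2 / 2)" using 1 unfolding 2 .
      also have "\<dots> \<le> ?e * (norm (v 0))\<^sup>2"
      proof (rule mult_left_mono)
        show "(norm (v 0))\<^sup>2 / 2 + (norm (v 0 $ 5))\<^sup>2 / 2 \<le> (norm (v 0))\<^sup>2" using 3[of 0] by linarith
      qed simp
      finally show ?thesis .
    qed
    moreover have "0 \<le> exp (- (rate * (\<rho>\<^sup>2 / (1 + \<rho>\<^sup>2) * (dmin \<eta>)\<^sup>2)) * t) * (norm (v 0))\<^sup>2" by simp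
    \<comment> \<open>The factor is 8 at this point; rounding it up to 9 gives the constant 3 after
      taking roots, which also halves the rate.\<close>
    ultimately have "(norm (v t))\<^sup>2 \<le> 9 * exp (- (rate * (\<rho>\<^sup>2 / (1 + \<rho>\<^sup>2) * (dmin \<eta>)\<^sup>2)) * t) * (norm (v 0))\<^sup>2"
      unfolding mult.assoc[of 4] mult.assoc[of 9] by linarith
    also have "\<dots> = (3 * exp (- (R / 2) * t * (\<rho>\<^sup>2 / (1 + \<rho>\<^sup>2) * (dmin \<eta>)\<^sup>2)) * norm (v 0))\<^sup>2"
    proof -
      have "exp (- (rate * (\<rho>\<^sup>2 / (1 + \<rho>\<^sup>2) * (dmin \<eta>)\<^sup>2)) * t) = (exp (- (R / 2) * t * (\<rho>\<^sup>2 / (1 + \<rho>\<^sup>2) * (dmin \<eta>)\<^sup>2)))\<^sup>2"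
      proof -
        have "exp (- (q * z) * t) = (exp (- (q / 2) * t * z))\<^sup>2" for q z :: real
          by (simp add: power2_eq_square flip: exp_add)
        then show ?thesis unfolding R_def by blast
      qed
      then show ?thesis by (simp add: power_mult_distrib)
    qed
    finally have "norm (v t) \<le> 3 * exp (- (R / 2) * t * (\<rho>\<^sup>2 / (1 + \<rho>\<^sup>2) * (dmin \<eta>)\<^sup>2)) * norm (v 0)"
      by (rule power2_le_imp_le) simp
    then show "norm (v t) \<le> 3 * exp (- (R / 2) * t * ((norm \<xi>)\<^sup>2 / (1 + (norm \<xi>)\<^sup>2) * (dmin (dir \<xi>))\<^sup>2)) * norm (v 0)"
      by (simp add: \<rho>_def \<eta>_def)
  qed (use R in simp)
qed

section \<open>The set of hyperbolic directions\<close>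

definition Hyp :: "(real^2) set" where "Hyp = {\<eta>. hyperbolic_dir \<kappa> \<gamma> \<mu> r \<eta>}"

text \<open>A vanishing coupling splits off the corresponding pair of waves, so two unit vectors are
  eigenvectors; the length 1 serves as witness.\<close>

lemma coupling_zero_hyperbolic:
  assumes \<eta>: "norm \<eta> = 1" and z: "a j \<eta> = 0"
  shows "hyperbolic_dir_wrt \<kappa> \<gamma> \<mu> r j \<eta>" "hyperbolic_dir \<kappa> \<gamma> \<mu> r \<eta>"
proof -
  have co: "coupling r j (1 *\<^sub>R \<eta>) = 0" using \<eta> z by (simp add: coupling_eq a_def dir_def)
  have "complex_of_real (omega \<mu> j (1 *\<^sub>R \<eta>)) \<in> spectrum (symbolB \<kappa> \<gamma> \<mu> r (1 *\<^sub>R \<eta>))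
     \<and> - complex_of_real (omega \<mu> j (1 *\<^sub>R \<eta>)) \<in> spectrum (symbolB \<kappa> \<gamma> \<mu> r (1 *\<^sub>R \<eta>))"
  proof -
    have spec: "l \<in> spectrum (symbolB \<kappa> \<gamma> \<mu> r (1 *\<^sub>R \<eta>))"
      if "v \<noteq> 0" "symbolB \<kappa> \<gamma> \<mu> r (1 *\<^sub>R \<eta>) *v v = l *s v" for v l
      using that unfolding spectrum_def by blast
    have ne: "(axis i 1 :: complex^5) \<noteq> 0" for i by (simp add: axis_eq_0_iff)
    consider "j = 1" | "j = 2" using exhaust_2[of j] by blast
    then show ?thesis
    proof cases
      case 1
      have "symbolB \<kappa> \<gamma> \<mu> r (1 *\<^sub>R \<eta>) *v axis 1 1 = complex_of_real (omega \<mu> 1 (1 *\<^sub>R \<eta>)) *s axis 1 1"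
        "symbolB \<kappa> \<gamma> \<mu> r (1 *\<^sub>R \<eta>) *v axis 3 1 = - complex_of_real (omega \<mu> 1 (1 *\<^sub>R \<eta>)) *s axis 3 1"
        unfolding vec_eq_iff forall_5 symbolB_mult using co 1 by (simp_all add: axis_def)
      then show ?thesis using spec[OF ne] 1 by simp
    next
      case 2
      have "symbolB \<kappa> \<gamma> \<mu> r (1 *\<^sub>R \<eta>) *v axis 2 1 = complex_of_real (omega \<mu> 2 (1 *\<^sub>R \<eta>)) *s axis 2 1"
        "symbolB \<kappa> \<gamma> \<mu> r (1 *\<^sub>R \<eta>) *v axis 4 1 = - complex_of_real (omega \<mu> 2 (1 *\<^sub>R \<eta>)) *s axis 4 1"
        unfolding vec_eq_iff forall_5 symbolB_mult using co 2 by (simp_all add: axis_def)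
      then show ?thesis using spec[OF ne] 2 by simp
    qed
  qed
  then show "hyperbolic_dir_wrt \<kappa> \<gamma> \<mu> r j \<eta>" "hyperbolic_dir \<kappa> \<gamma> \<mu> r \<eta>"
    unfolding hyperbolic_dir_wrt_def hyperbolic_dir_def using \<eta> zero_less_one by blast+
qed

text \<open>The decay estimate itself excludes real eigenvalues: for such an \<open>l\<close>, the
  solution \<open>cis (l * t) *s w\<close> has constant norm. If \<open>dmin \<eta>\<close> were
  nonzero, the estimate at \<open>t = 3 / b\<close> would yield
  \<open>exp 3 \<le> 3\<close>.\<close>

lemma hyperbolic_imp_coupling_zero:
  assumes "hyperbolic_dir \<kappa> \<gamma> \<mu> r \<eta>"
  shows "norm \<eta> = 1" "dmin \<eta> = 0"
proof -
  show \<eta>: "norm \<eta> = 1" using assms by (simp add: hyperbolic_dir_def)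
  obtain \<rho> l where \<rho>: "\<rho> > 0" and "complex_of_real l \<in> spectrum (symbolB \<kappa> \<gamma> \<mu> r (\<rho> *\<^sub>R \<eta>))"
    using assms unfolding hyperbolic_dir_def by blast
  then obtain w where w: "w \<noteq> 0" "symbolB \<kappa> \<gamma> \<mu> r (\<rho> *\<^sub>R \<eta>) *v w = complex_of_real l *s w"
    unfolding spectrum_def by blast
  obtain c where c: "c > 0" and decay:
    "\<And>\<xi> v t. \<xi> \<noteq> 0 \<Longrightarrow> t \<ge> 0 \<Longrightarrow>
       \<forall>s\<ge>0. (v has_vector_derivative (\<i> *s (symbolB \<kappa> \<gamma> \<mu> r \<xi> *v v s))) (at s within {0..}) \<Longrightarrow>
       norm (v t) \<le> 3 * exp (- c * t * ((norm \<xi>)\<^sup>2 / (1 + (norm \<xi>)\<^sup>2) * (dmin (dir \<xi>))\<^sup>2)) * norm (v 0)"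
    by (rule symbol_energy_decay) (rule that)
  define v where "v t = cis (l * t) *s w" for t
  have ode: "(v has_vector_derivative (\<i> *s (symbolB \<kappa> \<gamma> \<mu> r (\<rho> *\<^sub>R \<eta>) *v v s))) (at s within {0..})" for s
  proof -
    have eq: "\<i> *s (symbolB \<kappa> \<gamma> \<mu> r (\<rho> *\<^sub>R \<eta>) *v v s) = (cis (l * s) * (\<i> * complex_of_real l)) *s w"
      unfolding v_def vector_scalar_commute w(2) by (simp add: vec_eq_iff mult_ac)
    have d: "((\<lambda>t. cis (l * t)) has_vector_derivative (cis (l * s) * (\<i> * complex_of_real l))) (at s within {0..})"
      using exp_scaleR_has_vector_derivative_right[of "\<i> * complex_of_real l" s "{0..}"]
      by (simp add: cis_conv_exp scaleR_conv_of_real mult_ac)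
    have "bounded_linear (\<lambda>z. z *s w)"
    proof (intro bounded_linear_intro[where K="norm w"])
      show "(x + y) *s w = x *s w + y *s w" for x y by (rule vector_sadd_rdistrib)
      show "(k *\<^sub>R x) *s w = k *\<^sub>R (x *s w)" for k x by (simp add: vec_eq_iff)
      show "norm (x *s w) \<le> norm x * norm w" for x by (simp add: norm_vector_smult)
    qed
    moreover have vf: "v = (\<lambda>t. cis (l * t) *s w)" by (simp add: v_def fun_eq_iff)
    ultimately show ?thesis
      using bounded_linear.has_vector_derivative[OF _ d, of "\<lambda>z. z *s w"] unfolding eq vf[symmetric] by blast
  qed
  show "dmin \<eta> = 0"
  proof (rule ccontr)
    assume "dmin \<eta> \<noteq> 0"
    define b where "b = c * ((norm (\<rho> *\<^sub>R \<eta>))\<^sup>2 / (1 + (norm (\<rho> *\<^sub>R \<eta>))\<^sup>2) * (dmin \<eta>)\<^sup>2)"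
    have b: "b > 0"
    proof -
      have "0 < (norm (\<rho> *\<^sub>R \<eta>))\<^sup>2" using \<rho> \<eta> by simp
      moreover from this have "0 < 1 + (norm (\<rho> *\<^sub>R \<eta>))\<^sup>2" by linarith
      moreover have "0 < (dmin \<eta>)\<^sup>2" using \<open>dmin \<eta> \<noteq> 0\<close> by simp
      ultimately show ?thesis unfolding b_def using c by (intro mult_pos_pos divide_pos_pos)
    qed
    have nw: "norm (v t) = norm w" for t by (simp add: v_def norm_vector_smult)
    have "norm w \<le> 3 * exp (- (b * t)) * norm w" if "t \<ge> 0" for t
    proof -
      have "norm (v t) \<le> 3 * exp (- c * t * ((norm (\<rho> *\<^sub>R \<eta>))\<^sup>2 / (1 + (norm (\<rho> *\<^sub>R \<eta>))\<^sup>2) * (dmin (dir (\<rho> *\<^sub>R \<eta>)))\<^sup>2)) * norm (v 0)"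
        using \<rho> \<eta> ode that by (intro decay) auto
      then show ?thesis unfolding nw dir_scale[OF \<eta> \<rho>] by (simp add: b_def mult_ac)
    qed
    then have "1 \<le> 3 * exp (- (b * t))" if "t \<ge> 0" for t
      using that w(1) mult_le_cancel_right2[of "3 * exp (- (b * t))" "norm w"] by fastforce
    from this[of "3 / b"] have "1 \<le> 3 * exp (- 3 :: real)" using b by simp
    then have "exp (3::real) \<le> 3" by (simp add: exp_minus field_simps)
    then show False using exp_ge_add_one_self[of "3::real"] by simp
  qed
qed

lemma Hyp_iff: "\<eta> \<in> Hyp \<longleftrightarrow> norm \<eta> = 1 \<and> dmin \<eta> = 0"
proof
  show "\<eta> \<in> Hyp \<Longrightarrow> norm \<eta> = 1 \<and> dmin \<eta> = 0" using hyperbolic_imp_coupling_zero by (auto simp: Hyp_def)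
  assume h: "norm \<eta> = 1 \<and> dmin \<eta> = 0"
  then have "a 1 \<eta> = 0 \<or> a 2 \<eta> = 0" by (auto simp: dmin_def min_def split: if_splits)
  then show "\<eta> \<in> Hyp" using h coupling_zero_hyperbolic(2) by (auto simp: Hyp_def)
qed

text \<open>Away from a zero continuity suffices. At a zero the nonvanishing derivative bounds the
  coupling below by a multiple of the angle, and the chord is at most the angle.\<close>

lemma coupling_local_bound:
  assumes \<eta>0: "norm \<eta>0 = 1"
  obtains c \<rho> where "c > 0" "\<rho> > 0"
    "\<And>\<eta>. norm \<eta> = 1 \<Longrightarrow> norm (\<eta> - \<eta>0) < \<rho> \<Longrightarrow> c \<le> \<bar>a j \<eta>\<bar> \<or> (a j \<eta>0 = 0 \<and> c * norm (\<eta> - \<eta>0) \<le> \<bar>a j \<eta>\<bar>)"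
proof (cases "a j \<eta>0 = 0")
  case False
  have cont: "continuous_on {\<eta>. norm \<eta> = 1} (\<lambda>\<eta>. a j \<eta>)"
    unfolding a_def by (intro continuous_intros continuous_r)
  obtain \<rho> where \<rho>: "\<rho> > 0" "\<And>\<eta>. norm \<eta> = 1 \<Longrightarrow> dist \<eta> \<eta>0 < \<rho> \<Longrightarrow> dist (a j \<eta>) (a j \<eta>0) < \<bar>a j \<eta>0\<bar> / 2"
  proof -
    have "\<forall>e>0. \<exists>d>0. \<forall>\<eta>\<in>{\<eta>. norm \<eta> = 1}. dist \<eta> \<eta>0 < d \<longrightarrow> dist (a j \<eta>) (a j \<eta>0) < e"
      using bspec[OF cont[unfolded continuous_on_iff], of \<eta>0] \<eta>0 by simp
    moreover have "\<bar>a j \<eta>0\<bar> / 2 > 0" using False by simp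
    ultimately show thesis using that by blast
  qed
  show thesis
  proof (rule that[of "\<bar>a j \<eta>0\<bar> / 2" \<rho>])
    fix \<eta> assume "norm \<eta> = 1" "norm (\<eta> - \<eta>0) < \<rho>"
    then have "\<bar>a j \<eta> - a j \<eta>0\<bar> < \<bar>a j \<eta>0\<bar> / 2" using \<rho>(2)[of \<eta>] by (simp add: dist_norm)
    then show "\<bar>a j \<eta>0\<bar> / 2 \<le> \<bar>a j \<eta>\<bar> \<or> (a j \<eta>0 = 0 \<and> \<bar>a j \<eta>0\<bar> / 2 * norm (\<eta> - \<eta>0) \<le> \<bar>a j \<eta>\<bar>)" by linarith
  qed (use False \<rho> in auto)
next
  case True
  obtain \<theta>0 D where \<theta>0: "circ \<theta>0 = \<eta>0" and der: "((\<lambda>\<phi>. coupling r j (circ \<phi>)) has_real_derivative D) (at \<theta>0)" and D: "D \<noteq> 0"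
    using first_order[OF coupling_zero_hyperbolic(1)[OF \<eta>0 True]] unfolding simple_zero_on_circle_def by blast
  have co: "coupling r j (circ \<phi>) = a j (circ \<phi>)" for \<phi> by (simp add: coupling_eq a_def dir_def)
  have "((\<lambda>\<phi>. a j (circ \<phi>) / (\<phi> - \<theta>0)) \<longlongrightarrow> D) (at \<theta>0)"
    using der True unfolding co has_field_derivative_iff by (simp add: \<theta>0)
  then have "((\<lambda>\<phi>. \<bar>a j (circ \<phi>) / (\<phi> - \<theta>0)\<bar>) \<longlongrightarrow> \<bar>D\<bar>) (at \<theta>0)" by (rule tendsto_rabs)
  from order_tendstoD(1)[OF this, of "\<bar>D\<bar> / 2"] D
  obtain \<delta> where \<delta>: "\<delta> > 0" "\<And>\<phi>. \<phi> \<noteq> \<theta>0 \<Longrightarrow> dist \<phi> \<theta>0 < \<delta> \<Longrightarrow> \<bar>D\<bar> / 2 < \<bar>a j (circ \<phi>) / (\<phi> - \<theta>0)\<bar>"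
    unfolding eventually_at by auto
  obtain \<rho> where \<rho>: "\<rho> > 0" "\<And>\<eta>. norm \<eta> = 1 \<Longrightarrow> norm (\<eta> - circ \<theta>0) < \<rho> \<Longrightarrow> \<exists>\<theta>. circ \<theta> = \<eta> \<and> \<bar>\<theta> - \<theta>0\<bar> < \<delta>"
    by (rule circ_local_lift[OF \<delta>(1), of \<theta>0]) (rule that)
  show thesis
  proof (rule that[of "\<bar>D\<bar> / 2" \<rho>])
    fix \<eta> assume \<eta>: "norm \<eta> = 1" "norm (\<eta> - \<eta>0) < \<rho>"
    obtain \<theta> where \<theta>: "circ \<theta> = \<eta>" "\<bar>\<theta> - \<theta>0\<bar> < \<delta>" using \<rho>(2)[OF \<eta>(1)] \<eta>(2) \<theta>0 by blast
    have "\<bar>D\<bar> / 2 * norm (\<eta> - \<eta>0) \<le> \<bar>D\<bar> / 2 * \<bar>\<theta> - \<theta>0\<bar>"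
      using norm_circ_diff_le[of \<theta> \<theta>0] unfolding \<theta>(1) \<theta>0 by (intro mult_left_mono) auto
    also have "\<dots> \<le> \<bar>a j \<eta>\<bar>"
    proof (cases "\<theta> = \<theta>0")
      case False
      then have "\<bar>D\<bar> / 2 < \<bar>a j \<eta> / (\<theta> - \<theta>0)\<bar>" using \<delta>(2)[of \<theta>] \<theta> by (simp add: dist_real_def)
      then show ?thesis using False by (simp add: less_divide_eq less_imp_le)
    qed simp
    finally show "\<bar>D\<bar> / 2 \<le> \<bar>a j \<eta>\<bar> \<or> (a j \<eta>0 = 0 \<and> \<bar>D\<bar> / 2 * norm (\<eta> - \<eta>0) \<le> \<bar>a j \<eta>\<bar>)" using True by blast
  qed (use D \<rho> in auto)
qed

lemma dmin_local_bound:
  assumes \<eta>0: "norm \<eta>0 = 1"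
  shows "\<exists>c>0. \<exists>\<rho>>0. \<forall>\<eta>. norm \<eta> = 1 \<and> norm (\<eta> - \<eta>0) < \<rho> \<longrightarrow> c \<le> dmin \<eta> \<or> (\<eta>0 \<in> Hyp \<and> c * norm (\<eta> - \<eta>0) \<le> dmin \<eta>)"
proof -
  obtain c1 \<rho>1 where 1: "c1 > 0" "\<rho>1 > 0"
    "\<And>\<eta>. norm \<eta> = 1 \<Longrightarrow> norm (\<eta> - \<eta>0) < \<rho>1 \<Longrightarrow> c1 \<le> \<bar>a 1 \<eta>\<bar> \<or> (a 1 \<eta>0 = 0 \<and> c1 * norm (\<eta> - \<eta>0) \<le> \<bar>a 1 \<eta>\<bar>)"
    by (rule coupling_local_bound[OF \<eta>0, of 1]) (rule that)
  obtain c2 \<rho>2 where 2: "c2 > 0" "\<rho>2 > 0"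
    "\<And>\<eta>. norm \<eta> = 1 \<Longrightarrow> norm (\<eta> - \<eta>0) < \<rho>2 \<Longrightarrow> c2 \<le> \<bar>a 2 \<eta>\<bar> \<or> (a 2 \<eta>0 = 0 \<and> c2 * norm (\<eta> - \<eta>0) \<le> \<bar>a 2 \<eta>\<bar>)"
    by (rule coupling_local_bound[OF \<eta>0, of 2]) (rule that)
  \<comment> \<open>Distances on the circle are at most 2, so after halving a constant lower bound
    also implies one proportional to the distance; in this way one inequality covers both
    couplings.\<close>
  define c where "c = min c1 c2 / 2"
  have c: "c > 0" "2 * c \<le> c1" "2 * c \<le> c2" using 1 2 by (auto simp: c_def)
  show ?thesis
  proof (rule exI[of _ c], intro conjI c(1), rule exI[of _ "min \<rho>1 \<rho>2"], intro conjI allI impI)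
    fix \<eta> assume \<eta>: "norm \<eta> = 1 \<and> norm (\<eta> - \<eta>0) < min \<rho>1 \<rho>2"
    let ?n = "norm (\<eta> - \<eta>0)"
    have n2: "?n \<le> 2" using norm_triangle_ineq4[of \<eta> \<eta>0] \<eta> \<eta>0 by simp
    have n: "c * ?n \<le> c1" "c * ?n \<le> c2" using mult_left_mono[OF n2, of c] c by linarith+
    have m: "c * ?n \<le> c1 * ?n" "c * ?n \<le> c2 * ?n" using c by (auto intro!: mult_right_mono)
    have H: "\<eta>0 \<in> Hyp" if "a 1 \<eta>0 = 0 \<or> a 2 \<eta>0 = 0" using that \<eta>0 by (auto simp: Hyp_iff dmin_def)
    have d1: "c1 \<le> \<bar>a 1 \<eta>\<bar> \<or> (a 1 \<eta>0 = 0 \<and> c1 * ?n \<le> \<bar>a 1 \<eta>\<bar>)" using 1(3)[of \<eta>] \<eta> by simp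
    have d2: "c2 \<le> \<bar>a 2 \<eta>\<bar> \<or> (a 2 \<eta>0 = 0 \<and> c2 * ?n \<le> \<bar>a 2 \<eta>\<bar>)" using 2(3)[of \<eta>] \<eta> by simp
    have "c * ?n \<le> \<bar>a 1 \<eta>\<bar>" "c * ?n \<le> \<bar>a 2 \<eta>\<bar>" using d1 d2 n m by linarith+
    then have "c * ?n \<le> dmin \<eta>" by (simp add: dmin_def)
    moreover have "c \<le> dmin \<eta>" if "\<eta>0 \<notin> Hyp"
    proof -
      have "a 1 \<eta>0 \<noteq> 0" "a 2 \<eta>0 \<noteq> 0" using H that by auto
      then have "c1 \<le> \<bar>a 1 \<eta>\<bar>" "c2 \<le> \<bar>a 2 \<eta>\<bar>" using d1 d2 by auto
      then show ?thesis using c by (simp add: dmin_def)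
    qed
    ultimately show "c \<le> dmin \<eta> \<or> (\<eta>0 \<in> Hyp \<and> c * ?n \<le> dmin \<eta>)" by blast
  qed (use 1 2 in auto)
qed

text \<open>Finitely many of the local neighbourhoods cover the circle. In each of them
  \<open>dmin\<close> vanishes at most at the centre, so every hyperbolic direction is one of these
  centres: finiteness is a consequence of the simplicity of the zeros.\<close>

lemma Hyp_finite_and_bound:
  shows "finite Hyp" and "\<exists>c>0. \<forall>\<eta>. norm \<eta> = 1 \<longrightarrow> c \<le> dmin \<eta> \<or> (\<exists>z\<in>Hyp. c * norm (\<eta> - z) \<le> dmin \<eta>)"
proof -
  obtain c \<rho> where c: "\<And>\<eta>0. norm \<eta>0 = 1 \<Longrightarrow> c \<eta>0 > 0" "\<And>\<eta>0. norm \<eta>0 = 1 \<Longrightarrow> \<rho> \<eta>0 > 0"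
    "\<And>\<eta>0 \<eta>. norm \<eta>0 = 1 \<Longrightarrow> norm \<eta> = 1 \<Longrightarrow> norm (\<eta> - \<eta>0) < \<rho> \<eta>0 \<Longrightarrow> c \<eta>0 \<le> dmin \<eta> \<or> (\<eta>0 \<in> Hyp \<and> c \<eta>0 * norm (\<eta> - \<eta>0) \<le> dmin \<eta>)"
    using dmin_local_bound by metis
  have cover: "{\<eta>. norm \<eta> = 1} \<subseteq> (\<Union>\<eta>0\<in>{\<eta>. norm \<eta> = 1}. ball \<eta>0 (\<rho> \<eta>0))" using c(2) by force
  obtain T where T: "T \<subseteq> {\<eta>. norm \<eta> = 1}" "finite T" "{\<eta>. norm \<eta> = 1} \<subseteq> (\<Union>\<eta>0\<in>T. ball \<eta>0 (\<rho> \<eta>0))"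
    by (rule compactE_image[OF compact_circle _ cover]) auto
  have pick: "\<exists>\<eta>0\<in>T. norm \<eta>0 = 1 \<and> norm (\<eta> - \<eta>0) < \<rho> \<eta>0" if "norm \<eta> = 1" for \<eta>
    using T(1,3) that by (force simp: dist_norm norm_minus_commute)
  have Tne: "T \<noteq> {}" using pick[of "circ 0"] by auto
  have "Hyp \<subseteq> T"
  proof
    fix \<eta> assume "\<eta> \<in> Hyp"
    then have \<eta>: "norm \<eta> = 1" "dmin \<eta> = 0" by (auto simp: Hyp_iff)
    obtain \<eta>0 where \<eta>0: "\<eta>0 \<in> T" "norm \<eta>0 = 1" "norm (\<eta> - \<eta>0) < \<rho> \<eta>0" using pick[OF \<eta>(1)] by blast
    then have "c \<eta>0 * norm (\<eta> - \<eta>0) \<le> 0" using c(3)[OF \<eta>0(2) \<eta>(1) \<eta>0(3)] c(1)[OF \<eta>0(2)] \<eta>(2) by auto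
    then have "\<eta> = \<eta>0" using c(1)[OF \<eta>0(2)] by (simp add: mult_le_0_iff)
    then show "\<eta> \<in> T" using \<eta>0 by simp
  qed
  then show "finite Hyp" using T(2) finite_subset by blast
  define m where "m = Min (c ` T)"
  have m: "m > 0" unfolding m_def using T Tne c(1) by (subst Min_gr_iff) auto
  have mle: "m \<le> c \<eta>0" if "\<eta>0 \<in> T" for \<eta>0 unfolding m_def using T(2) that by (intro Min_le) auto
  show "\<exists>c>0. \<forall>\<eta>. norm \<eta> = 1 \<longrightarrow> c \<le> dmin \<eta> \<or> (\<exists>z\<in>Hyp. c * norm (\<eta> - z) \<le> dmin \<eta>)"
  proof (intro exI[of _ m] conjI m allI impI)
    fix \<eta> :: "real^2" assume \<eta>: "norm \<eta> = 1"
    obtain \<eta>0 where \<eta>0: "\<eta>0 \<in> T" "norm \<eta>0 = 1" "norm (\<eta> - \<eta>0) < \<rho> \<eta>0" using pick[OF \<eta>] by blast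
    from c(3)[OF \<eta>0(2) \<eta> \<eta>0(3)] show "m \<le> dmin \<eta> \<or> (\<exists>z\<in>Hyp. m * norm (\<eta> - z) \<le> dmin \<eta>)"
    proof
      assume "\<eta>0 \<in> Hyp \<and> c \<eta>0 * norm (\<eta> - \<eta>0) \<le> dmin \<eta>"
      moreover have "m * norm (\<eta> - \<eta>0) \<le> c \<eta>0 * norm (\<eta> - \<eta>0)" using mle[OF \<eta>0(1)] by (intro mult_right_mono) auto
      ultimately show ?thesis by (meson order_trans)
    qed (use mle[OF \<eta>0(1)] in linarith)
  qed
qed

end

section \<open>Multiplier estimates\<close>

text \<open>Young's inequality with the weights \<open>p * \<theta>\<close> and
  \<open>p / q\<close>, which add up to 1, is applied pointwise after normalising and then
  integrated. Since \<open>W\<close> and \<open>N\<close> are positive upper bounds rather than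
  norms, the normalisation is always possible.\<close>

lemma holder_normalised:
  fixes w G :: "'a \<Rightarrow> real" and p q :: real
  assumes p: "0 < p" "p < q" and \<theta>: "\<theta> = 1 / p - 1 / q"
    and [measurable]: "w \<in> borel_measurable M" "G \<in> borel_measurable M" and nn: "\<And>x. 0 \<le> w x" "\<And>x. 0 \<le> G x"
    and W: "W > 0" "(\<integral>\<^sup>+x. ennreal (w x powr (1 / \<theta>)) \<partial>M) \<le> ennreal (W powr (1 / \<theta>))"
    and N: "N > 0" "(\<integral>\<^sup>+x. ennreal (G x powr q) \<partial>M) \<le> ennreal (N powr q)"
  shows "(\<integral>\<^sup>+x. ennreal ((w x * G x) powr p) \<partial>M) \<le> ennreal ((W * N) powr p)"
proof -
  have q: "q > 0" using p by linarith
  have \<theta>0: "\<theta> > 0" using p q by (simp add: \<theta> field_simps)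
  have sum1: "p * \<theta> + p / q = 1" using p q by (simp add: \<theta> field_simps)
  have young: "(w x * G x) powr p \<le> (W * N) powr p * (p * \<theta> * (w x / W) powr (1 / \<theta>) + p / q * (G x / N) powr q)" for x
  proof (cases "w x = 0 \<or> G x = 0")
    case True
    then have "(w x * G x) powr p = 0" using p by auto
    moreover have "0 \<le> (W * N) powr p * (p * \<theta> * (w x / W) powr (1 / \<theta>) + p / q * (G x / N) powr q)"
      using p q \<theta>0 by auto
    ultimately show ?thesis by linarith
  next
    case False
    then have pos: "w x / W > 0" "G x / N > 0" using nn[of x] W N by (auto simp: less_le)
    have "((w x / W) powr (1 / \<theta>)) powr (p * \<theta>) * ((G x / N) powr q) powr (p / q) \<le> p * \<theta> * (w x / W) powr (1 / \<theta>) + p / q * (G x / N) powr q"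
      using pos p q \<theta>0 sum1 by (intro Youngs_inequality_0) auto
    moreover have "((w x / W) powr (1 / \<theta>)) powr (p * \<theta>) * ((G x / N) powr q) powr (p / q) = (w x / W) powr p * (G x / N) powr p"
      using \<theta>0 q by (simp add: powr_powr)
    moreover have "(w x * G x) powr p = (W * N) powr p * ((w x / W) powr p * (G x / N) powr p)"
      using W N nn[of x] by (simp add: powr_mult powr_divide)
    ultimately show ?thesis using W N by (simp add: mult_left_mono)
  qed
  have "(\<integral>\<^sup>+x. ennreal ((w x * G x) powr p) \<partial>M)
    \<le> (\<integral>\<^sup>+x. ennreal ((W * N) powr p * (p * \<theta> * W powr (- 1 / \<theta>))) * ennreal (w x powr (1 / \<theta>)) + ennreal ((W * N) powr p * (p / q * N powr (- q))) * ennreal (G x powr q) \<partial>M)"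
  proof (rule nn_integral_mono)
    fix x
    have "ennreal ((w x * G x) powr p) \<le> ennreal ((W * N) powr p * (p * \<theta> * (w x / W) powr (1 / \<theta>) + p / q * (G x / N) powr q))"
      by (rule ennreal_leI[OF young])
    also have "(W * N) powr p * (p * \<theta> * (w x / W) powr (1 / \<theta>) + p / q * (G x / N) powr q)
      = (W * N) powr p * (p * \<theta> * W powr (- 1 / \<theta>)) * w x powr (1 / \<theta>) + (W * N) powr p * (p / q * N powr (- q)) * G x powr q"
      using W N nn[of x] by (simp add: powr_divide powr_minus_divide distrib_left)
    also have "ennreal \<dots> = ennreal ((W * N) powr p * (p * \<theta> * W powr (- 1 / \<theta>))) * ennreal (w x powr (1 / \<theta>)) + ennreal ((W * N) powr p * (p / q * N powr (- q))) * ennreal (G x powr q)"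
      using p q \<theta>0 by (subst ennreal_plus) (auto simp flip: ennreal_mult)
    finally show "ennreal ((w x * G x) powr p) \<le> \<dots>" .
  qed
  also have "\<dots> = ennreal ((W * N) powr p * (p * \<theta> * W powr (- 1 / \<theta>))) * (\<integral>\<^sup>+x. ennreal (w x powr (1 / \<theta>)) \<partial>M) + ennreal ((W * N) powr p * (p / q * N powr (- q))) * (\<integral>\<^sup>+x. ennreal (G x powr q) \<partial>M)"
    by (simp add: nn_integral_add nn_integral_cmult)
  also have "\<dots> \<le> ennreal ((W * N) powr p * (p * \<theta> * W powr (- 1 / \<theta>))) * ennreal (W powr (1 / \<theta>)) + ennreal ((W * N) powr p * (p / q * N powr (- q))) * ennreal (N powr q)"
    by (intro add_mono mult_left_mono W N) auto
  also have "\<dots> = ennreal ((W * N) powr p * (p * \<theta> * W powr (- 1 / \<theta>)) * W powr (1 / \<theta>) + (W * N) powr p * (p / q * N powr (- q)) * N powr q)"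
    using p q \<theta>0 by (subst ennreal_plus) (auto simp flip: ennreal_mult)
  also have "(W * N) powr p * (p * \<theta> * W powr (- 1 / \<theta>)) * W powr (1 / \<theta>) + (W * N) powr p * (p / q * N powr (- q)) * N powr q = (W * N) powr p * (p * \<theta> + p / q)"
    using W N by (simp add: powr_minus_divide distrib_left)
  finally show ?thesis unfolding sum1 by simp
qed

text \<open>The norm of \<open>w\<close> in \<open>L\<^sup>a\<close> with \<open>1/a = 1/p - 1/q\<close> is at most \<open>W\<close>; for \<open>p = 2\<close> this is the supremum norm.\<close>

definition weight_norm_le :: "real \<Rightarrow> real \<Rightarrow> (real^2 \<Rightarrow> real) \<Rightarrow> real \<Rightarrow> bool" where
  "weight_norm_le p q w W \<longleftrightarrow>
     (if p < 2 then (\<integral>\<^sup>+\<xi>. ennreal (w \<xi> powr (1 / (1 / p - 1 / q))) \<partial>lborel) \<le> ennreal (W powr (1 / (1 / p - 1 / q)))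
      else \<forall>\<xi>. w \<xi> \<le> W)"

text \<open>The condition \<open>u \<le> 1\<close> bounds the supremum norm by \<open>B\<close> for
  \<open>p = 2\<close>, where \<open>\<theta> = 0\<close>; the integral of \<open>u\<close> is used
  for \<open>p < 2\<close>. The constant is \<open>1 + K\<close> rather than \<open>K\<close>
  because \<open>K\<close> may be 0 and \<open>0 powr 0 = 0\<close>.\<close>

lemma weight_norm_leI:
  fixes p q :: real
  defines "\<theta> \<equiv> 1 / p - 1 / q"
  assumes pq: "1 < p" "p \<le> 2" "p * q = p + q"
    and B: "B > 0" and K: "K \<ge> 0" and T: "T > 0" and w: "\<And>\<xi>. 0 \<le> w \<xi>" "\<And>\<xi>. w \<xi> \<le> B * u \<xi>"
    and u: "\<And>\<xi>. 0 \<le> u \<xi>" "\<And>\<xi>. u \<xi> \<le> 1" "u \<in> borel_measurable borel"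
    and int: "p < 2 \<Longrightarrow> (\<integral>\<^sup>+\<xi>. ennreal (u \<xi> powr (1 / \<theta>)) \<partial>lborel) \<le> ennreal (K * T)"
  shows "weight_norm_le p q w (B * (1 + K) powr \<theta> * T powr \<theta>)"
proof (cases "p < 2")
  case True
  have q: "q > 2" using powr_dual_gt_2(2)[OF pq True] .
  have \<theta>: "\<theta> > 0" using pq True q by (simp add: \<theta>_def field_simps)
  note [measurable] = u(3)
  have "(\<integral>\<^sup>+\<xi>. ennreal (w \<xi> powr (1 / \<theta>)) \<partial>lborel) \<le> (\<integral>\<^sup>+\<xi>. ennreal (B powr (1 / \<theta>)) * ennreal (u \<xi> powr (1 / \<theta>)) \<partial>lborel)"
  proof (rule nn_integral_mono)
    fix \<xi>
    have "w \<xi> powr (1 / \<theta>) \<le> (B * u \<xi>) powr (1 / \<theta>)" using w \<theta> by (intro powr_mono2) auto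
    also have "\<dots> = B powr (1 / \<theta>) * u \<xi> powr (1 / \<theta>)" using B u by (simp add: powr_mult)
    finally show "ennreal (w \<xi> powr (1 / \<theta>)) \<le> ennreal (B powr (1 / \<theta>)) * ennreal (u \<xi> powr (1 / \<theta>))"
      by (simp flip: ennreal_mult)
  qed
  also have "\<dots> = ennreal (B powr (1 / \<theta>)) * (\<integral>\<^sup>+\<xi>. ennreal (u \<xi> powr (1 / \<theta>)) \<partial>lborel)"
    by (rule nn_integral_cmult) measurable
  also have "\<dots> \<le> ennreal (B powr (1 / \<theta>)) * ennreal ((1 + K) * T)"
    using T by (intro mult_left_mono order_trans[OF int[OF True]] ennreal_leI mult_right_mono) auto
  also have "\<dots> = ennreal ((B * (1 + K) powr \<theta> * T powr \<theta>) powr (1 / \<theta>))"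
    using B K T \<theta> by (simp add: powr_mult powr_powr mult.assoc flip: ennreal_mult)
  finally show ?thesis using True by (simp add: weight_norm_le_def \<theta>_def)
next
  case False
  then have "p = 2" "q = 2" using pq powr_dual_gt_2(3)[OF pq] by auto
  then have "\<theta> = 0" by (simp add: \<theta>_def)
  moreover have "w \<xi> \<le> B" for \<xi> using w(2)[of \<xi>] mult_left_mono[OF u(2)[of \<xi>], of B] B by linarith
  ultimately show ?thesis using False K T by (simp add: weight_norm_le_def)
qed

lemma weighted_norm_bound:
  fixes g G :: "real^2 \<Rightarrow> complex^'n" and p q :: real
  assumes pq: "1 < p" "p \<le> 2" "p * q = p + q"
    and w: "w \<in> borel_measurable borel" "\<And>\<xi>. 0 \<le> w \<xi>" and W: "W > 0" "weight_norm_le p q w W"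
    and G: "G \<in> borel_measurable borel" and N: "N > 0" "(\<integral>\<^sup>+\<xi>. ennreal (norm (G \<xi>) powr q) \<partial>lborel) \<le> ennreal (N powr q)"
    and le: "AE \<xi> in lborel. norm (g \<xi>) \<le> w \<xi> * norm (G \<xi>)"
  shows "(\<integral>\<^sup>+\<xi>. ennreal (norm (g \<xi>) powr p) \<partial>lborel) \<le> ennreal ((W * N) powr p)"
proof -
  note [measurable] = w(1) G
  have "(\<integral>\<^sup>+\<xi>. ennreal (norm (g \<xi>) powr p) \<partial>lborel) \<le> (\<integral>\<^sup>+\<xi>. ennreal ((w \<xi> * norm (G \<xi>)) powr p) \<partial>lborel)"
  proof (rule nn_integral_mono_AE)
    show "AE \<xi> in lborel. ennreal (norm (g \<xi>) powr p) \<le> ennreal ((w \<xi> * norm (G \<xi>)) powr p)"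
      using le by eventually_elim (use pq in \<open>auto intro!: ennreal_leI powr_mono2\<close>)
  qed
  also have "\<dots> \<le> ennreal ((W * N) powr p)"
  proof (cases "p < 2")
    case True
    then show ?thesis
      using pq w W G N powr_dual_gt_2(2)[OF pq True] by (intro holder_normalised[where q=q and \<theta>="1 / p - 1 / q"]) (auto simp: weight_norm_le_def)
  next
    case False
    then have "p = 2" "q = 2" using pq powr_dual_gt_2(3)[OF pq] by auto
    have wW: "w \<xi> \<le> W" for \<xi> using W(2) False by (simp add: weight_norm_le_def)
    have "(\<integral>\<^sup>+\<xi>. ennreal ((w \<xi> * norm (G \<xi>)) powr p) \<partial>lborel) \<le> (\<integral>\<^sup>+\<xi>. ennreal (W powr p) * ennreal (norm (G \<xi>) powr p) \<partial>lborel)"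
    proof (rule nn_integral_mono)
      fix \<xi>
      have "(w \<xi> * norm (G \<xi>)) powr p \<le> (W * norm (G \<xi>)) powr p"
        using pq w wW by (intro powr_mono2 mult_right_mono) auto
      then show "ennreal ((w \<xi> * norm (G \<xi>)) powr p) \<le> ennreal (W powr p) * ennreal (norm (G \<xi>) powr p)"
        using W by (simp add: powr_mult flip: ennreal_mult)
    qed
    also have "\<dots> = ennreal (W powr p) * (\<integral>\<^sup>+\<xi>. ennreal (norm (G \<xi>) powr p) \<partial>lborel)"
      by (rule nn_integral_cmult) measurable
    also have "\<dots> \<le> ennreal (W powr p) * ennreal (N powr p)"
      using N(2) unfolding \<open>q = 2\<close> \<open>p = 2\<close> by (intro mult_left_mono) auto
    finally show ?thesis using W N by (simp add: powr_mult flip: ennreal_mult)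
  qed
  finally show ?thesis .
qed

section \<open>Bounds between \<open>L^p\<close> and Sobolev norms\<close>

lemma Lp_norm_leI:
  assumes "q > 0" "N \<ge> 0" "(\<integral>\<^sup>+x. ennreal (norm (f x) powr q) \<partial>lborel) \<le> ennreal (N powr q)"
  shows "Lp_norm q f \<le> ennreal N"
proof -
  let ?I = "\<integral>\<^sup>+x. ennreal (norm (f x) powr q) \<partial>lborel"
  have fin: "?I \<noteq> \<infinity>" using assms(3) by (auto simp: top_unique)
  have "enn2real ?I \<le> N powr q" using assms(3) enn2real_leI by (metis powr_ge_zero)
  then have "enn2real ?I powr (1 / q) \<le> (N powr q) powr (1 / q)" using assms(1) by (intro powr_mono2) auto
  also have "\<dots> = N" using assms by (simp add: powr_powr)
  finally show ?thesis using fin by (simp add: Lp_norm_def Let_def ennreal_leI)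
qed

lemma Lp_norm_leD:
  assumes "p > 0" "N > 0" "Lp_norm p f \<le> ennreal N"
  shows "(\<integral>\<^sup>+x. ennreal (norm (f x) powr p) \<partial>lborel) \<le> ennreal (N powr p)"
proof -
  let ?I = "\<integral>\<^sup>+x. ennreal (norm (f x) powr p) \<partial>lborel"
  have fin: "?I \<noteq> \<infinity>" using assms(3) by (auto simp: Lp_norm_def Let_def top_unique split: if_splits)
  then have "enn2real ?I powr (1 / p) \<le> N" using assms by (simp add: Lp_norm_def Let_def)
  then have "(enn2real ?I powr (1 / p)) powr p \<le> N powr p" using assms(1) by (intro powr_mono2) auto
  then have "enn2real ?I \<le> N powr p" using assms(1) by (simp add: powr_powr)
  then have "ennreal (enn2real ?I) \<le> ennreal (N powr p)" by (rule ennreal_leI)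
  moreover have "ennreal (enn2real ?I) = ?I" using fin by (simp add: less_top)
  ultimately show ?thesis by simp
qed

text \<open>Hausdorff-Young is available for positive bounds \<open>N\<close>, while the norm may be
  0 or infinite. So \<open>N\<close> approaches the norm from above, and an infinite norm leaves
  nothing to prove.\<close>

lemma Lp_norm_transfer:
  assumes p: "p > 0" and q: "q > 0" and K: "K > 0"
    and b: "\<And>N. N > 0 \<Longrightarrow> (\<integral>\<^sup>+x. ennreal (norm (F x) powr p) \<partial>lborel) \<le> ennreal (N powr p)
       \<Longrightarrow> (\<integral>\<^sup>+x. ennreal (norm (X x) powr q) \<partial>lborel) \<le> ennreal ((K * N) powr q)"
  shows "Lp_norm q X \<le> ennreal K * Lp_norm p F"
proof (cases "Lp_norm p F")
  case (real y)
  show ?thesis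
  proof (rule ennreal_le_epsilon)
    fix e :: real assume e: "e > 0"
    define N where "N = y + e / K"
    have N: "N > 0" using e K real by (simp add: N_def add_nonneg_pos)
    have "Lp_norm p F \<le> ennreal N" using real e K by (auto simp: N_def intro!: ennreal_leI)
    from b[OF N Lp_norm_leD[OF p N this]]
    have "Lp_norm q X \<le> ennreal (K * N)" using q K N by (intro Lp_norm_leI) auto
    also have "K * N = K * y + e" using K by (simp add: N_def distrib_left)
    also have "ennreal \<dots> = ennreal K * Lp_norm p F + ennreal e" using real K e by (simp add: ennreal_mult)
    finally show "Lp_norm q X \<le> ennreal K * Lp_norm p F + ennreal e" .
  qed
next
  case top
  then show ?thesis using K by (simp add: ennreal_mult_top)
qed

lemma mat_mult_vec: "mat c *v (v :: complex^'n) = c *s v"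
  by (simp add: vec_eq_iff matrix_vector_mult_def mat_def if_distrib[where f="\<lambda>x. x * _"] cong: if_cong)

lemma scalar_op_eq: "scalar_op m f = inv_fourier (\<lambda>\<xi>. complex_of_real (m \<xi>) *s fourier f \<xi>)"
  by (simp add: scalar_op_def mult_op_def mat_mult_vec)

lemma bracket_powr_mono:
  "a \<le> b \<Longrightarrow> (1 + (norm (\<xi> :: real^2))\<^sup>2) powr a \<le> (1 + (norm \<xi>)\<^sup>2) powr b"
  by (intro powr_mono) auto

lemma integrable_bracket_fourier:
  fixes V0 :: "real^2 \<Rightarrow> complex^'n"
  assumes V0: "schwartz V0"
  shows "integrable lborel (\<lambda>\<xi>. complex_of_real ((1 + (norm \<xi>)\<^sup>2) powr \<sigma>) *s fourier V0 \<xi>)"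
    and "continuous_on UNIV (\<lambda>\<xi>. complex_of_real ((1 + (norm \<xi>)\<^sup>2) powr \<sigma>) *s fourier V0 \<xi>)"
proof -
  have F: "continuous_on UNIV (fourier V0)" by (rule continuous_on_fourier[OF schwartz_integrable[OF V0]])
  have "continuous_on UNIV (\<lambda>\<xi>::real^2. (1 + (norm \<xi>)\<^sup>2) powr \<sigma>)"
  proof (intro continuous_intros ballI)
    show "1 + (norm x)\<^sup>2 \<noteq> 0" for x :: "real^2" using add_pos_nonneg[OF zero_less_one zero_le_power2[of "norm x"]] by simp
  qed
  then have c1: "continuous_on UNIV (\<lambda>\<xi>. (1 + (norm \<xi>)\<^sup>2) powr \<sigma> *\<^sub>R fourier V0 \<xi>)"
    by (intro continuous_on_scaleR F)
  have sc: "(\<lambda>\<xi>. (1 + (norm \<xi>)\<^sup>2) powr \<sigma> *\<^sub>R fourier V0 \<xi>) = (\<lambda>\<xi>. complex_of_real ((1 + (norm \<xi>)\<^sup>2) powr \<sigma>) *s fourier V0 \<xi>)"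
    by (simp add: fun_eq_iff vec_eq_iff scaleR_conv_of_real[where 'a=complex])
  show cont: "continuous_on UNIV (\<lambda>\<xi>. complex_of_real ((1 + (norm \<xi>)\<^sup>2) powr \<sigma>) *s fourier V0 \<xi>)"
    using c1 unfolding sc .
  obtain C where C: "C > 0" "\<And>\<xi>. norm (fourier V0 \<xi>) \<le> C * (1 + (norm \<xi>)\<^sup>2) powr (- (\<sigma> + 2))"
    by (rule schwartz_fourier_decay[OF V0]) (rule that)
  show "integrable lborel (\<lambda>\<xi>. complex_of_real ((1 + (norm \<xi>)\<^sup>2) powr \<sigma>) *s fourier V0 \<xi>)"
  proof (rule Bochner_Integration.integrable_bound)
    show "integrable lborel (\<lambda>\<xi>::real^2. C * (1 + (norm \<xi>)\<^sup>2) powr (-2))" using integrable_sobolev_weight[of 4] by simp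
    show "(\<lambda>\<xi>. complex_of_real ((1 + (norm \<xi>)\<^sup>2) powr \<sigma>) *s fourier V0 \<xi>) \<in> borel_measurable lborel"
      using borel_measurable_continuous_onI[OF cont] by simp
    show "AE \<xi> in lborel. norm (complex_of_real ((1 + (norm \<xi>)\<^sup>2) powr \<sigma>) *s fourier V0 \<xi>) \<le> norm (C * (1 + (norm \<xi>)\<^sup>2) powr (-2))"
    proof (rule AE_I2)
      fix \<xi> :: "real^2"
      have "norm (complex_of_real ((1 + (norm \<xi>)\<^sup>2) powr \<sigma>) *s fourier V0 \<xi>) \<le> (1 + (norm \<xi>)\<^sup>2) powr \<sigma> * (C * (1 + (norm \<xi>)\<^sup>2) powr (- (\<sigma> + 2)))"
        unfolding norm_vector_smult norm_of_real by (intro mult_mono C) auto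
      also have "\<dots> = C * (1 + (norm \<xi>)\<^sup>2) powr (-2)" by (simp add: powr_add[symmetric])
      finally show "norm (complex_of_real ((1 + (norm \<xi>)\<^sup>2) powr \<sigma>) *s fourier V0 \<xi>) \<le> norm (C * (1 + (norm \<xi>)\<^sup>2) powr (-2))" using C by simp
    qed
  qed
qed

text \<open>Fourier inversion for Schwartz functions. It turns the low-frequency estimates into the
  case of regularity 0 of the general multiplier estimate.\<close>

lemma Sobolev_norm_0:
  fixes V0 :: "real^2 \<Rightarrow> complex^'n"
  assumes V0: "schwartz V0"
  shows "Sobolev_norm p 0 V0 = Lp_norm p V0"
proof -
  have V0i: "integrable lborel V0" by (rule schwartz_integrable[OF V0])
  have one: "complex_of_real ((1 + (norm \<xi>)\<^sup>2) powr 0) *s v = v" for \<xi> :: "real^2" and v :: "complex^'n"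
    using add_pos_nonneg[OF zero_less_one zero_le_power2[of "norm \<xi>"]] by simp
  have Fi: "integrable lborel (fourier V0)" using integrable_bracket_fourier(1)[OF V0, of 0] unfolding one .
  have "inv_fourier (fourier V0) x = V0 x" for x
  proof (subst vec_eq_iff, rule allI)
    fix i
    have g: "integrable lborel (\<lambda>x. V0 x $ i)" by (rule integrable_vec_nth[OF V0i])
    have i2: "integrable lborel (sft (\<lambda>x. V0 x $ i))"
      using integrable_vec_nth[OF Fi, of i] by (simp add: fourier_nth[OF V0i])
    have "isCont (\<lambda>x. V0 x $ i) x"
      using schwartz_continuous[OF V0] by (intro continuous_intros) (auto simp: continuous_on_eq_continuous_at)
    from sft_inversion[OF g i2 this]
    show "inv_fourier (fourier V0) x $ i = V0 x $ i" by (simp add: fourier_nth[OF Fi] fourier_nth[OF V0i])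
  qed
  then have "scalar_op (\<lambda>\<xi>. (1 + (norm \<xi>)\<^sup>2) powr (0 / 2)) V0 = V0"
    unfolding scalar_op_eq div_0 one by (simp add: fun_eq_iff)
  then show ?thesis by (simp add: Sobolev_norm_def)
qed

text \<open>Differentiability is given for positive arguments only; close to 0 the cut-off is
  constant.\<close>

lemma cutoff_continuous:
  assumes "cutoff \<epsilon> h" "\<epsilon> > 0"
  shows "continuous_on {0..} h"
proof -
  have d: "h differentiable (at s)" if "s > 0" for s
  proof -
    have "((deriv ^^ 0) h) differentiable (at s)" using assms that unfolding cutoff_def by blast
    then show ?thesis by simp
  qed
  have z: "h s = 0" if "0 \<le> s" "s \<le> \<epsilon>" for s using assms that unfolding cutoff_def by blast
  have "continuous_on ({0..\<epsilon>} \<union> {\<epsilon>..}) h"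
  proof (intro continuous_on_closed_Un)
    show "continuous_on {0..\<epsilon>} h" using z by (subst continuous_on_cong[where g="\<lambda>_. 0"]) auto
    show "continuous_on {\<epsilon>..} h"
      using d assms(2) by (intro continuous_at_imp_continuous_on ballI differentiable_imp_continuous_within) auto
  qed auto
  moreover have "{0..\<epsilon>} \<union> {\<epsilon>..} = {0..}" using assms(2) by auto
  ultimately show ?thesis by simp
qed

lemma cutoff_bounded:
  assumes "cutoff \<epsilon> h" "\<epsilon> > 0"
  obtains B where "B \<ge> 1" "\<And>s. s \<ge> 0 \<Longrightarrow> \<bar>h s\<bar> \<le> B"
proof -
  have "bounded (h ` {0..2 * \<epsilon>})"
    by (intro compact_imp_bounded compact_continuous_image continuous_on_subset[OF cutoff_continuous[OF assms]]) auto
  then obtain B where "\<forall>y\<in>h ` {0..2 * \<epsilon>}. norm y \<le> B" unfolding bounded_iff by blast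
  then have B: "\<bar>h s\<bar> \<le> B" if "0 \<le> s" "s \<le> 2 * \<epsilon>" for s using that by auto
  have one: "h s = 1" if "s \<ge> 2 * \<epsilon>" for s using assms that unfolding cutoff_def by blast
  show thesis
  proof (rule that[of "max 1 B"])
    show "\<bar>h s\<bar> \<le> max 1 B" if "s \<ge> 0" for s using B[OF that] one[of s] by (cases "s \<le> 2 * \<epsilon>") auto
  qed simp
qed

section \<open>Norms of the frequency weights\<close>

lemma dual_exponent_gap:
  fixes p q :: real
  assumes "1 < p" "p \<le> 2" "p * q = p + q"
  shows "1 / p - 1 / q \<ge> 0" "p < 2 \<Longrightarrow> 1 / p - 1 / q > 0"
  using assms powr_dual_gt_2[OF assms] by (auto simp: field_simps)

lemma exp_powr_real: "exp (x::real) powr y = exp (y * x)"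
  by (simp add: powr_def)

text \<open>Raised to the power \<open>1 / \<theta>\<close>, the weight decays with order
  \<open>s / \<theta>\<close>, and the regularity condition says that this exceeds the dimension 2.
  The constant \<open>K\<close> is chosen before \<open>B\<close>, which is thus free to carry the
  exponential decay in time.\<close>

lemma sobolev_weight_norm:
  fixes p q s :: real
  assumes pq: "1 < p" "p \<le> 2" "p * q = p + q" and s: "s > 2 * (1 / p - 1 / q)"
  obtains K where "K > 0" "\<And>B. B > 0 \<Longrightarrow> weight_norm_le p q (\<lambda>\<xi>. B * (1 + (norm \<xi>)\<^sup>2) powr (- s / 2)) (B * K)"
proof -
  define \<theta> where "\<theta> = 1 / p - 1 / q"
  have \<theta>: "\<theta> \<ge> 0" "p < 2 \<Longrightarrow> \<theta> > 0" using dual_exponent_gap[OF pq] by (auto simp: \<theta>_def)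
  have s0: "s > 0" using s \<theta>(1) by (simp add: \<theta>_def)
  define k where "k = (LINT \<xi>|lborel. (1 + (norm (\<xi>::real^2))\<^sup>2) powr (- (s / \<theta>) / 2))"
  show thesis
  proof (rule that[of "(1 + \<bar>k\<bar>) powr \<theta>"])
    show "(1 + \<bar>k\<bar>) powr \<theta> > 0" by simp
    fix B :: real assume B: "B > 0"
    have "weight_norm_le p q (\<lambda>\<xi>. B * (1 + (norm \<xi>)\<^sup>2) powr (- s / 2)) (B * (1 + \<bar>k\<bar>) powr (1 / p - 1 / q) * 1 powr (1 / p - 1 / q))"
    proof (rule weight_norm_leI[OF pq B, where u="\<lambda>\<xi>. (1 + (norm \<xi>)\<^sup>2) powr (- s / 2)"])
      show "(1 + (norm \<xi>)\<^sup>2) powr (- s / 2) \<le> 1" for \<xi> :: "real^2"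
        using bracket_powr_mono[of "- s / 2" 0 \<xi>] s0 add_pos_nonneg[OF zero_less_one zero_le_power2[of "norm \<xi>"]] by simp
      assume p: "p < 2"
      have "s / \<theta> > 2" using s \<theta>(2)[OF p] by (simp add: \<theta>_def less_divide_eq)
      from integrable_sobolev_weight[OF this]
      have "(\<integral>\<^sup>+\<xi>. ennreal ((1 + (norm (\<xi>::real^2))\<^sup>2) powr (- (s / \<theta>) / 2)) \<partial>lborel) = ennreal k"
        unfolding k_def by (intro nn_integral_eq_integral) auto
      moreover have "((1 + (norm (\<xi>::real^2))\<^sup>2) powr (- s / 2)) powr (1 / (1 / p - 1 / q)) = (1 + (norm \<xi>)\<^sup>2) powr (- (s / \<theta>) / 2)" for \<xi>
        by (simp add: powr_powr \<theta>_def)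
      ultimately show "(\<integral>\<^sup>+\<xi>. ennreal (((1 + (norm (\<xi>::real^2))\<^sup>2) powr (- s / 2)) powr (1 / (1 / p - 1 / q))) \<partial>lborel) \<le> ennreal (\<bar>k\<bar> * 1)"
        by (simp add: ennreal_leI)
    qed (use B in auto)
    then show "weight_norm_le p q (\<lambda>\<xi>. B * (1 + (norm \<xi>)\<^sup>2) powr (- s / 2)) (B * (1 + \<bar>k\<bar>) powr \<theta>)"
      by (simp add: \<theta>_def)
  qed
qed

text \<open>The power \<open>1 / \<theta>\<close> replaces \<open>c\<close> by
  \<open>c / \<theta>\<close> in the exponent; decay of order 1 for the integral becomes order
  \<open>\<theta>\<close> for the norm.\<close>

lemma disc_weight_norm:
  fixes p q c R :: real
  assumes pq: "1 < p" "p \<le> 2" "p * q = p + q" and c: "c > 0" and R: "R > 0"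
  obtains K where "K > 0" "\<And>B t. B > 0 \<Longrightarrow> t \<ge> 0 \<Longrightarrow>
    weight_norm_le p q (\<lambda>\<xi>. B * (exp (- c * t * (norm \<xi>)\<^sup>2) * indicator {\<xi>. norm \<xi> \<le> R} \<xi>)) (B * K * (1 + t) powr (- (1 / p - 1 / q)))"
proof -
  define \<theta> where "\<theta> = 1 / p - 1 / q"
  have \<theta>: "\<theta> \<ge> 0" "p < 2 \<Longrightarrow> \<theta> > 0" using dual_exponent_gap[OF pq] by (auto simp: \<theta>_def)
  define k where "k = exp (c / \<theta> * R\<^sup>2) * (pi / (c / \<theta>))"
  show thesis
  proof (rule that[of "(1 + \<bar>k\<bar>) powr \<theta>"])
    show "(1 + \<bar>k\<bar>) powr \<theta> > 0" by simp
    fix B t :: real assume B: "B > 0" and t: "t \<ge> 0"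
    have "weight_norm_le p q (\<lambda>\<xi>. B * (exp (- c * t * (norm \<xi>)\<^sup>2) * indicator {\<xi>. norm \<xi> \<le> R} \<xi>)) (B * (1 + \<bar>k\<bar>) powr (1 / p - 1 / q) * ((1 + t) powr (- 1)) powr (1 / p - 1 / q))"
    proof (rule weight_norm_leI[OF pq B, where u="\<lambda>\<xi>. exp (- c * t * (norm \<xi>)\<^sup>2) * indicator {\<xi>. norm \<xi> \<le> R} \<xi>"])
      show "exp (- c * t * (norm \<xi>)\<^sup>2) * indicator {\<xi>. norm \<xi> \<le> R} \<xi> \<le> 1" for \<xi> :: "real^2"
        using c t by (auto simp: indicator_def)
      assume p: "p < 2"
      have c\<theta>: "c / \<theta> > 0" using c \<theta>(2)[OF p] by simp
      have eq: "ennreal ((exp (- c * t * (norm \<xi>)\<^sup>2) * indicator {\<xi>. norm \<xi> \<le> R} \<xi>) powr (1 / (1 / p - 1 / q))) = ennreal (exp (- (c / \<theta>) * t * (norm \<xi>)\<^sup>2)) * indicator {\<xi>. norm \<xi> \<le> R} \<xi>" for \<xi> :: "real^2"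
        using \<theta>(2)[OF p] by (auto simp: indicator_def exp_powr_real \<theta>_def[symmetric])
      show "(\<integral>\<^sup>+\<xi>. ennreal ((exp (- c * t * (norm (\<xi>::real^2))\<^sup>2) * indicator {\<xi>. norm \<xi> \<le> R} \<xi>) powr (1 / (1 / p - 1 / q))) \<partial>lborel) \<le> ennreal (\<bar>k\<bar> * (1 + t) powr (- 1))"
      proof -
        have "(\<integral>\<^sup>+\<xi>. ennreal (exp (- (c / \<theta>) * t * (norm (\<xi>::real^2))\<^sup>2)) * indicator {\<xi>. norm \<xi> \<le> R} \<xi> \<partial>lborel) \<le> ennreal (k * (1 + t) powr (- 1))"
          unfolding k_def by (rule nn_integral_disc_decay[OF R c\<theta> t])
        also have "\<dots> \<le> ennreal (\<bar>k\<bar> * (1 + t) powr (- 1))" by (intro ennreal_leI mult_right_mono) auto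
        finally show ?thesis unfolding eq .
      qed
    qed (use B t in auto)
    moreover have "((1 + t) powr (- 1)) powr \<theta> = (1 + t) powr (- \<theta>)" by (simp only: powr_powr mult_minus1)
    ultimately show "weight_norm_le p q (\<lambda>\<xi>. B * (exp (- c * t * (norm \<xi>)\<^sup>2) * indicator {\<xi>. norm \<xi> \<le> R} \<xi>)) (B * (1 + \<bar>k\<bar>) powr \<theta> * (1 + t) powr (- (1 / p - 1 / q)))"
      by (simp only: \<theta>_def)
  qed
qed

text \<open>Rotation by a right angle. For a unit vector \<open>z\<close>, the inner product with
  \<open>perp z\<close> is the coordinate transversal to the line through \<open>z\<close>.\<close>

definition perp :: "real^2 \<Rightarrow> real^2" where "perp z = vector [- z$2, z$1]"

lemma norm_perp: "norm (perp z) = norm z"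
  by (simp add: norm_eq_sqrt_inner inner_real2 perp_def add.commute)

text \<open>Replaces the distance to \<open>z\<close> by a linear function, for which the strip
  estimates are stated.\<close>

lemma inner_perp_le:
  assumes "norm z = 1" shows "\<bar>\<eta> \<bullet> perp z\<bar> \<le> norm (\<eta> - z)"
proof -
  have "z \<bullet> perp z = 0" by (simp add: inner_real2 perp_def)
  then have "\<eta> \<bullet> perp z = (\<eta> - z) \<bullet> perp z" by (simp add: inner_diff_left)
  then show ?thesis using Cauchy_Schwarz_ineq2[of "\<eta> - z" "perp z"] assms by (simp add: norm_perp)
qed

context thermoelastic_system
begin

lemma dmin_dir_eq: "dmin (dir \<xi>) = min \<bar>coupling r 1 \<xi> / norm \<xi>\<bar> \<bar>coupling r 2 \<xi> / norm \<xi>\<bar>"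
  by (cases "\<xi> = 0") (auto simp: dmin_def a_def coupling_eq dir_def)

lemma borel_measurable_dmin_dir [measurable]: "(\<lambda>\<xi>. dmin (dir \<xi>)) \<in> borel_measurable borel"
proof -
  have "continuous_on UNIV (coupling r j)" for j
    unfolding coupling_eq[abs_def] by (rule homogeneous_continuous[of "\<lambda>\<eta>. r j \<eta> \<bullet> \<eta>"]) (intro continuous_intros continuous_r)
  then have [measurable]: "coupling r j \<in> borel_measurable borel" for j by (rule borel_measurable_continuous_onI)
  show ?thesis unfolding dmin_dir_eq by measurable
qed

lemma Hyp_norm: "z \<in> Hyp \<Longrightarrow> norm z = 1" by (simp add: Hyp_iff)

text \<open>Scaling the lower bound for \<open>dmin\<close> by \<open>norm \<xi>\<close> turns the
  distance to \<open>z\<close> into the transversal coordinate of \<open>\<xi>\<close>. Where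
  \<open>dmin\<close> has a constant lower bound, any fixed \<open>z0\<close> serves, because
  distances on the circle are at most 2; for this some hyperbolic direction must exist.\<close>

lemma dmin_transversal_bound:
  assumes "Hyp \<noteq> {}"
  obtains b where "b > 0" "\<And>\<xi>. \<exists>z\<in>Hyp. b * (\<xi> \<bullet> perp z)\<^sup>2 \<le> (norm \<xi>)\<^sup>2 * (dmin (dir \<xi>))\<^sup>2"
proof -
  obtain c where c: "c > 0" "\<And>\<eta>. norm \<eta> = 1 \<Longrightarrow> c \<le> dmin \<eta> \<or> (\<exists>z\<in>Hyp. c * norm (\<eta> - z) \<le> dmin \<eta>)"
    using Hyp_finite_and_bound(2) by blast
  obtain z0 where z0: "z0 \<in> Hyp" using assms by blast
  have main: "\<exists>z\<in>Hyp. c / 2 * norm (\<eta> - z) \<le> dmin \<eta>" if \<eta>: "norm \<eta> = 1" for \<eta>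
  proof -
    from c(2)[OF \<eta>] show ?thesis
    proof
      assume d: "c \<le> dmin \<eta>"
      have "norm (\<eta> - z0) \<le> 2" using norm_triangle_ineq4[of \<eta> z0] \<eta> Hyp_norm[OF z0] by simp
      then have "c / 2 * norm (\<eta> - z0) \<le> c" using mult_left_mono[of "norm (\<eta> - z0)" 2 "c / 2"] c(1) by simp
      then show ?thesis using z0 d by (intro bexI[of _ z0]) auto
    next
      assume "\<exists>z\<in>Hyp. c * norm (\<eta> - z) \<le> dmin \<eta>"
      then obtain z where z: "z \<in> Hyp" "c * norm (\<eta> - z) \<le> dmin \<eta>" by blast
      have "c / 2 * norm (\<eta> - z) \<le> c * norm (\<eta> - z)" using c(1) by (intro mult_right_mono) auto
      then show ?thesis using z by (intro bexI[of _ z]) auto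
    qed
  qed
  show thesis
  proof (rule that[of "(c / 2)\<^sup>2"])
    fix \<xi> :: "real^2"
    show "\<exists>z\<in>Hyp. (c / 2)\<^sup>2 * (\<xi> \<bullet> perp z)\<^sup>2 \<le> (norm \<xi>)\<^sup>2 * (dmin (dir \<xi>))\<^sup>2"
    proof (cases "\<xi> = 0")
      case True then show ?thesis using z0 by auto
    next
      case False
      obtain z where z: "z \<in> Hyp" "c / 2 * norm (dir \<xi> - z) \<le> dmin (dir \<xi>)" using main[OF norm_dir[OF False]] by blast
      have "c / 2 * \<bar>dir \<xi> \<bullet> perp z\<bar> \<le> dmin (dir \<xi>)"
        using mult_left_mono[OF inner_perp_le[OF Hyp_norm[OF z(1)], of "dir \<xi>"], of "c / 2"] z(2) c(1) by linarith
      then have "norm \<xi> * (c / 2 * \<bar>dir \<xi> \<bullet> perp z\<bar>) \<le> norm \<xi> * dmin (dir \<xi>)" by (intro mult_left_mono) auto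
      then have "(norm \<xi> * (c / 2 * \<bar>dir \<xi> \<bullet> perp z\<bar>))\<^sup>2 \<le> (norm \<xi> * dmin (dir \<xi>))\<^sup>2"
        using c(1) by (intro power_mono) auto
      moreover have "\<xi> \<bullet> perp z = norm \<xi> * (dir \<xi> \<bullet> perp z)"
        using inner_scaleR_left[of "norm \<xi>" "dir \<xi>" "perp z"] unfolding norm_scale_dir .
      moreover have "(norm \<xi> * (c / 2 * \<bar>x\<bar>))\<^sup>2 = (c / 2)\<^sup>2 * (norm \<xi> * x)\<^sup>2" for x
        unfolding power_mult_distrib power2_abs by (simp only: mult_ac)
      ultimately have "(c / 2)\<^sup>2 * (\<xi> \<bullet> perp z)\<^sup>2 \<le> (norm \<xi>)\<^sup>2 * (dmin (dir \<xi>))\<^sup>2"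
        by (simp only: power_mult_distrib[of "norm \<xi>" "dmin (dir \<xi>)"])
      then show ?thesis using z(1) by blast
    qed
  qed (use c in auto)
qed

text \<open>The direction \<open>z\<close> given by \<open>dmin_transversal_bound\<close> varies
  with \<open>\<xi>\<close>; the sum over the finite set \<open>Hyp\<close> dominates whichever term
  applies.\<close>

lemma hyperbolic_sobolev_weight_norm:
  fixes p q s c :: real
  assumes pq: "1 < p" "p \<le> 2" "p * q = p + q" and s: "s > 2 * (1 / p - 1 / q)" and c: "c > 0" and ne: "Hyp \<noteq> {}"
  obtains K where "K > 0" "\<And>B t. B > 0 \<Longrightarrow> t \<ge> 0 \<Longrightarrow>
    weight_norm_le p q (\<lambda>\<xi>. B * ((1 + (norm \<xi>)\<^sup>2) powr (- s / 2) * exp (- c * t * (dmin (dir \<xi>))\<^sup>2))) (B * K * (1 + t) powr (- (1 / 2) * (1 / p - 1 / q)))"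
proof -
  define \<theta> where "\<theta> = 1 / p - 1 / q"
  have \<theta>: "\<theta> \<ge> 0" "p < 2 \<Longrightarrow> \<theta> > 0" using dual_exponent_gap[OF pq] by (auto simp: \<theta>_def)
  have s0: "s > 0" using s \<theta>(1) by (simp add: \<theta>_def)
  obtain b where b: "b > 0" "\<And>\<xi>. \<exists>z\<in>Hyp. b * (\<xi> \<bullet> perp z)\<^sup>2 \<le> (norm \<xi>)\<^sup>2 * (dmin (dir \<xi>))\<^sup>2"
    by (rule dmin_transversal_bound[OF ne]) (rule that)
  \<comment> \<open>For \<open>p = 2\<close> the divisor \<open>\<theta>\<close> is 0, so the bound
    is claimed only for \<open>p < 2\<close>, where the regularity condition gives
    \<open>s / \<theta> > 2\<close>.\<close>
  have "\<exists>k>0. p < 2 \<longrightarrow> (\<forall>n::real^2. \<forall>t\<ge>0. norm n = 1 \<longrightarrow>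
      (\<integral>\<^sup>+\<xi>. ennreal ((1 + (norm \<xi>)\<^sup>2) powr (- (s / \<theta>) / 2) * exp (- (c / \<theta> * b) * t * (\<xi> \<bullet> n)\<^sup>2 / (norm \<xi>)\<^sup>2)) \<partial>lborel) \<le> ennreal (k * (1 + t) powr (- 1 / 2)))"
  proof (cases "p < 2")
    case True
    have "s / \<theta> > 2" using s \<theta>(2)[OF True] by (simp add: \<theta>_def less_divide_eq)
    moreover have "c / \<theta> * b > 0" using c b \<theta>(2)[OF True] by simp
    ultimately show ?thesis by (rule nn_integral_sobolev_weight_decay) blast
  qed (auto intro: exI[of _ 1])
  then obtain k where k: "k > 0" "\<And>(n::real^2) t. p < 2 \<Longrightarrow> t \<ge> 0 \<Longrightarrow> norm n = 1 \<Longrightarrow>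
      (\<integral>\<^sup>+\<xi>. ennreal ((1 + (norm \<xi>)\<^sup>2) powr (- (s / \<theta>) / 2) * exp (- (c / \<theta> * b) * t * (\<xi> \<bullet> n)\<^sup>2 / (norm \<xi>)\<^sup>2)) \<partial>lborel) \<le> ennreal (k * (1 + t) powr (- 1 / 2))" by blast
  let ?K = "real (card Hyp) * k"
  have K0: "?K \<ge> 0" using k(1) by simp
  show thesis
  proof (rule that[of "(1 + ?K) powr \<theta>"])
    have "1 + ?K \<noteq> 0" using K0 by linarith
    then show "(1 + ?K) powr \<theta> > 0" by (simp only: powr_gt_zero) simp
    fix B t :: real assume B: "B > 0" and t: "t \<ge> 0"
    let ?u = "\<lambda>\<xi>. (1 + (norm \<xi>)\<^sup>2) powr (- s / 2) * exp (- c * t * (dmin (dir \<xi>))\<^sup>2)"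
    have "weight_norm_le p q (\<lambda>\<xi>. B * ?u \<xi>) (B * (1 + ?K) powr (1 / p - 1 / q) * ((1 + t) powr (- 1 / 2)) powr (1 / p - 1 / q))"
    proof (rule weight_norm_leI[OF pq B K0, where u="?u"])
      show "?u \<xi> \<le> 1" for \<xi>
      proof -
        have "(1 + (norm \<xi>)\<^sup>2) powr (- s / 2) \<le> 1"
          using bracket_powr_mono[of "- s / 2" 0 \<xi>] s0 add_pos_nonneg[OF zero_less_one zero_le_power2[of "norm \<xi>"]] by simp
        moreover have "exp (- c * t * (dmin (dir \<xi>))\<^sup>2) \<le> 1" using c t by simp
        ultimately show ?thesis by (intro mult_le_one) auto
      qed
      show "?u \<in> borel_measurable borel" by measurable
      assume p: "p < 2"
      note th = \<theta>(2)[OF p]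
      have "(\<integral>\<^sup>+\<xi>. ennreal (?u \<xi> powr (1 / (1 / p - 1 / q))) \<partial>lborel)
        \<le> (\<integral>\<^sup>+\<xi>. (\<Sum>z\<in>Hyp. ennreal ((1 + (norm \<xi>)\<^sup>2) powr (- (s / \<theta>) / 2) * exp (- (c / \<theta> * b) * t * (\<xi> \<bullet> perp z)\<^sup>2 / (norm \<xi>)\<^sup>2))) \<partial>lborel)"
      proof (rule nn_integral_mono)
        fix \<xi> :: "real^2"
        obtain z where z: "z \<in> Hyp" "b * (\<xi> \<bullet> perp z)\<^sup>2 \<le> (norm \<xi>)\<^sup>2 * (dmin (dir \<xi>))\<^sup>2" using b(2) by blast
        have "b * (\<xi> \<bullet> perp z)\<^sup>2 / (norm \<xi>)\<^sup>2 \<le> (dmin (dir \<xi>))\<^sup>2"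
          using z(2) by (cases "\<xi> = 0") (auto simp: divide_le_eq mult.commute)
        then have "c / \<theta> * t * (b * (\<xi> \<bullet> perp z)\<^sup>2 / (norm \<xi>)\<^sup>2) \<le> c / \<theta> * t * (dmin (dir \<xi>))\<^sup>2"
          using c t th by (intro mult_left_mono) auto
        then have e: "exp (- (c / \<theta>) * t * (dmin (dir \<xi>))\<^sup>2) \<le> exp (- (c / \<theta> * b) * t * (\<xi> \<bullet> perp z)\<^sup>2 / (norm \<xi>)\<^sup>2)" by (simp add: mult_ac)
        have "?u \<xi> powr (1 / (1 / p - 1 / q)) = (1 + (norm \<xi>)\<^sup>2) powr (- (s / \<theta>) / 2) * exp (- (c / \<theta>) * t * (dmin (dir \<xi>))\<^sup>2)"
          by (simp add: powr_mult powr_powr exp_powr_real \<theta>_def[symmetric] mult.commute)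
        also have "\<dots> \<le> (1 + (norm \<xi>)\<^sup>2) powr (- (s / \<theta>) / 2) * exp (- (c / \<theta> * b) * t * (\<xi> \<bullet> perp z)\<^sup>2 / (norm \<xi>)\<^sup>2)"
          using e by (intro mult_left_mono) auto
        finally have "ennreal (?u \<xi> powr (1 / (1 / p - 1 / q))) \<le> ennreal ((1 + (norm \<xi>)\<^sup>2) powr (- (s / \<theta>) / 2) * exp (- (c / \<theta> * b) * t * (\<xi> \<bullet> perp z)\<^sup>2 / (norm \<xi>)\<^sup>2))"
          by (rule ennreal_leI)
        also have "\<dots> \<le> (\<Sum>z\<in>Hyp. ennreal ((1 + (norm \<xi>)\<^sup>2) powr (- (s / \<theta>) / 2) * exp (- (c / \<theta> * b) * t * (\<xi> \<bullet> perp z)\<^sup>2 / (norm \<xi>)\<^sup>2)))"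
          using z(1) Hyp_finite_and_bound(1) by (intro member_le_sum) auto
        finally show "ennreal (?u \<xi> powr (1 / (1 / p - 1 / q))) \<le> \<dots>" .
      qed
      also have "\<dots> = (\<Sum>z\<in>Hyp. \<integral>\<^sup>+\<xi>. ennreal ((1 + (norm \<xi>)\<^sup>2) powr (- (s / \<theta>) / 2) * exp (- (c / \<theta> * b) * t * (\<xi> \<bullet> perp z)\<^sup>2 / (norm \<xi>)\<^sup>2)) \<partial>lborel)"
        by (rule nn_integral_sum) measurable
      also have "\<dots> \<le> (\<Sum>z\<in>Hyp. ennreal (k * (1 + t) powr (- 1 / 2)))"
        by (intro sum_mono k(2) p t) (simp add: norm_perp Hyp_norm)
      also have "\<dots> = ennreal (?K * (1 + t) powr (- 1 / 2))"
        using k(1) by (simp add: ennreal_of_nat_eq_real_of_nat mult.assoc flip: ennreal_mult)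
      finally show "(\<integral>\<^sup>+\<xi>. ennreal (?u \<xi> powr (1 / (1 / p - 1 / q))) \<partial>lborel) \<le> ennreal (?K * (1 + t) powr (- 1 / 2))" .
    qed (use B t in auto)
    moreover have "((1 + t) powr (- 1 / 2)) powr \<theta> = (1 + t) powr (- (1 / 2) * \<theta>)" by (simp add: powr_powr)
    ultimately show "weight_norm_le p q (\<lambda>\<xi>. B * ?u \<xi>) (B * (1 + ?K) powr \<theta> * (1 + t) powr (- (1 / 2) * (1 / p - 1 / q)))"
      by (simp add: \<theta>_def)
  qed
qed

lemma hyperbolic_disc_weight_norm:
  fixes p q c R :: real
  assumes pq: "1 < p" "p \<le> 2" "p * q = p + q" and c: "c > 0" and R: "R > 0" and ne: "Hyp \<noteq> {}"
  obtains K where "K > 0" "\<And>B t. B > 0 \<Longrightarrow> t \<ge> 0 \<Longrightarrow>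
    weight_norm_le p q (\<lambda>\<xi>. B * (exp (- c * t * ((norm \<xi>)\<^sup>2 * (dmin (dir \<xi>))\<^sup>2)) * indicator {\<xi>. norm \<xi> \<le> R} \<xi>)) (B * K * (1 + t) powr (- (1 / 2) * (1 / p - 1 / q)))"
proof -
  define \<theta> where "\<theta> = 1 / p - 1 / q"
  have \<theta>: "\<theta> \<ge> 0" "p < 2 \<Longrightarrow> \<theta> > 0" using dual_exponent_gap[OF pq] by (auto simp: \<theta>_def)
  obtain b where b: "b > 0" "\<And>\<xi>. \<exists>z\<in>Hyp. b * (\<xi> \<bullet> perp z)\<^sup>2 \<le> (norm \<xi>)\<^sup>2 * (dmin (dir \<xi>))\<^sup>2"
    by (rule dmin_transversal_bound[OF ne]) (rule that)
  \<comment> \<open>The factor \<open>R\<^sup>2\<close> undoes the scaling of the exponent in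
    \<open>nn_integral_strip_decay\<close>.\<close>
  define c' where "c' = c / \<theta> * b * R\<^sup>2"
  define k where "k = exp c' * (2 * sqrt 2 * sqrt (pi / c')) * R\<^sup>2"
  let ?K = "real (card Hyp) * \<bar>k\<bar>"
  have K0: "?K \<ge> 0" by simp
  show thesis
  proof (rule that[of "(1 + ?K) powr \<theta>"])
    have "1 + ?K \<noteq> 0" using K0 by linarith
    then show "(1 + ?K) powr \<theta> > 0" by (simp only: powr_gt_zero) simp
    fix B t :: real assume B: "B > 0" and t: "t \<ge> 0"
    let ?u = "\<lambda>\<xi>. exp (- c * t * ((norm \<xi>)\<^sup>2 * (dmin (dir \<xi>))\<^sup>2)) * indicator {\<xi>. norm \<xi> \<le> R} \<xi>"
    have "weight_norm_le p q (\<lambda>\<xi>. B * ?u \<xi>) (B * (1 + ?K) powr (1 / p - 1 / q) * ((1 + t) powr (- 1 / 2)) powr (1 / p - 1 / q))"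
    proof (rule weight_norm_leI[OF pq B K0, where u="?u"])
      show "?u \<xi> \<le> 1" for \<xi> using c t by (auto simp: indicator_def)
      show "?u \<in> borel_measurable borel" by measurable
      assume p: "p < 2"
      note th = \<theta>(2)[OF p]
      have c'0: "c' > 0" using c b R th by (simp add: c'_def)
      have "(\<integral>\<^sup>+\<xi>. ennreal (?u \<xi> powr (1 / (1 / p - 1 / q))) \<partial>lborel)
        \<le> (\<integral>\<^sup>+\<xi>. (\<Sum>z\<in>Hyp. ennreal (exp (- c' * t * (\<xi> \<bullet> perp z)\<^sup>2 / R\<^sup>2)) * indicator {\<xi>. norm \<xi> \<le> R} \<xi>) \<partial>lborel)"
      proof (rule nn_integral_mono)
        fix \<xi> :: "real^2"
        obtain z where z: "z \<in> Hyp" "b * (\<xi> \<bullet> perp z)\<^sup>2 \<le> (norm \<xi>)\<^sup>2 * (dmin (dir \<xi>))\<^sup>2" using b(2) by blast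
        then have "c / \<theta> * t * (b * (\<xi> \<bullet> perp z)\<^sup>2) \<le> c / \<theta> * t * ((norm \<xi>)\<^sup>2 * (dmin (dir \<xi>))\<^sup>2)"
          using c t th by (intro mult_left_mono) auto
        moreover have "c' * t * (\<xi> \<bullet> perp z)\<^sup>2 / R\<^sup>2 = c / \<theta> * t * (b * (\<xi> \<bullet> perp z)\<^sup>2)" using R by (simp add: c'_def)
        ultimately have e: "exp (- (c / \<theta>) * t * ((norm \<xi>)\<^sup>2 * (dmin (dir \<xi>))\<^sup>2)) \<le> exp (- c' * t * (\<xi> \<bullet> perp z)\<^sup>2 / R\<^sup>2)" by simp
        have "ennreal (?u \<xi> powr (1 / (1 / p - 1 / q))) = ennreal (exp (- (c / \<theta>) * t * ((norm \<xi>)\<^sup>2 * (dmin (dir \<xi>))\<^sup>2))) * indicator {\<xi>. norm \<xi> \<le> R} \<xi>"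
          using th by (auto simp: indicator_def exp_powr_real \<theta>_def[symmetric])
        also have "\<dots> \<le> ennreal (exp (- c' * t * (\<xi> \<bullet> perp z)\<^sup>2 / R\<^sup>2)) * indicator {\<xi>. norm \<xi> \<le> R} \<xi>"
          using e by (intro mult_right_mono ennreal_leI) auto
        also have "\<dots> \<le> (\<Sum>z\<in>Hyp. ennreal (exp (- c' * t * (\<xi> \<bullet> perp z)\<^sup>2 / R\<^sup>2)) * indicator {\<xi>. norm \<xi> \<le> R} \<xi>)"
          using z(1) Hyp_finite_and_bound(1) by (intro member_le_sum) auto
        finally show "ennreal (?u \<xi> powr (1 / (1 / p - 1 / q))) \<le> \<dots>" .
      qed
      also have "\<dots> = (\<Sum>z\<in>Hyp. \<integral>\<^sup>+\<xi>. ennreal (exp (- c' * t * (\<xi> \<bullet> perp z)\<^sup>2 / R\<^sup>2)) * indicator {\<xi>. norm \<xi> \<le> R} \<xi> \<partial>lborel)"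
        by (rule nn_integral_sum) measurable
      also have "\<dots> \<le> (\<Sum>z\<in>Hyp. ennreal (k * (1 + t) powr (- 1 / 2)))"
        unfolding k_def by (intro sum_mono nn_integral_strip_decay R c'0 t) (simp add: norm_perp Hyp_norm)
      also have "\<dots> \<le> (\<Sum>z\<in>Hyp. ennreal (\<bar>k\<bar> * (1 + t) powr (- 1 / 2)))"
        by (intro sum_mono ennreal_leI mult_right_mono) auto
      also have "\<dots> = ennreal (?K * (1 + t) powr (- 1 / 2))"
        by (simp add: ennreal_of_nat_eq_real_of_nat mult.assoc flip: ennreal_mult)
      finally show "(\<integral>\<^sup>+\<xi>. ennreal (?u \<xi> powr (1 / (1 / p - 1 / q))) \<partial>lborel) \<le> ennreal (?K * (1 + t) powr (- 1 / 2))" .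
    qed (use B t in auto)
    moreover have "((1 + t) powr (- 1 / 2)) powr \<theta> = (1 + t) powr (- (1 / 2) * \<theta>)" by (simp add: powr_powr)
    ultimately show "weight_norm_le p q (\<lambda>\<xi>. B * ?u \<xi>) (B * (1 + ?K) powr \<theta> * (1 + t) powr (- (1 / 2) * (1 / p - 1 / q)))"
      by (simp add: \<theta>_def)
  qed
qed

text \<open>Packages the conclusion of \<open>symbol_energy_decay\<close>, so that one rate can be
  fixed before the constants of the four estimates are built from it.\<close>

definition decay_rate :: "real \<Rightarrow> bool" where
  "decay_rate c \<longleftrightarrow> c > 0 \<and> (\<forall>\<xi> v t. \<xi> \<noteq> 0 \<longrightarrow> t \<ge> 0 \<longrightarrow>
       (\<forall>s\<ge>0. (v has_vector_derivative (\<i> *s (symbolB \<kappa> \<gamma> \<mu> r \<xi> *v v s))) (at s within {0..})) \<longrightarrow>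
       norm (v t) \<le> 3 * exp (- c * t * ((norm \<xi>)\<^sup>2 / (1 + (norm \<xi>)\<^sup>2) * (dmin (dir \<xi>))\<^sup>2)) * norm (v 0))"

lemma decay_rate_exists: "\<exists>c. decay_rate c"
  unfolding decay_rate_def by (rule symbol_energy_decay) blast

text \<open>The multiplier and the weight are quantified after the constant, so they may depend on
  \<open>t\<close>. The order \<open>\<sigma>\<close> of the data norm is free: \<open>s\<close> for
  high and 0 for low frequencies. Boundedness of \<open>m\<close> makes \<open>g\<close> integrable,
  as the final use of Hausdorff-Young demands.\<close>

lemma multiplier_estimate:
  fixes p q c :: real
  assumes pq: "1 < p" "p \<le> 2" "p * q = p + q" and c: "decay_rate c"
  shows "\<exists>C>0. \<forall>V0 V t m w W \<sigma> b. schwartz V0 \<longrightarrow> is_solution (symbolB \<kappa> \<gamma> \<mu> r) V0 V \<longrightarrow> t \<ge> 0 \<longrightarrow>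
      m \<in> borel_measurable borel \<longrightarrow> (\<forall>\<xi>. \<bar>m \<xi>\<bar> \<le> b) \<longrightarrow> w \<in> borel_measurable borel \<longrightarrow> (\<forall>\<xi>. 0 \<le> w \<xi>) \<longrightarrow>
      (\<forall>\<xi>. \<xi> \<noteq> 0 \<longrightarrow> \<bar>m \<xi>\<bar> * (3 * exp (- c * t * ((norm \<xi>)\<^sup>2 / (1 + (norm \<xi>)\<^sup>2) * (dmin (dir \<xi>))\<^sup>2))) \<le> w \<xi> * (1 + (norm \<xi>)\<^sup>2) powr (\<sigma> / 2)) \<longrightarrow>
      weight_norm_le p q w W \<longrightarrow> W > 0 \<longrightarrow>
      Lp_norm q (scalar_op m (V t)) \<le> ennreal (C * W) * Sobolev_norm p \<sigma> V0"
proof -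
  obtain C1 where C1: "C1 > 0" and HY: "\<And>(f :: real^2 \<Rightarrow> complex^5) N. integrable lborel f \<Longrightarrow> N > 0 \<Longrightarrow> (\<integral>\<^sup>+x. ennreal (norm (f x) powr p) \<partial>lborel) \<le> ennreal (N powr p)
      \<Longrightarrow> (\<integral>\<^sup>+\<xi>. ennreal (norm (inv_fourier f \<xi>) powr q) \<partial>lborel) \<le> ennreal ((C1 * N) powr q)"
    by (rule hausdorff_young[OF pq, where 'n=5]) (rule that)
  obtain C2 where C2: "C2 > 0" and dual: "\<And>(G :: real^2 \<Rightarrow> complex^5) N. integrable lborel G \<Longrightarrow> continuous_on UNIV G \<Longrightarrow> N > 0 \<Longrightarrow>
       (\<integral>\<^sup>+x. ennreal (norm (inv_fourier G x) powr p) \<partial>lborel) \<le> ennreal (N powr p)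
      \<Longrightarrow> (\<integral>\<^sup>+\<xi>. ennreal (norm (G \<xi>) powr q) \<partial>lborel) \<le> ennreal ((C2 * N) powr q)"
    by (rule hausdorff_young_dual[OF pq, where 'n=5]) (rule that)
  have c0: "c > 0" using c by (simp add: decay_rate_def)
  have q: "q > 0" using powr_dual_gt_2[OF pq] by simp
  show ?thesis
  proof (rule exI[of _ "C1 * C2"], intro conjI allI impI)
    show "C1 * C2 > 0" using C1 C2 by simp
    fix V0 :: "real^2 \<Rightarrow> complex^5" and V and t :: real and m w :: "real^2 \<Rightarrow> real" and W \<sigma> b :: real
    assume V0: "schwartz V0" and sol: "is_solution (symbolB \<kappa> \<gamma> \<mu> r) V0 V" and t: "t \<ge> 0"
      and m[measurable]: "m \<in> borel_measurable borel" and mb: "\<forall>\<xi>. \<bar>m \<xi>\<bar> \<le> b"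
      and w[measurable]: "w \<in> borel_measurable borel" and w0: "\<forall>\<xi>. 0 \<le> w \<xi>"
      and mw: "\<forall>\<xi>. \<xi> \<noteq> 0 \<longrightarrow> \<bar>m \<xi>\<bar> * (3 * exp (- c * t * ((norm \<xi>)\<^sup>2 / (1 + (norm \<xi>)\<^sup>2) * (dmin (dir \<xi>))\<^sup>2))) \<le> w \<xi> * (1 + (norm \<xi>)\<^sup>2) powr (\<sigma> / 2)"
      and W: "weight_norm_le p q w W" "W > 0"
    have Vi: "integrable lborel (V s)" if "s \<ge> 0" for s using sol that unfolding is_solution_def by blast
    have V00: "V 0 = V0" using sol unfolding is_solution_def by blast
    let ?e = "\<lambda>\<xi>. exp (- c * t * ((norm \<xi>)\<^sup>2 / (1 + (norm \<xi>)\<^sup>2) * (dmin (dir \<xi>))\<^sup>2))"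
    have bound: "norm (fourier (V t) \<xi>) \<le> 3 * ?e \<xi> * norm (fourier V0 \<xi>)" if "\<xi> \<noteq> 0" for \<xi>
    proof -
      have ode: "\<forall>s\<ge>0. ((\<lambda>s. fourier (V s) \<xi>) has_vector_derivative (\<i> *s (symbolB \<kappa> \<gamma> \<mu> r \<xi> *v fourier (V s) \<xi>))) (at s within {0..})"
        by (intro allI impI solution_fourier_ode[OF sol] continuous_on_symbolB_mult continuous_mu continuous_r)
      have imp: "\<xi> \<noteq> 0 \<longrightarrow> t \<ge> 0 \<longrightarrow>
       (\<forall>s\<ge>0. (v has_vector_derivative (\<i> *s (symbolB \<kappa> \<gamma> \<mu> r \<xi> *v v s))) (at s within {0..})) \<longrightarrow>
       norm (v t) \<le> 3 * ?e \<xi> * norm (v 0)" for v using c unfolding decay_rate_def by blast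
      show ?thesis using imp[of "\<lambda>s. fourier (V s) \<xi>"] ode that t V00 by simp
    qed
    \<comment> \<open>The decay estimate does not cover the origin, where there is no direction; a
      single point is a null set.\<close>
    have AE0: "AE \<xi> in lborel. (\<xi>::real^2) \<noteq> 0" by (rule AE_lborel_singleton)
    define G where "G \<xi> = complex_of_real ((1 + (norm \<xi>)\<^sup>2) powr (\<sigma> / 2)) *s fourier V0 \<xi>" for \<xi>
    define g where "g \<xi> = complex_of_real (m \<xi>) *s fourier (V t) \<xi>" for \<xi>
    have Gi: "integrable lborel G" and Gc: "continuous_on UNIV G"
      using integrable_bracket_fourier[OF V0, of "\<sigma> / 2"] by (auto simp: G_def[abs_def])
    have [measurable]: "G \<in> borel_measurable borel" by (rule borel_measurable_continuous_onI[OF Gc])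
    have Fm[measurable]: "fourier (V t) \<in> borel_measurable borel"
      by (rule borel_measurable_continuous_onI[OF continuous_on_fourier[OF Vi[OF t]]])
    have sc: "complex_of_real x *s v = x *\<^sub>R v" for x and v :: "complex^5"
      by (simp add: vec_eq_iff scaleR_conv_of_real[where 'a=complex])
    have [measurable]: "g \<in> borel_measurable borel" unfolding g_def[abs_def] sc by measurable
    have le: "AE \<xi> in lborel. norm (g \<xi>) \<le> w \<xi> * norm (G \<xi>)"
      using AE0
    proof eventually_elim
      fix \<xi> :: "real^2" assume \<xi>: "\<xi> \<noteq> 0"
      have "norm (g \<xi>) \<le> \<bar>m \<xi>\<bar> * (3 * ?e \<xi> * norm (fourier V0 \<xi>))"
        unfolding g_def norm_vector_smult norm_of_real by (intro mult_left_mono bound \<xi>) auto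
      also have "\<dots> = \<bar>m \<xi>\<bar> * (3 * ?e \<xi>) * norm (fourier V0 \<xi>)" by (simp only: mult.assoc)
      also have "\<dots> \<le> w \<xi> * (1 + (norm \<xi>)\<^sup>2) powr (\<sigma> / 2) * norm (fourier V0 \<xi>)"
        using mw \<xi> by (intro mult_right_mono) auto
      also have "\<dots> = w \<xi> * norm (G \<xi>)" by (simp add: G_def norm_vector_smult)
      finally show "norm (g \<xi>) \<le> w \<xi> * norm (G \<xi>)" .
    qed
    have gi: "integrable lborel g"
    proof (rule Bochner_Integration.integrable_bound)
      have one: "complex_of_real ((1 + (norm \<xi>)\<^sup>2) powr 0) *s v = v" for \<xi> :: "real^2" and v :: "complex^5"
        using add_pos_nonneg[OF zero_less_one zero_le_power2[of "norm \<xi>"]] by simp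
      have "integrable lborel (fourier V0)" using integrable_bracket_fourier(1)[OF V0, of 0] unfolding one .
      then show "integrable lborel (\<lambda>\<xi>. b * (3 * norm (fourier V0 \<xi>)))" by simp
      show "g \<in> borel_measurable lborel" by simp
      show "AE \<xi> in lborel. norm (g \<xi>) \<le> norm (b * (3 * norm (fourier V0 \<xi>)))"
        using AE0
      proof eventually_elim
        fix \<xi> :: "real^2" assume \<xi>: "\<xi> \<noteq> 0"
        have b0: "0 \<le> b" using mb abs_ge_zero order_trans by blast
        have "?e \<xi> \<le> 1" using c0 t by simp
        then have "3 * ?e \<xi> * norm (fourier V0 \<xi>) \<le> 3 * norm (fourier V0 \<xi>)" by (intro mult_right_mono) auto
        with bound[OF \<xi>] have "norm (fourier (V t) \<xi>) \<le> 3 * norm (fourier V0 \<xi>)" by linarith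
        then have "norm (g \<xi>) \<le> b * (3 * norm (fourier V0 \<xi>))"
          unfolding g_def norm_vector_smult norm_of_real using mb b0 by (intro mult_mono) auto
        then show "norm (g \<xi>) \<le> norm (b * (3 * norm (fourier V0 \<xi>)))" using b0 by simp
      qed
    qed
    have "Lp_norm q (inv_fourier g) \<le> ennreal (C1 * C2 * W) * Lp_norm p (inv_fourier G)"
    proof (rule Lp_norm_transfer)
      fix N :: real assume N: "N > 0" "(\<integral>\<^sup>+x. ennreal (norm (inv_fourier G x) powr p) \<partial>lborel) \<le> ennreal (N powr p)"
      have 1: "(\<integral>\<^sup>+\<xi>. ennreal (norm (G \<xi>) powr q) \<partial>lborel) \<le> ennreal ((C2 * N) powr q)" by (rule dual[OF Gi Gc N])
      have C2N: "C2 * N > 0" using C2 N by simp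
      have 2: "(\<integral>\<^sup>+\<xi>. ennreal (norm (g \<xi>) powr p) \<partial>lborel) \<le> ennreal ((W * (C2 * N)) powr p)"
        by (rule weighted_norm_bound[OF pq w w0[rule_format] W(2) W(1) _ C2N 1 le]) measurable
      have "W * (C2 * N) > 0" using W C2N by simp
      from HY[OF gi this 2] show "(\<integral>\<^sup>+x. ennreal (norm (inv_fourier g x) powr q) \<partial>lborel) \<le> ennreal ((C1 * C2 * W * N) powr q)"
        by (simp add: mult_ac)
    qed (use pq q C1 C2 W in auto)
    then show "Lp_norm q (scalar_op m (V t)) \<le> ennreal (C1 * C2 * W) * Sobolev_norm p \<sigma> V0"
      unfolding Sobolev_norm_def scalar_op_eq g_def[abs_def] G_def[abs_def] .
  qed
qed

end

section \<open>The four estimates\<close>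

lemma low_frequency_ratio:
  fixes x R :: real
  assumes "0 \<le> x" "x \<le> R"
  shows "1 / (1 + R\<^sup>2) * x\<^sup>2 \<le> x\<^sup>2 / (1 + x\<^sup>2)"
proof -
  have "1 + x\<^sup>2 \<le> 1 + R\<^sup>2" using assms by (simp add: power_mono)
  moreover have "1 + x\<^sup>2 > 0" by (rule add_pos_nonneg) auto
  ultimately have "x\<^sup>2 / (1 + R\<^sup>2) \<le> x\<^sup>2 / (1 + x\<^sup>2)" by (intro divide_left_mono) auto
  then show ?thesis by simp
qed

lemma high_frequency_ratio:
  fixes x \<epsilon> :: real
  assumes "0 \<le> \<epsilon>" "\<epsilon> \<le> x"
  shows "\<epsilon>\<^sup>2 / (1 + \<epsilon>\<^sup>2) \<le> x\<^sup>2 / (1 + x\<^sup>2)"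
proof -
  have "\<epsilon>\<^sup>2 \<le> x\<^sup>2" using assms by (intro power_mono)
  moreover have "1 + x\<^sup>2 > 0" "1 + \<epsilon>\<^sup>2 > 0" by (rule add_pos_nonneg; simp)+
  ultimately show ?thesis by (simp add: divide_le_eq le_divide_eq field_simps)
qed

context thermoelastic_system
begin

text \<open>On the support of \<open>h (norm \<xi>)\<close> the frequency factor of the exponent is
  at least \<open>\<beta>0\<close>, so the damping depends only on the direction; on that of
  \<open>1 - h (norm \<xi>)\<close> it is at least \<open>\<beta>1 * (norm \<xi>)\<^sup>2\<close>,
  which yields diffusive decay.\<close>

lemma Lp_Lq_estimates:
  fixes \<epsilon> p q s :: real and h :: "real \<Rightarrow> real"
  assumes \<epsilon>: "\<epsilon> > 0" and cut: "cutoff \<epsilon> h"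
    and pq: "1 < p" "p \<le> 2" "p * q = p + q" and s: "s > 2 * (1 / p - 1 / q)"
  shows "\<exists>C>0. \<exists>K>0. \<forall>V0 V. schwartz V0 \<and> is_solution (symbolB \<kappa> \<gamma> \<mu> r) V0 V \<longrightarrow>
    (\<forall>t\<ge>0.
       Lp_norm q (scalar_op (\<lambda>\<xi>. h (norm \<xi>) * P_par \<kappa> \<gamma> \<mu> r h (dir \<xi>)) (V t))
         \<le> ennreal (K * exp (- C * t)) * Sobolev_norm p s V0 \<and>
       Lp_norm q (scalar_op (\<lambda>\<xi>. (1 - h (norm \<xi>)) * P_par \<kappa> \<gamma> \<mu> r h (dir \<xi>)) (V t))
         \<le> ennreal (K * (1 + t) powr (- (1 / p - 1 / q))) * Lp_norm p V0 \<and>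
       Lp_norm q (scalar_op (\<lambda>\<xi>. h (norm \<xi>) * P_hyp \<kappa> \<gamma> \<mu> r h (dir \<xi>)) (V t))
         \<le> ennreal (K * (1 + t) powr (- (1 / 2) * (1 / p - 1 / q))) * Sobolev_norm p s V0 \<and>
       Lp_norm q (scalar_op (\<lambda>\<xi>. (1 - h (norm \<xi>)) * P_hyp \<kappa> \<gamma> \<mu> r h (dir \<xi>)) (V t))
         \<le> ennreal (K * (1 + t) powr (- (1 / 2) * (1 / p - 1 / q))) * Lp_norm p V0)"
proof -
  obtain c where rate: "decay_rate c" using decay_rate_exists by blast
  then have c: "c > 0" by (simp add: decay_rate_def)
  obtain c1 where c1: "c1 > 0" "\<And>\<eta>. norm \<eta> = 1 \<Longrightarrow> c1 \<le> dmin \<eta> \<or> (\<exists>z\<in>Hyp. c1 * norm (\<eta> - z) \<le> dmin \<eta>)"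
    using Hyp_finite_and_bound(2) by blast
  \<comment> \<open>The two alternatives of the bound on \<open>dmin\<close>: a constant one, and
    one by the distance to a hyperbolic direction, which exceeds \<open>\<epsilon>\<close> wherever
    \<open>P_par\<close> is nonzero.\<close>
  define d0 where "d0 = min c1 (c1 * \<epsilon>)"
  have d0: "d0 > 0" using c1 \<epsilon> by (simp add: d0_def)
  have h0: "h x = 0" if "0 \<le> x" "x \<le> \<epsilon>" for x using cut that unfolding cutoff_def by blast
  have h1: "h x = 1" if "x \<ge> 2 * \<epsilon>" for x using cut that unfolding cutoff_def by blast
  obtain Hb where Hb: "Hb \<ge> 1" "\<And>x. x \<ge> 0 \<Longrightarrow> \<bar>h x\<bar> \<le> Hb"
    by (rule cutoff_bounded[OF cut \<epsilon>]) (rule that)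
  let ?P = "P_par \<kappa> \<gamma> \<mu> r h" and ?Q = "P_hyp \<kappa> \<gamma> \<mu> r h"
  have P_eq: "?P \<eta> = (\<Prod>z\<in>Hyp. h (norm (\<eta> - z)))" for \<eta> by (simp add: P_par_def Hyp_def)
  have fin: "finite Hyp" by (rule Hyp_finite_and_bound(1))
  have far: "d0 \<le> dmin \<eta>" if \<eta>: "norm \<eta> = 1" "?P \<eta> \<noteq> 0" for \<eta>
  proof -
    have sep: "\<epsilon> < norm (\<eta> - z)" if "z \<in> Hyp" for z
    proof (rule ccontr)
      assume "\<not> \<epsilon> < norm (\<eta> - z)"
      then have "h (norm (\<eta> - z)) = 0" by (intro h0) auto
      then have "?P \<eta> = 0" unfolding P_eq using fin that by (intro prod_zero) auto
      then show False using \<eta> by simp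
    qed
    from c1(2)[OF \<eta>(1)] show ?thesis
    proof
      assume "\<exists>z\<in>Hyp. c1 * norm (\<eta> - z) \<le> dmin \<eta>"
      then obtain z where z: "z \<in> Hyp" "c1 * norm (\<eta> - z) \<le> dmin \<eta>" by blast
      have "c1 * \<epsilon> \<le> c1 * norm (\<eta> - z)" using sep[OF z(1)] c1(1) by (intro mult_left_mono) auto
      then show ?thesis using z(2) by (simp add: d0_def)
    qed (simp add: d0_def)
  qed
  define Pb where "Pb = Hb ^ card Hyp"
  have Pb: "Pb \<ge> 1" "\<bar>?P \<eta>\<bar> \<le> Pb" for \<eta>
  proof -
    show "Pb \<ge> 1" using Hb(1) by (simp add: Pb_def)
    have "\<bar>?P \<eta>\<bar> = (\<Prod>z\<in>Hyp. \<bar>h (norm (\<eta> - z))\<bar>)" unfolding P_eq by (rule abs_prod)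
    also have "\<dots> \<le> (\<Prod>z\<in>Hyp. Hb)" by (intro prod_mono) (auto intro: Hb(2))
    finally show "\<bar>?P \<eta>\<bar> \<le> Pb" by (simp add: Pb_def)
  qed
  have Qb: "\<bar>?Q \<eta>\<bar> \<le> 1 + Pb" for \<eta> using Pb(2)[of \<eta>] unfolding P_hyp_def by linarith
  \<comment> \<open>One bound for all four multipliers: adding 1 covers \<open>h\<close> together
    with \<open>1 - h\<close>, and \<open>P_par\<close> together with \<open>P_hyp\<close>.\<close>
  define B where "B = (1 + Hb) * (1 + Pb)"
  have B: "B > 0" using Hb Pb by (simp add: B_def)
  have hb: "\<bar>h (norm \<xi>)\<bar> \<le> 1 + Hb" "\<bar>1 - h (norm \<xi>)\<bar> \<le> 1 + Hb" for \<xi> :: "real^2"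
    using Hb(2)[of "norm \<xi>"] by auto
  have mb: "\<bar>h (norm \<xi>) * ?P (dir \<xi>)\<bar> \<le> B" "\<bar>(1 - h (norm \<xi>)) * ?P (dir \<xi>)\<bar> \<le> B"
     "\<bar>h (norm \<xi>) * ?Q (dir \<xi>)\<bar> \<le> B" "\<bar>(1 - h (norm \<xi>)) * ?Q (dir \<xi>)\<bar> \<le> B" for \<xi> :: "real^2"
  proof -
    have "\<bar>?P (dir \<xi>)\<bar> \<le> 1 + Pb" using Pb(2)[of "dir \<xi>"] by linarith
    then show "\<bar>h (norm \<xi>) * ?P (dir \<xi>)\<bar> \<le> B" "\<bar>(1 - h (norm \<xi>)) * ?P (dir \<xi>)\<bar> \<le> B"
      "\<bar>h (norm \<xi>) * ?Q (dir \<xi>)\<bar> \<le> B" "\<bar>(1 - h (norm \<xi>)) * ?Q (dir \<xi>)\<bar> \<le> B"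
      unfolding abs_mult B_def using hb[of \<xi>] Qb[of "dir \<xi>"] Hb by (intro mult_mono; simp)+
  qed
  have "continuous_on UNIV (\<lambda>\<xi>::real^2. h (norm \<xi>))"
    by (rule continuous_on_compose2[OF cutoff_continuous[OF cut \<epsilon>]]) (auto intro!: continuous_intros)
  then have hm: "(\<lambda>\<xi>::real^2. h (norm \<xi>)) \<in> borel_measurable borel" by (rule borel_measurable_continuous_onI)
  have hm'[measurable]: "(\<lambda>\<xi>. h (norm (f \<xi>))) \<in> borel_measurable borel" if "f \<in> borel_measurable borel" for f :: "real^2 \<Rightarrow> real^2"
    using measurable_compose[OF that hm] .
  have Pm[measurable]: "(\<lambda>\<xi>. ?P (dir \<xi>)) \<in> borel_measurable borel" unfolding P_eq by measurable
  have Qm[measurable]: "(\<lambda>\<xi>. ?Q (dir \<xi>)) \<in> borel_measurable borel" unfolding P_hyp_def by measurable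
  obtain C where C: "C > 0" and est0: "\<forall>V0 V t m w W \<sigma> b. schwartz V0 \<longrightarrow> is_solution (symbolB \<kappa> \<gamma> \<mu> r) V0 V \<longrightarrow> t \<ge> 0 \<longrightarrow>
      m \<in> borel_measurable borel \<longrightarrow> (\<forall>\<xi>. \<bar>m \<xi>\<bar> \<le> b) \<longrightarrow> w \<in> borel_measurable borel \<longrightarrow> (\<forall>\<xi>. 0 \<le> w \<xi>) \<longrightarrow>
      (\<forall>\<xi>. \<xi> \<noteq> 0 \<longrightarrow> \<bar>m \<xi>\<bar> * (3 * exp (- c * t * ((norm \<xi>)\<^sup>2 / (1 + (norm \<xi>)\<^sup>2) * (dmin (dir \<xi>))\<^sup>2))) \<le> w \<xi> * (1 + (norm \<xi>)\<^sup>2) powr (\<sigma> / 2)) \<longrightarrow>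
      weight_norm_le p q w W \<longrightarrow> W > 0 \<longrightarrow>
      Lp_norm q (scalar_op m (V t)) \<le> ennreal (C * W) * Sobolev_norm p \<sigma> V0"
    using multiplier_estimate[OF pq rate] by (elim exE conjE) (rule that)
  note est = est0[rule_format]
  \<comment> \<open>From this radius on \<open>1 - h\<close> vanishes.\<close>
  define R where "R = 2 * \<epsilon>"
  define \<beta>0 where "\<beta>0 = \<epsilon>\<^sup>2 / (1 + \<epsilon>\<^sup>2)"
  define \<beta>1 where "\<beta>1 = 1 / (1 + R\<^sup>2)"
  have R: "R > 0" using \<epsilon> by (simp add: R_def)
  have \<beta>: "\<beta>0 > 0" "\<beta>1 > 0" using \<epsilon> by (auto simp: \<beta>0_def \<beta>1_def intro!: divide_pos_pos add_pos_nonneg)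
  have hi: "\<beta>0 \<le> (norm \<xi>)\<^sup>2 / (1 + (norm \<xi>)\<^sup>2)" if "h (norm \<xi>) \<noteq> 0" for \<xi> :: "real^2"
    using that h0[of "norm \<xi>"] \<epsilon> unfolding \<beta>0_def by (intro high_frequency_ratio) force+
  have lo1: "norm \<xi> \<le> R" if "1 - h (norm \<xi>) \<noteq> 0" for \<xi> :: "real^2"
    using that h1[of "norm \<xi>"] unfolding R_def by force
  have lo: "\<beta>1 * (norm \<xi>)\<^sup>2 \<le> (norm \<xi>)\<^sup>2 / (1 + (norm \<xi>)\<^sup>2)" if "1 - h (norm \<xi>) \<noteq> 0" for \<xi> :: "real^2"
    unfolding \<beta>1_def using lo1[OF that] by (intro low_frequency_ratio) auto
  \<comment> \<open>Exponents have to be compared only where the multiplier is nonzero; this is how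
    the supports of the cut-offs enter.\<close>
  have mult: "\<bar>m\<bar> * (3 * exp (- c * t * x)) \<le> 3 * B * exp (- y)" if "\<bar>m\<bar> \<le> B" "m \<noteq> 0 \<Longrightarrow> y \<le> c * t * x" for m t x y :: real
  proof (cases "m = 0")
    case True
    then show ?thesis using B by simp
  next
    case False
    then have "exp (- c * t * x) \<le> exp (- y)" using that(2) by simp
    then have "\<bar>m\<bar> * (3 * exp (- c * t * x)) \<le> B * (3 * exp (- y))" using that(1) B by (intro mult_mono) auto
    then show ?thesis by (simp add: mult_ac)
  qed
  have ct: "c * t * u \<le> c * t * v" if "t \<ge> 0" "u \<le> v" for t u v :: real using c that by (intro mult_left_mono) auto
  have br: "(1 + (norm \<xi>)\<^sup>2) powr (- s / 2) * (1 + (norm \<xi>)\<^sup>2) powr (s / 2) = 1" "(1 + (norm \<xi>)\<^sup>2) powr (0 / 2) = 1" for \<xi> :: "real^2"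
    using add_pos_nonneg[OF zero_less_one zero_le_power2[of "norm \<xi>"]] by (auto simp: powr_add[symmetric])

  \<comment> \<open>The exponential rate: \<open>c\<close> times the lower bounds for the frequency
    factor and for \<open>(dmin (dir \<xi>))\<^sup>2\<close> on the support of the first
    multiplier.\<close>
  define C0 where "C0 = c * \<beta>0 * d0\<^sup>2"
  have C0: "C0 > 0" using c \<beta> d0 by (simp add: C0_def)
  obtain K1 where K1: "K1 > 0" "\<And>B. B > 0 \<Longrightarrow> weight_norm_le p q (\<lambda>\<xi>. B * (1 + (norm \<xi>)\<^sup>2) powr (- s / 2)) (B * K1)"
    by (rule sobolev_weight_norm[OF pq s]) (rule that)
  have E1: "Lp_norm q (scalar_op (\<lambda>\<xi>. h (norm \<xi>) * ?P (dir \<xi>)) (V t)) \<le> ennreal (C * (3 * B * exp (- (C0 * t)) * K1)) * Sobolev_norm p s V0"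
    if sol: "schwartz V0" "is_solution (symbolB \<kappa> \<gamma> \<mu> r) V0 V" "t \<ge> 0" for V0 V t
  proof (rule est[OF sol _ mb(1), where w="\<lambda>\<xi>. 3 * B * exp (- (C0 * t)) * (1 + (norm \<xi>)\<^sup>2) powr (- s / 2)"])
    fix \<xi> :: "real^2" assume \<xi>: "\<xi> \<noteq> 0"
    have "\<bar>h (norm \<xi>) * ?P (dir \<xi>)\<bar> * (3 * exp (- c * t * ((norm \<xi>)\<^sup>2 / (1 + (norm \<xi>)\<^sup>2) * (dmin (dir \<xi>))\<^sup>2))) \<le> 3 * B * exp (- (C0 * t))"
    proof (rule mult[OF mb(1)])
      assume "h (norm \<xi>) * ?P (dir \<xi>) \<noteq> 0"
      then have "\<beta>0 \<le> (norm \<xi>)\<^sup>2 / (1 + (norm \<xi>)\<^sup>2)" "d0 \<le> dmin (dir \<xi>)"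
        using hi far[OF norm_dir[OF \<xi>]] by auto
      then have "\<beta>0 * d0\<^sup>2 \<le> (norm \<xi>)\<^sup>2 / (1 + (norm \<xi>)\<^sup>2) * (dmin (dir \<xi>))\<^sup>2"
        using \<beta> d0 by (intro mult_mono power_mono) auto
      from ct[OF sol(3) this] show "C0 * t \<le> c * t * ((norm \<xi>)\<^sup>2 / (1 + (norm \<xi>)\<^sup>2) * (dmin (dir \<xi>))\<^sup>2)" by (simp add: C0_def mult_ac)
    qed
    then show "\<bar>h (norm \<xi>) * ?P (dir \<xi>)\<bar> * (3 * exp (- c * t * ((norm \<xi>)\<^sup>2 / (1 + (norm \<xi>)\<^sup>2) * (dmin (dir \<xi>))\<^sup>2)))
       \<le> 3 * B * exp (- (C0 * t)) * (1 + (norm \<xi>)\<^sup>2) powr (- s / 2) * (1 + (norm \<xi>)\<^sup>2) powr (s / 2)"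
      unfolding mult.assoc[of _ "_ powr _" "_ powr _"] br by simp
  next
    show "weight_norm_le p q (\<lambda>\<xi>. 3 * B * exp (- (C0 * t)) * (1 + (norm \<xi>)\<^sup>2) powr (- s / 2)) (3 * B * exp (- (C0 * t)) * K1)"
      using B by (intro K1(2)) auto
  qed (use B K1 in \<open>auto intro!: borel_measurable_times hm'\<close>)

  obtain K2 where K2: "K2 > 0" "\<And>B t. B > 0 \<Longrightarrow> t \<ge> 0 \<Longrightarrow>
    weight_norm_le p q (\<lambda>\<xi>. B * (exp (- (c * \<beta>1 * d0\<^sup>2) * t * (norm \<xi>)\<^sup>2) * indicator {\<xi>. norm \<xi> \<le> R} \<xi>)) (B * K2 * (1 + t) powr (- (1 / p - 1 / q)))"
    by (rule disc_weight_norm[OF pq _ R, of "c * \<beta>1 * d0\<^sup>2"]) (use c \<beta> d0 that in auto)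
  have E2: "Lp_norm q (scalar_op (\<lambda>\<xi>. (1 - h (norm \<xi>)) * ?P (dir \<xi>)) (V t)) \<le> ennreal (C * (3 * B * K2 * (1 + t) powr (- (1 / p - 1 / q)))) * Lp_norm p V0"
    if sol: "schwartz V0" "is_solution (symbolB \<kappa> \<gamma> \<mu> r) V0 V" "t \<ge> 0" for V0 V t
    unfolding Sobolev_norm_0[OF sol(1), symmetric]
  proof (rule est[OF sol _ mb(2), where w="\<lambda>\<xi>. 3 * B * (exp (- (c * \<beta>1 * d0\<^sup>2) * t * (norm \<xi>)\<^sup>2) * indicator {\<xi>. norm \<xi> \<le> R} \<xi>)"])
    fix \<xi> :: "real^2" assume \<xi>: "\<xi> \<noteq> 0"
    have "\<bar>(1 - h (norm \<xi>)) * ?P (dir \<xi>)\<bar> * (3 * exp (- c * t * ((norm \<xi>)\<^sup>2 / (1 + (norm \<xi>)\<^sup>2) * (dmin (dir \<xi>))\<^sup>2))) \<le> 3 * B * (exp (- (c * \<beta>1 * d0\<^sup>2) * t * (norm \<xi>)\<^sup>2) * indicator {\<xi>. norm \<xi> \<le> R} \<xi>)"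
    proof (cases "1 - h (norm \<xi>) = 0")
      case False
      have "\<bar>(1 - h (norm \<xi>)) * ?P (dir \<xi>)\<bar> * (3 * exp (- c * t * ((norm \<xi>)\<^sup>2 / (1 + (norm \<xi>)\<^sup>2) * (dmin (dir \<xi>))\<^sup>2))) \<le> 3 * B * exp (- (c * t * (\<beta>1 * (norm \<xi>)\<^sup>2 * d0\<^sup>2)))"
      proof (rule mult[OF mb(2)])
        assume "(1 - h (norm \<xi>)) * ?P (dir \<xi>) \<noteq> 0"
        then have "\<beta>1 * (norm \<xi>)\<^sup>2 \<le> (norm \<xi>)\<^sup>2 / (1 + (norm \<xi>)\<^sup>2)" "d0 \<le> dmin (dir \<xi>)"
          using lo far[OF norm_dir[OF \<xi>]] by auto
        then have "\<beta>1 * (norm \<xi>)\<^sup>2 * d0\<^sup>2 \<le> (norm \<xi>)\<^sup>2 / (1 + (norm \<xi>)\<^sup>2) * (dmin (dir \<xi>))\<^sup>2"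
          using \<beta> d0 by (intro mult_mono power_mono) auto
        from ct[OF sol(3) this] show "c * t * (\<beta>1 * (norm \<xi>)\<^sup>2 * d0\<^sup>2) \<le> c * t * ((norm \<xi>)\<^sup>2 / (1 + (norm \<xi>)\<^sup>2) * (dmin (dir \<xi>))\<^sup>2)" .
      qed
      then show ?thesis using lo1[OF False] by (simp add: mult_ac)
    qed (use B in simp)
    then show "\<bar>(1 - h (norm \<xi>)) * ?P (dir \<xi>)\<bar> * (3 * exp (- c * t * ((norm \<xi>)\<^sup>2 / (1 + (norm \<xi>)\<^sup>2) * (dmin (dir \<xi>))\<^sup>2)))
       \<le> 3 * B * (exp (- (c * \<beta>1 * d0\<^sup>2) * t * (norm \<xi>)\<^sup>2) * indicator {\<xi>. norm \<xi> \<le> R} \<xi>) * (1 + (norm \<xi>)\<^sup>2) powr (0 / 2)"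
      unfolding br by simp
  next
    show "weight_norm_le p q (\<lambda>\<xi>. 3 * B * (exp (- (c * \<beta>1 * d0\<^sup>2) * t * (norm \<xi>)\<^sup>2) * indicator {\<xi>. norm \<xi> \<le> R} \<xi>)) (3 * B * K2 * (1 + t) powr (- (1 / p - 1 / q)))"
      using B sol by (intro K2(2)) auto
  qed (use B K2 sol in \<open>auto intro!: borel_measurable_times borel_measurable_diff hm'\<close>)

  \<comment> \<open>Without hyperbolic directions \<open>P_par\<close> is an empty product, so
    \<open>P_hyp\<close> vanishes and the weight 0 is enough; the existential form merges this case
    with the general one.\<close>
  have "\<exists>K>0. \<forall>t\<ge>0. \<exists>w. w \<in> borel_measurable borel \<and> (\<forall>\<xi>. 0 \<le> w \<xi>) \<and>
     (\<forall>\<xi>. \<xi> \<noteq> 0 \<longrightarrow> \<bar>h (norm \<xi>) * ?Q (dir \<xi>)\<bar> * (3 * exp (- c * t * ((norm \<xi>)\<^sup>2 / (1 + (norm \<xi>)\<^sup>2) * (dmin (dir \<xi>))\<^sup>2))) \<le> w \<xi> * (1 + (norm \<xi>)\<^sup>2) powr (s / 2))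
     \<and> weight_norm_le p q w (K * (1 + t) powr (- (1 / 2) * (1 / p - 1 / q)))"
  proof (cases "Hyp = {}")
    case True
    then have Q0: "?Q \<eta> = 0" for \<eta> by (simp add: P_hyp_def P_eq)
    show ?thesis
      by (rule exI[of _ 1]) (auto simp: Q0 weight_norm_le_def intro!: exI[of _ "\<lambda>_. 0"])
  next
    case False
    obtain K where K: "K > 0" "\<And>B t. B > 0 \<Longrightarrow> t \<ge> 0 \<Longrightarrow>
      weight_norm_le p q (\<lambda>\<xi>. B * ((1 + (norm \<xi>)\<^sup>2) powr (- s / 2) * exp (- (c * \<beta>0) * t * (dmin (dir \<xi>))\<^sup>2))) (B * K * (1 + t) powr (- (1 / 2) * (1 / p - 1 / q)))"
      by (rule hyperbolic_sobolev_weight_norm[OF pq s _ False, of "c * \<beta>0"]) (use c \<beta> that in auto)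
    show ?thesis
    proof (rule exI[of _ "3 * B * K"], intro conjI allI impI)
      show "3 * B * K > 0" using B K by simp
      fix t :: real assume t: "t \<ge> 0"
      \<comment> \<open>Close to a hyperbolic direction \<open>dmin\<close> has no positive lower
        bound, so it stays in the weight.\<close>
      let ?w = "\<lambda>\<xi>. 3 * B * ((1 + (norm \<xi>)\<^sup>2) powr (- s / 2) * exp (- (c * \<beta>0) * t * (dmin (dir \<xi>))\<^sup>2))"
      have "\<bar>h (norm \<xi>) * ?Q (dir \<xi>)\<bar> * (3 * exp (- c * t * ((norm \<xi>)\<^sup>2 / (1 + (norm \<xi>)\<^sup>2) * (dmin (dir \<xi>))\<^sup>2))) \<le> ?w \<xi> * (1 + (norm \<xi>)\<^sup>2) powr (s / 2)" for \<xi>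
      proof -
        have "\<bar>h (norm \<xi>) * ?Q (dir \<xi>)\<bar> * (3 * exp (- c * t * ((norm \<xi>)\<^sup>2 / (1 + (norm \<xi>)\<^sup>2) * (dmin (dir \<xi>))\<^sup>2))) \<le> 3 * B * exp (- (c * t * (\<beta>0 * (dmin (dir \<xi>))\<^sup>2)))"
        proof (rule mult[OF mb(3)])
          assume "h (norm \<xi>) * ?Q (dir \<xi>) \<noteq> 0"
          then have "\<beta>0 \<le> (norm \<xi>)\<^sup>2 / (1 + (norm \<xi>)\<^sup>2)" using hi by auto
          then show "c * t * (\<beta>0 * (dmin (dir \<xi>))\<^sup>2) \<le> c * t * ((norm \<xi>)\<^sup>2 / (1 + (norm \<xi>)\<^sup>2) * (dmin (dir \<xi>))\<^sup>2)"
            by (intro ct t mult_right_mono) auto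
        qed
        also have "\<dots> = 3 * B * exp (- (c * \<beta>0) * t * (dmin (dir \<xi>))\<^sup>2) * ((1 + (norm \<xi>)\<^sup>2) powr (- s / 2) * (1 + (norm \<xi>)\<^sup>2) powr (s / 2))"
          unfolding br by (simp add: mult_ac)
        finally show ?thesis by (simp only: mult_ac)
      qed
      moreover have "?w \<in> borel_measurable borel" by measurable
      ultimately show "\<exists>w. w \<in> borel_measurable borel \<and> (\<forall>\<xi>. 0 \<le> w \<xi>) \<and>
       (\<forall>\<xi>. \<xi> \<noteq> 0 \<longrightarrow> \<bar>h (norm \<xi>) * ?Q (dir \<xi>)\<bar> * (3 * exp (- c * t * ((norm \<xi>)\<^sup>2 / (1 + (norm \<xi>)\<^sup>2) * (dmin (dir \<xi>))\<^sup>2))) \<le> w \<xi> * (1 + (norm \<xi>)\<^sup>2) powr (s / 2))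
       \<and> weight_norm_le p q w (3 * B * K * (1 + t) powr (- (1 / 2) * (1 / p - 1 / q)))"
        using B t K(2)[of "3 * B" t] by (intro exI[of _ ?w] conjI) auto
    qed
  qed
  then obtain K3 where K3: "K3 > 0" "\<And>t. t \<ge> 0 \<Longrightarrow> \<exists>w. w \<in> borel_measurable borel \<and> (\<forall>\<xi>. 0 \<le> w \<xi>) \<and>
     (\<forall>\<xi>. \<xi> \<noteq> 0 \<longrightarrow> \<bar>h (norm \<xi>) * ?Q (dir \<xi>)\<bar> * (3 * exp (- c * t * ((norm \<xi>)\<^sup>2 / (1 + (norm \<xi>)\<^sup>2) * (dmin (dir \<xi>))\<^sup>2))) \<le> w \<xi> * (1 + (norm \<xi>)\<^sup>2) powr (s / 2))
     \<and> weight_norm_le p q w (K3 * (1 + t) powr (- (1 / 2) * (1 / p - 1 / q)))"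
    by (elim exE conjE) (rule that, assumption, simp)
  have E3: "Lp_norm q (scalar_op (\<lambda>\<xi>. h (norm \<xi>) * ?Q (dir \<xi>)) (V t)) \<le> ennreal (C * (K3 * (1 + t) powr (- (1 / 2) * (1 / p - 1 / q)))) * Sobolev_norm p s V0"
    if sol: "schwartz V0" "is_solution (symbolB \<kappa> \<gamma> \<mu> r) V0 V" "t \<ge> 0" for V0 V t
  proof -
    obtain w where w: "w \<in> borel_measurable borel" "\<And>\<xi>. 0 \<le> w \<xi>"
     "\<And>\<xi>. \<xi> \<noteq> 0 \<Longrightarrow> \<bar>h (norm \<xi>) * ?Q (dir \<xi>)\<bar> * (3 * exp (- c * t * ((norm \<xi>)\<^sup>2 / (1 + (norm \<xi>)\<^sup>2) * (dmin (dir \<xi>))\<^sup>2))) \<le> w \<xi> * (1 + (norm \<xi>)\<^sup>2) powr (s / 2)"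
     "weight_norm_le p q w (K3 * (1 + t) powr (- (1 / 2) * (1 / p - 1 / q)))"
      using K3(2)[OF sol(3)] by (elim exE conjE) (rule that, assumption, simp_all)
    show ?thesis
      by (rule est[OF sol _ mb(3) w(1,2,3,4)]) (use K3(1) sol in \<open>auto intro!: borel_measurable_times hm'\<close>)
  qed

  have "\<exists>K>0. \<forall>t\<ge>0. \<exists>w. w \<in> borel_measurable borel \<and> (\<forall>\<xi>. 0 \<le> w \<xi>) \<and>
     (\<forall>\<xi>. \<xi> \<noteq> 0 \<longrightarrow> \<bar>(1 - h (norm \<xi>)) * ?Q (dir \<xi>)\<bar> * (3 * exp (- c * t * ((norm \<xi>)\<^sup>2 / (1 + (norm \<xi>)\<^sup>2) * (dmin (dir \<xi>))\<^sup>2))) \<le> w \<xi> * (1 + (norm \<xi>)\<^sup>2) powr (0 / 2))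
     \<and> weight_norm_le p q w (K * (1 + t) powr (- (1 / 2) * (1 / p - 1 / q)))"
  proof (cases "Hyp = {}")
    case True
    then have Q0: "?Q \<eta> = 0" for \<eta> by (simp add: P_hyp_def P_eq)
    show ?thesis
      by (rule exI[of _ 1]) (auto simp: Q0 weight_norm_le_def intro!: exI[of _ "\<lambda>_. 0"])
  next
    case False
    obtain K where K: "K > 0" "\<And>B t. B > 0 \<Longrightarrow> t \<ge> 0 \<Longrightarrow>
      weight_norm_le p q (\<lambda>\<xi>. B * (exp (- (c * \<beta>1) * t * ((norm \<xi>)\<^sup>2 * (dmin (dir \<xi>))\<^sup>2)) * indicator {\<xi>. norm \<xi> \<le> R} \<xi>)) (B * K * (1 + t) powr (- (1 / 2) * (1 / p - 1 / q)))"
      by (rule hyperbolic_disc_weight_norm[OF pq _ R False, of "c * \<beta>1"]) (use c \<beta> that in auto)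
    show ?thesis
    proof (rule exI[of _ "3 * B * K"], intro conjI allI impI)
      show "3 * B * K > 0" using B K by simp
      fix t :: real assume t: "t \<ge> 0"
      let ?w = "\<lambda>\<xi>. 3 * B * (exp (- (c * \<beta>1) * t * ((norm \<xi>)\<^sup>2 * (dmin (dir \<xi>))\<^sup>2)) * indicator {\<xi>. norm \<xi> \<le> R} \<xi>)"
      have "\<bar>(1 - h (norm \<xi>)) * ?Q (dir \<xi>)\<bar> * (3 * exp (- c * t * ((norm \<xi>)\<^sup>2 / (1 + (norm \<xi>)\<^sup>2) * (dmin (dir \<xi>))\<^sup>2))) \<le> ?w \<xi> * (1 + (norm \<xi>)\<^sup>2) powr (0 / 2)" for \<xi>
      proof (cases "1 - h (norm \<xi>) = 0")
        case False
        have "\<bar>(1 - h (norm \<xi>)) * ?Q (dir \<xi>)\<bar> * (3 * exp (- c * t * ((norm \<xi>)\<^sup>2 / (1 + (norm \<xi>)\<^sup>2) * (dmin (dir \<xi>))\<^sup>2))) \<le> 3 * B * exp (- (c * t * (\<beta>1 * (norm \<xi>)\<^sup>2 * (dmin (dir \<xi>))\<^sup>2)))"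
          by (rule mult[OF mb(4)]) (intro ct t mult_right_mono lo[OF False] zero_le_power2)
        then show ?thesis unfolding br using lo1[OF False] by (simp add: mult_ac)
      qed (use B in \<open>simp add: br\<close>)
      moreover have "?w \<in> borel_measurable borel" by measurable
      ultimately show "\<exists>w. w \<in> borel_measurable borel \<and> (\<forall>\<xi>. 0 \<le> w \<xi>) \<and>
       (\<forall>\<xi>. \<xi> \<noteq> 0 \<longrightarrow> \<bar>(1 - h (norm \<xi>)) * ?Q (dir \<xi>)\<bar> * (3 * exp (- c * t * ((norm \<xi>)\<^sup>2 / (1 + (norm \<xi>)\<^sup>2) * (dmin (dir \<xi>))\<^sup>2))) \<le> w \<xi> * (1 + (norm \<xi>)\<^sup>2) powr (0 / 2))
       \<and> weight_norm_le p q w (3 * B * K * (1 + t) powr (- (1 / 2) * (1 / p - 1 / q)))"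
        using B t K(2)[of "3 * B" t] by (intro exI[of _ ?w] conjI) auto
    qed
  qed
  then obtain K4 where K4: "K4 > 0" "\<And>t. t \<ge> 0 \<Longrightarrow> \<exists>w. w \<in> borel_measurable borel \<and> (\<forall>\<xi>. 0 \<le> w \<xi>) \<and>
     (\<forall>\<xi>. \<xi> \<noteq> 0 \<longrightarrow> \<bar>(1 - h (norm \<xi>)) * ?Q (dir \<xi>)\<bar> * (3 * exp (- c * t * ((norm \<xi>)\<^sup>2 / (1 + (norm \<xi>)\<^sup>2) * (dmin (dir \<xi>))\<^sup>2))) \<le> w \<xi> * (1 + (norm \<xi>)\<^sup>2) powr (0 / 2))
     \<and> weight_norm_le p q w (K4 * (1 + t) powr (- (1 / 2) * (1 / p - 1 / q)))"
    by (elim exE conjE) (rule that, assumption, simp)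
  have E4: "Lp_norm q (scalar_op (\<lambda>\<xi>. (1 - h (norm \<xi>)) * ?Q (dir \<xi>)) (V t)) \<le> ennreal (C * (K4 * (1 + t) powr (- (1 / 2) * (1 / p - 1 / q)))) * Lp_norm p V0"
    if sol: "schwartz V0" "is_solution (symbolB \<kappa> \<gamma> \<mu> r) V0 V" "t \<ge> 0" for V0 V t
  proof -
    obtain w where w: "w \<in> borel_measurable borel" "\<And>\<xi>. 0 \<le> w \<xi>"
     "\<And>\<xi>. \<xi> \<noteq> 0 \<Longrightarrow> \<bar>(1 - h (norm \<xi>)) * ?Q (dir \<xi>)\<bar> * (3 * exp (- c * t * ((norm \<xi>)\<^sup>2 / (1 + (norm \<xi>)\<^sup>2) * (dmin (dir \<xi>))\<^sup>2))) \<le> w \<xi> * (1 + (norm \<xi>)\<^sup>2) powr (0 / 2)"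
     "weight_norm_le p q w (K4 * (1 + t) powr (- (1 / 2) * (1 / p - 1 / q)))"
      using K4(2)[OF sol(3)] by (elim exE conjE) (rule that, assumption, simp_all)
    show ?thesis
      unfolding Sobolev_norm_0[OF sol(1), symmetric]
      by (rule est[OF sol _ mb(4) w(1,2,3,4)]) (use K4(1) sol in \<open>auto intro!: borel_measurable_times borel_measurable_diff hm'\<close>)
  qed

  define K where "K = C * (3 * B * K1) + C * (3 * B * K2) + C * K3 + C * K4"
  have Kpos: "C * (3 * B * K1) > 0" "C * (3 * B * K2) > 0" "C * K3 > 0" "C * K4 > 0"
    using C B K1 K2 K3 K4 by auto
  have up: "ennreal (k * x) * Y \<le> ennreal (K * x) * Y" if "k \<le> K" "x \<ge> 0" for k x and Y :: ennreal
    using that by (intro mult_right_mono ennreal_leI) auto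
  show ?thesis
  proof (rule exI[of _ C0], intro conjI C0, rule exI[of _ K], intro conjI allI impI)
    show "K > 0" using Kpos unfolding K_def by linarith
    fix V0 V and t :: real
    assume sv: "schwartz V0 \<and> is_solution (symbolB \<kappa> \<gamma> \<mu> r) V0 V" and t: "t \<ge> 0"
    then have sol: "schwartz V0" "is_solution (symbolB \<kappa> \<gamma> \<mu> r) V0 V" by auto
    have fin: "X \<le> ennreal (K * x) * Y" if "X \<le> ennreal y * Y" "y = k * x" "k \<le> K" "x \<ge> 0" for X Y :: ennreal and y k x
      using order_trans[OF that(1) up[OF that(3,4), of Y, folded that(2)]] .
    have le: "C * (3 * B * K1) \<le> K" "C * (3 * B * K2) \<le> K" "C * K3 \<le> K" "C * K4 \<le> K"
      using Kpos unfolding K_def by linarith+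
    show "Lp_norm q (scalar_op (\<lambda>\<xi>. h (norm \<xi>) * ?P (dir \<xi>)) (V t)) \<le> ennreal (K * exp (- C0 * t)) * Sobolev_norm p s V0"
      by (rule fin[OF E1[OF sol t] _ le(1)]) auto
    show "Lp_norm q (scalar_op (\<lambda>\<xi>. (1 - h (norm \<xi>)) * ?P (dir \<xi>)) (V t)) \<le> ennreal (K * (1 + t) powr (- (1 / p - 1 / q))) * Lp_norm p V0"
      by (rule fin[OF E2[OF sol t] _ le(2)]) (auto simp only: mult.assoc powr_ge_zero)
    show "Lp_norm q (scalar_op (\<lambda>\<xi>. h (norm \<xi>) * ?Q (dir \<xi>)) (V t)) \<le> ennreal (K * (1 + t) powr (- (1 / 2) * (1 / p - 1 / q))) * Sobolev_norm p s V0"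
      by (rule fin[OF E3[OF sol t] _ le(3)]) (auto simp only: mult.assoc powr_ge_zero)
    show "Lp_norm q (scalar_op (\<lambda>\<xi>. (1 - h (norm \<xi>)) * ?Q (dir \<xi>)) (V t)) \<le> ennreal (K * (1 + t) powr (- (1 / 2) * (1 / p - 1 / q))) * Lp_norm p V0"
      by (rule fin[OF E4[OF sol t] _ le(4)]) (auto simp only: mult.assoc powr_ge_zero)
  qed
qed

end

theorem theorem3p1:
  fixes \<kappa> \<gamma> \<epsilon> p q s :: real
    and A :: "real^2 \<Rightarrow> complex^2^2"
    and \<mu> :: "2 \<Rightarrow> real^2 \<Rightarrow> real"
    and r :: "2 \<Rightarrow> real^2 \<Rightarrow> real^2"
    and h :: "real \<Rightarrow> real"
  assumes "\<kappa> > 0" and "\<gamma> \<noteq> 0"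
    and A1: "analytic_on_circle A"
    and A2: "\<And>\<eta>. norm \<eta> = 1 \<Longrightarrow> self_adjoint (A \<eta>) \<and> positive_matrix (A \<eta>)"
    and eigen: "\<And>j \<eta>. norm \<eta> = 1 \<Longrightarrow>
                  A \<eta> *v cvec (r j \<eta>) = complex_of_real (\<mu> j \<eta>) *s cvec (r j \<eta>)"
    and orthonormal: "\<And>j \<eta>. norm \<eta> = 1 \<Longrightarrow> norm (r j \<eta>) = 1"
                     "\<And>\<eta>. norm \<eta> = 1 \<Longrightarrow> r 1 \<eta> \<bullet> r 2 \<eta> = 0"
    and analytic: "\<And>j. analytic_on_circle (\<mu> j)" "\<And>j. analytic_on_circle (r j)"
    and A3: "\<And>\<eta>. norm \<eta> = 1 \<Longrightarrow> card (spectrum (A \<eta>)) = 2"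
    and first_order: "\<And>j \<eta>. hyperbolic_dir_wrt \<kappa> \<gamma> \<mu> r j \<eta> \<Longrightarrow>
                        simple_zero_on_circle (coupling r j) \<eta>"
    and A4: "\<And>j \<eta>. hyperbolic_dir_wrt \<kappa> \<gamma> \<mu> r j \<eta> \<Longrightarrow>
               complex_of_real (\<gamma>\<^sup>2) \<noteq> 2 * complex_of_real (\<mu> j \<eta>) - trace (A \<eta>)"
    and "\<epsilon> > 0" and "cutoff \<epsilon> h"
    and "1 < p" and "p \<le> 2" and "p * q = p + q" and "s > 2 * (1 / p - 1 / q)"
  shows "\<exists>C>0. \<exists>K>0. \<forall>V0 V. schwartz V0 \<and> is_solution (symbolB \<kappa> \<gamma> \<mu> r) V0 V \<longrightarrow>
    (\<forall>t\<ge>0.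
       Lp_norm q (scalar_op (\<lambda>\<xi>. h (norm \<xi>) * P_par \<kappa> \<gamma> \<mu> r h (dir \<xi>)) (V t))
         \<le> ennreal (K * exp (- C * t)) * Sobolev_norm p s V0 \<and>
       Lp_norm q (scalar_op (\<lambda>\<xi>. (1 - h (norm \<xi>)) * P_par \<kappa> \<gamma> \<mu> r h (dir \<xi>)) (V t))
         \<le> ennreal (K * (1 + t) powr (- (1 / p - 1 / q))) * Lp_norm p V0 \<and>
       Lp_norm q (scalar_op (\<lambda>\<xi>. h (norm \<xi>) * P_hyp \<kappa> \<gamma> \<mu> r h (dir \<xi>)) (V t))
         \<le> ennreal (K * (1 + t) powr (- (1 / 2) * (1 / p - 1 / q))) * Sobolev_norm p s V0 \<and>
       Lp_norm q (scalar_op (\<lambda>\<xi>. (1 - h (norm \<xi>)) * P_hyp \<kappa> \<gamma> \<mu> r h (dir \<xi>)) (V t))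
         \<le> ennreal (K * (1 + t) powr (- (1 / 2) * (1 / p - 1 / q))) * Lp_norm p V0)"
proof -
  interpret thermoelastic_system \<kappa> \<gamma> A \<mu> r
    by unfold_locales (use assms in auto)
  show ?thesis
    using assms by (intro Lp_Lq_estimates) auto
qed

end
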